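(* Let $(R,\mathfrak m,k)$ be a commutative noetherian local ring with Hilbert series $H_R(t)=1+et+et^2+t^3$, and set $s=\operatorname{rank}_k(0:_R\mathfrak m)$. Assume there exists a non-zero exact zero divisor $a\in\mathfrak m$. Then the following are equivalent: (1) $R$ is a Koszul ring; (2) $e\ge s+2$. When these hold, every finitely generated $R$-module $M$ has a syzygy module that is Koszul.
   Context: $H_R(t)=\sum_{n\ge0}\operatorname{rank}_k(\mathfrak m^n/\mathfrak m^{n+1})t^n$. An element $a\in R$ is an exact zero divisor if $R\neq(0:_R a)\cong R/aR\neq0$. A finitely generated $R$-module $M$ is Koszul if $\operatorname{gr}_{\mathfrak m}(M)=\bigoplus_n\mathfrak m^nM/\mathfrak m^{n+1}M$ has a linear resolution over $\operatorname{gr}_{\mathfrak m}(R)=\bigoplus_n\mathfrak m^n/\mathfrak m^{n+1}$, i.e. $\operatorname{Tor}_i^{\operatorname{gr}R}(\operatorname{gr}M,k)_j=0$ for $j\neq i$ (equivalently, the linear part of a minimal free resolution of $M$ is acyclic); $R$ is Koszul if $k$ is a Koszul $R$-module. The $n$-th syzygy module of $M$ is the cokernel of the $n$-th differential of a minimal free resolution of $M$; a syzygy module of $M$ is a module isomorphic to the $n$-th syzygy module for some $n\ge0$. *)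

theory Defs
  imports "HOL-Algebra.Algebra"
begin

definition noetherian_ring :: "('a, 'b) ring_scheme \<Rightarrow> bool" where
  "noetherian_ring R \<longleftrightarrow> cring R \<and>
     (\<forall>I. ideal I R \<longrightarrow> (\<exists>S. finite S \<and> S \<subseteq> carrier R \<and> I = Idl\<^bsub>R\<^esub> S))"

definition local_noetherian_ring :: "('a, 'b) ring_scheme \<Rightarrow> bool" where
  "local_noetherian_ring R \<longleftrightarrow> noetherian_ring R \<and> (\<exists>!I. maximalideal I R)"

definition max_ideal :: "('a, 'b) ring_scheme \<Rightarrow> 'a set" where
  "max_ideal R = (THE I. maximalideal I R)"

fun ideal_power :: "('a, 'b) ring_scheme \<Rightarrow> 'a set \<Rightarrow> nat \<Rightarrow> 'a set" where
  "ideal_power R I 0 = carrier R"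
| "ideal_power R I (Suc n) = ideal_prod R I (ideal_power R I n)"

text \<open>rank over the residue field k = R/m of the quotient N/Q, where N, Q are
  R-submodules of R with m N \<subseteq> Q \<subseteq> N: the least size of a subset S of N whose
  residue classes span N/Q over k (the k-span of the classes of S is the image of
  the R-span Idl S, since m acts trivially on N/Q).\<close>
definition rank_res :: "('a, 'b) ring_scheme \<Rightarrow> 'a set \<Rightarrow> 'a set \<Rightarrow> nat" where
  "rank_res R N Q = (LEAST c. \<exists>S. finite S \<and> card S = c \<and> S \<subseteq> N \<and>
      (\<forall>x\<in>N. \<exists>y\<in>Idl\<^bsub>R\<^esub> S. x \<ominus>\<^bsub>R\<^esub> y \<in> Q))"

definition hilbert_fun :: "('a, 'b) ring_scheme \<Rightarrow> nat \<Rightarrow> nat" where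
  "hilbert_fun R n = rank_res R (ideal_power R (max_ideal R) n)
                                (ideal_power R (max_ideal R) (Suc n))"

definition annihilator :: "('a, 'b) ring_scheme \<Rightarrow> 'a set \<Rightarrow> 'a set" where
  "annihilator R Y = {x. x \<in> carrier R \<and> (\<forall>y\<in>Y. x \<otimes>\<^bsub>R\<^esub> y = \<zero>\<^bsub>R\<^esub>)}"

definition socle_rank :: "('a, 'b) ring_scheme \<Rightarrow> nat" where
  "socle_rank R = rank_res R (annihilator R (max_ideal R)) {\<zero>\<^bsub>R\<^esub>}"

definition exact_zero_divisor :: "('a, 'b) ring_scheme \<Rightarrow> 'a \<Rightarrow> bool" where
  "exact_zero_divisor R a \<longleftrightarrow> a \<in> carrier R \<and>
     annihilator R {a} \<noteq> carrier R \<and>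
     carrier (R Quot (PIdl\<^bsub>R\<^esub> a)) \<noteq> {\<zero>\<^bsub>R Quot (PIdl\<^bsub>R\<^esub> a)\<^esub>} \<and>
     (\<exists>f. bij_betw f (annihilator R {a}) (carrier (R Quot (PIdl\<^bsub>R\<^esub> a))) \<and>
        (\<forall>x\<in>annihilator R {a}. \<forall>y\<in>annihilator R {a}.
            f (x \<oplus>\<^bsub>R\<^esub> y) = f x \<oplus>\<^bsub>R Quot (PIdl\<^bsub>R\<^esub> a)\<^esub> f y) \<and>
        (\<forall>r\<in>carrier R. \<forall>x\<in>annihilator R {a}.
            f (r \<otimes>\<^bsub>R\<^esub> x) = ((PIdl\<^bsub>R\<^esub> a) +>\<^bsub>R\<^esub> r) \<otimes>\<^bsub>R Quot (PIdl\<^bsub>R\<^esub> a)\<^esub> f x))"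

definition vecs :: "('a, 'b) ring_scheme \<Rightarrow> nat \<Rightarrow> (nat \<Rightarrow> 'a) set" where
  "vecs R n = {v. (\<forall>j<n. v j \<in> carrier R) \<and> (\<forall>j\<ge>n. v j = \<zero>\<^bsub>R\<^esub>)}"

definition zero_vec :: "('a, 'b) ring_scheme \<Rightarrow> nat \<Rightarrow> 'a" where
  "zero_vec R = (\<lambda>j. \<zero>\<^bsub>R\<^esub>)"

definition free_module :: "('a, 'b) ring_scheme \<Rightarrow> nat \<Rightarrow> ('a, nat \<Rightarrow> 'a) module" where
  "free_module R n = \<lparr>carrier = vecs R n, monoid.mult = (\<lambda>v w. undefined), monoid.one = undefined,
      ring.zero = zero_vec R, ring.add = (\<lambda>v w j. v j \<oplus>\<^bsub>R\<^esub> w j),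
      module.smult = (\<lambda>r v j. r \<otimes>\<^bsub>R\<^esub> v j)\<rparr>"

definition matvec :: "('a, 'b) ring_scheme \<Rightarrow> (nat \<Rightarrow> nat \<Rightarrow> 'a) \<Rightarrow> nat \<Rightarrow> nat
                       \<Rightarrow> (nat \<Rightarrow> 'a) \<Rightarrow> (nat \<Rightarrow> 'a)" where
  "matvec R A rows cols v =
     (\<lambda>i. if i < rows then (\<Oplus>\<^bsub>R\<^esub> j\<in>{..<cols}. A i j \<otimes>\<^bsub>R\<^esub> v j) else \<zero>\<^bsub>R\<^esub>)"

definition linear_map :: "('a, 'b) ring_scheme \<Rightarrow> ('a, 'c) module \<Rightarrow> ('a, 'd) module
                           \<Rightarrow> ('c \<Rightarrow> 'd) \<Rightarrow> bool" where
  "linear_map R M N f \<longleftrightarrow> f \<in> carrier M \<rightarrow> carrier N \<and>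
     (\<forall>x\<in>carrier M. \<forall>y\<in>carrier M. f (x \<oplus>\<^bsub>M\<^esub> y) = f x \<oplus>\<^bsub>N\<^esub> f y) \<and>
     (\<forall>r\<in>carrier R. \<forall>x\<in>carrier M. f (r \<odot>\<^bsub>M\<^esub> x) = r \<odot>\<^bsub>N\<^esub> f x)"

definition finitely_generated_module :: "('a, 'b) ring_scheme \<Rightarrow> ('a, 'c) module \<Rightarrow> bool" where
  "finitely_generated_module R M \<longleftrightarrow> module R M \<and>
     (\<exists>(n::nat) g. (\<forall>i<n. g i \<in> carrier M) \<and>
        (\<forall>x\<in>carrier M. \<exists>c. (\<forall>i<n. c i \<in> carrier R) \<and>
            x = (\<Oplus>\<^bsub>M\<^esub> i\<in>{..<n}. c i \<odot>\<^bsub>M\<^esub> g i)))"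

definition min_free_resolution ::
  "('a, 'b) ring_scheme \<Rightarrow> ('a, 'c) module \<Rightarrow> (nat \<Rightarrow> nat) \<Rightarrow> (nat \<Rightarrow> nat \<Rightarrow> nat \<Rightarrow> 'a)
     \<Rightarrow> ((nat \<Rightarrow> 'a) \<Rightarrow> 'c) \<Rightarrow> bool" where
  "min_free_resolution R M b d \<epsilon> \<longleftrightarrow>
     (\<forall>i\<ge>1. \<forall>p<b (i - 1). \<forall>q<b i. d i p q \<in> max_ideal R) \<and>
     (\<forall>i\<ge>1. \<forall>w\<in>vecs R (b (i + 1)).
        matvec R (d i) (b (i - 1)) (b i) (matvec R (d (i + 1)) (b i) (b (i + 1)) w) = zero_vec R) \<and>
     (\<forall>i\<ge>1. \<forall>v\<in>vecs R (b i). matvec R (d i) (b (i - 1)) (b i) v = zero_vec R \<longrightarrow>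
        (\<exists>w\<in>vecs R (b (i + 1)). v = matvec R (d (i + 1)) (b i) (b (i + 1)) w)) \<and>
     linear_map R (free_module R (b 0)) M \<epsilon> \<and>
     \<epsilon> ` vecs R (b 0) = carrier M \<and>
     {v \<in> vecs R (b 0). \<epsilon> v = \<zero>\<^bsub>M\<^esub>} = matvec R (d 1) (b 0) (b 1) ` vecs R (b 1)"

text \<open>Acyclicity of the linear part lin(F) of the resolution: lin(F)_i = gr(F_i)(-i),
  whose internal degree (i+p) component is (m^p/m^(p+1))^(b i), with differential
  induced by the entries of d i modulo m^2. Acyclic = H_i(lin F) = 0 for i \<ge> 1,
  checked in each internal degree (the degree p-1 part is 0 for p = 0).\<close>
definition linear_part_acyclic ::
  "('a, 'b) ring_scheme \<Rightarrow> (nat \<Rightarrow> nat) \<Rightarrow> (nat \<Rightarrow> nat \<Rightarrow> nat \<Rightarrow> 'a) \<Rightarrow> bool" where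
  "linear_part_acyclic R b d \<longleftrightarrow>
     (\<forall>i\<ge>1. \<forall>p. \<forall>v\<in>vecs R (b i).
        (\<forall>q<b i. v q \<in> ideal_power R (max_ideal R) p) \<and>
        (\<forall>r<b (i - 1). matvec R (d i) (b (i - 1)) (b i) v r \<in> ideal_power R (max_ideal R) (p + 2))
        \<longrightarrow> (\<exists>w\<in>vecs R (b (i + 1)).
              (p = 0 \<longrightarrow> w = zero_vec R) \<and>
              (\<forall>q<b (i + 1). w q \<in> ideal_power R (max_ideal R) (p - 1)) \<and>
              (\<forall>q<b i. v q \<ominus>\<^bsub>R\<^esub> matvec R (d (i + 1)) (b i) (b (i + 1)) w q
                          \<in> ideal_power R (max_ideal R) (p + 1))))"

text \<open>Koszul module: the linear part of a minimal free resolution is acyclic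
  (equivalent to gr_m(M) having a linear resolution over gr_m(R)).\<close>
definition koszul_module :: "('a, 'b) ring_scheme \<Rightarrow> ('a, 'c) module \<Rightarrow> bool" where
  "koszul_module R M \<longleftrightarrow> finitely_generated_module R M \<and>
     (\<exists>b d \<epsilon>. min_free_resolution R M b d \<epsilon> \<and> linear_part_acyclic R b d)"

definition residue_module :: "('a, 'b) ring_scheme \<Rightarrow> ('a, 'a set) module" where
  "residue_module R = \<lparr>carrier = carrier (R Quot (max_ideal R)),
      monoid.mult = monoid.mult (R Quot (max_ideal R)), monoid.one = monoid.one (R Quot (max_ideal R)),
      ring.zero = ring.zero (R Quot (max_ideal R)), ring.add = ring.add (R Quot (max_ideal R)),
      module.smult = (\<lambda>r C. rcoset_mult R (max_ideal R) ((max_ideal R) +>\<^bsub>R\<^esub> r) C)\<rparr>"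

definition koszul_ring :: "('a, 'b) ring_scheme \<Rightarrow> bool" where
  "koszul_ring R \<longleftrightarrow> koszul_module R (residue_module R)"

text \<open>The n-th syzygy module (n \<ge> 1) of a resolution, realised as the image of
  d n inside R^(b (n-1)) (isomorphic to the cokernel of d (n+1)).\<close>
definition syzygy_module :: "('a, 'b) ring_scheme \<Rightarrow> (nat \<Rightarrow> nat) \<Rightarrow> (nat \<Rightarrow> nat \<Rightarrow> nat \<Rightarrow> 'a)
     \<Rightarrow> nat \<Rightarrow> ('a, nat \<Rightarrow> 'a) module" where
  "syzygy_module R b d n = (free_module R (b (n - 1)))
      \<lparr>carrier := matvec R (d n) (b (n - 1)) (b n) ` vecs R (b n)\<rparr>"

end

theory Submission
  imports Defs
begin

text \<open>Write \<open>m\<close> for the maximal ideal. Since \<open>m^4 = 0\<close>, everything is controlled by lengths. The exact zero divisor \<open>a\<close>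
  has a partner \<open>a'\<close> such that \<open>a R\<close> and \<open>a' R\<close> annihilate each other exactly. If \<open>Y\<close> is the set of \<open>u \<in> m\<close> with
  \<open>u m \<subseteq> a R\<close>, then the socle is \<open>a' Y\<close> and \<open>m / Y\<close> has length \<open>e - s\<close> (when \<open>a, a' \<notin> m^2\<close>, as is the case for
  \<open>e \<ge> 3\<close>).

  If \<open>e \<le> s + 1\<close>, then \<open>m\<close> is generated by \<open>Y\<close> and one element \<open>x\<close>, and a power of \<open>x\<close> gives a relation of the
  associated graded ring that is not a consequence of the quadratic ones; so \<open>R\<close> is not Koszul. The small cases with
  \<open>a \<in> m^2\<close> or \<open>a' \<in> m^2\<close> are excluded by the same kind of relation.

  If \<open>e \<ge> s + 2\<close>, there are \<open>c, c' \<in> m - Y\<close> with \<open>c c' \<in> a m\<close>, and \<open>m^2 = a m + c m = a m + c' m\<close>. In a minimal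
  resolution \<open>F\<close> with differential \<open>d\<close>, an element \<open>w\<close> of \<open>F_n\<close> with \<open>d w \<in> m^2 F\<close> lifts to a chain with values in
  the Tate complex on \<open>a, a', c, c'\<close>. A chain condition for the possible tails of such chains in \<open>F_0\<close> forces
  \<open>w \<in> m F_n\<close> for large \<open>n\<close>. For these \<open>n\<close> the alternating sum of the Hilbert function of the \<open>n\<close>-th syzygy is
  non-increasing, and it is bounded below because the homology of multiplication by \<open>a, a'\<close> on the syzygies has constant
  length. Hence it is eventually constant, which means \<open>m^3 F_n = d (m^2 F_(n+1))\<close>. The two facts together are
  acyclicity of the linear part. For the residue field both hold from the start.\<close>

section \<open>Length in modular lattices of sets\<close>

text \<open>Quotients are avoided: Hilbert function values, the socle rank and Betti numbers all
  appear as lengths of intervals of submodules, so the Jordan-Hoelder theorem and the diamond law of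
  a modular lattice replace dimension counts.

  The Hilbert series enters through H_R(-1) = 1 - e + e - 1 = 0: a free module contributes nothing
  to alternating sums of Hilbert functions, so that such a sum changes from one syzygy to the next
  only where strictness fails.

  The obstacle is linearity of minimal generators: finite length alone does not bound the degree
  beyond which no generator has its boundary in m^2 F. Modulo a the square of the maximal ideal has
  length one, and there c c' = 0 gives a second periodicity beside that of a and a'. The coefficient
  l in c c' = l a glues the two into one complex. The tails of chains in all degrees then form a
  module over two shift operators, and the chain condition is the dual of Hilbert's basis theorem in
  two variables. For the residue field the tails lie in m F_0, which consists of boundaries.\<close>

locale modular_sets =
  fixes L :: "'v set set" and J :: "'v set \<Rightarrow> 'v set \<Rightarrow> 'v set"
  assumes int_closed: "A \<in> L \<Longrightarrow> B \<in> L \<Longrightarrow> A \<inter> B \<in> L"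
    and join_closed: "A \<in> L \<Longrightarrow> B \<in> L \<Longrightarrow> J A B \<in> L"
    and join_ub1: "A \<in> L \<Longrightarrow> B \<in> L \<Longrightarrow> A \<subseteq> J A B"
    and join_ub2: "A \<in> L \<Longrightarrow> B \<in> L \<Longrightarrow> B \<subseteq> J A B"
    and join_least: "A \<in> L \<Longrightarrow> B \<in> L \<Longrightarrow> C \<in> L \<Longrightarrow> A \<subseteq> C \<Longrightarrow> B \<subseteq> C \<Longrightarrow> J A B \<subseteq> C"
    and modular: "A \<in> L \<Longrightarrow> B \<in> L \<Longrightarrow> C \<in> L \<Longrightarrow> A \<subseteq> C \<Longrightarrow> J A B \<inter> C \<subseteq> J A (B \<inter> C)"
begin

lemma join_absorb: "A \<in> L \<Longrightarrow> B \<in> L \<Longrightarrow> B \<subseteq> A \<Longrightarrow> J A B = A"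
  using join_ub1 join_least by blast

lemma join_absorb2: "A \<in> L \<Longrightarrow> B \<in> L \<Longrightarrow> A \<subseteq> B \<Longrightarrow> J A B = B"
  using join_ub2 join_least by blast

definition covers :: "'v set \<Rightarrow> 'v set \<Rightarrow> bool" where
  "covers A B \<longleftrightarrow> A \<in> L \<and> B \<in> L \<and> A \<subset> B \<and> (\<forall>D\<in>L. A \<subseteq> D \<longrightarrow> D \<subseteq> B \<longrightarrow> D = A \<or> D = B)"

inductive has_length :: "'v set \<Rightarrow> 'v set \<Rightarrow> nat \<Rightarrow> bool" for A where
  has_length_0: "A \<in> L \<Longrightarrow> has_length A A 0"
| has_length_Suc: "has_length A B n \<Longrightarrow> covers B C \<Longrightarrow> has_length A C (Suc n)"

lemma has_length_L: "has_length A B n \<Longrightarrow> A \<in> L \<and> B \<in> L \<and> A \<subseteq> B"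
  by (induction rule: has_length.induct) (auto simp: covers_def)

lemma covers_has_length: "covers A B \<Longrightarrow> has_length A B 1"
  using has_length_Suc[OF has_length_0] by (auto simp: covers_def)

text \<open>A cover of A by B remains a cover either after intersecting with C or after joining with
  C, and becomes an equality in the other place. The element \<open>J A (B \<inter> C)\<close> lies
  between A and B and decides which case occurs; modularity transports the absence of intermediate
  elements.\<close>

lemma covers_inter_join:
  assumes AB: "covers A B" and C: "C \<in> L"
  shows "A \<inter> C = B \<inter> C \<and> covers (J A C) (J B C) \<or> covers (A \<inter> C) (B \<inter> C) \<and> J A C = J B C"
proof -
  have L: "A \<in> L" "B \<in> L" "A \<subseteq> B" "A \<noteq> B" using AB by (auto simp: covers_def)
  have btw: "D = A \<or> D = B" if "D \<in> L" "A \<subseteq> D" "D \<subseteq> B" for D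
    using AB that unfolding covers_def by blast
  have BC: "B \<inter> C \<in> L" "A \<inter> C \<in> L" using L C int_closed by auto
  have J: "J A C \<in> L" "J B C \<in> L" "J A (B \<inter> C) \<in> L" using L C BC join_closed by auto
  have "J A (B \<inter> C) = A \<or> J A (B \<inter> C) = B"
    by (rule btw[OF J(3) join_ub1[OF L(1) BC(1)] join_least[OF L(1) BC(1) L(2) L(3)]]) blast
  then show ?thesis
  proof
    assume D: "J A (B \<inter> C) = A"
    then have sub: "B \<inter> C \<subseteq> A" using join_ub2[OF L(1) BC(1)] by simp
    have "\<not> J B C \<subseteq> J A C"
    proof
      assume "J B C \<subseteq> J A C"
      then have "B \<subseteq> J A C \<inter> B" using join_ub1[OF L(2) C] by blast
      also have "\<dots> \<subseteq> J A (C \<inter> B)" using modular[OF L(1) C L(2) L(3)] .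
      finally show False using D L by (simp add: Int_commute)
    qed
    moreover have "J A C \<subseteq> J B C"
      by (rule join_least[OF L(1) C J(2)]) (use L C join_ub1 join_ub2 in blast)+
    moreover have "E = J A C \<or> E = J B C" if E: "E \<in> L" "J A C \<subseteq> E" "E \<subseteq> J B C" for E
    proof -
      have CE: "C \<subseteq> E" "A \<subseteq> E" using E join_ub1[OF L(1) C] join_ub2[OF L(1) C] by auto
      have EB: "E \<inter> B \<in> L" using E L int_closed by blast
      have "E \<inter> B = A \<or> E \<inter> B = B" by (rule btw) (use EB CE L in auto)
      then show ?thesis
      proof
        assume eq: "E \<inter> B = A"
        have "J B C \<subseteq> J C B" by (rule join_least[OF L(2) C join_closed[OF C L(2)]]) (use L C join_ub1 join_ub2 in blast)+
        then have "E \<subseteq> J C B \<inter> E" using E by auto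
        also have "\<dots> \<subseteq> J C (B \<inter> E)" by (rule modular[OF C L(2) E(1) CE(1)])
        also have "\<dots> = J C A" using eq by (simp add: Int_commute)
        also have "\<dots> \<subseteq> J A C" by (rule join_least[OF C L(1) J(1)]) (use L C join_ub1 join_ub2 in blast)+
        finally show ?thesis using E by blast
      next
        assume "E \<inter> B = B"
        then have "J B C \<subseteq> E" using join_least[OF L(2) C E(1)] CE by blast
        then show ?thesis using E by blast
      qed
    qed
    ultimately have "covers (J A C) (J B C)" unfolding covers_def using J by blast
    then show ?thesis using sub L by blast
  next
    assume D: "J A (B \<inter> C) = B"
    have "J A (B \<inter> C) \<subseteq> J A C"
      by (rule join_least[OF L(1) BC(1) J(1)]) (use L C join_ub1 join_ub2 in blast)+
    then have "J B C \<subseteq> J A C" using D join_least[OF L(2) C J(1)] join_ub2[OF L(1) C] by auto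
    moreover have "J A C \<subseteq> J B C"
      by (rule join_least[OF L(1) C J(2)]) (use L C join_ub1 join_ub2 in blast)+
    moreover have "A \<inter> C \<noteq> B \<inter> C"
    proof
      assume "A \<inter> C = B \<inter> C"
      then have "J A (B \<inter> C) = A" using join_absorb[OF L(1) BC(1)] by auto
      then show False using D L by simp
    qed
    moreover have "E = A \<inter> C \<or> E = B \<inter> C" if E: "E \<in> L" "A \<inter> C \<subseteq> E" "E \<subseteq> B \<inter> C" for E
    proof -
      have "J A E = A \<or> J A E = B"
        by (rule btw[OF join_closed[OF L(1) E(1)] join_ub1[OF L(1) E(1)] join_least[OF L(1) E(1) L(2) L(3)]])
          (use E in blast)
      then show ?thesis
      proof
        assume "J A E = A"
        then show ?thesis using E join_ub2[OF L(1) E(1)] by blast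
      next
        assume eq: "J A E = B"
        have "J A E \<subseteq> J E A" by (rule join_least[OF L(1) E(1) join_closed[OF E(1) L(1)]])
            (use L E join_ub1 join_ub2 in blast)+
        then have "B \<inter> C \<subseteq> J E A \<inter> C" using eq by auto
        also have "\<dots> \<subseteq> J E (A \<inter> C)" by (rule modular[OF E(1) L(1) C]) (use E in auto)
        also have "\<dots> = E" by (rule join_absorb) (use E BC in auto)
        finally show ?thesis using E by blast
      qed
    qed
    ultimately show ?thesis unfolding covers_def using BC L by blast
  qed
qed

lemma has_length_split:
  assumes "has_length A B n" "C \<in> L"
  shows "\<exists>p q. has_length (A \<inter> C) (B \<inter> C) p \<and> has_length (J A C) (J B C) q \<and> p + q = n"
  using assms(1)
proof (induction rule: has_length.induct)
  case has_length_0
  then have "has_length (A \<inter> C) (A \<inter> C) 0" "has_length (J A C) (J A C) 0"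
    using assms(2) int_closed join_closed has_length.has_length_0 by auto
  then show ?case by (intro exI[of _ 0]) simp
next
  case (has_length_Suc B n D)
  then obtain p q where pq: "has_length (A \<inter> C) (B \<inter> C) p" "has_length (J A C) (J B C) q" "p + q = n"
    by blast
  from covers_inter_join[OF has_length_Suc.hyps(2) assms(2)] show ?case
  proof
    assume h: "B \<inter> C = D \<inter> C \<and> covers (J B C) (J D C)"
    have "has_length (J A C) (J D C) (Suc q)" using has_length.has_length_Suc[OF pq(2)] h by blast
    then show ?thesis using pq h by (intro exI[of _ p] exI[of _ "Suc q"]) auto
  next
    assume h: "covers (B \<inter> C) (D \<inter> C) \<and> J B C = J D C"
    have "has_length (A \<inter> C) (D \<inter> C) (Suc p)" using has_length.has_length_Suc[OF pq(1)] h by blast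
    then show ?thesis using pq h by (intro exI[of _ "Suc p"] exI[of _ q]) auto
  qed
qed

lemma has_length_refl: "has_length A A n \<Longrightarrow> n = 0"
  by (erule has_length.cases) (auto dest: has_length_L simp: covers_def)

lemma has_length_covers: "covers A B \<Longrightarrow> has_length A B n \<Longrightarrow> n = 1"
proof (erule has_length.cases)
  fix D m C assume h: "covers A B" "B = C" "n = Suc m" "has_length A D m" "covers D C"
  then have "D = A" using has_length_L[OF h(4)] unfolding covers_def by blast
  then show ?thesis using h has_length_refl by auto
qed (auto simp: covers_def)

text \<open>Jordan-Hoelder: the second chain is split along the penultimate element B of the first
  one. The part below B has the right length by induction, the part above B is a chain along a cover
  and has length 1.\<close>

lemma has_length_unique: "has_length A B n \<Longrightarrow> has_length A B m \<Longrightarrow> n = m"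
proof (induction arbitrary: m rule: has_length.induct)
  case has_length_0
  then show ?case using has_length_refl by blast
next
  case (has_length_Suc B n C)
  have L: "A \<in> L" "B \<in> L" "A \<subseteq> B" "C \<in> L" "B \<subseteq> C" using has_length_L[OF has_length_Suc.hyps(1)] has_length_Suc.hyps(2)
    by (auto simp: covers_def)
  obtain p q where pq: "has_length (A \<inter> B) (C \<inter> B) p" "has_length (J A B) (J C B) q" "p + q = m"
    using has_length_split[OF has_length_Suc.prems L(2)] by blast
  have "A \<inter> B = A" "C \<inter> B = B" "J A B = B" "J C B = C" using L join_absorb join_absorb2 by auto
  then have "p = n" "q = 1" using pq has_length_Suc.IH has_length_covers[OF has_length_Suc.hyps(2)] by auto
  then show ?case using pq by simp
qed

lemma has_length_trans: "has_length B C m \<Longrightarrow> has_length A B n \<Longrightarrow> has_length A C (n + m)"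
  by (induction rule: has_length.induct) (auto intro: has_length_Suc)

text \<open>A finite chain from Z to T stays finite when it is intersected with B and then joined
  with A.\<close>

lemma has_length_between:
  assumes "has_length Z T N" "A \<in> L" "B \<in> L" "Z \<subseteq> A" "A \<subseteq> B" "B \<subseteq> T"
  shows "\<exists>n. has_length A B n"
proof -
  have ZT: "Z \<in> L" "T \<in> L" using has_length_L[OF assms(1)] by auto
  obtain p where "has_length (Z \<inter> B) (T \<inter> B) p" using has_length_split[OF assms(1,3)] by blast
  moreover have "Z \<inter> B = Z" "T \<inter> B = B" using assms by auto
  ultimately have "has_length Z B p" by simp
  then obtain q where "has_length (J Z A) (J B A) q" using has_length_split assms(2) by blast
  moreover have "J Z A = A" "J B A = B" using assms ZT join_absorb join_absorb2 by auto
  ultimately show ?thesis by auto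
qed

definition len :: "'v set \<Rightarrow> 'v set \<Rightarrow> nat" where
  "len A B = (THE n. has_length A B n)"

lemma len_eq: "has_length A B n \<Longrightarrow> len A B = n"
  unfolding len_def using has_length_unique by blast

lemma len_refl [simp]: "A \<in> L \<Longrightarrow> len A A = 0"
  by (intro len_eq has_length_0)

end

section \<open>Modular lattices of finite length\<close>

locale finite_modular_sets = modular_sets +
  fixes Z T N
  assumes bounds: "A \<in> L \<Longrightarrow> Z \<subseteq> A \<and> A \<subseteq> T"
    and finite_length: "has_length Z T N"
begin

lemma len_has_length: "A \<in> L \<Longrightarrow> B \<in> L \<Longrightarrow> A \<subseteq> B \<Longrightarrow> has_length A B (len A B)"
proof -
  assume L: "A \<in> L" "B \<in> L" "A \<subseteq> B"
  obtain n where n: "has_length A B n"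
    using has_length_between[OF finite_length L(1,2) _ L(3)] bounds[OF L(1)] bounds[OF L(2)] by blast
  then show ?thesis using len_eq[OF n] by simp
qed

lemma len_add: "A \<in> L \<Longrightarrow> B \<in> L \<Longrightarrow> C \<in> L \<Longrightarrow> A \<subseteq> B \<Longrightarrow> B \<subseteq> C \<Longrightarrow> len A C = len A B + len B C"
  by (rule len_eq[OF has_length_trans[of B C "len B C" A "len A B", OF len_has_length len_has_length]])

text \<open>When a chain from \<open>A \<inter> B\<close> to A is split along B, no step lies in the
  intersections, so every step survives in the join with B.\<close>

lemma len_diamond: "A \<in> L \<Longrightarrow> B \<in> L \<Longrightarrow> len (A \<inter> B) A = len B (J A B)"
proof -
  assume L: "A \<in> L" "B \<in> L"
  have "has_length (A \<inter> B) A (len (A \<inter> B) A)" using L int_closed len_has_length by blast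
  then obtain p q where pq: "has_length (A \<inter> B \<inter> B) (A \<inter> B) p" "has_length (J (A \<inter> B) B) (J A B) q"
    "p + q = len (A \<inter> B) A" using has_length_split L(2) by blast
  have "p = 0" using pq(1) has_length_refl by (simp add: Int_assoc)
  moreover have "J (A \<inter> B) B = B" using L int_closed join_absorb2 by auto
  ultimately show ?thesis using pq len_eq by auto
qed

lemma len_pos: "A \<in> L \<Longrightarrow> B \<in> L \<Longrightarrow> A \<subseteq> B \<Longrightarrow> A \<noteq> B \<Longrightarrow> len A B > 0"
proof (rule ccontr)
  assume L: "A \<in> L" "B \<in> L" "A \<subseteq> B" "A \<noteq> B" and "\<not> len A B > 0"
  then have "has_length A B 0" using len_has_length[OF L(1-3)] by simp
  then show False using L(4) by (cases) auto
qed

lemma len_eq_0: "A \<in> L \<Longrightarrow> B \<in> L \<Longrightarrow> A \<subseteq> B \<Longrightarrow> len A B = 0 \<longleftrightarrow> A = B"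
  using len_pos by fastforce

lemma len_mono: "A \<in> L \<Longrightarrow> B \<in> L \<Longrightarrow> C \<in> L \<Longrightarrow> D \<in> L \<Longrightarrow> A \<subseteq> B \<Longrightarrow> B \<subseteq> C \<Longrightarrow> C \<subseteq> D \<Longrightarrow> len B C \<le> len A D"
  using len_add[of A B D] len_add[of B C D] by auto

lemma len_1_covers: "A \<in> L \<Longrightarrow> B \<in> L \<Longrightarrow> A \<subseteq> B \<Longrightarrow> len A B = 1 \<Longrightarrow> covers A B"
proof -
  assume L: "A \<in> L" "B \<in> L" "A \<subseteq> B" and 1: "len A B = 1"
  have "has_length A B (Suc 0)" using len_has_length[OF L] 1 by simp
  then show ?thesis
  proof cases
    case (has_length_Suc D)
    from has_length_Suc(1) have "A = D" by cases auto
    then show ?thesis using has_length_Suc by simp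
  qed
qed

end

section \<open>Submodules\<close>

definition smod :: "('a, 'b) ring_scheme \<Rightarrow> ('a, 'c, 'd) module_scheme \<Rightarrow> 'c set \<Rightarrow> bool" where
  "smod R M A \<longleftrightarrow> A \<subseteq> carrier M \<and> \<zero>\<^bsub>M\<^esub> \<in> A \<and> (\<forall>x\<in>A. \<forall>y\<in>A. x \<oplus>\<^bsub>M\<^esub> y \<in> A) \<and>
     (\<forall>r\<in>carrier R. \<forall>x\<in>A. r \<odot>\<^bsub>M\<^esub> x \<in> A)"

definition msum :: "('a, 'c, 'd) module_scheme \<Rightarrow> 'c set \<Rightarrow> 'c set \<Rightarrow> 'c set" where
  "msum M A B = {x \<oplus>\<^bsub>M\<^esub> y | x y. x \<in> A \<and> y \<in> B}"

abbreviation slen :: "('a, 'b) ring_scheme \<Rightarrow> ('a, 'c, 'd) module_scheme \<Rightarrow> 'c set \<Rightarrow> 'c set \<Rightarrow> nat" where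
  "slen R M \<equiv> modular_sets.len {A. smod R M A}"

abbreviation hlen :: "('a, 'b) ring_scheme \<Rightarrow> ('a, 'c, 'd) module_scheme \<Rightarrow> 'c set \<Rightarrow> 'c set \<Rightarrow> nat \<Rightarrow> bool" where
  "hlen R M \<equiv> modular_sets.has_length {A. smod R M A}"

abbreviation scov :: "('a, 'b) ring_scheme \<Rightarrow> ('a, 'c, 'd) module_scheme \<Rightarrow> 'c set \<Rightarrow> 'c set \<Rightarrow> bool" where
  "scov R M \<equiv> modular_sets.covers {A. smod R M A}"

lemma smodI:
  assumes "A \<subseteq> carrier M" "\<zero>\<^bsub>M\<^esub> \<in> A" "\<And>x y. x \<in> A \<Longrightarrow> y \<in> A \<Longrightarrow> x \<oplus>\<^bsub>M\<^esub> y \<in> A"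
    "\<And>r x. r \<in> carrier R \<Longrightarrow> x \<in> A \<Longrightarrow> r \<odot>\<^bsub>M\<^esub> x \<in> A"
  shows "smod R M A"
  using assms unfolding smod_def by blast

lemma smod_sub: "smod R M A \<Longrightarrow> A \<subseteq> carrier M"
  and smod_carr: "smod R M A \<Longrightarrow> x \<in> A \<Longrightarrow> x \<in> carrier M"
  and smod_zero: "smod R M A \<Longrightarrow> \<zero>\<^bsub>M\<^esub> \<in> A"
  and smod_add: "smod R M A \<Longrightarrow> x \<in> A \<Longrightarrow> y \<in> A \<Longrightarrow> x \<oplus>\<^bsub>M\<^esub> y \<in> A"
  and smod_smult: "smod R M A \<Longrightarrow> r \<in> carrier R \<Longrightarrow> x \<in> A \<Longrightarrow> r \<odot>\<^bsub>M\<^esub> x \<in> A"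
  unfolding smod_def by blast+

lemma msumI: "x \<in> A \<Longrightarrow> y \<in> B \<Longrightarrow> x \<oplus>\<^bsub>M\<^esub> y \<in> msum M A B"
  unfolding msum_def by blast

lemma msumE: "z \<in> msum M A B \<Longrightarrow> (\<And>x y. x \<in> A \<Longrightarrow> y \<in> B \<Longrightarrow> z = x \<oplus>\<^bsub>M\<^esub> y \<Longrightarrow> P) \<Longrightarrow> P"
  unfolding msum_def by blast

context module
begin

lemma smod_neg: "smod R M A \<Longrightarrow> x \<in> A \<Longrightarrow> \<ominus>\<^bsub>M\<^esub> x \<in> A"
  using smod_smult[of R M A "\<ominus> \<one>" x] smod_carr[of R M A x] smult_l_minus[of \<one> x] by simp

lemma smod_minus: "smod R M A \<Longrightarrow> x \<in> A \<Longrightarrow> y \<in> A \<Longrightarrow> x \<ominus>\<^bsub>M\<^esub> y \<in> A"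
  unfolding a_minus_def by (intro smod_add smod_neg)

lemma smod_cancel: "smod R M A \<Longrightarrow> x \<in> A \<Longrightarrow> y \<in> carrier M \<Longrightarrow> x \<oplus>\<^bsub>M\<^esub> y \<in> A \<Longrightarrow> y \<in> A"
proof -
  assume h: "smod R M A" "x \<in> A" "y \<in> carrier M" "x \<oplus>\<^bsub>M\<^esub> y \<in> A"
  have x: "x \<in> carrier M" using h smod_carr by metis
  have "\<ominus>\<^bsub>M\<^esub> x \<oplus>\<^bsub>M\<^esub> (x \<oplus>\<^bsub>M\<^esub> y) \<in> A" by (rule smod_add[OF h(1) smod_neg[OF h(1,2)] h(4)])
  then show ?thesis using x h by (simp add: M.r_neg1)
qed

lemma smod_carrier: "smod R M (carrier M)"
  by (auto intro!: smodI)

lemma smod_zero_mod: "smod R M {\<zero>\<^bsub>M\<^esub>}"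
  by (auto intro!: smodI)

lemma smod_int: "smod R M A \<Longrightarrow> smod R M B \<Longrightarrow> smod R M (A \<inter> B)"
  unfolding smod_def by blast

lemma smod_msum: assumes A: "smod R M A" and B: "smod R M B" shows "smod R M (msum M A B)"
proof (rule smodI)
  show "msum M A B \<subseteq> carrier M" using smod_sub[OF A] smod_sub[OF B] by (auto simp: msum_def)
  have "\<zero>\<^bsub>M\<^esub> \<oplus>\<^bsub>M\<^esub> \<zero>\<^bsub>M\<^esub> \<in> msum M A B" by (intro msumI smod_zero[OF A] smod_zero[OF B])
  then show "\<zero>\<^bsub>M\<^esub> \<in> msum M A B" by simp
next
  fix z w assume "z \<in> msum M A B" "w \<in> msum M A B"
  then obtain x y x' y' where h: "x \<in> A" "y \<in> B" "x' \<in> A" "y' \<in> B"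
    and zw: "z = x \<oplus>\<^bsub>M\<^esub> y" "w = x' \<oplus>\<^bsub>M\<^esub> y'" by (auto simp: msum_def)
  have c: "x \<in> carrier M" "y \<in> carrier M" "x' \<in> carrier M" "y' \<in> carrier M"
    using h smod_carr[OF A] smod_carr[OF B] by auto
  have "z \<oplus>\<^bsub>M\<^esub> w = (x \<oplus>\<^bsub>M\<^esub> x') \<oplus>\<^bsub>M\<^esub> (y \<oplus>\<^bsub>M\<^esub> y')" using c zw by (simp add: M.a_ac)
  also have "\<dots> \<in> msum M A B" by (intro msumI smod_add[OF A] smod_add[OF B] h)
  finally show "z \<oplus>\<^bsub>M\<^esub> w \<in> msum M A B" .
next
  fix r z assume r: "r \<in> carrier R" and "z \<in> msum M A B"
  then obtain x y where h: "x \<in> A" "y \<in> B" and z: "z = x \<oplus>\<^bsub>M\<^esub> y" by (auto simp: msum_def)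
  have c: "x \<in> carrier M" "y \<in> carrier M" using h smod_carr[OF A] smod_carr[OF B] by auto
  have "r \<odot>\<^bsub>M\<^esub> z = r \<odot>\<^bsub>M\<^esub> x \<oplus>\<^bsub>M\<^esub> r \<odot>\<^bsub>M\<^esub> y" using c z r by (simp add: smult_r_distr)
  also have "\<dots> \<in> msum M A B" by (intro msumI smod_smult[OF A r] smod_smult[OF B r] h)
  finally show "r \<odot>\<^bsub>M\<^esub> z \<in> msum M A B" .
qed

lemma msum_ub1: "smod R M A \<Longrightarrow> smod R M B \<Longrightarrow> A \<subseteq> msum M A B"
proof
  fix x assume h: "smod R M A" "smod R M B" "x \<in> A"
  have "x \<oplus>\<^bsub>M\<^esub> \<zero>\<^bsub>M\<^esub> \<in> msum M A B" by (intro msumI h smod_zero[OF h(2)])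
  then show "x \<in> msum M A B" using smod_carr[OF h(1,3)] by simp
qed

lemma msum_ub2: "smod R M A \<Longrightarrow> smod R M B \<Longrightarrow> B \<subseteq> msum M A B"
proof
  fix x assume h: "smod R M A" "smod R M B" "x \<in> B"
  have "\<zero>\<^bsub>M\<^esub> \<oplus>\<^bsub>M\<^esub> x \<in> msum M A B" by (intro msumI h smod_zero[OF h(1)])
  then show "x \<in> msum M A B" using smod_carr[OF h(2,3)] by simp
qed

lemma msum_least: "smod R M C \<Longrightarrow> A \<subseteq> C \<Longrightarrow> B \<subseteq> C \<Longrightarrow> msum M A B \<subseteq> C"
  by (auto simp: msum_def intro!: smod_add)

lemma modular_smod: "modular_sets {A. smod R M A} (msum M)"
proof (unfold_locales; simp add: smod_int smod_msum msum_ub1 msum_ub2 msum_least)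
  fix A B C assume h: "smod R M A" "smod R M B" "smod R M C" "A \<subseteq> C"
  show "msum M A B \<inter> C \<subseteq> msum M A (B \<inter> C)"
  proof
    fix z assume "z \<in> msum M A B \<inter> C"
    then obtain x y where xy: "x \<in> A" "y \<in> B" "z = x \<oplus>\<^bsub>M\<^esub> y" "z \<in> C" by (auto simp: msum_def)
    have "y \<in> C" by (rule smod_cancel[OF h(3), of x]) (use xy h smod_carr[OF h(2)] in auto)
    then show "z \<in> msum M A (B \<inter> C)" using xy by (auto simp: msum_def)
  qed
qed

sublocale lat: modular_sets "{A. smod R M A}" "msum M"
  by (rule modular_smod)

end

locale fmodule = module +
  assumes finite_len: "\<exists>N. hlen R M {\<zero>\<^bsub>M\<^esub>} (carrier M) N"
begin

sublocale fin: finite_modular_sets "{A. smod R M A}" "msum M" "{\<zero>\<^bsub>M\<^esub>}" "carrier M"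
  "SOME N. hlen R M {\<zero>\<^bsub>M\<^esub>} (carrier M) N"
proof
  show "A \<in> {A. smod R M A} \<Longrightarrow> {\<zero>\<^bsub>M\<^esub>} \<subseteq> A \<and> A \<subseteq> carrier M" for A by (auto simp: smod_def)
  show "hlen R M {\<zero>\<^bsub>M\<^esub>} (carrier M) (SOME N. hlen R M {\<zero>\<^bsub>M\<^esub>} (carrier M) N)"
    by (rule someI_ex[OF finite_len])
qed

lemma slen_hlen: "smod R M A \<Longrightarrow> smod R M B \<Longrightarrow> A \<subseteq> B \<Longrightarrow> hlen R M A B (slen R M A B)"
  using fin.len_has_length by simp

lemma slen_add: "smod R M A \<Longrightarrow> smod R M B \<Longrightarrow> smod R M C \<Longrightarrow> A \<subseteq> B \<Longrightarrow> B \<subseteq> C \<Longrightarrow>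
    slen R M A C = slen R M A B + slen R M B C"
  by (rule fin.len_add) simp_all

lemma slen_diamond: "smod R M A \<Longrightarrow> smod R M B \<Longrightarrow> slen R M (A \<inter> B) A = slen R M B (msum M A B)"
  using fin.len_diamond by simp

lemma slen_eq_0: "smod R M A \<Longrightarrow> smod R M B \<Longrightarrow> A \<subseteq> B \<Longrightarrow> slen R M A B = 0 \<longleftrightarrow> A = B"
  using fin.len_eq_0 by simp

lemma slen_mono: "smod R M A \<Longrightarrow> smod R M B \<Longrightarrow> smod R M C \<Longrightarrow> smod R M D \<Longrightarrow>
    A \<subseteq> B \<Longrightarrow> B \<subseteq> C \<Longrightarrow> C \<subseteq> D \<Longrightarrow> slen R M B C \<le> slen R M A D"
  by (rule fin.len_mono[of A B C D]) simp_all

lemma slen_1_cov: "smod R M A \<Longrightarrow> smod R M B \<Longrightarrow> A \<subseteq> B \<Longrightarrow> slen R M A B = 1 \<Longrightarrow> scov R M A B"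
  using fin.len_1_covers by simp

end

subsection \<open>Linear maps\<close>

lemma linear_mapD:
  assumes "linear_map R M N f"
  shows "x \<in> carrier M \<Longrightarrow> f x \<in> carrier N"
    and "x \<in> carrier M \<Longrightarrow> y \<in> carrier M \<Longrightarrow> f (x \<oplus>\<^bsub>M\<^esub> y) = f x \<oplus>\<^bsub>N\<^esub> f y"
    and "r \<in> carrier R \<Longrightarrow> x \<in> carrier M \<Longrightarrow> f (r \<odot>\<^bsub>M\<^esub> x) = r \<odot>\<^bsub>N\<^esub> f x"
  using assms unfolding linear_map_def by blast+

locale two_modules = M: module R M + N: module R N
  for R (structure) and M :: "('a, 'c) module" and N :: "('a, 'd) module" +
  fixes f
  assumes lin: "linear_map R M N f"
begin

lemmas f_closed = linear_mapD(1)[OF lin]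
  and f_add = linear_mapD(2)[OF lin]
  and f_smult = linear_mapD(3)[OF lin]

lemma f_zero: "f \<zero>\<^bsub>M\<^esub> = \<zero>\<^bsub>N\<^esub>"
  using f_smult[of "\<zero>" "\<zero>\<^bsub>M\<^esub>"] f_closed[of "\<zero>\<^bsub>M\<^esub>"] by simp

lemma f_neg: "x \<in> carrier M \<Longrightarrow> f (\<ominus>\<^bsub>M\<^esub> x) = \<ominus>\<^bsub>N\<^esub> f x"
  using f_smult[of "\<ominus> \<one>" x] f_closed[of x] M.smult_l_minus[of \<one> x] N.smult_l_minus[of \<one> "f x"] by simp

lemma f_minus: "x \<in> carrier M \<Longrightarrow> y \<in> carrier M \<Longrightarrow> f (x \<ominus>\<^bsub>M\<^esub> y) = f x \<ominus>\<^bsub>N\<^esub> f y"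
  by (simp add: a_minus_def f_add f_neg)

lemma smod_image: "smod R M A \<Longrightarrow> smod R N (f ` A)"
proof (rule smodI)
  assume A: "smod R M A"
  note c = smod_carr[OF A]
  show "f ` A \<subseteq> carrier N" using c f_closed by blast
  show "\<zero>\<^bsub>N\<^esub> \<in> f ` A" using smod_zero[OF A] f_zero by force
  show "x \<oplus>\<^bsub>N\<^esub> y \<in> f ` A" if xy: "x \<in> f ` A" "y \<in> f ` A" for x y
  proof -
    obtain u v where "u \<in> A" "v \<in> A" "x = f u" "y = f v" using xy by blast
    then show ?thesis using f_add[OF c c] smod_add[OF A] by (metis imageI)
  qed
  show "r \<odot>\<^bsub>N\<^esub> x \<in> f ` A" if rx: "r \<in> carrier R" "x \<in> f ` A" for r x
  proof -
    obtain u where "u \<in> A" "x = f u" using rx by blast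
    then show ?thesis using f_smult[OF rx(1) c] smod_smult[OF A rx(1)] by (metis imageI)
  qed
qed

lemma smod_vimage: "smod R N B \<Longrightarrow> smod R M {x \<in> carrier M. f x \<in> B}"
  by (rule smodI) (auto simp: f_zero f_add f_smult intro: smod_zero smod_add smod_smult)

lemma scov_image:
  assumes AB: "scov R M A B" and ker: "\<And>x. x \<in> B \<Longrightarrow> f x = \<zero>\<^bsub>N\<^esub> \<Longrightarrow> x \<in> A"
  shows "scov R N (f ` A) (f ` B)"
proof -
  have s: "smod R M A" "smod R M B" "A \<subseteq> B" "A \<noteq> B" using AB by (auto simp: M.lat.covers_def)
  note c = smod_carr[OF s(2)]
  have inA: "x \<in> A" if xB: "x \<in> B" "f x \<in> f ` A" for x
  proof -
    obtain y where y: "y \<in> A" "f x = f y" using xB(2) by blast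
    have "f (x \<ominus>\<^bsub>M\<^esub> y) = \<zero>\<^bsub>N\<^esub>"
      using y xB s c f_closed by (subst f_minus) (auto simp: N.M.r_neg a_minus_def)
    then have "x \<ominus>\<^bsub>M\<^esub> y \<in> A" using ker M.smod_minus[OF s(2) xB(1)] y s by blast
    then have "y \<oplus>\<^bsub>M\<^esub> (x \<ominus>\<^bsub>M\<^esub> y) \<in> A" using y smod_add[OF s(1)] by blast
    moreover have "y \<oplus>\<^bsub>M\<^esub> (x \<ominus>\<^bsub>M\<^esub> y) = x"
    proof -
      have "x \<in> carrier M" "y \<in> carrier M" using c[of x] c[of y] y xB s by auto
      then show ?thesis using M.M.r_neg1[of x "\<ominus>\<^bsub>M\<^esub> x"] M.M.a_lcomm[of y x "\<ominus>\<^bsub>M\<^esub> y"] by (simp add: a_minus_def M.M.r_neg)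
    qed
    ultimately show ?thesis by simp
  qed
  have "f ` A \<noteq> f ` B" using inA s by blast
  moreover have "D = f ` A \<or> D = f ` B" if D: "smod R N D" "f ` A \<subseteq> D" "D \<subseteq> f ` B" for D
  proof -
    let ?E = "{x \<in> carrier M. f x \<in> D} \<inter> B"
    have E: "smod R M ?E" by (rule M.smod_int[OF smod_vimage[OF D(1)] s(2)])
    have "A \<subseteq> ?E" using s D c by auto
    then have "?E = A \<or> ?E = B" using AB E unfolding M.lat.covers_def by blast
    moreover have "f ` ?E = D"
    proof
      show "D \<subseteq> f ` ?E"
      proof
        fix y assume y: "y \<in> D"
        then obtain x where "x \<in> B" "y = f x" using D(3) by blast
        then show "y \<in> f ` ?E" using y c by blast
      qed
    qed auto
    ultimately show ?thesis by (elim disjE) simp_all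
  qed
  ultimately show ?thesis unfolding N.lat.covers_def using s smod_image by auto
qed

lemma hlen_image:
  assumes "hlen R M A B n" and "\<And>x. x \<in> B \<Longrightarrow> f x = \<zero>\<^bsub>N\<^esub> \<Longrightarrow> x \<in> A"
  shows "hlen R N (f ` A) (f ` B) n"
  using assms
proof (induction rule: M.lat.has_length.induct)
  case has_length_0
  then show ?case using smod_image N.lat.has_length_0 by simp
next
  case (has_length_Suc B n C)
  have "A \<subseteq> B" "B \<subseteq> C" using M.lat.has_length_L[OF has_length_Suc.hyps(1)] has_length_Suc.hyps(2)
    by (auto simp: M.lat.covers_def)
  have "hlen R N (f ` A) (f ` B) n" by (rule has_length_Suc.IH) (use has_length_Suc.prems \<open>B \<subseteq> C\<close> in blast)
  moreover have "scov R N (f ` B) (f ` C)"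
    by (rule scov_image[OF has_length_Suc.hyps(2)]) (use has_length_Suc.prems \<open>A \<subseteq> B\<close> in blast)
  ultimately show ?case by (rule N.lat.has_length_Suc)
qed

end

text \<open>The isomorphism theorem for subquotients: if the kernel of f on B lies in A, then B/A
  and f(B)/f(A) are isomorphic. Nearly all length comparisons below are instances, with f a
  differential or a multiplication.\<close>

lemma slen_image:
  assumes "fmodule R M" "module R N" "linear_map R M N f" "smod R M A" "smod R M B" "A \<subseteq> B"
    and "\<And>x. x \<in> B \<Longrightarrow> f x = \<zero>\<^bsub>N\<^esub> \<Longrightarrow> x \<in> A"
  shows "slen R N (f ` A) (f ` B) = slen R M A B"
proof -
  interpret M: fmodule R M by fact
  interpret N: module R N by fact
  interpret two_modules R M N f by unfold_locales fact
  show ?thesis by (rule N.lat.len_eq[OF hlen_image[OF M.slen_hlen[OF assms(4-6)] assms(7)]])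
qed

subsection \<open>Local rings and ranks\<close>

definition self_module :: "('a, 'b) ring_scheme \<Rightarrow> ('a, 'a) module" where
  "self_module R = \<lparr>carrier = carrier R, monoid.mult = monoid.mult R, monoid.one = monoid.one R,
      ring.zero = \<zero>\<^bsub>R\<^esub>, ring.add = ring.add R, module.smult = monoid.mult R\<rparr>"

lemma self_module_simps [simp]:
  "carrier (self_module R) = carrier R" "\<zero>\<^bsub>self_module R\<^esub> = \<zero>\<^bsub>R\<^esub>"
  "x \<oplus>\<^bsub>self_module R\<^esub> y = x \<oplus>\<^bsub>R\<^esub> y" "r \<odot>\<^bsub>self_module R\<^esub> x = r \<otimes>\<^bsub>R\<^esub> x"
  by (simp_all add: self_module_def)

context cring
begin

lemma module_self: "module R (self_module R)"
proof (rule moduleI)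
  show "abelian_group (self_module R)"
    by (rule abelian_groupI) (auto simp: a_ac intro: l_neg)
qed (auto simp: l_distr r_distr m_assoc is_cring)

lemma smod_self_iff: "smod R (self_module R) A \<longleftrightarrow> ideal A R"
proof
  assume A: "smod R (self_module R) A"
  interpret S: module R "self_module R" by (rule module_self)
  have neg: "\<ominus> x \<in> A" if "x \<in> A" for x
  proof -
    have x: "x \<in> carrier R" using smod_carr[OF A that] by simp
    have "(\<ominus> \<one>) \<otimes> x \<in> A" using smod_smult[OF A, of "\<ominus> \<one>" x] that by simp
    moreover have "(\<ominus> \<one>) \<otimes> x = \<ominus> x" using x by (simp add: l_minus)
    ultimately show ?thesis by simp
  qed
  show "ideal A R"
  proof (rule idealI)
    show "subgroup A (add_monoid R)"
      by (rule subgroup.intro)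
        (use A neg in \<open>auto simp: smod_def simp flip: a_inv_def\<close>)
    show "x \<otimes> a \<in> A" "a \<otimes> x \<in> A" if "a \<in> A" "x \<in> carrier R" for a x
      using A that m_comm[of a x] smod_carr[OF A that(1)] by (auto simp: smod_def)
  qed (rule ring_axioms)
next
  assume "ideal A R"
  then interpret ideal A R .
  show "smod R (self_module R) A"
    by (rule smodI) (auto simp: I_l_closed a_subset subsetD[OF a_subset])
qed

end

locale local_cring = cring +
  fixes mx :: "'a set"
  assumes mx_ideal: "ideal mx R" and one_notin_mx: "\<one> \<notin> mx"
    and unit_notin_mx: "x \<in> carrier R \<Longrightarrow> x \<notin> mx \<Longrightarrow> x \<in> Units R"
begin

lemma mx_carr: "x \<in> mx \<Longrightarrow> x \<in> carrier R"
  by (rule ideal.Icarr[OF mx_ideal])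

lemma notin_mx_inv:
  assumes "x \<in> carrier R" "x \<notin> mx"
  obtains y where "y \<in> carrier R" "y \<otimes> x = \<one>"
  using unit_notin_mx[OF assms] Units_l_inv_ex by blast

lemma one_minus_mx: "x \<in> mx \<Longrightarrow> \<one> \<ominus> x \<notin> mx"
proof
  assume h: "x \<in> mx" "\<one> \<ominus> x \<in> mx"
  interpret ideal mx R by (rule mx_ideal)
  have "(\<one> \<ominus> x) \<oplus> x \<in> mx" using h by (rule a_closed[rotated])
  moreover have "(\<one> \<ominus> x) \<oplus> x = \<one>" using mx_carr[OF h(1)] by algebra
  ultimately show False using one_notin_mx by simp
qed

lemma smod_span: "module R M \<Longrightarrow> x \<in> carrier M \<Longrightarrow> smod R M {r \<odot>\<^bsub>M\<^esub> x | r. r \<in> carrier R}"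
proof -
  assume "module R M" and x: "x \<in> carrier M"
  then interpret M: module R M by simp
  show ?thesis
  proof (rule smodI)
    show "\<zero>\<^bsub>M\<^esub> \<in> {r \<odot>\<^bsub>M\<^esub> x | r. r \<in> carrier R}" using x M.smult_l_null[of x] by (metis (mono_tags, lifting) mem_Collect_eq zero_closed)
    show "u \<oplus>\<^bsub>M\<^esub> v \<in> {r \<odot>\<^bsub>M\<^esub> x | r. r \<in> carrier R}"
      if uv: "u \<in> {r \<odot>\<^bsub>M\<^esub> x | r. r \<in> carrier R}" "v \<in> {r \<odot>\<^bsub>M\<^esub> x | r. r \<in> carrier R}" for u v
    proof -
      obtain p q where "p \<in> carrier R" "q \<in> carrier R" "u = p \<odot>\<^bsub>M\<^esub> x" "v = q \<odot>\<^bsub>M\<^esub> x" using uv by blast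
      then show ?thesis using x by (auto intro!: exI[of _ "p \<oplus> q"] simp: M.smult_l_distr)
    qed
    show "s \<odot>\<^bsub>M\<^esub> u \<in> {r \<odot>\<^bsub>M\<^esub> x | r. r \<in> carrier R}"
      if su: "s \<in> carrier R" "u \<in> {r \<odot>\<^bsub>M\<^esub> x | r. r \<in> carrier R}" for s u
    proof -
      obtain p where "p \<in> carrier R" "u = p \<odot>\<^bsub>M\<^esub> x" using su by blast
      then show ?thesis using x su by (auto intro!: exI[of _ "s \<otimes> p"] simp: M.smult_assoc1)
    qed
  qed (use x in auto)
qed

lemma in_span: "module R M \<Longrightarrow> x \<in> carrier M \<Longrightarrow> x \<in> {r \<odot>\<^bsub>M\<^esub> x | r. r \<in> carrier R}"
  using module.smult_one[of R M x] by force

text \<open>An element of the larger module outside B has the form u + r x with u in B and r a unit,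
  because m x lies in B; so it recovers x.\<close>

lemma scov_span:
  assumes M: "module R M" and B: "smod R M B" and x: "x \<in> carrier M" "x \<notin> B"
    and mx: "\<And>r. r \<in> mx \<Longrightarrow> r \<odot>\<^bsub>M\<^esub> x \<in> B"
  shows "scov R M B (msum M B {r \<odot>\<^bsub>M\<^esub> x | r. r \<in> carrier R})" (is "scov R M B (msum M B ?X)")
proof -
  interpret M: module R M by fact
  have X: "smod R M ?X" "x \<in> ?X" using smod_span[OF M x(1)] in_span[OF M x(1)] by auto
  have "D = B \<or> D = msum M B ?X" if D: "smod R M D" "B \<subseteq> D" "D \<subseteq> msum M B ?X" for D
  proof (cases "D = B")
    case False
    then obtain z where z: "z \<in> D" "z \<notin> B" using D by blast
    then obtain u r where ur: "u \<in> B" "r \<in> carrier R" "z = u \<oplus>\<^bsub>M\<^esub> r \<odot>\<^bsub>M\<^esub> x"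
      using D by (auto simp: msum_def)
    have rx: "r \<odot>\<^bsub>M\<^esub> x \<in> D" using M.smod_cancel[OF D(1), of u] ur z D x by blast
    have "r \<notin> mx" using mx[of r] ur z smod_add[OF B] by blast
    then obtain s where s: "s \<in> carrier R" "s \<otimes> r = \<one>" using notin_mx_inv ur by blast
    have "s \<odot>\<^bsub>M\<^esub> (r \<odot>\<^bsub>M\<^esub> x) = x" using M.smult_assoc1[of s r x] s ur x by simp
    then have "x \<in> D" using smod_smult[OF D(1) s(1) rx] by simp
    then have "?X \<subseteq> D" using smod_smult[OF D(1)] by blast
    then have "msum M B ?X \<subseteq> D" using M.msum_least D by blast
    then show ?thesis using D by blast
  qed simp
  moreover have "B \<subset> msum M B ?X" using M.msum_ub1[OF B X(1)] M.msum_ub2[OF B X(1)] X x by blast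
  ultimately show ?thesis unfolding M.lat.covers_def using B X M.smod_msum by auto
qed

lemma scov_msum:
  assumes M: "module R M" and "scov R M B C" "x \<in> C" "x \<notin> B"
  shows "C = msum M B {r \<odot>\<^bsub>M\<^esub> x | r. r \<in> carrier R}" (is "C = msum M B ?X")
proof -
  interpret M: module R M by fact
  have s: "smod R M B" "smod R M C" "B \<subseteq> C" using assms by (auto simp: M.lat.covers_def)
  have x: "x \<in> carrier M" using smod_carr[OF s(2)] assms by blast
  have X: "smod R M ?X" "x \<in> ?X" using smod_span[OF M x(1)] in_span[OF M x(1)] by auto
  have "?X \<subseteq> C" using smod_smult[OF s(2)] assms by blast
  then have "msum M B ?X \<subseteq> C" using M.msum_least s by blast
  moreover have "msum M B ?X \<noteq> B" using M.msum_ub2[OF s(1) X(1)] X assms by blast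
  ultimately show ?thesis using assms(2) M.smod_msum[OF s(1) X(1)] M.msum_ub1[OF s(1) X(1)]
    unfolding M.lat.covers_def by blast
qed

section \<open>Ranks over the residue field as lengths\<close>

lemma hlen_msum_genideal:
  assumes N: "ideal N R" and Q: "ideal Q R" and QN: "\<And>r x. r \<in> mx \<Longrightarrow> x \<in> N \<Longrightarrow> r \<otimes> x \<in> Q"
    and S: "finite S" "S \<subseteq> N"
  shows "\<exists>n\<le>card S. hlen R (self_module R) Q (msum (self_module R) Q (Idl S)) n"
proof -
  interpret S: module R "self_module R" by (rule module_self)
  let ?M = "self_module R"
  have Qs: "smod R ?M Q" using Q smod_self_iff by simp
  show ?thesis using S
  proof (induction rule: finite_induct)
    case empty
    have "Idl {} = {\<zero>}"
    proof
      show "Idl {} \<subseteq> {\<zero>}" by (rule genideal_minimal[OF zeroideal]) simp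
      show "{\<zero>} \<subseteq> Idl {}" using genideal_ideal[of "{}"]
        additive_subgroup.zero_closed[OF ideal.axioms(1)] by blast
    qed
    then have "msum ?M Q (Idl {}) = Q" using ideal.Icarr[OF Q] by (force simp: msum_def)
    then show ?case using S.lat.has_length_0[of Q] Qs by auto
  next
    case (insert x S)
    have Sc: "S \<subseteq> carrier R" "x \<in> carrier R" using insert ideal.Icarr[OF N] by auto
    let ?U = "msum ?M Q (Idl S)" and ?V = "msum ?M Q (Idl (insert x S))"
    let ?X = "{r \<odot>\<^bsub>?M\<^esub> x | r. r \<in> carrier R}"
    have I: "ideal (Idl S) R" "ideal (Idl (insert x S)) R" using Sc genideal_ideal by auto
    have s: "smod R ?M (Idl S)" "smod R ?M (Idl (insert x S))" using I smod_self_iff by auto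
    have U: "smod R ?M ?U" using S.smod_msum[OF Qs s(1)] .
    have V: "smod R ?M ?V" using S.smod_msum[OF Qs s(2)] .
    have X: "smod R ?M ?X" "x \<in> ?X"
      using smod_span[OF module_self, of x] in_span[OF module_self, of x] Sc by auto
    have eq: "?V = msum ?M ?U ?X"
    proof
      have UX: "smod R ?M (msum ?M ?U ?X)" by (rule S.smod_msum[OF U X(1)])
      have "S \<subseteq> Idl S" using genideal_self[OF Sc(1)] .
      then have "insert x S \<subseteq> msum ?M ?U ?X"
        using X(2) S.msum_ub1[OF U X(1)] S.msum_ub2[OF U X(1)] S.msum_ub2[OF Qs s(1)] by blast
      then have "Idl (insert x S) \<subseteq> msum ?M ?U ?X"
        using genideal_minimal[of "msum ?M ?U ?X"] UX smod_self_iff by blast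
      then show "?V \<subseteq> msum ?M ?U ?X"
        using S.msum_least[OF UX] S.msum_ub1[OF U X(1)] S.msum_ub1[OF Qs s(1)] by blast
      have ins: "insert x S \<subseteq> Idl (insert x S)" using genideal_self[of "insert x S"] Sc by blast
      have "Idl S \<subseteq> Idl (insert x S)" using genideal_minimal[OF I(2), of S] ins by blast
      then have "?U \<subseteq> ?V"
        using S.msum_least[OF V] S.msum_ub1[OF Qs s(2)] S.msum_ub2[OF Qs s(2)] by blast
      moreover have "?X \<subseteq> ?V" using smod_smult[OF V, of _ x] ins S.msum_ub2[OF Qs s(2)] by blast
      ultimately show "msum ?M ?U ?X \<subseteq> ?V" using S.msum_least[OF V] by blast
    qed
    obtain n where n: "n \<le> card S" "hlen R ?M Q ?U n" using insert by auto
    show ?case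
    proof (cases "x \<in> ?U")
      case True
      then have "?X \<subseteq> ?U" using smod_smult[OF U, of _ x] by blast
      then have "?V = ?U" using eq S.msum_least[OF U] S.msum_ub1[OF U X(1)] by blast
      then show ?thesis using n insert by (intro exI[of _ n]) auto
    next
      case False
      have "scov R ?M ?U ?V" unfolding eq
      proof (rule scov_span[OF module_self U])
        show "r \<odot>\<^bsub>?M\<^esub> x \<in> ?U" if "r \<in> mx" for r
          using QN[OF that, of x] insert S.msum_ub1[OF Qs s(1)] by auto
      qed (use Sc False in auto)
      then have "hlen R ?M Q ?V (Suc n)" using S.lat.has_length_Suc n(2) by blast
      then show ?thesis using n insert by (intro exI[of _ "Suc n"]) auto
    qed
  qed
qed

lemma hlen_gens:
  assumes "hlen R (self_module R) Q N n"
  shows "\<exists>S. finite S \<and> card S \<le> n \<and> S \<subseteq> N \<and> (\<forall>x\<in>N. \<exists>y\<in>Idl S. x \<ominus> y \<in> Q)"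
proof -
  interpret S: module R "self_module R" by (rule module_self)
  let ?M = "self_module R"
  show ?thesis using assms
  proof (induction rule: S.lat.has_length.induct)
    case has_length_0
    then have Q: "ideal Q R" using smod_self_iff by simp
    have "\<zero> \<in> Idl {}" using genideal_ideal[of "{}"] additive_subgroup.zero_closed[OF ideal.axioms(1)] by blast
    then show ?case using ideal.Icarr[OF Q] by (intro exI[of _ "{}"]) (auto simp: a_minus_def intro!: bexI[of _ "\<zero>"])
  next
    case (has_length_Suc B n C)
    then obtain S where S: "finite S" "card S \<le> n" "S \<subseteq> B" "\<And>x. x \<in> B \<Longrightarrow> \<exists>y\<in>Idl S. x \<ominus> y \<in> Q" by blast
    have s: "smod R ?M B" "smod R ?M C" "B \<subseteq> C" "B \<noteq> C" using has_length_Suc.hyps(2) by (auto simp: S.lat.covers_def)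
    have Q: "ideal Q R" using S.lat.has_length_L[OF has_length_Suc.hyps(1)] smod_self_iff by auto
    obtain x where x: "x \<in> C" "x \<notin> B" using s by blast
    have C: "C = msum ?M B {r \<odot>\<^bsub>?M\<^esub> x | r. r \<in> carrier R}" using scov_msum[OF module_self has_length_Suc.hyps(2) x] .
    have Cc: "C \<subseteq> carrier R" using smod_sub[OF s(2)] by simp
    have ins: "insert x S \<subseteq> carrier R" using S(3) s(3) x Cc by blast
    have I: "ideal (Idl (insert x S)) R" using genideal_ideal[OF ins] .
    have sub: "Idl S \<subseteq> Idl (insert x S)" "x \<in> Idl (insert x S)"
      using genideal_minimal[OF I, of S] genideal_self[OF ins] by auto
    have "\<exists>y\<in>Idl (insert x S). z \<ominus> y \<in> Q" if z: "z \<in> C" for z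
    proof -
      obtain u r where ur: "u \<in> B" "r \<in> carrier R" "z = u \<oplus> r \<otimes> x" using z C by (auto simp: msum_def)
      obtain y where y: "y \<in> Idl S" "u \<ominus> y \<in> Q" using S(4)[OF ur(1)] by blast
      have rx: "r \<otimes> x \<in> Idl (insert x S)" using ideal.I_l_closed[OF I sub(2) ur(2)] .
      have mem: "y \<oplus> r \<otimes> x \<in> Idl (insert x S)"
        using additive_subgroup.a_closed[OF ideal.axioms(1)[OF I]] rx sub y by blast
      have "u \<in> carrier R" "x \<in> carrier R" "y \<in> carrier R"
        using ur(1) s(3) x Cc ideal.Icarr[OF I] sub y by auto
      then have "z \<ominus> (y \<oplus> r \<otimes> x) = u \<ominus> y" using ur by algebra
      then show ?thesis using mem y by metis
    qed
    moreover have "card (insert x S) \<le> Suc n" using S by (simp add: card_insert_if)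
    ultimately show ?case using S x s by (intro exI[of _ "insert x S"]) auto
  qed
qed

text \<open>Both inequalities count generators: since m N lies in Q, each generator raises the
  length over Q by at most one, and conversely a chain from Q to N yields one generator per step.
  Finite generation of N guarantees that the least number in \<open>rank_res\<close> is
  attained.\<close>

lemma rank_res_hlen:
  assumes N: "ideal N R" and Q: "ideal Q R" and sub: "Q \<subseteq> N"
    and QN: "\<And>r x. r \<in> mx \<Longrightarrow> x \<in> N \<Longrightarrow> r \<otimes> x \<in> Q"
    and fg: "\<exists>S. finite S \<and> S \<subseteq> carrier R \<and> N = Idl S"
  shows "hlen R (self_module R) Q N (rank_res R N Q)"
proof -
  interpret S: module R "self_module R" by (rule module_self)
  let ?M = "self_module R"
  have Qs: "smod R ?M Q" and Ns: "smod R ?M N" using N Q smod_self_iff by auto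
  let ?P = "\<lambda>c. \<exists>S. finite S \<and> card S = c \<and> S \<subseteq> N \<and> (\<forall>x\<in>N. \<exists>y\<in>Idl S. x \<ominus> y \<in> Q)"
  have *: "\<exists>n\<le>card S. hlen R ?M Q N n"
    if S: "finite S" "S \<subseteq> N" "\<forall>x\<in>N. \<exists>y\<in>Idl S. x \<ominus> y \<in> Q" for S
  proof -
    have Sc: "S \<subseteq> carrier R" using S ideal.Icarr[OF N] by blast
    have I: "ideal (Idl S) R" using genideal_ideal[OF Sc] .
    have Is: "smod R ?M (Idl S)" using I smod_self_iff by simp
    have "Idl S \<subseteq> N" using genideal_minimal[OF N S(2)] .
    then have "msum ?M Q (Idl S) \<subseteq> N" using S.msum_least[OF Ns sub] by blast
    moreover have "N \<subseteq> msum ?M Q (Idl S)"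
    proof
      fix x assume x: "x \<in> N"
      then obtain y where y: "y \<in> Idl S" "x \<ominus> y \<in> Q" using S by blast
      have "(x \<ominus> y) \<oplus>\<^bsub>?M\<^esub> y \<in> msum ?M Q (Idl S)" using y by (intro msumI)
      moreover have "(x \<ominus> y) \<oplus> y = x" using ideal.Icarr[OF N x] ideal.Icarr[OF I y(1)] by algebra
      ultimately show "x \<in> msum ?M Q (Idl S)" by simp
    qed
    ultimately have "msum ?M Q (Idl S) = N" by blast
    then show ?thesis using hlen_msum_genideal[OF N Q QN S(1,2)] by simp
  qed
  obtain S0 where S0: "finite S0" "S0 \<subseteq> carrier R" "N = Idl S0" using fg by blast
  have "\<forall>x\<in>N. \<exists>y\<in>Idl S0. x \<ominus> y \<in> Q"
  proof
    fix x assume x: "x \<in> N"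
    have "x \<ominus> x = \<zero>" using ideal.Icarr[OF N x] by (simp add: a_minus_def r_neg)
    then show "\<exists>y\<in>Idl S0. x \<ominus> y \<in> Q" using x S0 additive_subgroup.zero_closed[OF ideal.axioms(1)[OF Q]] by metis
  qed
  then have P0: "?P (card S0)" using S0 genideal_self[OF S0(2)] by blast
  have rr: "rank_res R N Q = (LEAST c. ?P c)" unfolding rank_res_def ..
  have "?P (rank_res R N Q)" unfolding rr using P0 by (rule LeastI)
  then obtain S where "finite S" "card S = rank_res R N Q" "S \<subseteq> N" "\<forall>x\<in>N. \<exists>y\<in>Idl S. x \<ominus> y \<in> Q" by blast
  then obtain n where n: "n \<le> rank_res R N Q" "hlen R ?M Q N n" using * by metis
  obtain T where T: "finite T" "card T \<le> n" "T \<subseteq> N" "\<forall>x\<in>N. \<exists>y\<in>Idl T. x \<ominus> y \<in> Q"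
    using hlen_gens[OF n(2)] by blast
  then have "?P (card T)" by blast
  then have "rank_res R N Q \<le> card T" unfolding rr by (rule Least_le)
  then show ?thesis using n T by (metis le_antisym le_trans)
qed

end

section \<open>Exact zero divisors in short local rings\<close>

context local_cring
begin

abbreviation mp :: "nat \<Rightarrow> 'a set" where "mp n \<equiv> ideal_power R mx n"

abbreviation slf :: "('a, 'a) module" where "slf \<equiv> self_module R"

lemma mp_ideal: "ideal (mp n) R"
  by (induction n) (auto intro: ideal_prod_is_ideal mx_ideal oneideal)

lemma mp_carr: "x \<in> mp n \<Longrightarrow> x \<in> carrier R"
  by (rule ideal.Icarr[OF mp_ideal])

lemma mp_zero: "\<zero> \<in> mp n"
  using additive_subgroup.zero_closed[OF ideal.axioms(1)[OF mp_ideal]] .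

lemma mp_add: "x \<in> mp n \<Longrightarrow> y \<in> mp n \<Longrightarrow> x \<oplus> y \<in> mp n"
  using additive_subgroup.a_closed[OF ideal.axioms(1)[OF mp_ideal]] .

lemma mp_neg: "x \<in> mp n \<Longrightarrow> \<ominus> x \<in> mp n"
  using additive_subgroup.a_inv_closed[OF ideal.axioms(1)[OF mp_ideal]] .

lemma mp_minus: "x \<in> mp n \<Longrightarrow> y \<in> mp n \<Longrightarrow> x \<ominus> y \<in> mp n"
  unfolding a_minus_def by (intro mp_add mp_neg)

lemma mp_smult: "r \<in> carrier R \<Longrightarrow> x \<in> mp n \<Longrightarrow> r \<otimes> x \<in> mp n"
  by (rule ideal.I_l_closed[OF mp_ideal])

lemma mp_smult_r: "r \<in> carrier R \<Longrightarrow> x \<in> mp n \<Longrightarrow> x \<otimes> r \<in> mp n"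
  by (rule ideal.I_r_closed[OF mp_ideal])

lemma mp_1: "mp (Suc 0) = mx"
  using ideal_prod_one[OF mx_ideal] by simp

lemma mp_Suc_subset:
  assumes I: "ideal I R" and *: "\<And>u v. u \<in> mx \<Longrightarrow> v \<in> mp n \<Longrightarrow> u \<otimes> v \<in> I"
  shows "mp (Suc n) \<subseteq> I"
proof
  fix x assume "x \<in> mp (Suc n)"
  then have "x \<in> ideal_prod R mx (mp n)" by simp
  then show "x \<in> I"
    by (induction rule: ideal_prod.induct)
      (use * additive_subgroup.a_closed[OF ideal.axioms(1)[OF I]] in auto)
qed

lemma mx_mult: "u \<in> mx \<Longrightarrow> v \<in> mp n \<Longrightarrow> u \<otimes> v \<in> mp (Suc n)"
  using ideal_prod.prod by fastforce

lemma ideal_preimage: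
  assumes I: "ideal I R" and y: "y \<in> carrier R"
  shows "ideal {x \<in> carrier R. x \<otimes> y \<in> I} R"
proof -
  have I0: "smod R slf I" using I smod_self_iff by simp
  have "smod R slf {x \<in> carrier R. x \<otimes> y \<in> I}"
  proof (rule smodI)
    fix u v assume "u \<in> {x \<in> carrier R. x \<otimes> y \<in> I}" "v \<in> {x \<in> carrier R. x \<otimes> y \<in> I}"
    then show "u \<oplus>\<^bsub>slf\<^esub> v \<in> {x \<in> carrier R. x \<otimes> y \<in> I}" using smod_add[OF I0] y by (auto simp: l_distr)
  next
    fix r u assume "r \<in> carrier R" "u \<in> {x \<in> carrier R. x \<otimes> y \<in> I}"
    then show "r \<odot>\<^bsub>slf\<^esub> u \<in> {x \<in> carrier R. x \<otimes> y \<in> I}" using smod_smult[OF I0] y by (auto simp: m_assoc)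
  qed (use y smod_zero[OF I0] in auto)
  then show ?thesis using smod_self_iff by simp
qed

lemma mp_mult: "x \<in> mp i \<Longrightarrow> y \<in> mp j \<Longrightarrow> x \<otimes> y \<in> mp (i + j)"
proof (induction i arbitrary: x)
  case 0
  then show ?case using mp_smult[of x y j] by simp
next
  case (Suc i)
  have yc: "y \<in> carrier R" using mp_carr Suc by blast
  have "mp (Suc i) \<subseteq> {x \<in> carrier R. x \<otimes> y \<in> mp (Suc i + j)}"
  proof (rule mp_Suc_subset[OF ideal_preimage[OF mp_ideal yc]])
    fix u v assume uv: "u \<in> mx" "v \<in> mp i"
    have c: "u \<in> carrier R" "v \<in> carrier R" using uv mx_carr mp_carr by auto
    have "u \<otimes> (v \<otimes> y) \<in> mp (Suc (i + j))" using mx_mult uv Suc by blast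
    then show "u \<otimes> v \<in> {x \<in> carrier R. x \<otimes> y \<in> mp (Suc i + j)}" using c yc by (simp add: m_assoc)
  qed
  then show ?case using Suc by blast
qed

lemma mp_Suc_le: "mp (Suc n) \<subseteq> mp n"
  by (rule mp_Suc_subset[OF mp_ideal]) (use mx_carr mp_smult in blast)

lemma mp_antimono: "i \<le> j \<Longrightarrow> mp j \<subseteq> mp i"
  by (induction rule: dec_induct) (use mp_Suc_le in blast)+

lemma mp_smod: "smod R slf (mp n)"
  using mp_ideal smod_self_iff by simp

lemma mx_smod: "smod R slf mx"
  using mx_ideal smod_self_iff by simp

lemma mul_linear: "y \<in> carrier R \<Longrightarrow> linear_map R slf slf (\<lambda>x. x \<otimes> y)"
  unfolding linear_map_def by (auto simp: l_distr m_assoc)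

lemma smod_mul: "y \<in> carrier R \<Longrightarrow> smod R slf I \<Longrightarrow> smod R slf ((\<lambda>x. x \<otimes> y) ` I)"
proof -
  assume h: "y \<in> carrier R" "smod R slf I"
  interpret S: module R slf by (rule module_self)
  interpret two_modules R slf slf "\<lambda>x. x \<otimes> y" by unfold_locales (rule mul_linear[OF h(1)])
  show ?thesis by (rule smod_image[OF h(2)])
qed

lemma PIdl_mul: "PIdl y = (\<lambda>x. x \<otimes> y) ` carrier R"
  unfolding cgenideal_def by auto

lemma PIdl_smod: "y \<in> carrier R \<Longrightarrow> smod R slf (PIdl y)"
  using cgenideal_ideal smod_self_iff by blast

lemma scov_mx: "scov R slf mx (carrier R)"
proof -
  interpret S: module R slf by (rule module_self)
  have "D = mx \<or> D = carrier R" if D: "smod R slf D" "mx \<subseteq> D" for D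
  proof (cases "D = mx")
    case False
    then obtain x where x: "x \<in> D" "x \<notin> mx" using D by blast
    have xc: "x \<in> carrier R" using smod_carr[OF D(1) x(1)] by simp
    obtain y where y: "y \<in> carrier R" "y \<otimes> x = \<one>" using notin_mx_inv[OF xc x(2)] .
    have 1: "\<one> \<in> D" using smod_smult[OF D(1) y(1) x(1)] y by simp
    have "z \<in> D" if "z \<in> carrier R" for z using smod_smult[OF D(1) that 1] that by simp
    then show ?thesis using smod_sub[OF D(1)] by auto
  qed simp
  moreover have "mx \<noteq> carrier R" using one_notin_mx by auto
  ultimately show ?thesis unfolding S.lat.covers_def using mx_smod S.smod_carrier smod_sub[OF mx_smod] by auto
qed

end

section \<open>Local rings with Hilbert series 1 + e t + e t^2 + t^3, and exact zero divisors in
  them\<close>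

locale short_ring = local_cring +
  fixes e :: nat
  assumes mp4: "mp 4 = {\<zero>}"
    and hlen1: "hlen R slf (mp 2) (mp 1) e"
    and hlen2: "hlen R slf (mp 3) (mp 2) e"
    and hlen3: "hlen R slf (mp 4) (mp 3) 1"
begin

abbreviation ln where "ln \<equiv> slen R slf"

lemma mp_ge4: "n \<ge> 4 \<Longrightarrow> x \<in> mp n \<Longrightarrow> x = \<zero>"
  using mp_antimono[of 4 n] mp4 by blast

lemma hlen_carrier: "hlen R slf {\<zero>} (carrier R) (2 * e + 2)"
proof -
  interpret S0: module R slf by (rule module_self)
  have "hlen R slf (mp 1) (carrier R) 1" using S0.lat.covers_has_length[OF scov_mx] mp_1 by simp
  then have "hlen R slf (mp 4) (carrier R) (1 + e + e + 1)"
    using S0.lat.has_length_trans hlen1 hlen2 hlen3 by blast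
  then show ?thesis using mp4 by (simp add: mult_2)
qed

sublocale S: fmodule R slf
proof -
  interpret S0: module R slf by (rule module_self)
  show "fmodule R slf" by unfold_locales (use hlen_carrier in auto)
qed

lemma ln_mp: "ln {\<zero>} (carrier R) = 2 * e + 2" "ln mx (carrier R) = 1" "ln (mp 2) mx = e"
  "ln (mp 3) (mp 2) = e" "ln {\<zero>} (mp 3) = 1" "ln {\<zero>} (mp 2) = e + 1"
proof -
  show h1: "ln {\<zero>} (carrier R) = 2 * e + 2" "ln mx (carrier R) = 1" "ln (mp 2) mx = e"
    "ln (mp 3) (mp 2) = e" "ln {\<zero>} (mp 3) = 1"
    using S.lat.len_eq[OF hlen_carrier] S.lat.len_eq[OF S.lat.covers_has_length[OF scov_mx]]
      S.lat.len_eq[OF hlen1] S.lat.len_eq[OF hlen2] S.lat.len_eq[OF hlen3] mp_1 mp4 by simp_all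
  show "ln {\<zero>} (mp 2) = e + 1"
    using S.slen_add[of "{\<zero>}" "mp 3" "mp 2"] h1 S.smod_zero_mod mp_smod mp_antimono[of 2 3] mp_zero by auto
qed

lemma slen_mul:
  assumes y: "y \<in> carrier R" and A: "smod R slf A" and B: "smod R slf B" "A \<subseteq> B"
    and ker: "\<And>x. x \<in> B \<Longrightarrow> x \<otimes> y = \<zero> \<Longrightarrow> x \<in> A"
  shows "ln ((\<lambda>x. x \<otimes> y) ` A) ((\<lambda>x. x \<otimes> y) ` B) = ln A B"
  by (rule slen_image[OF S.fmodule_axioms module_self mul_linear[OF y] A B]) (use ker in auto)

lemma smod0: "smod R slf {\<zero>}" using S.smod_zero_mod by simp

lemma smodC: "smod R slf (carrier R)" using S.smod_carrier by simp

lemma mp3_ne: "mp 3 \<noteq> {\<zero>}"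
  using ln_mp(5) S.lat.len_refl[of "{\<zero>}"] smod0 by auto

lemma mp2_mx: "mp 2 \<subseteq> mx" using mp_antimono[of 1 2] mp_1 by simp

end

locale exact_pair = short_ring +
  fixes a b
  assumes a_mx: "a \<in> mx" and b_mx: "b \<in> mx"
    and ann_a: "x \<in> carrier R \<Longrightarrow> x \<otimes> a = \<zero> \<longleftrightarrow> x \<in> PIdl b"
    and ann_b: "x \<in> carrier R \<Longrightarrow> x \<otimes> b = \<zero> \<longleftrightarrow> x \<in> PIdl a"
begin

text \<open>The axioms are symmetric in the two elements. Facts about \<open>b\<close> are obtained
  below by applying the lemmas about \<open>a\<close> to the swapped pair.\<close>

lemma swap: "exact_pair R mx e b a"
  by unfold_locales (use a_mx b_mx ann_a ann_b in auto)

lemma a_carr: "a \<in> carrier R" and b_carr: "b \<in> carrier R"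
  using a_mx b_mx mx_carr by auto

lemma PIdl_a_mx: "PIdl a \<subseteq> mx"
  using a_mx ideal.I_l_closed[OF mx_ideal] unfolding cgenideal_def by blast

lemmas Pa = PIdl_smod[OF a_carr]
lemmas Pb = PIdl_smod[OF b_carr]

lemma ab0: "a \<otimes> b = \<zero>"
  using ann_b[OF a_carr] cgenideal_self[OF a_carr] by simp

lemma mul_b_Pa: "(\<lambda>x. x \<otimes> b) ` (PIdl a) = {\<zero>}"
proof
  show "(\<lambda>x. x \<otimes> b) ` (PIdl a) \<subseteq> {\<zero>}" using ann_b smod_carr[OF Pa] by auto
  show "{\<zero>} \<subseteq> (\<lambda>x. x \<otimes> b) ` (PIdl a)" using ab0 cgenideal_self[OF a_carr] by force
qed

lemma ln_Pb: "ln {\<zero>} (PIdl b) = ln (PIdl a) (carrier R)"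
proof -
  have "ln ((\<lambda>x. x \<otimes> b) ` (PIdl a)) ((\<lambda>x. x \<otimes> b) ` carrier R) = ln (PIdl a) (carrier R)"
    by (rule slen_mul[OF b_carr Pa smodC]) (use smod_sub[OF Pa] ann_b in auto)
  then show ?thesis unfolding mul_b_Pa PIdl_mul[of b] .
qed

text \<open>Multiplication by b identifies R/aR with bR, so the lengths of aR and bR add up to the
  length of R.\<close>

lemma ln_sum: "ln {\<zero>} (PIdl a) + ln {\<zero>} (PIdl b) = 2 * e + 2"
proof -
  have "ln {\<zero>} (carrier R) = ln {\<zero>} (PIdl a) + ln (PIdl a) (carrier R)"
    by (rule S.slen_add[OF smod0 Pa smodC]) (use smod_zero[OF Pa] smod_sub[OF Pa] in auto)
  then show ?thesis using ln_Pb ln_mp by simp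
qed

lemma ln_am: "ln ((\<lambda>x. x \<otimes> a) ` mx) (PIdl a) = 1"
proof -
  have "PIdl b \<subseteq> mx" using exact_pair.PIdl_a_mx[OF swap] .
  then have "ln ((\<lambda>x. x \<otimes> a) ` mx) ((\<lambda>x. x \<otimes> a) ` carrier R) = ln mx (carrier R)"
    by (intro slen_mul[OF a_carr mx_smod smodC]) (use smod_sub[OF mx_smod] ann_a in auto)
  then show ?thesis using ln_mp PIdl_mul by simp
qed

lemma ln_Pa: "ln {\<zero>} (PIdl a) = ln {\<zero>} ((\<lambda>x. x \<otimes> a) ` mx) + 1"
proof -
  have s: "smod R slf ((\<lambda>x. x \<otimes> a) ` mx)" by (rule smod_mul[OF a_carr mx_smod])
  have "ln {\<zero>} (PIdl a) = ln {\<zero>} ((\<lambda>x. x \<otimes> a) ` mx) + ln ((\<lambda>x. x \<otimes> a) ` mx) (PIdl a)"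
    by (rule S.slen_add[OF smod0 s Pa]) (use smod_zero[OF s] mx_carr PIdl_mul in auto)
  then show ?thesis using ln_am by simp
qed

lemma ln_Pa_le: "ln {\<zero>} (PIdl a) \<le> e + 2"
proof -
  have s: "smod R slf ((\<lambda>x. x \<otimes> a) ` mx)" by (rule smod_mul[OF a_carr mx_smod])
  have "(\<lambda>x. x \<otimes> a) ` mx \<subseteq> mp 2" using a_mx mp_1 mp_mult[of _ 1 a 1] by (auto simp: numeral_2_eq_2)
  then have "ln {\<zero>} ((\<lambda>x. x \<otimes> a) ` mx) \<le> ln {\<zero>} (mp 2)"
    by (intro S.slen_mono smod0 s mp_smod) (use smod_zero[OF s] in auto)
  then show ?thesis using ln_Pa ln_mp by simp
qed

lemma ln_Pa_le2: assumes "a \<in> mp 2" shows "ln {\<zero>} (PIdl a) \<le> 2"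
proof -
  have s: "smod R slf ((\<lambda>x. x \<otimes> a) ` mx)" by (rule smod_mul[OF a_carr mx_smod])
  have "(\<lambda>x. x \<otimes> a) ` mx \<subseteq> mp 3" using assms mx_mult[of _ a 2] by (auto simp: numeral_3_eq_3)
  then have "ln {\<zero>} ((\<lambda>x. x \<otimes> a) ` mx) \<le> ln {\<zero>} (mp 3)"
    by (intro S.slen_mono smod0 s mp_smod) (use smod_zero[OF s] in auto)
  then show ?thesis using ln_Pa ln_mp by simp
qed

text \<open>If a is in m^2, then a m lies in m^3 and aR has length at most 2, while bR has length at
  most e + 2; together they have length 2 e + 2.\<close>

lemma e_le_2: "a \<in> mp 2 \<Longrightarrow> e \<le> 2"
  using ln_Pa_le2 exact_pair.ln_Pa_le[OF swap] ln_sum by simp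

lemma mult_a_mp2: "a \<notin> mp 2 \<Longrightarrow> r \<in> carrier R \<Longrightarrow> r \<otimes> a \<in> mp 2 \<Longrightarrow> r \<in> mx"
proof (rule ccontr)
  assume h: "a \<notin> mp 2" "r \<in> carrier R" "r \<otimes> a \<in> mp 2" "r \<notin> mx"
  obtain s where s: "s \<in> carrier R" "s \<otimes> r = \<one>" using notin_mx_inv[OF h(2,4)] .
  have "s \<otimes> (r \<otimes> a) = a" using s h a_carr by (simp flip: m_assoc)
  then show False using mp_smult[OF s(1) h(3)] h(1) by simp
qed

text \<open>The length of the square of the maximal ideal of R/aR. It turns out to be 1 when neither
  a nor b is in m^2.\<close>

abbreviation "xa \<equiv> ln (PIdl a) (msum slf (PIdl a) (mp 2))"

lemma Pa_mp2: "smod R slf (msum slf (PIdl a) (mp 2))"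
  by (rule S.smod_msum[OF Pa mp_smod])

lemma Pa_mp2_mx: "msum slf (PIdl a) (mp 2) \<subseteq> mx"
  by (rule S.msum_least[OF mx_smod PIdl_a_mx mp2_mx])

lemma am_eq: "a \<notin> mp 2 \<Longrightarrow> PIdl a \<inter> mp 2 = (\<lambda>x. x \<otimes> a) ` mx"
proof
  assume a: "a \<notin> mp 2"
  show "PIdl a \<inter> mp 2 \<subseteq> (\<lambda>x. x \<otimes> a) ` mx" using mult_a_mp2[OF a] PIdl_mul by auto
  show "(\<lambda>x. x \<otimes> a) ` mx \<subseteq> PIdl a \<inter> mp 2"
    using a_mx mp_1 mp_mult[of _ 1 a 1] mx_carr PIdl_mul by (auto simp: numeral_2_eq_2)
qed

lemma ln_Pa_mx: assumes "a \<notin> mp 2" shows "ln (PIdl a) mx + 1 = e + xa"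
proof -
  have "ln (mp 2) (msum slf (PIdl a) (mp 2)) = 1"
    using S.slen_diamond[OF Pa mp_smod[of 2]] am_eq[OF assms] ln_am by simp
  moreover have "ln (mp 2) mx = ln (mp 2) (msum slf (PIdl a) (mp 2)) + ln (msum slf (PIdl a) (mp 2)) mx"
    by (rule S.slen_add[OF mp_smod Pa_mp2 mx_smod S.msum_ub2[OF Pa mp_smod] Pa_mp2_mx])
  moreover have "ln (PIdl a) mx = xa + ln (msum slf (PIdl a) (mp 2)) mx"
    by (rule S.slen_add[OF Pa Pa_mp2 mx_smod S.msum_ub1[OF Pa mp_smod] Pa_mp2_mx])
  ultimately show ?thesis using ln_mp by simp
qed

lemma ln_Pa_carrier: assumes "a \<notin> mp 2" shows "ln (PIdl a) (carrier R) = e + xa"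
proof -
  have "ln (PIdl a) (carrier R) = ln (PIdl a) mx + ln mx (carrier R)"
    by (rule S.slen_add[OF Pa mx_smod smodC PIdl_a_mx]) (use mx_carr in auto)
  then show ?thesis using ln_Pa_mx[OF assms] ln_mp by simp
qed

lemma xa_0: assumes "xa = 0" shows "mp 2 \<subseteq> PIdl a"
  using S.slen_eq_0[OF Pa Pa_mp2 S.msum_ub1[OF Pa mp_smod]] assms S.msum_ub2[OF Pa mp_smod[of 2]] by blast

lemma xa_0_mp2: assumes "a \<notin> mp 2" "mp 2 \<subseteq> PIdl a" shows "mp 2 = (\<lambda>x. x \<otimes> a) ` mx"
  using assms am_eq by auto

lemma mul_a_mp2_sub: "(\<lambda>x. x \<otimes> a) ` mp 2 \<subseteq> mp 3"
proof
  fix z assume "z \<in> (\<lambda>x. x \<otimes> a) ` mp 2"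
  then obtain x where x: "x \<in> mp 2" "z = x \<otimes> a" by blast
  have "a \<otimes> x \<in> mp (Suc 2)" using mx_mult[OF a_mx x(1)] .
  then show "z \<in> mp 3" using x m_comm[OF a_carr mp_carr[OF x(1)]] by simp
qed

text \<open>If m^2 lies in aR, then m^2 = a m and m^3 = a m^2. So multiplication by a on m^2 has
  image of length 1 and kernel \<open>mp 2 \<inter> PIdl b\<close> of length e. But bR also has
  length e, and would have to lie in m^2.\<close>

lemma xa_ne_0: assumes "a \<notin> mp 2" "b \<notin> mp 2" shows "xa \<noteq> 0"
proof
  assume x0: "xa = 0"
  have m2: "mp 2 = (\<lambda>x. x \<otimes> a) ` mx" by (rule xa_0_mp2[OF assms(1) xa_0[OF x0]])
  let ?a2 = "(\<lambda>x. x \<otimes> a) ` mp 2"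
  have s: "smod R slf ?a2" by (rule smod_mul[OF a_carr mp_smod])
  have "mp 3 \<subseteq> ?a2"
  proof -
    have "mp (Suc 2) \<subseteq> ?a2"
    proof (rule mp_Suc_subset)
      show "ideal ?a2 R" using s smod_self_iff by simp
      fix u v assume u: "u \<in> mx" and "v \<in> mp 2"
      then obtain y where y: "y \<in> mx" "v = y \<otimes> a" using m2 by blast
      have "u \<otimes> y \<in> mp 2" using mp_mult[of u 1 y 1] u y mp_1 by (simp add: numeral_2_eq_2)
      moreover have "u \<otimes> v = (u \<otimes> y) \<otimes> a" using u y mx_carr a_carr by (simp add: m_assoc)
      ultimately show "u \<otimes> v \<in> ?a2" by blast
    qed
    then show ?thesis by simp
  qed
  then have a2: "?a2 = mp 3" using mul_a_mp2_sub by blast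
  let ?Q = "mp 2 \<inter> PIdl b"
  have Q: "smod R slf ?Q" by (rule S.smod_int[OF mp_smod Pb])
  have "(\<lambda>x. x \<otimes> a) ` ?Q = {\<zero>}" using ann_a smod_carr[OF Pb] smod_zero[OF Q] a_carr by (auto intro!: image_eqI[of _ _ "\<zero>"])
  moreover have "ln ((\<lambda>x. x \<otimes> a) ` ?Q) ?a2 = ln ?Q (mp 2)"
    by (rule slen_mul[OF a_carr Q mp_smod]) (use ann_a mp_carr in auto)
  ultimately have "ln ?Q (mp 2) = 1" using a2 ln_mp by simp
  moreover have "ln {\<zero>} (mp 2) = ln {\<zero>} ?Q + ln ?Q (mp 2)"
    by (rule S.slen_add[OF smod0 Q mp_smod]) (use smod_zero[OF Q] in auto)
  moreover have "ln {\<zero>} (PIdl b) = ln {\<zero>} ?Q + ln ?Q (PIdl b)"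
    by (rule S.slen_add[OF smod0 Q Pb]) (use smod_zero[OF Q] in auto)
  moreover have "ln {\<zero>} (PIdl b) = e" using ln_Pb ln_Pa_carrier[OF assms(1)] x0 by simp
  ultimately have "ln ?Q (PIdl b) = 0" using ln_mp by simp
  then have "?Q = PIdl b" using S.slen_eq_0[OF Q Pb] by blast
  then show False using cgenideal_self[OF b_carr] assms(2) by blast
qed

text \<open>By \<open>ln_sum\<close> the numbers belonging to a and to b add up to 2, and neither
  vanishes.\<close>

lemma xa_1: assumes "a \<notin> mp 2" "b \<notin> mp 2" shows "xa = 1"
proof -
  have "ln {\<zero>} (PIdl a) = e + ln (PIdl b) (msum slf (PIdl b) (mp 2))"
    using exact_pair.ln_Pb[OF swap] exact_pair.ln_Pa_carrier[OF swap assms(2)] by simp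
  moreover have "ln {\<zero>} (PIdl b) = e + xa" using ln_Pb ln_Pa_carrier[OF assms(1)] by simp
  ultimately have "xa + ln (PIdl b) (msum slf (PIdl b) (mp 2)) = 2" using ln_sum by simp
  then show ?thesis using xa_ne_0[OF assms] exact_pair.xa_ne_0[OF swap assms(2,1)] by simp
qed

section \<open>The socle of R and the socle of R/aR\<close>

definition soc :: "'a set" where "soc = annihilator R mx"

definition Y :: "'a set" where "Y = {u \<in> mx. \<forall>v\<in>mx. u \<otimes> v \<in> PIdl a}"

lemma soc_smod: "smod R slf soc"
  unfolding soc_def annihilator_def by (rule smodI) (auto simp: mx_carr l_distr m_assoc)

lemma Y_smod: "smod R slf Y"
proof (rule smodI)
  fix u v assume "u \<in> Y" "v \<in> Y"
  then show "u \<oplus>\<^bsub>slf\<^esub> v \<in> Y"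
    using smod_add[OF mx_smod] smod_add[OF Pa] by (auto simp: Y_def mx_carr l_distr)
next
  fix r u assume "r \<in> carrier R" "u \<in> Y"
  then show "r \<odot>\<^bsub>slf\<^esub> u \<in> Y"
    using smod_smult[OF mx_smod] smod_smult[OF Pa] by (auto simp: Y_def mx_carr m_assoc)
qed (use mx_carr smod_zero[OF mx_smod] smod_zero[OF Pa] in \<open>auto simp: Y_def\<close>)

lemma Y_carr: "u \<in> Y \<Longrightarrow> u \<in> carrier R"
  unfolding Y_def using mx_carr by blast

lemma Pa_Y: "PIdl a \<subseteq> Y"
proof
  fix u assume u: "u \<in> PIdl a"
  have "u \<otimes> v \<in> PIdl a" if "v \<in> mx" for v
    by (rule ideal.I_r_closed[OF cgenideal_ideal[OF a_carr] u mx_carr[OF that]])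
  then show "u \<in> Y" using u PIdl_a_mx unfolding Y_def by blast
qed

lemma soc_Pa: "soc \<subseteq> PIdl a"
  using ann_b b_mx unfolding soc_def annihilator_def by auto

lemma soc_Pb: "soc \<subseteq> PIdl b"
  using exact_pair.soc_Pa[OF swap] unfolding soc_def exact_pair.soc_def[OF swap] .

lemma mp3_soc: "mp 3 \<subseteq> soc"
proof
  fix x assume x: "x \<in> mp 3"
  have "x \<otimes> y = \<zero>" if "y \<in> mx" for y
    using mp_mult[OF x, of y 1] that mp_1 mp4 by (simp add: numeral_eq_Suc del: ideal_power.simps)
  then show "x \<in> soc" unfolding soc_def annihilator_def using mp_carr[OF x] by blast
qed

lemma mp2_Y: "mp 2 \<subseteq> Y"
proof
  fix u assume u: "u \<in> mp 2"
  have "u \<otimes> v \<in> PIdl a" if "v \<in> mx" for v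
    using mp_mult[OF u, of v 1] that mp_1 mp3_soc soc_Pa by (auto simp: numeral_eq_Suc simp del: ideal_power.simps)
  then show "u \<in> Y" using u mp2_mx unfolding Y_def by blast
qed

text \<open>The socle of R lies in bR, which multiplication by b identifies with R/aR; so it
  corresponds to the socle of R/aR, of which \<open>Y\<close> is the preimage. If aR = m, then R/aR
  is a field whose socle contains units, and these are missing from \<open>Y\<close>; hence the
  assumption.\<close>

lemma soc_eq: assumes "PIdl a \<noteq> mx" shows "soc = (\<lambda>x. x \<otimes> b) ` Y"
proof
  show "soc \<subseteq> (\<lambda>x. x \<otimes> b) ` Y"
  proof
    fix z assume z: "z \<in> soc"
    then obtain t where t: "t \<in> carrier R" "z = t \<otimes> b" using soc_Pb PIdl_mul by blast
    have zy: "t \<otimes> y \<in> PIdl a" if "y \<in> mx" for y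
    proof -
      have yc: "y \<in> carrier R" using mx_carr that .
      have "z \<otimes> y = \<zero>" using z that unfolding soc_def annihilator_def by blast
      then have "(t \<otimes> y) \<otimes> b = \<zero>" using t yc b_carr by (simp add: m_ac)
      then show ?thesis using ann_b t yc by simp
    qed
    have "t \<in> mx"
    proof (rule ccontr)
      assume "t \<notin> mx"
      then obtain s where s: "s \<in> carrier R" "s \<otimes> t = \<one>" using notin_mx_inv t by blast
      have "y \<in> PIdl a" if y: "y \<in> mx" for y
      proof -
        have "s \<otimes> (t \<otimes> y) \<in> PIdl a" using smod_smult[OF Pa s(1) zy[OF y]] by simp
        then show ?thesis using s t mx_carr[OF y] by (simp flip: m_assoc)
      qed
      then show False using assms PIdl_a_mx by blast
    qed
    then show "z \<in> (\<lambda>x. x \<otimes> b) ` Y" using t zy unfolding Y_def by blast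
  qed
  show "(\<lambda>x. x \<otimes> b) ` Y \<subseteq> soc"
  proof
    fix z assume "z \<in> (\<lambda>x. x \<otimes> b) ` Y"
    then obtain t where t: "t \<in> mx" "\<And>v. v \<in> mx \<Longrightarrow> t \<otimes> v \<in> PIdl a" "z = t \<otimes> b" unfolding Y_def by blast
    have "z \<otimes> v = \<zero>" if v: "v \<in> mx" for v
    proof -
      have "z \<otimes> v = (t \<otimes> v) \<otimes> b" using t mx_carr v b_carr by (simp add: m_ac)
      then show ?thesis using ann_b[of "t \<otimes> v"] t v mx_carr by simp
    qed
    then show "z \<in> soc" unfolding soc_def annihilator_def using t mx_carr b_carr by simp
  qed
qed

text \<open>The length of the socle is that of Y/aR by \<open>soc_eq\<close>, and aR has colength e
  in m because \<open>xa\<close> is 1. The bound on e keeps aR different from m.\<close>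

lemma ln_Y: assumes "a \<notin> mp 2" "b \<notin> mp 2" "e \<ge> 1" shows "ln Y mx + ln {\<zero>} soc = e"
proof -
  have m: "ln (PIdl a) mx = e" using ln_Pa_mx[OF assms(1)] xa_1[OF assms(1,2)] by simp
  then have ne: "PIdl a \<noteq> mx" using assms(3) S.lat.len_refl[of mx] mx_smod by auto
  have "ln ((\<lambda>x. x \<otimes> b) ` (PIdl a)) ((\<lambda>x. x \<otimes> b) ` Y) = ln (PIdl a) Y"
    by (rule slen_mul[OF b_carr Pa Y_smod Pa_Y]) (simp add: ann_b Y_carr)
  then have "ln {\<zero>} soc = ln (PIdl a) Y" using mul_b_Pa soc_eq[OF ne] by simp
  moreover have "ln (PIdl a) mx = ln (PIdl a) Y + ln Y mx"
    by (rule S.slen_add[OF Pa Y_smod mx_smod Pa_Y]) (auto simp: Y_def)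
  ultimately show ?thesis using m by simp
qed

text \<open>Since m^3 is simple, a m^2 is 0 or m^3. If it were 0, then m^2 would lie in bR, contrary
  to \<open>xa_1\<close> for the swapped pair.\<close>

lemma am2: assumes "a \<notin> mp 2" "b \<notin> mp 2" shows "(\<lambda>x. x \<otimes> a) ` mp 2 = mp 3"
proof -
  let ?a2 = "(\<lambda>x. x \<otimes> a) ` mp 2"
  have s: "smod R slf ?a2" by (rule smod_mul[OF a_carr mp_smod])
  have cov: "scov R slf {\<zero>} (mp 3)"
    by (rule S.slen_1_cov[OF smod0 mp_smod]) (use mp_zero ln_mp in auto)
  then have "?a2 = {\<zero>} \<or> ?a2 = mp 3"
    using s smod_zero[OF s] mul_a_mp2_sub unfolding S.lat.covers_def by auto
  moreover have "?a2 \<noteq> {\<zero>}"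
  proof
    assume z: "?a2 = {\<zero>}"
    have "mp 2 \<subseteq> PIdl b"
    proof
      fix x assume "x \<in> mp 2"
      then show "x \<in> PIdl b" using z ann_a[of x] mp_carr[of x 2] by blast
    qed
    then have "msum slf (PIdl b) (mp 2) = PIdl b" using S.msum_least[OF Pb] S.msum_ub1[OF Pb mp_smod] by blast
    then have "ln (PIdl b) (msum slf (PIdl b) (mp 2)) = 0" using S.lat.len_refl[of "PIdl b"] Pb by simp
    then show False using exact_pair.xa_1[OF swap assms(2,1)] by simp
  qed
  ultimately show ?thesis by blast
qed

text \<open>By \<open>xa_1\<close> there is nothing strictly between aR and aR + m^2. As c is not in
  \<open>Y\<close>, the ideal c m is not contained in aR, hence aR + c m = aR + m^2. For the second
  part, a unit coefficient t would put c into \<open>Y\<close>, because aR and m^2 lie in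
  \<open>Y\<close>.\<close>

lemma notin_Y:
  assumes ab: "a \<notin> mp 2" "b \<notin> mp 2" and c: "c \<in> mx" "c \<notin> Y"
  shows "z \<in> mp 2 \<Longrightarrow> \<exists>u\<in>mx. \<exists>v\<in>mx. z = u \<otimes> c \<oplus> v \<otimes> a"
    and "r \<in> carrier R \<Longrightarrow> t \<in> carrier R \<Longrightarrow> r \<otimes> a \<oplus> t \<otimes> c \<in> mp 2 \<Longrightarrow> r \<in> mx \<and> t \<in> mx"
proof -
  have cc: "c \<in> carrier R" using c mx_carr by blast
  let ?cm = "(\<lambda>x. x \<otimes> c) ` mx"
  have s: "smod R slf ?cm" by (rule smod_mul[OF cc mx_smod])
  have cm2: "?cm \<subseteq> mp 2" using c mp_1 mp_mult[of _ 1 c 1] by (auto simp: numeral_2_eq_2)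
  let ?U = "msum slf (PIdl a) ?cm"
  have U: "smod R slf ?U" by (rule S.smod_msum[OF Pa s])
  have "scov R slf (PIdl a) (msum slf (PIdl a) (mp 2))"
    by (rule S.slen_1_cov[OF Pa Pa_mp2 S.msum_ub1[OF Pa mp_smod] xa_1[OF ab]])
  moreover have "?U \<subseteq> msum slf (PIdl a) (mp 2)"
    by (rule S.msum_least[OF Pa_mp2 S.msum_ub1[OF Pa mp_smod]]) (use cm2 S.msum_ub2[OF Pa mp_smod[of 2]] in blast)
  moreover have "?U \<noteq> PIdl a"
  proof
    assume "?U = PIdl a"
    then have "?cm \<subseteq> PIdl a" using S.msum_ub2[OF Pa s] by simp
    then have "c \<otimes> v \<in> PIdl a" if "v \<in> mx" for v using that m_comm[OF cc mx_carr[OF that]] by auto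
    then show False using c unfolding Y_def by blast
  qed
  ultimately have Ueq: "?U = msum slf (PIdl a) (mp 2)"
    using U S.msum_ub1[OF Pa s] unfolding S.lat.covers_def by blast
  show "\<exists>u\<in>mx. \<exists>v\<in>mx. z = u \<otimes> c \<oplus> v \<otimes> a" if z: "z \<in> mp 2"
  proof -
    have "z \<in> ?U" using z Ueq S.msum_ub2[OF Pa mp_smod[of 2]] by blast
    then obtain v u where uv: "v \<in> carrier R" "u \<in> mx" "z = v \<otimes> a \<oplus> u \<otimes> c"
      unfolding msum_def PIdl_mul by auto
    have uc: "u \<in> carrier R" using mx_carr uv by blast
    have "z \<ominus> u \<otimes> c \<in> mp 2" using mp_minus[OF z] cm2 uv by blast
    moreover have "z \<ominus> u \<otimes> c = v \<otimes> a" using uv uc cc a_carr by algebra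
    ultimately have "v \<in> mx" using mult_a_mp2[OF ab(1) uv(1)] by simp
    then show ?thesis using uv uc cc a_carr a_comm[of "v \<otimes> a" "u \<otimes> c"] by auto
  qed
  show "r \<in> mx \<and> t \<in> mx" if rt: "r \<in> carrier R" "t \<in> carrier R" "r \<otimes> a \<oplus> t \<otimes> c \<in> mp 2"
  proof -
    have tm: "t \<in> mx"
    proof (rule ccontr)
      assume "t \<notin> mx"
      then obtain q where q: "q \<in> carrier R" "q \<otimes> t = \<one>" using notin_mx_inv rt by blast
      have "r \<otimes> a \<oplus> t \<otimes> c \<in> Y" using rt mp2_Y by blast
      moreover have "r \<otimes> a \<in> Y" using rt Pa_Y PIdl_mul by blast
      ultimately have "t \<otimes> c \<in> Y" using S.smod_cancel[OF Y_smod, of "r \<otimes> a" "t \<otimes> c"] rt cc by simp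
      then have "q \<otimes> (t \<otimes> c) \<in> Y" using smod_smult[OF Y_smod q(1)] by simp
      then show False using q rt cc c by (simp flip: m_assoc)
    qed
    have "t \<otimes> c \<in> mp 2" using cm2 tm by blast
    then have "(r \<otimes> a \<oplus> t \<otimes> c) \<ominus> t \<otimes> c \<in> mp 2" using mp_minus rt by blast
    moreover have "(r \<otimes> a \<oplus> t \<otimes> c) \<ominus> t \<otimes> c = r \<otimes> a" using rt a_carr cc by algebra
    ultimately show ?thesis using tm mult_a_mp2[OF ab(1) rt(1)] by simp
  qed
qed

text \<open>Multiplication by c maps m into (aR + m^2)/aR, which has length 1. So its kernel
  \<open>?C\<close> has colength at most 1 in m, whereas \<open>Y\<close>, which is contained in it,
  has colength at least 2. Any element of the kernel outside \<open>Y\<close> serves as c'.\<close>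

lemma orthogonal_pair:
  assumes ab: "a \<notin> mp 2" "b \<notin> mp 2" and Y2: "ln Y mx \<ge> 2"
  obtains c c' l where "c \<in> mx" "c \<notin> Y" "c' \<in> mx" "c' \<notin> Y" "l \<in> mx" "c \<otimes> c' = l \<otimes> a"
proof -
  have Ymx: "Y \<subseteq> mx" unfolding Y_def by blast
  have "Y \<noteq> mx" using Y2 S.lat.len_refl[of mx] mx_smod by auto
  then obtain c where c: "c \<in> mx" "c \<notin> Y" using Ymx by blast
  have cc: "c \<in> carrier R" using c mx_carr by blast
  let ?C = "{z \<in> mx. z \<otimes> c \<in> PIdl a}" and ?cm = "(\<lambda>x. x \<otimes> c) ` mx"
  have "?C = mx \<inter> {x \<in> carrier R. x \<otimes> c \<in> PIdl a}" using mx_carr by blast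
  then have Cs: "smod R slf ?C"
    using S.smod_int[OF mx_smod] ideal_preimage[of "PIdl a" c] cgenideal_ideal[OF a_carr] cc smod_self_iff by simp
  have s: "smod R slf ?cm" by (rule smod_mul[OF cc mx_smod])
  have cm2: "?cm \<subseteq> mp 2" using c mp_1 mp_mult[of _ 1 c 1] by (auto simp: numeral_2_eq_2)
  have "ln ((\<lambda>x. x \<otimes> c) ` ?C) ?cm = ln ?C mx"
    by (rule slen_mul[OF cc Cs mx_smod]) (use smod_zero[OF Pa] in auto)
  moreover have "(\<lambda>x. x \<otimes> c) ` ?C = ?cm \<inter> PIdl a" by blast
  ultimately have "ln ?C mx = ln (PIdl a) (msum slf ?cm (PIdl a))" using S.slen_diamond[OF s Pa] by simp
  also have "\<dots> \<le> xa"
    by (rule S.slen_mono[OF Pa Pa S.smod_msum[OF s Pa] Pa_mp2]) 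
      (use S.msum_ub2[OF s Pa] S.msum_least[OF Pa_mp2] S.msum_ub1[OF Pa mp_smod] S.msum_ub2[OF Pa mp_smod[of 2]] cm2 in blast)+
  finally have "ln ?C mx \<le> 1" using xa_1[OF ab] by simp
  then have "?C \<noteq> Y" using Y2 by auto
  moreover have "Y \<subseteq> ?C" using c Ymx unfolding Y_def by blast
  ultimately obtain c' where c': "c' \<in> mx" "c' \<otimes> c \<in> PIdl a" "c' \<notin> Y" by blast
  then obtain l where l: "l \<in> carrier R" "c' \<otimes> c = l \<otimes> a" unfolding PIdl_mul by auto
  have "c' \<otimes> c \<in> mp 2" using c' c mp_1 mp_mult[of c' 1 c 1] by (simp add: numeral_2_eq_2)
  then have "l \<in> mx" using l mult_a_mp2[OF ab(1)] by simp
  then show ?thesis using that c c' l m_comm[OF cc mx_carr[OF c'(1)]] by metis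
qed

end

section \<open>Free modules\<close>

lemma free_module_simps [simp]:
  "carrier (free_module R n) = vecs R n" "\<zero>\<^bsub>free_module R n\<^esub> = zero_vec R"
  "v \<oplus>\<^bsub>free_module R n\<^esub> w = (\<lambda>j. v j \<oplus>\<^bsub>R\<^esub> w j)" "r \<odot>\<^bsub>free_module R n\<^esub> v = (\<lambda>j. r \<otimes>\<^bsub>R\<^esub> v j)"
  by (simp_all add: free_module_def)

text \<open>For an ideal I this is I F, where F is the free module of rank n.\<close>

definition vin :: "('a, 'b) ring_scheme \<Rightarrow> 'a set \<Rightarrow> nat \<Rightarrow> (nat \<Rightarrow> 'a) set" where
  "vin R I n = {v \<in> vecs R n. \<forall>j<n. v j \<in> I}"

definition ev :: "('a, 'b) ring_scheme \<Rightarrow> nat \<Rightarrow> 'a \<Rightarrow> nat \<Rightarrow> 'a" where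
  "ev R k r = (\<lambda>j. if j = k then r else \<zero>\<^bsub>R\<^esub>)"

definition dot :: "('a, 'b) ring_scheme \<Rightarrow> nat \<Rightarrow> (nat \<Rightarrow> 'a) \<Rightarrow> (nat \<Rightarrow> 'a) \<Rightarrow> 'a" where
  "dot R n u v = (\<Oplus>\<^bsub>R\<^esub> j\<in>{..<n}. u j \<otimes>\<^bsub>R\<^esub> v j)"

definition comb :: "('a, 'c) module \<Rightarrow> nat \<Rightarrow> (nat \<Rightarrow> 'c) \<Rightarrow> (nat \<Rightarrow> 'a) \<Rightarrow> 'c" where
  "comb M n g v = (\<Oplus>\<^bsub>M\<^esub> k\<in>{..<n}. v k \<odot>\<^bsub>M\<^esub> g k)"

lemma matvec_dot: "matvec R A r c v i = (if i < r then dot R c (A i) v else \<zero>\<^bsub>R\<^esub>)"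
  unfolding matvec_def dot_def by simp

context cring
begin

abbreviation fm :: "nat \<Rightarrow> ('a, nat \<Rightarrow> 'a) module" where "fm n \<equiv> free_module R n"

lemma vecs_carr: "v \<in> vecs R n \<Longrightarrow> v j \<in> carrier R"
  unfolding vecs_def by (cases "j < n") auto

lemma vecsI: "(\<And>j. v j \<in> carrier R) \<Longrightarrow> (\<And>j. j \<ge> n \<Longrightarrow> v j = \<zero>) \<Longrightarrow> v \<in> vecs R n"
  unfolding vecs_def by auto

lemma vecs_ge: "v \<in> vecs R n \<Longrightarrow> j \<ge> n \<Longrightarrow> v j = \<zero>"
  unfolding vecs_def by auto

lemma zero_vecs [simp]: "zero_vec R \<in> vecs R n"
  unfolding vecs_def zero_vec_def by auto

lemma module_fm: "module R (fm n)"
proof (rule moduleI)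
  show "abelian_group (fm n)"
  proof (rule abelian_groupI)
    fix x assume x: "x \<in> carrier (fm n)"
    show "\<exists>y\<in>carrier (fm n). y \<oplus>\<^bsub>fm n\<^esub> x = \<zero>\<^bsub>fm n\<^esub>"
    proof (rule bexI[of _ "\<lambda>j. \<ominus> x j"])
      have x': "x \<in> vecs R n" using x by simp
      show "(\<lambda>j. \<ominus> x j) \<oplus>\<^bsub>fm n\<^esub> x = \<zero>\<^bsub>fm n\<^esub>" using vecs_carr[OF x'] by (simp add: l_neg zero_vec_def)
      show "(\<lambda>j. \<ominus> x j) \<in> carrier (fm n)" using vecs_carr[OF x'] vecs_ge[OF x'] by (auto intro!: vecsI)
    qed
  qed (auto simp: zero_vec_def vecs_carr vecs_ge a_ac intro!: vecsI)
qed (auto simp: vecs_carr vecs_ge l_distr r_distr m_assoc is_cring intro!: vecsI)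

lemma fm_neg: "v \<in> vecs R n \<Longrightarrow> (\<ominus>\<^bsub>fm n\<^esub> v) = (\<lambda>j. \<ominus> v j)"
proof -
  assume v: "v \<in> vecs R n"
  interpret M: module R "fm n" by (rule module_fm)
  have "\<ominus>\<^bsub>fm n\<^esub> v = (\<ominus> \<one>) \<odot>\<^bsub>fm n\<^esub> v" using M.smult_l_minus[of \<one> v] v M.smult_one[of v] by simp
  also have "\<dots> = (\<lambda>j. \<ominus> v j)" using vecs_carr[OF v] by (simp add: l_minus)
  finally show ?thesis .
qed

lemma fm_minus: "v \<in> vecs R n \<Longrightarrow> w \<in> vecs R n \<Longrightarrow> v \<ominus>\<^bsub>fm n\<^esub> w = (\<lambda>j. v j \<ominus> w j)"
  by (simp add: a_minus_def fm_neg)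

lemma vin_carr: "v \<in> vin R I n \<Longrightarrow> v \<in> vecs R n"
  unfolding vin_def by auto

lemma vin_smod: "ideal I R \<Longrightarrow> smod R (fm n) (vin R I n)"
proof -
  assume I: "ideal I R"
  then interpret ideal I R .
  show ?thesis
  proof (rule smodI)
    fix x y assume "x \<in> vin R I n" "y \<in> vin R I n"
    then show "x \<oplus>\<^bsub>fm n\<^esub> y \<in> vin R I n" by (auto simp: vin_def vecs_carr vecs_ge intro!: vecsI)
  next
    fix r x assume "r \<in> carrier R" "x \<in> vin R I n"
    then show "r \<odot>\<^bsub>fm n\<^esub> x \<in> vin R I n" by (auto simp: vin_def vecs_carr vecs_ge I_l_closed intro!: vecsI)
  qed (auto simp: vin_def zero_vec_def vecs_def)
qed

lemma vin_mem: "ideal I R \<Longrightarrow> v \<in> vin R I n \<Longrightarrow> v j \<in> I"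
proof -
  assume h: "ideal I R" "v \<in> vin R I n"
  show ?thesis
  proof (cases "j < n")
    case False
    then show ?thesis using h vecs_ge[OF vin_carr[OF h(2)]] additive_subgroup.zero_closed[OF ideal.axioms(1)[OF h(1)]] by simp
  qed (use h in \<open>auto simp: vin_def\<close>)
qed

lemma vin_mono: "I \<subseteq> J \<Longrightarrow> vin R I n \<subseteq> vin R J n"
  unfolding vin_def by auto

lemma vin_carrier: "vin R (carrier R) n = vecs R n"
  unfolding vin_def vecs_def by auto

lemma vin_zero: "vin R {\<zero>} n = {zero_vec R}"
proof
  show "vin R {\<zero>} n \<subseteq> {zero_vec R}"
  proof
    fix v assume v: "v \<in> vin R {\<zero>} n"
    have "v j = \<zero>" for j using v by (cases "j < n") (auto simp: vin_def vecs_def)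
    then show "v \<in> {zero_vec R}" unfolding zero_vec_def by auto
  qed
  show "{zero_vec R} \<subseteq> vin R {\<zero>} n" by (auto simp: vin_def vecs_def zero_vec_def)
qed

lemma ev_vecs: "k < n \<Longrightarrow> r \<in> carrier R \<Longrightarrow> ev R k r \<in> vecs R n"
  unfolding ev_def vecs_def by auto

lemma ev_vin: "k < n \<Longrightarrow> ideal I R \<Longrightarrow> r \<in> I \<Longrightarrow> ev R k r \<in> vin R I n"
  unfolding vin_def using ev_vecs[of k n r] ideal.Icarr[of I R r] additive_subgroup.zero_closed[OF ideal.axioms(1)]
  by (auto simp: ev_def)

text \<open>A vector is the sum of its coordinate vectors. The last premise mentions only the
  coordinates of the given \<open>v\<close>, so the rule also applies when these are restricted to
  an ideal.\<close>

lemma vec_induct: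
  assumes v: "v \<in> vecs R n" and z: "zero_vec R \<in> P"
    and add: "\<And>x y. x \<in> P \<Longrightarrow> y \<in> P \<Longrightarrow> (\<lambda>j. x j \<oplus> y j) \<in> P"
    and ev: "\<And>k. k < n \<Longrightarrow> ev R k (v k) \<in> P"
  shows "v \<in> P"
proof -
  have "(\<lambda>j. if j < m then v j else \<zero>) \<in> P" if "m \<le> n" for m
    using that
  proof (induction m)
    case 0
    then show ?case using z by (simp add: zero_vec_def)
  next
    case (Suc m)
    then have "(\<lambda>j. (if j < m then v j else \<zero>) \<oplus> ev R m (v m) j) \<in> P"
      by (intro add ev) auto
    moreover have "(\<lambda>j. (if j < m then v j else \<zero>) \<oplus> ev R m (v m) j) = (\<lambda>j. if j < Suc m then v j else \<zero>)"
      by (rule ext) (auto simp: ev_def vecs_carr[OF v] less_Suc_eq)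
    ultimately show ?case by simp
  qed
  from this[of n] have "(\<lambda>j. if j < n then v j else \<zero>) \<in> P" by simp
  moreover have "(\<lambda>j. if j < n then v j else \<zero>) = v" by (rule ext) (auto simp: vecs_ge[OF v])
  ultimately show ?thesis by simp
qed

lemma finsum_in_ideal:
  assumes I: "ideal I R" and "finite A" "\<And>i. i \<in> A \<Longrightarrow> f i \<in> I"
  shows "finsum R f A \<in> I"
  using assms(2,3)
proof (induction rule: finite_induct)
  case empty
  then show ?case using additive_subgroup.zero_closed[OF ideal.axioms(1)[OF I]] by simp
next
  case (insert x A)
  then show ?case using ideal.Icarr[OF I] additive_subgroup.a_closed[OF ideal.axioms(1)[OF I]]
    by (subst finsum_insert) auto
qed

lemma dot_closed: "(\<And>j. j < n \<Longrightarrow> u j \<in> carrier R) \<Longrightarrow> (\<And>j. j < n \<Longrightarrow> v j \<in> carrier R) \<Longrightarrow> dot R n u v \<in> carrier R"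
  unfolding dot_def by (rule finsum_closed) auto

lemma dot_cong: "(\<And>j. j < n \<Longrightarrow> u j \<otimes> v j = u' j \<otimes> v' j) \<Longrightarrow> (\<And>j. j < n \<Longrightarrow> u' j \<otimes> v' j \<in> carrier R) \<Longrightarrow>
   dot R n u v = dot R n u' v'"
  unfolding dot_def by (rule finsum_cong') auto

lemma dot_add_right:
  "(\<And>j. j < n \<Longrightarrow> u j \<in> carrier R) \<Longrightarrow> (\<And>j. j < n \<Longrightarrow> v j \<in> carrier R) \<Longrightarrow> (\<And>j. j < n \<Longrightarrow> w j \<in> carrier R) \<Longrightarrow>
   dot R n u (\<lambda>j. v j \<oplus> w j) = dot R n u v \<oplus> dot R n u w"
proof -
  assume h: "\<And>j. j < n \<Longrightarrow> u j \<in> carrier R" "\<And>j. j < n \<Longrightarrow> v j \<in> carrier R" "\<And>j. j < n \<Longrightarrow> w j \<in> carrier R"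
  have "dot R n u (\<lambda>j. v j \<oplus> w j) = (\<Oplus>j\<in>{..<n}. u j \<otimes> v j \<oplus> u j \<otimes> w j)"
    unfolding dot_def by (rule finsum_cong') (auto simp: h r_distr)
  also have "\<dots> = dot R n u v \<oplus> dot R n u w" unfolding dot_def by (rule finsum_addf) (auto simp: h)
  finally show ?thesis .
qed

lemma dot_smult_right:
  "r \<in> carrier R \<Longrightarrow> (\<And>j. j < n \<Longrightarrow> u j \<in> carrier R) \<Longrightarrow> (\<And>j. j < n \<Longrightarrow> v j \<in> carrier R) \<Longrightarrow>
   dot R n u (\<lambda>j. r \<otimes> v j) = r \<otimes> dot R n u v"
proof -
  assume h: "r \<in> carrier R" "\<And>j. j < n \<Longrightarrow> u j \<in> carrier R" "\<And>j. j < n \<Longrightarrow> v j \<in> carrier R"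
  have "dot R n u (\<lambda>j. r \<otimes> v j) = (\<Oplus>j\<in>{..<n}. r \<otimes> (u j \<otimes> v j))"
    unfolding dot_def by (rule finsum_cong') (auto simp: h m_lcomm)
  also have "\<dots> = r \<otimes> dot R n u v" unfolding dot_def by (rule finsum_rdistr[symmetric]) (auto simp: h)
  finally show ?thesis .
qed

lemma dot_comm: "(\<And>j. j < n \<Longrightarrow> u j \<in> carrier R) \<Longrightarrow> (\<And>j. j < n \<Longrightarrow> v j \<in> carrier R) \<Longrightarrow> dot R n u v = dot R n v u"
  unfolding dot_def by (auto intro!: finsum_cong' simp: m_comm)

lemma dot_add_left:
  "(\<And>j. j < n \<Longrightarrow> u j \<in> carrier R) \<Longrightarrow> (\<And>j. j < n \<Longrightarrow> v j \<in> carrier R) \<Longrightarrow> (\<And>j. j < n \<Longrightarrow> w j \<in> carrier R) \<Longrightarrow>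
   dot R n (\<lambda>j. v j \<oplus> w j) u = dot R n v u \<oplus> dot R n w u"
  using dot_add_right[of n u v w] dot_comm[of n u] by simp

lemma dot_smult_left:
  "r \<in> carrier R \<Longrightarrow> (\<And>j. j < n \<Longrightarrow> u j \<in> carrier R) \<Longrightarrow> (\<And>j. j < n \<Longrightarrow> v j \<in> carrier R) \<Longrightarrow>
   dot R n (\<lambda>j. r \<otimes> v j) u = r \<otimes> dot R n v u"
  using dot_smult_right[of r n u v] dot_comm[of n u] by simp

lemma dot_ideal: "ideal I R \<Longrightarrow> (\<And>j. j < n \<Longrightarrow> u j \<in> carrier R) \<Longrightarrow> (\<And>j. j < n \<Longrightarrow> v j \<in> I) \<Longrightarrow> dot R n u v \<in> I"
  unfolding dot_def by (rule finsum_in_ideal) (auto simp: ideal.I_l_closed)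

lemma dot_ev: "k < n \<Longrightarrow> r \<in> carrier R \<Longrightarrow> (\<And>j. j < n \<Longrightarrow> u j \<in> carrier R) \<Longrightarrow> dot R n u (ev R k r) = u k \<otimes> r"
proof -
  assume h: "k < n" "r \<in> carrier R" "\<And>j. j < n \<Longrightarrow> u j \<in> carrier R"
  have "dot R n u (ev R k r) = (\<Oplus>j\<in>{..<n}. if k = j then u j \<otimes> r else \<zero>)"
    unfolding dot_def ev_def by (rule finsum_cong') (use h in auto)
  also have "\<dots> = u k \<otimes> r" using finsum_singleton[of k "{..<n}" "\<lambda>j. u j \<otimes> r"] h by auto
  finally show ?thesis .
qed

lemma matvec_linear:
  assumes "\<And>i j. i < r \<Longrightarrow> j < c \<Longrightarrow> A i j \<in> carrier R"
  shows "linear_map R (fm c) (fm r) (matvec R A r c)"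
  unfolding linear_map_def
proof (intro conjI ballI funcsetI)
  fix v assume v: "v \<in> carrier (fm c)"
  show "matvec R A r c v \<in> carrier (fm r)"
    using v assms by (auto intro!: vecsI dot_closed simp: matvec_dot vecs_carr)
  fix w assume w: "w \<in> carrier (fm c)"
  show "matvec R A r c (v \<oplus>\<^bsub>fm c\<^esub> w) = matvec R A r c v \<oplus>\<^bsub>fm r\<^esub> matvec R A r c w"
    using v w assms by (auto simp: matvec_dot vecs_carr dot_add_right)
next
  fix s v assume "s \<in> carrier R" "v \<in> carrier (fm c)"
  then show "matvec R A r c (s \<odot>\<^bsub>fm c\<^esub> v) = s \<odot>\<^bsub>fm r\<^esub> matvec R A r c v"
    using assms by (auto simp: matvec_dot vecs_carr dot_smult_right)
qed

lemma comb_linear: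
  assumes M: "module R M" and g: "\<And>k. k < t \<Longrightarrow> g k \<in> carrier M"
  shows "linear_map R (fm t) M (comb M t g)"
proof -
  interpret M: module R M by fact
  show ?thesis unfolding linear_map_def
  proof (intro conjI ballI funcsetI)
    fix v assume v: "v \<in> carrier (fm t)"
    show "comb M t g v \<in> carrier M" unfolding comb_def using v g by (intro M.finsum_closed) (auto simp: vecs_carr)
    fix w assume w: "w \<in> carrier (fm t)"
    have "comb M t g (v \<oplus>\<^bsub>fm t\<^esub> w) = (\<Oplus>\<^bsub>M\<^esub>k\<in>{..<t}. v k \<odot>\<^bsub>M\<^esub> g k \<oplus>\<^bsub>M\<^esub> w k \<odot>\<^bsub>M\<^esub> g k)" unfolding comb_def
      by (rule M.finsum_cong') (use v w g in \<open>auto simp: vecs_carr M.smult_l_distr\<close>)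
    also have "\<dots> = comb M t g v \<oplus>\<^bsub>M\<^esub> comb M t g w" unfolding comb_def
      by (rule M.finsum_addf) (use v w g in \<open>auto simp: vecs_carr\<close>)
    finally show "comb M t g (v \<oplus>\<^bsub>fm t\<^esub> w) = comb M t g v \<oplus>\<^bsub>M\<^esub> comb M t g w" .
  next
    fix s v assume sv: "s \<in> carrier R" "v \<in> carrier (fm t)"
    have "comb M t g (s \<odot>\<^bsub>fm t\<^esub> v) = (\<Oplus>\<^bsub>M\<^esub>k\<in>{..<t}. s \<odot>\<^bsub>M\<^esub> (v k \<odot>\<^bsub>M\<^esub> g k))" unfolding comb_def
      by (rule M.finsum_cong') (use sv g in \<open>auto simp: vecs_carr M.smult_assoc1\<close>)
    also have "\<dots> = s \<odot>\<^bsub>M\<^esub> comb M t g v" unfolding comb_def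
      by (rule M.finsum_smult_ldistr[symmetric]) (use sv g in \<open>auto simp: vecs_carr\<close>)
    finally show "comb M t g (s \<odot>\<^bsub>fm t\<^esub> v) = s \<odot>\<^bsub>M\<^esub> comb M t g v" .
  qed
qed

lemma comb_ev:
  assumes M: "module R M" and g: "\<And>k. k < t \<Longrightarrow> g k \<in> carrier M" and k: "k < t" "r \<in> carrier R"
  shows "comb M t g (ev R k r) = r \<odot>\<^bsub>M\<^esub> g k"
proof -
  interpret M: module R M by fact
  have "comb M t g (ev R k r) = (\<Oplus>\<^bsub>M\<^esub>j\<in>{..<t}. if k = j then r \<odot>\<^bsub>M\<^esub> g j else \<zero>\<^bsub>M\<^esub>)"
    unfolding comb_def ev_def by (rule M.finsum_cong') (use g k in auto)
  also have "\<dots> = r \<odot>\<^bsub>M\<^esub> g k" using M.finsum_singleton[of k "{..<t}" "\<lambda>j. r \<odot>\<^bsub>M\<^esub> g j"] g k by auto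
  finally show ?thesis .
qed

lemma comb_in_smod:
  assumes M: "module R M" and A: "smod R M A" and g: "\<And>k. k < t \<Longrightarrow> g k \<in> carrier M" and v: "v \<in> vecs R t"
    and gA: "\<And>k. k < t \<Longrightarrow> v k \<odot>\<^bsub>M\<^esub> g k \<in> A"
  shows "comb M t g v \<in> A"
proof -
  interpret M: module R M by fact
  interpret f: two_modules R "fm t" M "comb M t g"
    by (intro two_modules.intro module_fm M two_modules_axioms.intro comb_linear g)
  have "v \<in> {v \<in> vecs R t. comb M t g v \<in> A}"
  proof (rule vec_induct[OF v])
    show "zero_vec R \<in> {v \<in> vecs R t. comb M t g v \<in> A}" using f.f_zero smod_zero[OF A] by simp
    show "(\<lambda>j. x j \<oplus> y j) \<in> {v \<in> vecs R t. comb M t g v \<in> A}"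
      if "x \<in> {v \<in> vecs R t. comb M t g v \<in> A}" "y \<in> {v \<in> vecs R t. comb M t g v \<in> A}" for x y
      using that f.f_add[of x y] smod_add[OF A] f.M.M.a_closed[of x y] by simp
    show "ev R k (v k) \<in> {v \<in> vecs R t. comb M t g v \<in> A}" if "k < t" for k
      using comb_ev[OF M g that vecs_carr[OF v]] gA[OF that] ev_vecs[OF that vecs_carr[OF v]] by simp
  qed
  then show ?thesis by simp
qed

lemma comb_fm:
  assumes "\<And>k. k < t \<Longrightarrow> g k \<in> vecs R n" "v \<in> vecs R t"
  shows "comb (fm n) t g v = matvec R (\<lambda>i k. g k i) n t v"
proof -
  interpret M: module R "fm n" by (rule module_fm)
  interpret f: two_modules R "fm t" "fm n" "comb (fm n) t g"
    by (intro two_modules.intro module_fm two_modules_axioms.intro comb_linear) (use assms in auto)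
  interpret h: two_modules R "fm t" "fm n" "matvec R (\<lambda>i k. g k i) n t"
    by (intro two_modules.intro module_fm two_modules_axioms.intro matvec_linear) (use assms vecs_carr in auto)
  let ?P = "{v \<in> vecs R t. comb (fm n) t g v = matvec R (\<lambda>i k. g k i) n t v}"
  have "v \<in> ?P"
  proof (rule vec_induct[OF assms(2)])
    show "zero_vec R \<in> ?P" using f.f_zero h.f_zero by simp
    show "(\<lambda>j. x j \<oplus> y j) \<in> ?P" if "x \<in> ?P" "y \<in> ?P" for x y
      using that f.f_add[of x y] h.f_add[of x y] f.M.M.a_closed[of x y] by simp
    show "ev R k (v k) \<in> ?P" if k: "k < t" for k
    proof -
      have vk: "v k \<in> carrier R" using vecs_carr[OF assms(2)] .
      have g: "\<And>j. g k j \<in> carrier R" "\<And>j. j \<ge> n \<Longrightarrow> g k j = \<zero>" using assms(1)[OF k] vecs_carr vecs_ge by auto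
      have "comb (fm n) t g (ev R k (v k)) = (\<lambda>j. v k \<otimes> g k j)"
        using comb_ev[OF module_fm _ k vk, of g n] assms(1) by simp
      moreover have "matvec R (\<lambda>i k. g k i) n t (ev R k (v k)) = (\<lambda>j. v k \<otimes> g k j)"
      proof
        fix j
        have gc: "g k' j \<in> carrier R" if "k' < t" for k' using vecs_carr[OF assms(1)[OF that]] .
        have "dot R t (\<lambda>k. g k j) (ev R k (v k)) = g k j \<otimes> v k" by (rule dot_ev[OF k vk gc])
        then show "matvec R (\<lambda>i k. g k i) n t (ev R k (v k)) j = v k \<otimes> g k j"
          using g vk by (cases "j < n") (simp_all add: matvec_dot m_comm)
      qed
      ultimately show ?thesis using ev_vecs[OF k vk] by simp
    qed
  qed
  then show ?thesis by simp
qed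

end

section \<open>Lengths of free modules and minimal systems of generators\<close>

context local_cring
begin

text \<open>Nakayama for a simple quotient C/B: if mu x were outside B, it would generate C over B,
  whence (1 - r mu) x is in B for some r, and 1 - r mu is a unit.\<close>

lemma scov_mx_smult:
  assumes M: "module R M" and cov: "scov R M B C" and x: "x \<in> C" and \<mu>: "\<mu> \<in> mx"
  shows "\<mu> \<odot>\<^bsub>M\<^esub> x \<in> B"
proof (rule ccontr)
  interpret M: module R M by fact
  assume n: "\<mu> \<odot>\<^bsub>M\<^esub> x \<notin> B"
  have s: "smod R M B" "smod R M C" using cov by (auto simp: M.lat.covers_def)
  have xc: "x \<in> carrier M" and mc: "\<mu> \<in> carrier R" using smod_carr[OF s(2) x] mx_carr[OF \<mu>] by auto
  have "C = msum M B {r \<odot>\<^bsub>M\<^esub> (\<mu> \<odot>\<^bsub>M\<^esub> x) | r. r \<in> carrier R}"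
    by (rule scov_msum[OF M cov smod_smult[OF s(2) mc x] n])
  then obtain z r where zr: "z \<in> B" "r \<in> carrier R" "x = z \<oplus>\<^bsub>M\<^esub> r \<odot>\<^bsub>M\<^esub> (\<mu> \<odot>\<^bsub>M\<^esub> x)"
  proof -
    from \<open>C = _\<close> x have "x \<in> msum M B {r \<odot>\<^bsub>M\<^esub> (\<mu> \<odot>\<^bsub>M\<^esub> x) | r. r \<in> carrier R}" by simp
    then show ?thesis by (rule msumE) (use that in blast)
  qed
  have zc: "z \<in> carrier M" using smod_carr[OF s(1)] zr by blast
  let ?q = "r \<otimes> \<mu>"
  have qm: "?q \<in> mx" using ideal.I_l_closed[OF mx_ideal \<mu> zr(2)] .
  have eq: "x = z \<oplus>\<^bsub>M\<^esub> ?q \<odot>\<^bsub>M\<^esub> x" using zr xc mc by (simp add: M.smult_assoc1)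
  have "(\<one> \<ominus> ?q) \<odot>\<^bsub>M\<^esub> x = x \<ominus>\<^bsub>M\<^esub> ?q \<odot>\<^bsub>M\<^esub> x"
    using xc mc zr by (simp add: a_minus_def M.smult_l_distr M.smult_l_minus)
  also have "\<dots> = (z \<oplus>\<^bsub>M\<^esub> ?q \<odot>\<^bsub>M\<^esub> x) \<ominus>\<^bsub>M\<^esub> ?q \<odot>\<^bsub>M\<^esub> x" using eq by simp
  also have "\<dots> = z" using zc xc mc zr by (simp add: a_minus_def M.M.a_assoc M.M.r_neg)
  finally have 1: "(\<one> \<ominus> ?q) \<odot>\<^bsub>M\<^esub> x \<in> B" using zr by simp
  have qc: "\<one> \<ominus> ?q \<in> carrier R" using mc zr by simp
  obtain y where y: "y \<in> carrier R" "y \<otimes> (\<one> \<ominus> ?q) = \<one>" using notin_mx_inv[OF qc one_minus_mx[OF qm]] .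
  have "y \<odot>\<^bsub>M\<^esub> ((\<one> \<ominus> ?q) \<odot>\<^bsub>M\<^esub> x) = x" using y qc xc by (simp flip: M.smult_assoc1)
  then have "x \<in> B" using smod_smult[OF s(1) y(1) 1] by simp
  then show False using n smod_smult[OF s(1) mc] by blast
qed

lemma hlen_vin_cov:
  assumes cov: "scov R slf I J"
  shows "hlen R (fm n) (vin R I n) (vin R J n) n"
proof -
  interpret S: module R slf by (rule module_self)
  interpret M: module R "fm n" by (rule module_fm)
  have Is: "smod R slf I" and Js: "smod R slf J" and ij0: "I \<subseteq> J" "I \<noteq> J"
    using cov unfolding S.lat.covers_def by auto
  have ij: "ideal I R" "ideal J R" "I \<subseteq> J" "I \<noteq> J"
    using Is Js ij0 by (simp_all add: smod_self_iff)
  obtain r where r: "r \<in> J" "r \<notin> I" using ij by blast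
  have rc: "r \<in> carrier R" using ideal.Icarr[OF ij(2) r(1)] .
  have J: "J = msum slf I {s \<odot>\<^bsub>slf\<^esub> r | s. s \<in> carrier R}" by (rule scov_msum[OF module_self cov r])
  \<comment> \<open>\<open>W m\<close> interpolates between I F and J F: the first m coordinates
    range over J and the others over I. Passing to \<open>Suc m\<close> is a cover.\<close>
  define W where "W m = {v \<in> vecs R n. (\<forall>j<n. (j < m \<longrightarrow> v j \<in> J) \<and> (m \<le> j \<longrightarrow> v j \<in> I))}" for m
  have W: "smod R (fm n) (W m)" for m
  proof (rule smodI)
    fix x y assume "x \<in> W m" "y \<in> W m"
    then show "x \<oplus>\<^bsub>fm n\<^esub> y \<in> W m"
      using smod_add[OF Is] smod_add[OF Js] by (auto simp: W_def vecs_carr vecs_ge intro!: vecsI)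
  next
    fix s x assume "s \<in> carrier R" "x \<in> W m"
    then show "s \<odot>\<^bsub>fm n\<^esub> x \<in> W m"
      using smod_smult[OF Is] smod_smult[OF Js] by (auto simp: W_def vecs_carr vecs_ge intro!: vecsI)
  qed (use smod_zero[OF Is] smod_zero[OF Js] in \<open>auto simp: W_def zero_vec_def vecs_def\<close>)
  have step: "scov R (fm n) (W m) (W (Suc m))" if m: "m < n" for m
  proof -
    let ?x = "ev R m r"
    have "W (Suc m) = msum (fm n) (W m) {s \<odot>\<^bsub>fm n\<^esub> ?x | s. s \<in> carrier R}" (is "_ = ?Z")
    proof
      show "W (Suc m) \<subseteq> ?Z"
      proof
        fix v assume v: "v \<in> W (Suc m)"
        have vc: "v \<in> vecs R n" using v W_def by auto
        have "v m \<in> J" using v m W_def by auto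
        then obtain u s where us: "u \<in> I" "s \<in> carrier R" "v m = u \<oplus> s \<otimes> r" using J by (auto simp: msum_def)
        have uc: "u \<in> carrier R" using ideal.Icarr[OF ij(1) us(1)] .
        let ?w = "\<lambda>j. if j = m then u else v j"
        have w: "?w \<in> W m" using v us(1) uc vc vecs_carr[OF vc] vecs_ge[OF vc] m unfolding W_def
          by (auto intro!: vecsI)
        have eq: "v = ?w \<oplus>\<^bsub>fm n\<^esub> s \<odot>\<^bsub>fm n\<^esub> ?x"
          using us vecs_carr[OF vc] by (auto simp: ev_def)
        have "?w \<oplus>\<^bsub>fm n\<^esub> s \<odot>\<^bsub>fm n\<^esub> ?x \<in> ?Z" by (rule msumI[OF w]) (use us(2) in blast)
        then show "v \<in> ?Z" by (subst eq)
      qed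
      have sub: "W m \<subseteq> W (Suc m)" using ij(3) unfolding W_def by (auto simp: less_Suc_eq)
      have "?x \<in> W (Suc m)" using ev_vecs[OF m rc] r m smod_zero[OF Is] smod_zero[OF Js] unfolding W_def by (auto simp: ev_def)
      then have "{s \<odot>\<^bsub>fm n\<^esub> ?x | s. s \<in> carrier R} \<subseteq> W (Suc m)" using smod_smult[OF W[of "Suc m"], of _ ?x] by blast
      then show "?Z \<subseteq> W (Suc m)" by (rule M.msum_least[OF W sub])
    qed
    moreover have "scov R (fm n) (W m) ?Z"
    proof (rule scov_span[OF module_fm W])
      show "?x \<in> carrier (fm n)" using ev_vecs[OF m rc] by simp
      show "?x \<notin> W m" using r m unfolding W_def by (auto simp: ev_def)
      show "\<mu> \<odot>\<^bsub>fm n\<^esub> ?x \<in> W m" if "\<mu> \<in> mx" for \<mu>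
      proof -
        have "\<mu> \<otimes> r \<in> I" using scov_mx_smult[OF module_self cov r(1) that] by simp
        then show ?thesis using mx_carr[OF that] rc m smod_zero[OF Is] smod_zero[OF Js]
          unfolding W_def by (auto simp: ev_def intro!: vecsI)
      qed
    qed
    ultimately show ?thesis by simp
  qed
  have "hlen R (fm n) (W 0) (W m) m" if "m \<le> n" for m using that
  proof (induction m)
    case 0
    then show ?case using M.lat.has_length_0 W by simp
  next
    case (Suc m)
    then show ?case using M.lat.has_length_Suc[of "W 0" "W m" m "W (Suc m)"] step by simp
  qed
  from this[of n] have "hlen R (fm n) (W 0) (W n) n" by simp
  moreover have "W 0 = vin R I n" "W n = vin R J n" unfolding W_def vin_def by auto
  ultimately show ?thesis by simp
qed

lemma hlen_vin:
  assumes "hlen R slf I J k" shows "hlen R (fm n) (vin R I n) (vin R J n) (k * n)"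
proof -
  interpret S: module R slf by (rule module_self)
  interpret M: module R "fm n" by (rule module_fm)
  show ?thesis using assms
  proof (induction rule: S.lat.has_length.induct)
    case has_length_0
    then show ?case using M.lat.has_length_0 vin_smod smod_self_iff by simp
  next
    case (has_length_Suc J k K)
    show ?case using M.lat.has_length_trans[OF hlen_vin_cov[OF has_length_Suc.hyps(2)] has_length_Suc.IH]
      by (simp add: add.commute)
  qed
qed

lemma hlen_gens_module:
  assumes M: "module R M" and "hlen R M {\<zero>\<^bsub>M\<^esub>} A n"
  shows "\<exists>g. (\<forall>k<n. g k \<in> A) \<and> A \<subseteq> comb M n g ` vecs R n"
proof -
  interpret M: module R M by fact
  show ?thesis using assms(2)
  proof (induction rule: M.lat.has_length.induct)
    case has_length_0
    have "comb M 0 (\<lambda>_. \<zero>\<^bsub>M\<^esub>) (zero_vec R) = \<zero>\<^bsub>M\<^esub>" by (simp add: comb_def)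
    then have "\<zero>\<^bsub>M\<^esub> \<in> comb M 0 (\<lambda>_. \<zero>\<^bsub>M\<^esub>) ` vecs R 0" by (metis image_eqI zero_vecs)
    then show ?case by (intro exI[of _ "\<lambda>_. \<zero>\<^bsub>M\<^esub>"]) simp
  next
    case (has_length_Suc B n C)
    then obtain g where g: "\<And>k. k < n \<Longrightarrow> g k \<in> B" "B \<subseteq> comb M n g ` vecs R n" by blast
    have s: "smod R M B" "smod R M C" "B \<subseteq> C" "B \<noteq> C" using has_length_Suc.hyps(2) by (auto simp: M.lat.covers_def)
    obtain x where x: "x \<in> C" "x \<notin> B" using s by blast
    have C: "C = msum M B {r \<odot>\<^bsub>M\<^esub> x | r. r \<in> carrier R}" by (rule scov_msum[OF M has_length_Suc.hyps(2) x])
    let ?g = "g(n := x)"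
    have gC: "?g k \<in> C" if "k < Suc n" for k using that g s x by (auto simp: less_Suc_eq)
    have gM: "?g k \<in> carrier M" if "k < Suc n" for k using gC[OF that] smod_carr[OF s(2)] by blast
    have gM': "g k \<in> carrier M" if "k < n" for k using gM[of k] that by simp
    have "z \<in> comb M (Suc n) ?g ` vecs R (Suc n)" if z: "z \<in> C" for z
    proof -
      obtain u r where ur: "u \<in> B" "r \<in> carrier R" "z = u \<oplus>\<^bsub>M\<^esub> r \<odot>\<^bsub>M\<^esub> x" using z C by (auto simp: msum_def)
      obtain v where v: "v \<in> vecs R n" "u = comb M n g v" using g ur by blast
      let ?w = "v(n := r)"
      have w: "?w \<in> vecs R (Suc n)" using v ur by (auto simp: vecs_def)
      have "comb M (Suc n) ?g ?w = r \<odot>\<^bsub>M\<^esub> x \<oplus>\<^bsub>M\<^esub> (\<Oplus>\<^bsub>M\<^esub>k\<in>{..<n}. ?w k \<odot>\<^bsub>M\<^esub> ?g k)"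
        unfolding comb_def lessThan_Suc
        by (subst M.finsum_insert) (use vecs_carr[OF v(1)] gM' smod_carr[OF s(2) x(1)] ur(2) in auto)
      also have "(\<Oplus>\<^bsub>M\<^esub>k\<in>{..<n}. ?w k \<odot>\<^bsub>M\<^esub> ?g k) = comb M n g v"
        unfolding comb_def by (rule M.finsum_cong') (use vecs_carr[OF v(1)] gM' in auto)
      finally have "comb M (Suc n) ?g ?w = r \<odot>\<^bsub>M\<^esub> x \<oplus>\<^bsub>M\<^esub> u" unfolding v(2) .
      also have "\<dots> = z"
        using ur(2,3) M.M.a_comm[of u "r \<odot>\<^bsub>M\<^esub> x"] smod_carr[OF s(1) ur(1)] smod_carr[OF s(2) x(1)] by simp
      finally have "comb M (Suc n) ?g ?w = z" .
      then show ?thesis using w by blast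
    qed
    then show ?case using gC by blast
  qed
qed

text \<open>The number of generators is chosen least possible. A relation with a unit coefficient
  would express one generator by the others, so all relations have coefficients in m. This is what
  makes the resolutions built from it minimal.\<close>

lemma minimal_cover:
  assumes M: "module R M" and A: "smod R M A"
    and fg: "\<exists>n g. (\<forall>k<n. g k \<in> A) \<and> A \<subseteq> comb M n g ` vecs R n"
  obtains t g where "\<And>k. k < t \<Longrightarrow> g k \<in> A" "comb M t g ` vecs R t = A"
    "\<And>v. v \<in> vecs R t \<Longrightarrow> comb M t g v = \<zero>\<^bsub>M\<^esub> \<Longrightarrow> v \<in> vin R mx t"
proof -
  interpret M: module R M by fact
  let ?P = "\<lambda>n. \<exists>g. (\<forall>k<n. g k \<in> A) \<and> A \<subseteq> comb M n g ` vecs R n"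
  define t where "t = (LEAST n. ?P n)"
  have "?P t" unfolding t_def by (rule LeastI_ex[OF fg])
  then obtain g where g: "\<And>k. k < t \<Longrightarrow> g k \<in> A" "A \<subseteq> comb M t g ` vecs R t" by blast
  have gM: "g k \<in> carrier M" if "k < t" for k using g(1)[OF that] smod_carr[OF A] by blast
  have im: "comb M t g ` vecs R t = A"
  proof
    show "comb M t g ` vecs R t \<subseteq> A"
    proof
      fix z assume "z \<in> comb M t g ` vecs R t"
      then obtain v where v: "v \<in> vecs R t" "z = comb M t g v" by blast
      show "z \<in> A" unfolding v(2) by (rule comb_in_smod[OF M A gM v(1)]) (use g smod_smult[OF A] vecs_carr[OF v(1)] in auto)
    qed
  qed (rule g(2))
  have "v \<in> vin R mx t" if v: "v \<in> vecs R t" and v0: "comb M t g v = \<zero>\<^bsub>M\<^esub>" for v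
  proof (rule ccontr)
    assume "v \<notin> vin R mx t"
    then obtain k0 where k0: "k0 < t" "v k0 \<notin> mx" using v unfolding vin_def by blast
    obtain m where tm: "t = Suc m" using k0 by (cases t) auto
    define h where "h k = (if k < k0 then g k else g (Suc k))" for k
    have hA: "h k \<in> A" if "k < m" for k unfolding h_def using that tm g(1) by auto
    have hM: "h k \<in> carrier M" if "k < m" for k using hA[OF that] smod_carr[OF A] by blast
    interpret f: two_modules R "fm t" M "comb M t g"
      by (intro two_modules.intro module_fm M two_modules_axioms.intro comb_linear gM)
    interpret h: two_modules R "fm m" M "comb M m h"
      by (intro two_modules.intro module_fm M two_modules_axioms.intro comb_linear hM)
    let ?B = "comb M m h ` vecs R m"
    have B: "smod R M ?B" using h.smod_image[OF h.M.smod_carrier] by simp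
    have hB: "h k \<in> ?B" if "k < m" for k
    proof -
      have "h k = comb M m h (ev R k \<one>)" using comb_ev[OF M hM that one_closed] hM[OF that] by simp
      then show ?thesis using ev_vecs[OF that one_closed] by blast
    qed
    have gB: "g k \<in> ?B" if k: "k < t" "k \<noteq> k0" for k
    proof (cases "k < k0")
      case True
      then have "h k = g k" "k < m" using k0 tm by (auto simp: h_def)
      then show ?thesis using hB by metis
    next
      case False
      then obtain k' where k': "k = Suc k'" using k by (cases k) auto
      then have "h k' = g k" "k' < m" using k False tm by (auto simp: h_def)
      then show ?thesis using hB by metis
    qed
    let ?w = "\<lambda>j. if j = k0 then \<zero> else v j"
    have w: "?w \<in> vecs R t" using v by (auto simp: vecs_def)
    have vk: "v k0 \<in> carrier R" using vecs_carr[OF v] .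
    have "comb M t g ?w \<in> ?B"
    proof (rule comb_in_smod[OF M B gM w])
      fix k assume k: "k < t"
      show "?w k \<odot>\<^bsub>M\<^esub> g k \<in> ?B"
        using smod_zero[OF B] gM[OF k] smod_smult[OF B vecs_carr[OF v] gB[OF k]] by auto
    qed
    moreover have "v = ?w \<oplus>\<^bsub>fm t\<^esub> ev R k0 (v k0)" using vecs_carr[OF v] by (auto simp: ev_def)
    then have "comb M t g v = comb M t g ?w \<oplus>\<^bsub>M\<^esub> v k0 \<odot>\<^bsub>M\<^esub> g k0"
      using f.f_add[of ?w "ev R k0 (v k0)"] w ev_vecs[OF k0(1) vk] comb_ev[OF M gM k0(1) vk] by simp
    ultimately have "v k0 \<odot>\<^bsub>M\<^esub> g k0 \<in> ?B"
      using M.smod_cancel[OF B, of "comb M t g ?w" "v k0 \<odot>\<^bsub>M\<^esub> g k0"] v0 smod_zero[OF B] vk gM[OF k0(1)] by simp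
    moreover obtain y where y: "y \<in> carrier R" "y \<otimes> v k0 = \<one>" using notin_mx_inv[OF vk k0(2)] .
    ultimately have "y \<odot>\<^bsub>M\<^esub> (v k0 \<odot>\<^bsub>M\<^esub> g k0) \<in> ?B" using smod_smult[OF B] by blast
    then have "g k0 \<in> ?B" using y vk gM[OF k0(1)] by (simp flip: M.smult_assoc1)
    then have all: "g k \<in> ?B" if "k < t" for k using gB that by blast
    have "A \<subseteq> ?B"
    proof
      fix z assume "z \<in> A"
      then obtain u where u: "u \<in> vecs R t" "z = comb M t g u" using g(2) by blast
      show "z \<in> ?B" unfolding u(2)
        by (rule comb_in_smod[OF M B gM u(1)]) (use smod_smult[OF B vecs_carr[OF u(1)] all] in auto)
    qed
    then have "?P m" using hA by blast
    then have "t \<le> m" unfolding t_def by (rule Least_le)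
    then show False using tm by simp
  qed
  then show ?thesis using that g im by blast
qed

end

context short_ring
begin

lemma fmodule_fm: "fmodule R (fm n)"
proof -
  interpret M: module R "fm n" by (rule module_fm)
  show ?thesis
  proof
    have "hlen R (fm n) (vin R {\<zero>} n) (vin R (carrier R) n) ((2 * e + 2) * n)"
      by (rule hlen_vin[OF hlen_carrier])
    then show "\<exists>N. hlen R (fm n) {\<zero>\<^bsub>fm n\<^esub>} (carrier (fm n)) N" using vin_zero vin_carrier by auto
  qed
qed

lemma slen_vin: "smod R slf I \<Longrightarrow> smod R slf J \<Longrightarrow> I \<subseteq> J \<Longrightarrow> slen R (fm n) (vin R I n) (vin R J n) = ln I J * n"
proof -
  assume h: "smod R slf I" "smod R slf J" "I \<subseteq> J"
  interpret M: module R "fm n" by (rule module_fm)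
  show ?thesis by (rule M.lat.len_eq[OF hlen_vin[OF S.slen_hlen[OF h]]])
qed

end

section \<open>Koszul rings of this shape have small socle\<close>

text \<open>The beginning of a minimal resolution of the residue field: \<open>xg\<close> is the
  first differential, read as a row of generators of m, and \<open>D2\<close> is the second. The
  last axiom is acyclicity of the linear part in homological degree 1: in the associated graded
  ring, syzygies of the generators in positive degree come from linear ones, so defining relations
  are quadratic.\<close>

locale koszul_gens = short_ring +
  fixes N1 N2 :: nat and xg :: "nat \<Rightarrow> 'a" and D2 :: "(nat \<Rightarrow> 'a) \<Rightarrow> nat \<Rightarrow> 'a"
  assumes X_mx: "q < N1 \<Longrightarrow> xg q \<in> mx"
    and X_gen: "u \<in> mx \<Longrightarrow> \<exists>v\<in>vecs R N1. dot R N1 xg v = u"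
    and D2_lin: "linear_map R (fm N2) (fm N1) D2"
    and D2_mx: "w \<in> vecs R N2 \<Longrightarrow> D2 w \<in> vin R mx N1"
    and D2_syz: "w \<in> vecs R N2 \<Longrightarrow> dot R N1 xg (D2 w) = \<zero>"
    and quadratic: "p \<ge> 1 \<Longrightarrow> v \<in> vin R (mp p) N1 \<Longrightarrow> dot R N1 xg v \<in> mp (p + 2) \<Longrightarrow>
      \<exists>w\<in>vin R (mp (p - 1)) N2. \<forall>q<N1. v q \<ominus> D2 w q \<in> mp (p + 1)"
begin

lemma X_carr: "q < N1 \<Longrightarrow> xg q \<in> carrier R" using X_mx mx_carr by blast

sublocale D2: two_modules R "fm N2" "fm N1" D2
  by (intro two_modules.intro module_fm two_modules_axioms.intro D2_lin)

text \<open>The relation x x^p = a c modulo m^(p+2) is not generated by linear syzygies. The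
  functional that detects this takes the coefficient of x in each generator and is evaluated modulo
  I: it sends the relation to a unit times x^p, which is not in I, but sends m^(p-1) times a linear
  syzygy into I. It is applied with p = 3 and I = 0 when e = 1, and with p = 2 and I = aR when e is
  at most s + 1.\<close>

lemma not_monomial:
  assumes Ys: "ideal Y R" and Yx: "Y \<subseteq> mx" and I: "ideal I R" and x: "x \<in> mx"
    and dec: "\<And>u. u \<in> mx \<Longrightarrow> \<exists>r\<in>carrier R. \<exists>y\<in>Y. u = r \<otimes> x \<oplus> y"
    and p: "p \<ge> 2" and mpI: "mp (p + 1) \<subseteq> I" and YI: "\<And>w y. w \<in> mp (p - 1) \<Longrightarrow> y \<in> Y \<Longrightarrow> w \<otimes> y \<in> I"
    and xp: "x [^] p \<notin> I" and aY: "a \<in> Y" and c: "c \<in> mp p"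
    and rel: "x \<otimes> x [^] p \<ominus> a \<otimes> c \<in> mp (p + 2)"
  shows False
proof -
  have xc: "x \<in> carrier R" and ac: "a \<in> carrier R" and cc: "c \<in> carrier R"
    using mx_carr[OF x] ideal.Icarr[OF Ys aY] mp_carr[OF c] by auto
  have xpow: "x [^] n \<in> mp n" for n :: nat
  proof (induction n)
    case (Suc n)
    have "x \<otimes> x [^] n \<in> mp (Suc n)" using mx_mult[OF x Suc] .
    then show ?case using xc by (simp add: m_comm)
  qed (use xc in simp)
  have Yzero: "\<zero> \<in> Y" "\<zero> \<in> I" using additive_subgroup.zero_closed[OF ideal.axioms(1)] Ys I by auto
  have Ic: "z \<in> carrier R" if "z \<in> I" for z using ideal.Icarr[OF I that] .
  have Iadd: "z \<oplus> w \<in> I" if "z \<in> I" "w \<in> I" for z w using additive_subgroup.a_closed[OF ideal.axioms(1)[OF I] that] .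
  have Ineg: "\<ominus> z \<in> I" if "z \<in> I" for z using additive_subgroup.a_inv_closed[OF ideal.axioms(1)[OF I] that] .
  have Imul: "r \<otimes> z \<in> I" if "r \<in> carrier R" "z \<in> I" for r z using ideal.I_l_closed[OF I that(2,1)] .
  \<comment> \<open>If t were a unit, x would be in Y, and then x^p = x^(p-1) x would be in
    I.\<close>
  have xY: "t \<in> mx" if t: "t \<in> carrier R" "t \<otimes> x \<in> Y" for t
  proof (rule ccontr)
    assume "t \<notin> mx"
    then obtain s where s: "s \<in> carrier R" "s \<otimes> t = \<one>" using notin_mx_inv t by blast
    have "s \<otimes> (t \<otimes> x) \<in> Y" using ideal.I_l_closed[OF Ys t(2) s(1)] .
    then have "x \<in> Y" using s t xc by (simp flip: m_assoc)
    then have "x [^] (p - 1) \<otimes> x \<in> I" using YI xpow by blast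
    then show False using xp p xc by (simp flip: nat_pow_Suc)
  qed
  have "\<exists>r y. \<forall>q<N1. r q \<in> carrier R \<and> y q \<in> Y \<and> xg q = r q \<otimes> x \<oplus> y q"
  proof -
    have "\<forall>q. \<exists>r y. q < N1 \<longrightarrow> r \<in> carrier R \<and> y \<in> Y \<and> xg q = r \<otimes> x \<oplus> y" using dec X_mx by metis
    then show ?thesis by metis
  qed
  then obtain \<beta> \<eta> where \<beta>: "\<And>q. q < N1 \<Longrightarrow> \<beta> q \<in> carrier R" and \<eta>: "\<And>q. q < N1 \<Longrightarrow> \<eta> q \<in> Y"
    and Xeq: "\<And>q. q < N1 \<Longrightarrow> xg q = x \<otimes> \<beta> q \<oplus> \<eta> q" using m_comm[OF xc] by metis
  have \<eta>c: "\<eta> q \<in> carrier R" if "q < N1" for q using \<eta>[OF that] ideal.Icarr[OF Ys] by blast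
  have dotX: "dot R N1 xg v = x \<otimes> dot R N1 \<beta> v \<oplus> dot R N1 \<eta> v" if v: "\<And>q. q < N1 \<Longrightarrow> v q \<in> carrier R" for v
  proof -
    have "dot R N1 xg v = dot R N1 (\<lambda>q. x \<otimes> \<beta> q \<oplus> \<eta> q) v"
      by (rule dot_cong) (use Xeq v \<beta> \<eta>c xc in auto)
    also have "\<dots> = dot R N1 (\<lambda>q. x \<otimes> \<beta> q) v \<oplus> dot R N1 \<eta> v"
      by (rule dot_add_left) (use v \<beta> \<eta>c xc in auto)
    also have "dot R N1 (\<lambda>q. x \<otimes> \<beta> q) v = x \<otimes> dot R N1 \<beta> v"
      by (rule dot_smult_left) (use v \<beta> xc in auto)
    finally show ?thesis .
  qed
  have dotc: "dot R N1 \<beta> v \<in> carrier R" if "\<And>q. q < N1 \<Longrightarrow> v q \<in> carrier R" for v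
    by (rule dot_closed) (use that \<beta> in auto)
  have dot\<eta>: "dot R N1 \<eta> v \<in> Y" if v: "\<And>q. q < N1 \<Longrightarrow> v q \<in> carrier R" for v
    using dot_ideal[OF Ys, of N1 v \<eta>] v \<eta> \<eta>c dot_comm[of N1 \<eta> v] by simp
  have unit: "dot R N1 \<beta> v \<in> mx"
    if v: "\<And>q. q < N1 \<Longrightarrow> v q \<in> carrier R" and XvY: "dot R N1 xg v \<in> Y" for v
  proof -
    interpret Y: ideal Y R by (rule Ys)
    have "dot R N1 xg v \<ominus> dot R N1 \<eta> v \<in> Y" using XvY dot\<eta>[OF v] unfolding a_minus_def by (auto intro: Y.a_closed Y.a_inv_closed)
    moreover have "dot R N1 xg v \<ominus> dot R N1 \<eta> v = dot R N1 \<beta> v \<otimes> x"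
      using dotX[OF v] dotc[OF v] ideal.Icarr[OF Ys dot\<eta>[OF v]] xc
      by (simp add: a_minus_def a_assoc r_neg m_comm)
    ultimately show ?thesis using xY[OF dotc[OF v]] by simp
  qed
  text \<open>The functional \<open>v \<mapsto> dot \<beta> v\<close> modulo \<open>I\<close> kills \<open>mp (p - 1)\<close> times the linear syzygies.\<close>
  have syz: "w \<otimes> dot R N1 \<beta> \<kappa> \<in> I"
    if w: "w \<in> mp (p - 1)" and \<kappa>: "\<kappa> \<in> vin R mx N1" and \<kappa>0: "dot R N1 xg \<kappa> = \<zero>" for w \<kappa>
  proof -
    have \<kappa>m: "\<kappa> q \<in> mx" and \<kappa>c: "\<kappa> q \<in> carrier R" for q using vin_mem[OF mx_ideal \<kappa>] mx_carr by auto
    obtain \<alpha> y where \<alpha>: "\<And>q. \<alpha> q \<in> carrier R" and y: "\<And>q. y q \<in> Y" and \<kappa>eq: "\<And>q. \<kappa> q = x \<otimes> \<alpha> q \<oplus> y q"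
      using dec[OF \<kappa>m] m_comm[OF xc] by metis
    have yc: "y q \<in> carrier R" for q using ideal.Icarr[OF Ys y] .
    have wc: "w \<in> carrier R" using mp_carr[OF w] .
    let ?B = "dot R N1 \<beta> \<alpha>"
    have Bc: "?B \<in> carrier R" using dotc \<alpha> by blast
    have eq: "dot R N1 \<beta> \<kappa> = x \<otimes> ?B \<oplus> dot R N1 \<beta> y"
    proof -
      have "dot R N1 \<beta> \<kappa> = dot R N1 \<beta> (\<lambda>q. x \<otimes> \<alpha> q \<oplus> y q)" by (rule dot_cong) (use \<kappa>eq \<beta> \<alpha> yc xc in auto)
      also have "\<dots> = dot R N1 \<beta> (\<lambda>q. x \<otimes> \<alpha> q) \<oplus> dot R N1 \<beta> y" by (rule dot_add_right) (use \<beta> \<alpha> yc xc in auto)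
      also have "dot R N1 \<beta> (\<lambda>q. x \<otimes> \<alpha> q) = x \<otimes> ?B" by (rule dot_smult_right) (use \<beta> \<alpha> xc in auto)
      finally show ?thesis .
    qed
    have byY: "dot R N1 \<beta> y \<in> Y" by (rule dot_ideal[OF Ys]) (use \<beta> y in auto)
    have byc: "dot R N1 \<beta> y \<in> carrier R" using ideal.Icarr[OF Ys byY] .
    \<comment> \<open>Multiplied by x^(p-2), the syzygy becomes \<open>?B\<close> x^p plus terms in
      m^(p-1) Y, and these lie in I. A unit \<open>?B\<close> would therefore put x^p into
      I.\<close>
    have Bm: "?B \<in> mx"
    proof (rule ccontr)
      assume nB: "?B \<notin> mx"
      let ?z = "x [^] (p - 2)"
      have zc: "?z \<in> carrier R" using xc by simp
      have \<eta>\<kappa>: "dot R N1 \<eta> (\<lambda>q. ?z \<otimes> \<kappa> q) \<in> I"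
        unfolding dot_def
      proof (rule finsum_in_ideal[OF I])
        fix q assume "q \<in> {..<N1}"
        then have q: "q < N1" by simp
        have "?z \<otimes> \<kappa> q \<in> mp (p - 1)" using mp_mult[OF xpow[of "p - 2"], of "\<kappa> q" 1] \<kappa>m[of q] mp_1 p
          by (simp add: Suc_diff_Suc numeral_2_eq_2 del: ideal_power.simps)
        then have "(?z \<otimes> \<kappa> q) \<otimes> \<eta> q \<in> I" using YI \<eta>[OF q] by blast
        then show "\<eta> q \<otimes> (?z \<otimes> \<kappa> q) \<in> I" using m_comm zc \<kappa>c \<eta>c[OF q] by simp
      qed simp
      have \<eta>\<kappa>2: "dot R N1 \<eta> (\<lambda>q. ?z \<otimes> \<kappa> q) = ?z \<otimes> dot R N1 \<eta> \<kappa>"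
        by (rule dot_smult_right) (use zc \<eta>c \<kappa>c in auto)
      have \<eta>\<kappa>c: "dot R N1 \<eta> \<kappa> \<in> carrier R" by (rule dot_closed) (use \<eta>c \<kappa>c in auto)
      have byI: "?z \<otimes> (x \<otimes> dot R N1 \<beta> y) \<in> I"
      proof -
        have "?z \<otimes> x \<in> mp (p - 1)" using mp_mult[OF xpow[of "p - 2"], of x 1] x mp_1 p
          by (simp add: Suc_diff_Suc numeral_2_eq_2 del: ideal_power.simps)
        then have "(?z \<otimes> x) \<otimes> dot R N1 \<beta> y \<in> I" using YI byY by blast
        then show ?thesis using zc xc byc by (simp add: m_assoc)
      qed
      have "?z \<otimes> dot R N1 xg \<kappa> = \<zero>" using \<kappa>0 zc by simp
      moreover have "dot R N1 xg \<kappa> = x \<otimes> (x \<otimes> ?B \<oplus> dot R N1 \<beta> y) \<oplus> dot R N1 \<eta> \<kappa>"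
        using dotX[of \<kappa>] \<kappa>c eq by simp
      ultimately have sum0: "?z \<otimes> (x \<otimes> (x \<otimes> ?B \<oplus> dot R N1 \<beta> y) \<oplus> dot R N1 \<eta> \<kappa>) = \<zero>" by simp
      have "?B \<otimes> (?z \<otimes> (x \<otimes> x)) \<oplus> (?z \<otimes> (x \<otimes> dot R N1 \<beta> y) \<oplus> ?z \<otimes> dot R N1 \<eta> \<kappa>)
          = ?z \<otimes> (x \<otimes> (x \<otimes> ?B \<oplus> dot R N1 \<beta> y) \<oplus> dot R N1 \<eta> \<kappa>)"
        using zc xc Bc byc \<eta>\<kappa>c by algebra
      then have "?B \<otimes> (?z \<otimes> (x \<otimes> x)) \<oplus> (?z \<otimes> (x \<otimes> dot R N1 \<beta> y) \<oplus> ?z \<otimes> dot R N1 \<eta> \<kappa>) = \<zero>"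
        using sum0 by simp
      then have "?B \<otimes> (?z \<otimes> (x \<otimes> x)) = \<ominus> (?z \<otimes> (x \<otimes> dot R N1 \<beta> y) \<oplus> ?z \<otimes> dot R N1 \<eta> \<kappa>)"
        by (rule minus_equality[symmetric]) (use zc xc Bc byc \<eta>\<kappa>c in auto)
      also have "\<dots> \<in> I" using byI \<eta>\<kappa> \<eta>\<kappa>2 Iadd Ineg by simp
      finally have "?B \<otimes> (?z \<otimes> (x \<otimes> x)) \<in> I" .
      moreover have "?z \<otimes> (x \<otimes> x) = x [^] p"
      proof -
        have "?z \<otimes> x [^] (2::nat) = x [^] (p - 2 + 2)" by (rule nat_pow_mult[OF xc])
        moreover have "p - 2 + 2 = p" "x [^] (2::nat) = x \<otimes> x" using p xc by (simp_all add: numeral_2_eq_2)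
        ultimately show ?thesis by (simp only:)
      qed
      ultimately have BI: "?B \<otimes> x [^] p \<in> I" by simp
      obtain s where s: "s \<in> carrier R" "s \<otimes> ?B = \<one>" using notin_mx_inv[OF Bc nB] .
      have "s \<otimes> (?B \<otimes> x [^] p) \<in> I" using Imul[OF s(1) BI] .
      then have "x [^] p \<in> I" using s Bc xc by (simp flip: m_assoc)
      then show False using xp by simp
    qed
    have "w \<otimes> (x \<otimes> ?B) \<in> I"
    proof -
      have "x \<otimes> ?B \<in> mp 2" using mp_mult[of x 1 ?B 1] x Bm mp_1 by (simp add: numeral_2_eq_2)
      then have "w \<otimes> (x \<otimes> ?B) \<in> mp (p + 1)" using mp_mult[OF w, of "x \<otimes> ?B" 2] p
        by (simp add: Suc_diff_Suc numeral_2_eq_2 del: ideal_power.simps)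
      then show ?thesis using mpI by blast
    qed
    moreover have "w \<otimes> dot R N1 \<beta> y \<in> I" using YI[OF w byY] .
    ultimately show ?thesis using eq Iadd wc xc Bc byc by (simp add: r_distr)
  qed
  have main: "dot R N1 \<beta> v \<in> I" if v: "v \<in> vin R (mp p) N1" and Xv: "dot R N1 xg v \<in> mp (p + 2)" for v
  proof -
    obtain w where w: "w \<in> vin R (mp (p - 1)) N2" "\<And>q. q < N1 \<Longrightarrow> v q \<ominus> D2 w q \<in> mp (p + 1)"
      using quadratic[OF _ v Xv] p by auto
    have wv: "w \<in> vecs R N2" using vin_carr[OF w(1)] .
    have vc: "v q \<in> carrier R" for q using vecs_carr[OF vin_carr[OF v]] .
    have D2c: "D2 u q \<in> carrier R" if "u \<in> vecs R N2" for u q using vecs_carr[of "D2 u" N1] D2.f_closed[of u] that by simp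
    have "w \<in> {u \<in> vecs R N2. dot R N1 \<beta> (D2 u) \<in> I}" (is "w \<in> ?P")
    proof (rule vec_induct[OF wv])
      have "dot R N1 \<beta> (D2 (zero_vec R)) \<in> I"
        using D2.f_zero by (auto intro!: dot_ideal[OF I] simp: \<beta> zero_vec_def Yzero)
      then show "zero_vec R \<in> ?P" by simp
      show "(\<lambda>j. s j \<oplus> t j) \<in> ?P" if "s \<in> ?P" "t \<in> ?P" for s t
      proof -
        have "D2 (\<lambda>j. s j \<oplus> t j) = (\<lambda>j. D2 s j \<oplus> D2 t j)" using D2.f_add[of s t] that by simp
        then have "dot R N1 \<beta> (D2 (\<lambda>j. s j \<oplus> t j)) = dot R N1 \<beta> (D2 s) \<oplus> dot R N1 \<beta> (D2 t)"
          using that dot_add_right[of N1 \<beta> "D2 s" "D2 t"] \<beta> D2c by auto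
        then show ?thesis using that Iadd D2.M.M.a_closed[of s t] by auto
      qed
      show "ev R k (w k) \<in> ?P" if k: "k < N2" for k
      proof -
        have wk: "w k \<in> mp (p - 1)" "w k \<in> carrier R" using vin_mem[OF mp_ideal w(1)] mp_carr by auto
        have e1: "ev R k \<one> \<in> vecs R N2" using ev_vecs[OF k one_closed] .
        have "ev R k (w k) = w k \<odot>\<^bsub>fm N2\<^esub> ev R k \<one>" using wk by (auto simp: ev_def)
        then have "D2 (ev R k (w k)) = (\<lambda>j. w k \<otimes> D2 (ev R k \<one>) j)"
          using D2.f_smult[OF wk(2), of "ev R k \<one>"] e1 by simp
        then have "dot R N1 \<beta> (D2 (ev R k (w k))) = w k \<otimes> dot R N1 \<beta> (D2 (ev R k \<one>))"
          using dot_smult_right[OF wk(2), of N1 \<beta> "D2 (ev R k \<one>)"] \<beta> D2c[OF e1] by simp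
        then show ?thesis using syz[OF wk(1) D2_mx[OF e1] D2_syz[OF e1]] ev_vecs[OF k wk(2)] by simp
      qed
    qed
    then have 1: "dot R N1 \<beta> (D2 w) \<in> I" by simp
    have 2: "dot R N1 \<beta> (\<lambda>q. v q \<ominus> D2 w q) \<in> I" by (rule dot_ideal[OF I]) (use \<beta> w(2) mpI in auto)
    have "dot R N1 \<beta> v = dot R N1 \<beta> (\<lambda>q. (v q \<ominus> D2 w q) \<oplus> D2 w q)"
    proof (rule dot_cong)
      fix q assume q: "q < N1"
      have "(v q \<ominus> D2 w q) \<oplus> D2 w q = v q" using vc[of q] D2c[OF wv, of q] by algebra
      then show "\<beta> q \<otimes> v q = \<beta> q \<otimes> ((v q \<ominus> D2 w q) \<oplus> D2 w q)" by simp
      show "\<beta> q \<otimes> ((v q \<ominus> D2 w q) \<oplus> D2 w q) \<in> carrier R" using \<beta>[OF q] vc D2c[OF wv] by simp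
    qed
    also have "\<dots> = dot R N1 \<beta> (\<lambda>q. v q \<ominus> D2 w q) \<oplus> dot R N1 \<beta> (D2 w)"
      by (rule dot_add_right) (use \<beta> vc D2c[OF wv] in auto)
    finally show ?thesis using 1 2 Iadd by simp
  qed
  obtain r where r: "r \<in> vecs R N1" "dot R N1 xg r = x" using X_gen[OF x] by blast
  obtain s where s: "s \<in> vecs R N1" "dot R N1 xg s = a" using X_gen[of a] aY Yx by blast
  have rc: "r q \<in> carrier R" and sc: "s q \<in> carrier R" for q using vecs_carr r s by auto
  have xpc: "x [^] p \<in> carrier R" using xc by simp
  \<comment> \<open>The relation in coordinates: r expresses x and s expresses a through the
    generators.\<close>
  let ?v = "\<lambda>q. x [^] p \<otimes> r q \<oplus> (\<ominus> c) \<otimes> s q"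
  have v: "?v \<in> vin R (mp p) N1"
    unfolding vin_def
  proof (intro CollectI conjI allI impI)
    show "?v \<in> vecs R N1" using rc sc xpc cc vecs_ge[OF r(1)] vecs_ge[OF s(1)] by (intro vecsI) auto
    show "?v q \<in> mp p" if "q < N1" for q
      using mp_add mp_smult_r[OF rc xpow] mp_smult_r[OF sc mp_neg[OF c]] by blast
  qed
  have split: "dot R N1 u ?v = x [^] p \<otimes> dot R N1 u r \<oplus> (\<ominus> c) \<otimes> dot R N1 u s"
    if u: "\<And>q. q < N1 \<Longrightarrow> u q \<in> carrier R" for u
    using dot_add_right[of N1 u "\<lambda>q. x [^] p \<otimes> r q" "\<lambda>q. (\<ominus> c) \<otimes> s q"] u rc sc xpc cc
      dot_smult_right[OF xpc, of N1 u r] dot_smult_right[of "\<ominus> c" N1 u s] by simp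
  have "dot R N1 xg ?v = x \<otimes> x [^] p \<ominus> a \<otimes> c"
    using split[of xg, OF X_carr] r(2) s(2) xpc xc ac cc by (simp add: a_minus_def l_minus r_minus m_comm)
  then have "dot R N1 \<beta> ?v \<in> I" using main[OF v] rel by simp
  then have 1: "x [^] p \<otimes> dot R N1 \<beta> r \<oplus> (\<ominus> c) \<otimes> dot R N1 \<beta> s \<in> I" using split[OF \<beta>] by simp
  have brc: "dot R N1 \<beta> r \<in> carrier R" "dot R N1 \<beta> s \<in> carrier R" using dotc rc sc by auto
  have "dot R N1 \<beta> s \<in> mx" using unit[of s] sc s aY by simp
  then have "dot R N1 \<beta> s \<otimes> c \<in> mp (p + 1)" using mx_mult[OF _ c] by simp
  then have 2: "c \<otimes> dot R N1 \<beta> s \<in> I" using mpI m_comm[OF brc(2) cc] by auto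
  have "(x [^] p \<otimes> dot R N1 \<beta> r \<oplus> (\<ominus> c) \<otimes> dot R N1 \<beta> s) \<oplus> c \<otimes> dot R N1 \<beta> s = dot R N1 \<beta> r \<otimes> x [^] p"
    using brc xpc cc by algebra
  then have 3: "dot R N1 \<beta> r \<otimes> x [^] p \<in> I" using Iadd[OF 1 2] by simp
  show False
  proof (cases "dot R N1 \<beta> r \<in> mx")
    case False
    obtain t where t: "t \<in> carrier R" "t \<otimes> dot R N1 \<beta> r = \<one>" using notin_mx_inv[OF brc(1) False] .
    have "t \<otimes> (dot R N1 \<beta> r \<otimes> x [^] p) \<in> I" using Imul[OF t(1) 3] .
    then show False using t brc xpc xp by (simp flip: m_assoc)
  next
    \<comment> \<open>The x-coefficient of x itself cannot lie in m: otherwise (1 - q) x is in Y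
      with a unit factor, which \<open>xY\<close> forbids.\<close>
    case True
    let ?q = "dot R N1 \<beta> r"
    have \<eta>r: "dot R N1 \<eta> r \<in> Y" using dot\<eta> rc by blast
    have "x = x \<otimes> ?q \<oplus> dot R N1 \<eta> r" using dotX[of r] rc r by simp
    then have "(\<one> \<ominus> ?q) \<otimes> x = (x \<otimes> ?q \<oplus> dot R N1 \<eta> r) \<ominus> ?q \<otimes> x" using xc brc
      by (simp add: a_minus_def l_distr l_minus)
    also have "\<dots> = dot R N1 \<eta> r" using xc brc ideal.Icarr[OF Ys \<eta>r] by algebra
    finally have "(\<one> \<ominus> ?q) \<otimes> x \<in> Y" using \<eta>r by simp
    then have "\<one> \<ominus> ?q \<in> mx" using xY brc by simp
    then show False using one_minus_mx[OF True] by simp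
  qed
qed

text \<open>The cubic relation b a = 0, with b quadratic, is not generated by linear syzygies. As
  m^2 = a m, vectors over m^2 can be divided by a, and the obstruction is the product of the
  quotient with the generators modulo m^3. The quotient is unique up to multiples of b, hence up to
  m^2, which the generators take into m^3. For the relation b a = 0 one gets b itself, which is not
  in m^3.\<close>

lemma not_binary:
  assumes a: "a \<in> mx" and y: "y \<in> mx" and b: "b \<in> mp 2" "b \<notin> mp 3" and ab: "b \<otimes> a = \<zero>"
    and ann: "\<And>z. z \<in> carrier R \<Longrightarrow> z \<otimes> a = \<zero> \<Longrightarrow> \<exists>r\<in>carrier R. z = r \<otimes> b"
    and dec: "\<And>u. u \<in> mx \<Longrightarrow> \<exists>r\<in>carrier R. \<exists>s\<in>carrier R. u = r \<otimes> a \<oplus> s \<otimes> y"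
    and mp2: "\<And>z. z \<in> mp 2 \<Longrightarrow> \<exists>u\<in>mx. z = u \<otimes> a"
  shows False
proof -
  have ac: "a \<in> carrier R" and yc: "y \<in> carrier R" and bc: "b \<in> carrier R" using a y b mx_carr mp_carr by auto
  have bm2: "z \<in> mp 2" if "z \<in> carrier R" "z \<otimes> a = \<zero>" for z using ann[OF that] mp_smult[OF _ b(1)] by blast
  have mp3: "\<exists>u\<in>mp 2. z = u \<otimes> a" if "z \<in> mp 3" for z
  proof -
    have "mp (Suc 2) \<subseteq> (\<lambda>x. x \<otimes> a) ` mp 2"
    proof (rule mp_Suc_subset)
      show "ideal ((\<lambda>x. x \<otimes> a) ` mp 2) R" using smod_mul[OF ac mp_smod] smod_self_iff by blast
      fix u v assume u: "u \<in> mx" and "v \<in> mp 2"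
      then obtain t where t: "t \<in> mx" "v = t \<otimes> a" using mp2 by blast
      have "u \<otimes> t \<in> mp 2" using mp_mult[of u 1 t 1] u t mp_1 by (simp add: numeral_2_eq_2)
      moreover have "u \<otimes> v = (u \<otimes> t) \<otimes> a" using u t mx_carr ac by (simp add: m_assoc)
      ultimately show "u \<otimes> v \<in> (\<lambda>x. x \<otimes> a) ` mp 2" by blast
    qed
    then show ?thesis using that by auto
  qed
  have "\<exists>r s. \<forall>q<N1. r q \<in> carrier R \<and> s q \<in> carrier R \<and> xg q = r q \<otimes> a \<oplus> s q \<otimes> y"
  proof -
    have "\<forall>q. \<exists>r s. q < N1 \<longrightarrow> r \<in> carrier R \<and> s \<in> carrier R \<and> xg q = r \<otimes> a \<oplus> s \<otimes> y" using dec X_mx by metis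
    then show ?thesis by metis
  qed
  then obtain \<beta> \<gamma> where \<beta>: "\<And>q. q < N1 \<Longrightarrow> \<beta> q \<in> carrier R" and \<gamma>: "\<And>q. q < N1 \<Longrightarrow> \<gamma> q \<in> carrier R"
    and Xeq: "\<And>q. q < N1 \<Longrightarrow> xg q = a \<otimes> \<beta> q \<oplus> y \<otimes> \<gamma> q" using m_comm ac yc by metis
  have dc\<beta>: "dot R N1 \<beta> v \<in> carrier R" and dc\<gamma>: "dot R N1 \<gamma> v \<in> carrier R" if "\<And>q. v q \<in> carrier R" for v
    using dot_closed[of N1 \<beta> v] dot_closed[of N1 \<gamma> v] that \<beta> \<gamma> by auto
  have dotX: "dot R N1 xg v = a \<otimes> dot R N1 \<beta> v \<oplus> y \<otimes> dot R N1 \<gamma> v" if v: "\<And>q. v q \<in> carrier R" for v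
  proof -
    have "dot R N1 xg v = dot R N1 (\<lambda>q. a \<otimes> \<beta> q \<oplus> y \<otimes> \<gamma> q) v"
      by (rule dot_cong) (use Xeq v \<beta> \<gamma> ac yc in auto)
    also have "\<dots> = dot R N1 (\<lambda>q. a \<otimes> \<beta> q) v \<oplus> dot R N1 (\<lambda>q. y \<otimes> \<gamma> q) v"
      by (rule dot_add_left) (use v \<beta> \<gamma> ac yc in auto)
    also have "dot R N1 (\<lambda>q. a \<otimes> \<beta> q) v = a \<otimes> dot R N1 \<beta> v"
      by (rule dot_smult_left) (use v \<beta> ac in auto)
    also have "dot R N1 (\<lambda>q. y \<otimes> \<gamma> q) v = y \<otimes> dot R N1 \<gamma> v"
      by (rule dot_smult_left) (use v \<gamma> yc in auto)
    finally show ?thesis .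
  qed
  have dcX: "dot R N1 xg v \<in> carrier R" if "\<And>q. v q \<in> carrier R" for v
    using dot_closed[of N1 xg v] that X_carr by auto
  define \<Phi> where "\<Phi> V \<longleftrightarrow> (\<exists>Z. (\<forall>q. Z q \<in> carrier R \<and> (q < N1 \<longrightarrow> V q = Z q \<otimes> a)) \<and> dot R N1 xg Z \<in> mp 3)" for V
  text \<open>Dividing by \<open>a\<close> turns a vector of quadrics into a cubic; on multiples of linear syzygies that cubic vanishes.\<close>
  have syz: "\<Phi> (\<lambda>q. w \<otimes> \<kappa> q)" if w: "w \<in> mx" and \<kappa>: "\<kappa> \<in> vin R mx N1" and \<kappa>0: "dot R N1 xg \<kappa> = \<zero>" for w \<kappa>
  proof -
    have \<kappa>m: "\<kappa> q \<in> mx" and \<kappa>c: "\<kappa> q \<in> carrier R" for q using vin_mem[OF mx_ideal \<kappa>] mx_carr by auto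
    obtain s t where st: "s \<in> carrier R" "t \<in> carrier R" "w = s \<otimes> a \<oplus> t \<otimes> y" using dec[OF w] by blast
    have "\<exists>z\<in>mx. y \<otimes> \<kappa> q = z \<otimes> a" for q
      using mp2[of "y \<otimes> \<kappa> q"] mp_mult[of y 1 "\<kappa> q" 1] y \<kappa>m[of q] mp_1 by (simp add: numeral_2_eq_2)
    then obtain \<zeta> where \<zeta>: "\<And>q. \<zeta> q \<in> mx" "\<And>q. y \<otimes> \<kappa> q = \<zeta> q \<otimes> a" by metis
    have \<zeta>c: "\<zeta> q \<in> carrier R" for q using \<zeta> mx_carr by blast
    let ?Z = "\<lambda>q. s \<otimes> \<kappa> q \<oplus> t \<otimes> \<zeta> q"
    have Zc: "?Z q \<in> carrier R" for q using st \<kappa>c \<zeta>c by simp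
    have e1: "w \<otimes> \<kappa> q = ?Z q \<otimes> a" for q
    proof -
      have "w \<otimes> \<kappa> q = s \<otimes> \<kappa> q \<otimes> a \<oplus> t \<otimes> (y \<otimes> \<kappa> q)" using st \<kappa>c[of q] ac yc by algebra
      also have "\<dots> = ?Z q \<otimes> a" unfolding \<zeta>(2) using st \<kappa>c[of q] \<zeta>c[of q] ac by algebra
      finally show ?thesis .
    qed
    \<comment> \<open>a times \<open>?T\<close> is the product of the generators with the syzygy,
      that is 0. So \<open>?T\<close> annihilates a and lies in m^2, because the annihilator is
      bR.\<close>
    let ?T = "dot R N1 \<beta> \<kappa> \<oplus> dot R N1 \<gamma> \<zeta>"
    have Tc: "?T \<in> carrier R" using dc\<beta>[of \<kappa>] dc\<gamma>[of \<zeta>] \<kappa>c \<zeta>c by simp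
    have sw: "a \<otimes> dot R N1 u \<zeta> = y \<otimes> dot R N1 u \<kappa>" if u: "\<And>q. q < N1 \<Longrightarrow> u q \<in> carrier R" for u
    proof -
      have "a \<otimes> dot R N1 u \<zeta> = dot R N1 u (\<lambda>q. a \<otimes> \<zeta> q)" by (rule dot_smult_right[symmetric]) (use u \<zeta>c ac in auto)
      also have "\<dots> = dot R N1 u (\<lambda>q. y \<otimes> \<kappa> q)" unfolding \<zeta>(2) using m_comm[OF ac \<zeta>c] by simp
      also have "\<dots> = y \<otimes> dot R N1 u \<kappa>" by (rule dot_smult_right) (use u \<kappa>c yc in auto)
      finally show ?thesis .
    qed
    have "a \<otimes> ?T = a \<otimes> dot R N1 \<beta> \<kappa> \<oplus> a \<otimes> dot R N1 \<gamma> \<zeta>" using dc\<beta>[of \<kappa>] dc\<gamma>[of \<zeta>] \<kappa>c \<zeta>c ac by (simp add: r_distr)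
    also have "\<dots> = dot R N1 xg \<kappa>" using sw[OF \<gamma>] dotX[OF \<kappa>c] by simp
    finally have "?T \<otimes> a = \<zero>" using \<kappa>0 m_comm[OF ac Tc] by simp
    then have "?T \<in> mp 2" using bm2 Tc by blast
    then have yT: "y \<otimes> ?T \<in> mp 3" using mx_mult[OF y, of ?T 2] by (simp add: numeral_3_eq_3)
    have "dot R N1 xg \<zeta> = y \<otimes> dot R N1 \<beta> \<kappa> \<oplus> y \<otimes> dot R N1 \<gamma> \<zeta>" using dotX[OF \<zeta>c] sw[OF \<beta>] by simp
    then have xg\<zeta>: "dot R N1 xg \<zeta> \<in> mp 3" using yT dc\<beta>[of \<kappa>] dc\<gamma>[of \<zeta>] \<kappa>c \<zeta>c yc by (simp add: r_distr)
    have "dot R N1 xg ?Z = s \<otimes> dot R N1 xg \<kappa> \<oplus> t \<otimes> dot R N1 xg \<zeta>"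
      using dot_add_right[of N1 xg "\<lambda>q. s \<otimes> \<kappa> q" "\<lambda>q. t \<otimes> \<zeta> q"] X_carr st \<kappa>c \<zeta>c
        dot_smult_right[OF st(1), of N1 xg \<kappa>] dot_smult_right[OF st(2), of N1 xg \<zeta>] by simp
    then have "dot R N1 xg ?Z \<in> mp 3" using \<kappa>0 st xg\<zeta> mp_smult[OF st(2) xg\<zeta>] mp_carr[OF xg\<zeta>] by simp
    then show ?thesis unfolding \<Phi>_def by (intro exI[of _ ?Z]) (use e1 Zc in auto)
  qed
  obtain s where s: "s \<in> vecs R N1" "dot R N1 xg s = a" using X_gen[OF a] by blast
  have sc: "s q \<in> carrier R" for q using vecs_carr[OF s(1)] .
  let ?v = "\<lambda>q. b \<otimes> s q"
  have v: "?v \<in> vin R (mp 2) N1" unfolding vin_def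
    using sc bc vecs_ge[OF s(1)] mp_smult_r[OF sc b(1)] by (auto intro!: vecsI)
  have "dot R N1 xg ?v = b \<otimes> a" using dot_smult_right[OF bc, of N1 xg s] X_carr sc s by simp
  then have "dot R N1 xg ?v \<in> mp (2 + 2)" using ab mp_zero by simp
  then obtain w where w: "w \<in> vin R (mp (2 - 1)) N2" "\<And>q. q < N1 \<Longrightarrow> ?v q \<ominus> D2 w q \<in> mp (2 + 1)"
    using quadratic[OF _ v] by auto
  have wv: "w \<in> vecs R N2" using vin_carr[OF w(1)] .
  have D2c: "D2 u q \<in> carrier R" if "u \<in> vecs R N2" for u q using vecs_carr[of "D2 u" N1] D2.f_closed[of u] that by simp
  have "w \<in> {u \<in> vecs R N2. \<Phi> (D2 u)}" (is "w \<in> ?P")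
  proof (rule vec_induct[OF wv])
    have "dot R N1 xg (\<lambda>_. \<zero>) \<in> mp 3" by (rule dot_ideal[OF mp_ideal]) (use X_carr mp_zero in auto)
    then show "zero_vec R \<in> ?P" using D2.f_zero ac
      by (auto simp: \<Phi>_def zero_vecs[unfolded zero_vec_def] zero_vec_def intro!: exI[of _ "\<lambda>_. \<zero>"])
    show "(\<lambda>j. p j \<oplus> t j) \<in> ?P" if pt: "p \<in> ?P" "t \<in> ?P" for p t
    proof -
      obtain Z where Z: "\<And>q. Z q \<in> carrier R" "\<And>q. q < N1 \<Longrightarrow> D2 p q = Z q \<otimes> a" "dot R N1 xg Z \<in> mp 3"
        using pt(1) unfolding \<Phi>_def by blast
      obtain Z' where Z': "\<And>q. Z' q \<in> carrier R" "\<And>q. q < N1 \<Longrightarrow> D2 t q = Z' q \<otimes> a" "dot R N1 xg Z' \<in> mp 3"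
        using pt(2) unfolding \<Phi>_def by blast
      have "D2 (\<lambda>j. p j \<oplus> t j) = (\<lambda>j. D2 p j \<oplus> D2 t j)" using D2.f_add[of p t] pt by simp
      then have "D2 (\<lambda>j. p j \<oplus> t j) q = (Z q \<oplus> Z' q) \<otimes> a" if "q < N1" for q
        using Z(1,2)[of q] Z'(1,2)[of q] that ac by (simp add: l_distr)
      moreover have "dot R N1 xg (\<lambda>q. Z q \<oplus> Z' q) \<in> mp 3"
        using dot_add_right[of N1 xg Z Z'] X_carr Z(1) Z'(1) mp_add[OF Z(3) Z'(3)] by simp
      ultimately have "\<Phi> (D2 (\<lambda>j. p j \<oplus> t j))" unfolding \<Phi>_def
        by (intro exI[of _ "\<lambda>q. Z q \<oplus> Z' q"]) (use Z(1) Z'(1) in auto)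
      then show ?thesis using pt D2.M.M.a_closed[of p t] by auto
    qed
    show "ev R k (w k) \<in> ?P" if k: "k < N2" for k
    proof -
      have "w k \<in> mp (2 - 1)" by (rule vin_mem[OF mp_ideal w(1)])
      then have wk: "w k \<in> mx" "w k \<in> carrier R" using mp_1 mx_carr by auto
      have e1: "ev R k \<one> \<in> vecs R N2" using ev_vecs[OF k one_closed] .
      have "ev R k (w k) = w k \<odot>\<^bsub>fm N2\<^esub> ev R k \<one>" using wk by (auto simp: ev_def)
      then have "D2 (ev R k (w k)) = (\<lambda>j. w k \<otimes> D2 (ev R k \<one>) j)"
        using D2.f_smult[OF wk(2), of "ev R k \<one>"] e1 by simp
      then show ?thesis using syz[OF wk(1) D2_mx[OF e1] D2_syz[OF e1]] ev_vecs[OF k wk(2)] by simp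
    qed
  qed
  then obtain Z where Z: "\<And>q. Z q \<in> carrier R" "\<And>q. q < N1 \<Longrightarrow> D2 w q = Z q \<otimes> a" "dot R N1 xg Z \<in> mp 3"
    unfolding \<Phi>_def by blast
  have w3: "?v q \<ominus> D2 w q \<in> mp 3" if "q < N1" for q using w(2)[OF that] by (simp add: numeral_3_eq_3 numeral_2_eq_2)
  have "\<exists>z\<in>mp 2. q < N1 \<longrightarrow> ?v q \<ominus> D2 w q = z \<otimes> a" for q
    using mp3[OF w3, of q] mp_zero[of 2] by (cases "q < N1") auto
  then have "\<exists>Z'. \<forall>q. Z' q \<in> mp 2 \<and> (q < N1 \<longrightarrow> ?v q \<ominus> D2 w q = Z' q \<otimes> a)" by (intro choice) blast
  then obtain Z' where Z': "\<And>q. Z' q \<in> mp 2" "\<And>q. q < N1 \<Longrightarrow> ?v q \<ominus> D2 w q = Z' q \<otimes> a" by blast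
  have Z'c: "Z' q \<in> carrier R" for q using Z'(1) mp_carr by blast
  obtain h where h: "h \<in> mx" "b = h \<otimes> a" using mp2[OF b(1)] by blast
  have hc: "h \<in> carrier R" using h mx_carr by blast
  \<comment> \<open>The difference of two quotients by a of the same vector, hence annihilated by a
    and in m^2.\<close>
  define E where "E q = h \<otimes> s q \<ominus> (Z q \<oplus> Z' q)" for q
  have Ec: "E q \<in> carrier R" for q unfolding E_def using hc sc Z(1) Z'c by simp
  have Em: "E q \<in> mp 2" if q: "q < N1" for q
  proof (rule bm2[OF Ec])
    have "?v q = Z' q \<otimes> a \<oplus> Z q \<otimes> a"
    proof -
      have "(?v q \<ominus> D2 w q) \<oplus> D2 w q = ?v q" using bc sc[of q] D2c[OF wv, of q] by algebra
      then show ?thesis using Z'(2)[OF q] Z(2)[OF q] by simp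
    qed
    then have eq: "h \<otimes> a \<otimes> s q = Z' q \<otimes> a \<oplus> Z q \<otimes> a" using h by simp
    have "E q \<otimes> a = h \<otimes> a \<otimes> s q \<ominus> (Z' q \<otimes> a \<oplus> Z q \<otimes> a)"
      unfolding E_def using hc sc[of q] Z(1)[of q] Z'c[of q] ac by algebra
    also have "\<dots> = \<zero>" unfolding eq using Z(1)[of q] Z'c[of q] ac by (simp add: a_minus_def r_neg)
    finally show "E q \<otimes> a = \<zero>" .
  qed
  have in3: "dot R N1 xg u \<in> mp 3" if u: "\<And>q. q < N1 \<Longrightarrow> u q \<in> mp 2" for u
    unfolding dot_def by (rule finsum_in_ideal[OF mp_ideal])
      (use mx_mult[OF X_mx u] in \<open>auto simp: numeral_3_eq_3\<close>)
  have "h \<otimes> a = dot R N1 xg (\<lambda>q. h \<otimes> s q)" using dot_smult_right[OF hc, of N1 xg s] X_carr sc s by simp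
  also have "\<dots> = dot R N1 xg (\<lambda>q. E q \<oplus> (Z q \<oplus> Z' q))"
  proof (rule dot_cong)
    fix q assume q: "q < N1"
    have "E q \<oplus> (Z q \<oplus> Z' q) = h \<otimes> s q" unfolding E_def using hc sc[of q] Z(1)[of q] Z'c[of q] by algebra
    then show "xg q \<otimes> (h \<otimes> s q) = xg q \<otimes> (E q \<oplus> (Z q \<oplus> Z' q))" by simp
    show "xg q \<otimes> (E q \<oplus> (Z q \<oplus> Z' q)) \<in> carrier R" using X_carr[OF q] Ec Z(1) Z'c by simp
  qed
  also have "\<dots> = dot R N1 xg E \<oplus> (dot R N1 xg Z \<oplus> dot R N1 xg Z')"
    using dot_add_right[of N1 xg E "\<lambda>q. Z q \<oplus> Z' q"] dot_add_right[of N1 xg Z Z'] X_carr Ec Z(1) Z'c by simp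
  also have "\<dots> \<in> mp 3" by (intro mp_add in3 Em Z(3) Z'(1))
  finally show False using b h by simp
qed

end

section \<open>Exclusion of small e and of large socles\<close>

context koszul_gens
begin

lemma e_pos: "e \<ge> 1"
proof (rule ccontr)
  assume "\<not> e \<ge> 1"
  then have e0: "e = 0" by simp
  have "mp 2 = mx" using S.slen_eq_0[OF mp_smod mx_smod mp2_mx] ln_mp e0 by simp
  moreover have "mp 3 = mp 2" using S.slen_eq_0[OF mp_smod mp_smod mp_antimono[of 2 3]] ln_mp e0 by simp
  ultimately have "mp 4 = mp 3" by (simp add: numeral_eq_Suc)
  then show False using mp4 mp3_ne by simp
qed

lemma scov_dec:
  assumes cov: "scov R slf B C" and x: "x \<in> C" "x \<notin> B" and u: "u \<in> C"
  shows "\<exists>r\<in>carrier R. \<exists>y\<in>B. u = r \<otimes> x \<oplus> y"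
proof -
  have BC: "smod R slf B" "smod R slf C" using cov by (auto simp: S.lat.covers_def)
  have "u \<in> msum slf B {r \<odot>\<^bsub>slf\<^esub> x | r. r \<in> carrier R}" using scov_msum[OF module_self cov x] u by simp
  then obtain y r where "y \<in> B" "r \<in> carrier R" "u = y \<oplus> r \<otimes> x" by (auto simp: msum_def)
  then show ?thesis using a_comm[of y "r \<otimes> x"] smod_carr[OF BC(1)] smod_carr[OF BC(2) x(1)] by auto
qed

text \<open>For e = 1 the powers of m are spanned by powers of one element x, and x^3 is not zero.
  The associated graded ring is k[x]/(x^4), whose relation has degree 4.\<close>

lemma e_ne_1: "e \<noteq> 1"
proof
  assume e1: "e = 1"
  have cov: "scov R slf (mp 2) mx" by (rule S.slen_1_cov[OF mp_smod mx_smod mp2_mx]) (use ln_mp e1 in simp)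
  then obtain x where x: "x \<in> mx" "x \<notin> mp 2" by (auto simp: S.lat.covers_def)
  have xc: "x \<in> carrier R" using x mx_carr by blast
  have dec: "\<exists>r\<in>carrier R. \<exists>y\<in>mp 2. u = r \<otimes> x \<oplus> y" if "u \<in> mx" for u by (rule scov_dec[OF cov x that])
  have xpow: "x [^] n \<in> mp n" for n :: nat
  proof (induction n)
    case (Suc n)
    have "x \<otimes> x [^] n \<in> mp (Suc n)" using mx_mult[OF x(1) Suc] .
    then show ?case using xc by (simp add: m_comm)
  qed (use xc in simp)
  have K: "mp n \<subseteq> msum slf (PIdl (x [^] n)) (mp (Suc n))" for n
  proof (induction n)
    case 0
    have "z \<in> PIdl (x [^] (0::nat))" if "z \<in> carrier R" for z using that by (auto simp: PIdl_mul)
    moreover have "PIdl (x [^] (0::nat)) \<subseteq> msum slf (PIdl (x [^] (0::nat))) (mp (Suc 0))"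
      by (rule S.msum_ub1[OF PIdl_smod mp_smod]) (use xc in simp)
    ultimately show ?case by auto
  next
    case (Suc n)
    have xn: "x [^] n \<in> carrier R" "x [^] Suc n \<in> carrier R" using xc by auto
    show ?case
    proof (rule mp_Suc_subset)
      show "ideal (msum slf (PIdl (x [^] Suc n)) (mp (Suc (Suc n)))) R"
        using S.smod_msum[OF PIdl_smod[OF xn(2)] mp_smod] smod_self_iff by blast
      fix u v assume u: "u \<in> mx" and v: "v \<in> mp n"
      obtain r y where ry: "r \<in> carrier R" "y \<in> mp 2" "u = r \<otimes> x \<oplus> y" using dec[OF u] by blast
      obtain t z where tz: "t \<in> carrier R" "z \<in> mp (Suc n)" "v = t \<otimes> x [^] n \<oplus> z"
        using Suc v by (auto simp: msum_def PIdl_mul)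
      have c: "y \<in> carrier R" "z \<in> carrier R" "v \<in> carrier R"
        using mp_carr[OF ry(2)] mp_carr[OF tz(2)] mp_carr[OF v] by auto
      have "u \<otimes> v = (r \<otimes> t) \<otimes> x [^] Suc n \<oplus> (r \<otimes> (x \<otimes> z) \<oplus> y \<otimes> v)"
        unfolding ry(3) using tz(3) ry(1) tz(1) c xc xn by (simp add: l_distr r_distr m_ac a_ac)
      moreover have "(r \<otimes> t) \<otimes> x [^] Suc n \<in> PIdl (x [^] Suc n)" using ry tz by (auto simp: PIdl_mul)
      moreover have "r \<otimes> (x \<otimes> z) \<oplus> y \<otimes> v \<in> mp (Suc (Suc n))"
      proof (rule mp_add)
        show "r \<otimes> (x \<otimes> z) \<in> mp (Suc (Suc n))" by (rule mp_smult[OF ry(1) mx_mult[OF x(1) tz(2)]])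
        show "y \<otimes> v \<in> mp (Suc (Suc n))" using mp_mult[OF ry(2) v] by simp
      qed
      ultimately show "u \<otimes> v \<in> msum slf (PIdl (x [^] Suc n)) (mp (Suc (Suc n)))"
        using msumI[of "(r \<otimes> t) \<otimes> x [^] Suc n" "PIdl (x [^] Suc n)" "r \<otimes> (x \<otimes> z) \<oplus> y \<otimes> v" "mp (Suc (Suc n))" slf] by simp
    qed
  qed
  have x3: "x [^] (3::nat) \<noteq> \<zero>"
  proof
    assume z: "x [^] (3::nat) = \<zero>"
    have "mp 3 \<subseteq> {\<zero>}"
    proof
      fix u assume "u \<in> mp 3"
      then obtain r t where "r \<in> carrier R" "t \<in> mp 4" "u = r \<otimes> x [^] (3::nat) \<oplus> t"
        using K[of 3] by (auto simp: msum_def PIdl_mul numeral_eq_Suc simp del: ideal_power.simps)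
      then show "u \<in> {\<zero>}" using z mp4 by simp
    qed
    then show False using mp3_ne mp_zero[of 3] by blast
  qed
  show False
  proof (rule not_monomial[of "mp 2" "{\<zero>}" x 3 \<zero> \<zero>])
    show "mp (3 + 1) \<subseteq> {\<zero>}" using mp4 by (simp add: numeral_eq_Suc)
    show "w \<otimes> y \<in> {\<zero>}" if "w \<in> mp (3 - 1)" "y \<in> mp 2" for w y
      using mp_mult[OF that] mp_ge4[of 4] by simp
    have "x \<otimes> x [^] (3::nat) \<in> mp 4" using mx_mult[OF x(1) xpow[of 3]] by (simp add: numeral_eq_Suc)
    then have "x \<otimes> x [^] (3::nat) = \<zero>" using mp4 by simp
    then show "x \<otimes> x [^] (3::nat) \<ominus> \<zero> \<otimes> \<zero> \<in> mp (3 + 2)" using mp_zero by (simp add: a_minus_def)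
  qed (use x x3 mp_ideal zeroideal mp2_mx dec mp_zero in auto)
qed

text \<open>With b in m^2 and e at least 2, the length bounds force e = 2, with aR of length 4 and
  bR of length 2. Hence \<open>xa\<close> is 0, so that m^2 = a m, and one further element y
  generates m together with a.\<close>

lemma binary_case:
  assumes ep: "exact_pair R mx e a b" and b2: "b \<in> mp 2" and e2: "e \<ge> 2"
  shows False
proof -
  interpret exact_pair R mx e a b by fact
  have e: "e = 2" using exact_pair.e_le_2[OF swap b2] e2 by simp
  have lb: "ln {\<zero>} (PIdl b) \<le> 2" using exact_pair.ln_Pa_le2[OF swap b2] .
  then have la: "ln {\<zero>} (PIdl a) = 4" "ln {\<zero>} (PIdl b) = 2" using ln_sum ln_Pa_le e by auto
  have a2: "a \<notin> mp 2" using ln_Pa_le2 la by auto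
  have "xa = 0" using ln_Pa_carrier[OF a2] ln_Pb la e by simp
  then have m2: "mp 2 = (\<lambda>x. x \<otimes> a) ` mx" using xa_0_mp2[OF a2 xa_0] by blast
  have "ln (PIdl a) mx = 1" using ln_Pa_mx[OF a2] \<open>xa = 0\<close> e by simp
  then have cov: "scov R slf (PIdl a) mx" by (intro S.slen_1_cov[OF Pa mx_smod PIdl_a_mx])
  then obtain y where y: "y \<in> mx" "y \<notin> PIdl a" by (auto simp: S.lat.covers_def)
  show False
  proof (rule not_binary[of a y b])
    show "b \<notin> mp 3"
    proof
      assume b3: "b \<in> mp 3"
      have "PIdl b \<subseteq> mp 3" using mp_smult[OF _ b3] by (auto simp: PIdl_mul)
      then have "ln {\<zero>} (PIdl b) \<le> ln {\<zero>} (mp 3)"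
        by (intro S.slen_mono smod0 Pb mp_smod) (use smod_zero[OF Pb] in auto)
      then show False using la ln_mp by simp
    qed
    show "b \<otimes> a = \<zero>" using ab0 m_comm[OF a_carr b_carr] by simp
    show "\<exists>r\<in>carrier R. z = r \<otimes> b" if "z \<in> carrier R" "z \<otimes> a = \<zero>" for z
      using ann_a[OF that(1)] that(2) by (auto simp: PIdl_mul)
    show "\<exists>r\<in>carrier R. \<exists>s\<in>carrier R. u = r \<otimes> a \<oplus> s \<otimes> y" if u: "u \<in> mx" for u
    proof -
      obtain s z where sz: "s \<in> carrier R" "z \<in> PIdl a" "u = s \<otimes> y \<oplus> z" using scov_dec[OF cov y u] by blast
      then obtain r where r: "r \<in> carrier R" "z = r \<otimes> a" by (auto simp: PIdl_mul)
      have "u = r \<otimes> a \<oplus> s \<otimes> y" using sz r a_comm mx_carr[OF y(1)] a_carr by simp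
      then show ?thesis using r sz by blast
    qed
    show "\<exists>u\<in>mx. z = u \<otimes> a" if "z \<in> mp 2" for z using that m2 by blast
  qed (use a_mx y b2 in auto)
qed

text \<open>If the bound fails, \<open>Y\<close> has colength at most 1 in m. Colength 0 would mean
  that m^2 lies in aR, so m = xR + Y for some x. Then x^2 is not in aR, since otherwise x m would
  be, and x^3 is in m^3 = a m^2. This gives a cubic relation x^3 = a c to which
  \<open>not_monomial\<close> applies.\<close>

lemma socle_bound:
  assumes ep: "exact_pair R mx e a b"
  shows "e \<ge> ln {\<zero>} (annihilator R mx) + 2"
proof (rule ccontr)
  interpret exact_pair R mx e a b by fact
  assume neg: "\<not> e \<ge> ln {\<zero>} (annihilator R mx) + 2"
  have e2: "e \<ge> 2" using e_pos e_ne_1 by simp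
  have ab: "a \<notin> mp 2" "b \<notin> mp 2" using binary_case[OF ep _ e2] binary_case[OF swap _ e2] by blast+
  have "ln Y mx \<le> 1" using ln_Y[OF ab] e2 neg unfolding soc_def by simp
  have Ymx: "Y \<subseteq> mx" unfolding Y_def by blast
  have "Y \<noteq> mx"
  proof
    assume "Y = mx"
    then have "mp (Suc 1) \<subseteq> PIdl a"
      by (intro mp_Suc_subset cgenideal_ideal a_carr) (use mp_1 in \<open>auto simp: Y_def\<close>)
    then have "msum slf (PIdl a) (mp 2) = PIdl a"
      using S.msum_least[OF Pa, of "PIdl a" "mp 2"] S.msum_ub1[OF Pa mp_smod[of 2]] by (simp add: numeral_2_eq_2)
    then have "xa = 0" using S.lat.len_refl[of "PIdl a"] Pa by simp
    then show False using xa_1[OF ab] by simp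
  qed
  then have "ln Y mx = 1" using S.slen_eq_0[OF Y_smod mx_smod Ymx] \<open>ln Y mx \<le> 1\<close> by simp
  then have cov: "scov R slf Y mx" by (intro S.slen_1_cov[OF Y_smod mx_smod Ymx])
  then obtain x where x: "x \<in> mx" "x \<notin> Y" using \<open>Y \<noteq> mx\<close> Ymx by blast
  have xc: "x \<in> carrier R" using x mx_carr by blast
  have dec: "\<exists>r\<in>carrier R. \<exists>y\<in>Y. u = r \<otimes> x \<oplus> y" if "u \<in> mx" for u by (rule scov_dec[OF cov x that])
  have YP: "w \<otimes> y \<in> PIdl a" if "w \<in> mx" "y \<in> Y" for w y
    using that m_comm[OF mx_carr[OF that(1)] Y_carr[OF that(2)]] unfolding Y_def by auto
  have x2: "x [^] (2::nat) = x \<otimes> x" using xc by (simp add: numeral_2_eq_2)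
  have "x \<otimes> x \<notin> PIdl a"
  proof
    assume xx: "x \<otimes> x \<in> PIdl a"
    have "x \<otimes> v \<in> PIdl a" if v: "v \<in> mx" for v
    proof -
      obtain r y where ry: "r \<in> carrier R" "y \<in> Y" "v = r \<otimes> x \<oplus> y" using dec[OF v] by blast
      have "x \<otimes> v = r \<otimes> (x \<otimes> x) \<oplus> x \<otimes> y" using ry xc Y_carr[OF ry(2)] by (simp add: r_distr m_lcomm)
      then show ?thesis using smod_add[OF Pa] smod_smult[OF Pa ry(1) xx] YP[OF x(1) ry(2)] by simp
    qed
    then show False using x unfolding Y_def by blast
  qed
  have xx2: "x \<otimes> x \<in> mp 2" using mp_mult[of x 1 x 1] x mp_1 by (simp add: numeral_2_eq_2)
  have "x \<otimes> (x \<otimes> x) \<in> mp 3" using mx_mult[OF x(1) xx2] by (simp add: numeral_3_eq_3)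
  then obtain c where c: "c \<in> mp 2" "x \<otimes> (x \<otimes> x) = c \<otimes> a" using am2[OF ab] by blast
  show False
  proof (rule not_monomial[of Y "PIdl a" x 2 a c])
    show "ideal Y R" using Y_smod smod_self_iff by simp
    show "mp (2 + 1) \<subseteq> PIdl a" using mp3_soc soc_Pa by (simp add: numeral_3_eq_3 numeral_2_eq_2)
    show "w \<otimes> y \<in> PIdl a" if "w \<in> mp (2 - 1)" "y \<in> Y" for w y using YP that mp_1 by simp
    have "x \<otimes> x [^] (2::nat) = a \<otimes> c" using c x2 m_comm[OF a_carr mp_carr[OF c(1)]] by simp
    then show "x \<otimes> x [^] (2::nat) \<ominus> a \<otimes> c \<in> mp (2 + 2)"
      using mp_zero mp_carr[OF c(1)] a_carr by (simp add: a_minus_def r_neg)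
    show "a \<in> Y" using Pa_Y cgenideal_self[OF a_carr] by blast
  qed (use x x2 \<open>x \<otimes> x \<notin> PIdl a\<close> Ymx cgenideal_ideal[OF a_carr] dec c in auto)
qed

end

section \<open>Two-periodic arrays\<close>

declare ideal_power.simps(2) [simp del]

text \<open>The pair c, c' plays modulo aR a role similar to that of a, a' in R, but only in low
  degrees: its product vanishes modulo aR, each of its elements is independent of a modulo m^2, and
  each generates m^2 together with a. The coefficient \<open>l\<close> records the failure of c c'
  to vanish in R itself.\<close>

locale orthogonal_data = short_ring +
  fixes a a' c c' l
  assumes mem: "a \<in> mx" "a' \<in> mx" "c \<in> mx" "c' \<in> mx" "l \<in> mx"
    and aa': "a \<otimes> a' = \<zero>"
    and ann1: "x \<in> carrier R \<Longrightarrow> x \<otimes> a = \<zero> \<Longrightarrow> \<exists>u\<in>carrier R. x = u \<otimes> a'"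
    and ann2: "x \<in> carrier R \<Longrightarrow> x \<otimes> a' = \<zero> \<Longrightarrow> \<exists>u\<in>carrier R. x = u \<otimes> a"
    and a_mp2: "r \<in> carrier R \<Longrightarrow> r \<otimes> a \<in> mp 2 \<Longrightarrow> r \<in> mx"
    and a'_mp2: "r \<in> carrier R \<Longrightarrow> r \<otimes> a' \<in> mp 2 \<Longrightarrow> r \<in> mx"
    and ac_mp2: "r \<in> carrier R \<Longrightarrow> t \<in> carrier R \<Longrightarrow> r \<otimes> a \<oplus> t \<otimes> c \<in> mp 2 \<Longrightarrow> r \<in> mx \<and> t \<in> mx"
    and ac'_mp2: "r \<in> carrier R \<Longrightarrow> t \<in> carrier R \<Longrightarrow> r \<otimes> a \<oplus> t \<otimes> c' \<in> mp 2 \<Longrightarrow> r \<in> mx \<and> t \<in> mx"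
    and gen: "z \<in> mp 2 \<Longrightarrow> \<exists>u\<in>mx. \<exists>v\<in>mx. z = u \<otimes> c \<oplus> v \<otimes> a"
    and gen': "z \<in> mp 2 \<Longrightarrow> \<exists>u\<in>mx. \<exists>v\<in>mx. z = u \<otimes> c' \<oplus> v \<otimes> a"
    and cc': "c \<otimes> c' = l \<otimes> a"
begin

lemma carr: "a \<in> carrier R" "a' \<in> carrier R" "c \<in> carrier R" "c' \<in> carrier R" "l \<in> carrier R"
  using mem mx_carr by auto

text \<open>The coefficient of the differential that leaves second index j; likewise
  \<open>ce\<close> for the first index.\<close>

definition al :: "nat \<Rightarrow> 'a" where "al j = (if odd j then a else a')"

definition ce :: "nat \<Rightarrow> 'a" where "ce i = (if odd i then c else c')"

text \<open>The sign depending on the parity of j makes the two directions anticommute.\<close>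

definition ga :: "nat \<Rightarrow> nat \<Rightarrow> 'a" where "ga i j = (if even j then ce i else \<ominus> ce i)"

text \<open>An array \<open>g\<close> is an element of the algebra that Tate's construction obtains from \<open>R\<close> by adjoining exterior
  variables \<open>x, y\<close> with boundaries \<open>a, c\<close> and divided power variables \<open>z, w\<close> with boundaries \<open>a' x\<close> and
  \<open>c' y - l x\<close>: odd and even first indices \<open>i\<close> stand for the divided powers of \<open>w\<close> with and without the factor \<open>y\<close>,
  second indices \<open>j\<close> likewise for \<open>z\<close> and \<open>x\<close>. Then \<open>Dl\<close> is the differential.\<close>

definition Dl :: "(nat \<Rightarrow> nat \<Rightarrow> nat \<Rightarrow> 'a) \<Rightarrow> nat \<Rightarrow> nat \<Rightarrow> nat \<Rightarrow> 'a" where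
  "Dl g i j = (\<lambda>t. al (Suc j) \<otimes> g i (Suc j) t \<oplus>
     (ga (Suc i) j \<otimes> g (Suc i) j t \<oplus> (if odd j then \<ominus> l \<otimes> g (i + 2) (j - 1) t else \<zero>)))"

lemma al_mx: "al j \<in> mx" and al_carr: "al j \<in> carrier R"
  using mem carr by (auto simp: al_def)

lemma ce_mx: "ce i \<in> mx" and ce_carr: "ce i \<in> carrier R"
  using mem carr by (auto simp: ce_def)

lemma mx_neg: "x \<in> mx \<Longrightarrow> \<ominus> x \<in> mx"
  using additive_subgroup.a_inv_closed[OF ideal.axioms(1)[OF mx_ideal]] .

lemma ga_mx: "ga i j \<in> mx" and ga_carr: "ga i j \<in> carrier R"
  using ce_mx[of i] mx_neg ce_carr[of i] by (auto simp: ga_def)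

lemma ce_ce: "ce i \<otimes> ce (Suc i) = l \<otimes> a"
  using cc' m_comm carr by (auto simp: ce_def)

lemma ann_al: "x \<in> carrier R \<Longrightarrow> x \<otimes> al j = \<zero> \<Longrightarrow> \<exists>u\<in>carrier R. x = u \<otimes> al (Suc j)"
  using ann1 ann2 by (auto simp: al_def)

lemma al_mp2: "r \<in> carrier R \<Longrightarrow> r \<otimes> al j \<in> mp 2 \<Longrightarrow> r \<in> mx"
  using a_mp2 a'_mp2 by (auto simp: al_def split: if_splits)

lemma gen_ce: "z \<in> mp 2 \<Longrightarrow> \<exists>u\<in>mx. \<exists>v\<in>mx. z = u \<otimes> ce i \<oplus> v \<otimes> a"
  using gen gen' by (auto simp: ce_def)

lemma Dl_cong: "(\<And>p q. p + q = Suc (i + j) \<Longrightarrow> g p q = h p q) \<Longrightarrow> Dl g i j = Dl h i j"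
  unfolding Dl_def by (auto simp: fun_eq_iff)

lemma Dl_mem:
  assumes V: "smod R (fm n) V" and g: "\<And>p q. p + q = Suc (i + j) \<Longrightarrow> g p q \<in> V"
  shows "Dl g i j \<in> V"
proof -
  interpret M: module R "fm n" by (rule module_fm)
  have 3: "(\<lambda>t. if odd j then \<ominus> l \<otimes> g (i + 2) (j - 1) t else \<zero>) \<in> V"
  proof (cases "odd j")
    case True
    then have "g (i + 2) (j - 1) \<in> V" by (intro g) (auto elim: oddE)
    then show ?thesis using smod_smult[OF V, of "\<ominus> l"] carr True by simp
  next
    case False
    then show ?thesis using smod_zero[OF V] by (simp add: zero_vec_def)
  qed
  have 1: "(\<lambda>t. al (Suc j) \<otimes> g i (Suc j) t) \<in> V" using smod_smult[OF V al_carr g[of i "Suc j"]] by simp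
  have 2: "(\<lambda>t. ga (Suc i) j \<otimes> g (Suc i) j t) \<in> V" using smod_smult[OF V ga_carr g[of "Suc i" j]] by simp
  show ?thesis using smod_add[OF V 1] smod_add[OF V 2 3] by (simp add: Dl_def)
qed

lemma Dl_mp:
  assumes g: "\<And>p q. p + q = Suc (i + j) \<Longrightarrow> g p q \<in> vin R (mp k) n"
  shows "Dl g i j \<in> vin R (mp (Suc k)) n"
proof -
  have v: "Dl g i j \<in> vecs R n"
    using Dl_mem[OF vin_smod[OF mp_ideal], of i j g k n] g vin_carr by blast
  have "Dl g i j t \<in> mp (Suc k)" for t
  proof -
    have gm: "g p q t \<in> mp k" if "p + q = Suc (i + j)" for p q using vin_mem[OF mp_ideal g[OF that]] .
    have 3: "(if odd j then \<ominus> l \<otimes> g (i + 2) (j - 1) t else \<zero>) \<in> mp (Suc k)"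
    proof (cases "odd j")
      case True
      then have "g (i + 2) (j - 1) t \<in> mp k" by (intro gm) (auto elim: oddE)
      then show ?thesis using mx_mult[OF mx_neg[OF mem(5)]] True by simp
    qed (use mp_zero in simp)
    show ?thesis unfolding Dl_def using mx_mult[OF al_mx gm[of i "Suc j"]] mx_mult[OF ga_mx gm[of "Suc i" j]] 3 by (intro mp_add) auto
  qed
  then show ?thesis using v unfolding vin_def by blast
qed

lemma Dl_vecs: "(\<And>p q. p + q = Suc (i + j) \<Longrightarrow> g p q \<in> vecs R n) \<Longrightarrow> Dl g i j \<in> vecs R n"
  using Dl_mem[of n "vecs R n" i j g] module.smod_carrier[OF module_fm, of n] by simp

lemma Dl_add:
  assumes g: "\<And>p q. p + q = Suc (i + j) \<Longrightarrow> g p q \<in> vecs R n" and h: "\<And>p q. p + q = Suc (i + j) \<Longrightarrow> h p q \<in> vecs R n"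
  shows "Dl (\<lambda>i j t. g i j t \<oplus> h i j t) i j = (\<lambda>t. Dl g i j t \<oplus> Dl h i j t)"
proof
  fix t
  have gc: "g p q t \<in> carrier R" and hc: "h p q t \<in> carrier R" if "p + q = Suc (i + j)" for p q
    using g[OF that] h[OF that] vecs_carr by auto
  have c1: "g i (Suc j) t \<in> carrier R" "h i (Suc j) t \<in> carrier R" "g (Suc i) j t \<in> carrier R" "h (Suc i) j t \<in> carrier R"
    using gc hc by auto
  show "Dl (\<lambda>i j t. g i j t \<oplus> h i j t) i j t = Dl g i j t \<oplus> Dl h i j t"
  proof (cases "odd j")
    case True
    then have c2: "g (i + 2) (j - 1) t \<in> carrier R" "h (i + 2) (j - 1) t \<in> carrier R"
      using gc[of "i + 2" "j - 1"] hc[of "i + 2" "j - 1"] by (auto elim: oddE)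
    show ?thesis unfolding Dl_def using True c1 c2 al_carr[of "Suc j"] ga_carr[of "Suc i" j] carr(5)
      by (simp add: r_distr a_ac)
  next
    case False
    then show ?thesis unfolding Dl_def using c1 al_carr[of "Suc j"] ga_carr[of "Suc i" j]
      by (simp add: r_distr a_ac)
  qed
qed

lemma Dl_smult:
  assumes g: "\<And>p q. p + q = Suc (i + j) \<Longrightarrow> g p q \<in> vecs R n" and r: "r \<in> carrier R"
  shows "Dl (\<lambda>i j t. r \<otimes> g i j t) i j = (\<lambda>t. r \<otimes> Dl g i j t)"
proof
  fix t
  have gc: "g p q t \<in> carrier R" if "p + q = Suc (i + j)" for p q
    using g[OF that] vecs_carr by auto
  have c1: "g i (Suc j) t \<in> carrier R" "g (Suc i) j t \<in> carrier R" using gc by auto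
  show "Dl (\<lambda>i j t. r \<otimes> g i j t) i j t = r \<otimes> Dl g i j t"
  proof (cases "odd j")
    case True
    then have c2: "g (i + 2) (j - 1) t \<in> carrier R" using gc[of "i + 2" "j - 1"] by (auto elim: oddE)
    show ?thesis unfolding Dl_def using True c1 c2 al_carr[of "Suc j"] ga_carr[of "Suc i" j] carr(5) r
      by (simp add: r_distr m_lcomm)
  next
    case False
    then show ?thesis unfolding Dl_def using c1 al_carr[of "Suc j"] ga_carr[of "Suc i" j] r
      by (simp add: r_distr m_lcomm)
  qed
qed

lemma linear_Dl:
  assumes f: "linear_map R (fm n) (fm n') f" and g: "\<And>p q. p + q = Suc (i + j) \<Longrightarrow> g p q \<in> vecs R n"
  shows "f (Dl g i j) = Dl (\<lambda>p q. f (g p q)) i j"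
proof -
  interpret two_modules R "fm n" "fm n'" f by (intro two_modules.intro module_fm two_modules_axioms.intro f)
  have add: "f (\<lambda>t. u t \<oplus> v t) = (\<lambda>t. f u t \<oplus> f v t)" if "u \<in> vecs R n" "v \<in> vecs R n" for u v
    using f_add[of u v] that by simp
  have sm: "f (\<lambda>t. r \<otimes> u t) = (\<lambda>t. r \<otimes> f u t)" if "r \<in> carrier R" "u \<in> vecs R n" for r u
    using f_smult[of r u] that by simp
  have sc: "(\<lambda>t. r \<otimes> u t) \<in> vecs R n" if "r \<in> carrier R" "u \<in> vecs R n" for r u
    using M.smult_closed[of r u] that by simp
  have ad: "(\<lambda>t. u t \<oplus> v t) \<in> vecs R n" if "u \<in> vecs R n" "v \<in> vecs R n" for u v
    using M.M.a_closed[of u v] that by simp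
  have g1: "g i (Suc j) \<in> vecs R n" "g (Suc i) j \<in> vecs R n" using g by auto
  let ?w = "\<lambda>t. if odd j then \<ominus> l \<otimes> g (i + 2) (j - 1) t else \<zero>"
  have w: "?w \<in> vecs R n \<and> f ?w = (\<lambda>t. if odd j then \<ominus> l \<otimes> f (g (i + 2) (j - 1)) t else \<zero>)"
  proof (cases "odd j")
    case True
    then have "g (i + 2) (j - 1) \<in> vecs R n" by (intro g) (auto elim: oddE)
    then show ?thesis using True sm[of "\<ominus> l"] sc[of "\<ominus> l"] carr by simp
  next
    case False
    then show ?thesis using f_zero zero_vecs by (simp add: zero_vec_def)
  qed
  have s1: "(\<lambda>t. al (Suc j) \<otimes> g i (Suc j) t) \<in> vecs R n" "(\<lambda>t. ga (Suc i) j \<otimes> g (Suc i) j t) \<in> vecs R n"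
    using sc al_carr ga_carr g1 by auto
  show ?thesis unfolding Dl_def
    using add[OF s1(1) ad[OF s1(2) conjunct1[OF w]]] add[OF s1(2) conjunct1[OF w]] conjunct2[OF w]
      sm[OF al_carr g1(1)] sm[OF ga_carr g1(2)] by simp
qed

text \<open>The square of the second direction vanishes by a a' = 0, and the mixed terms cancel by
  the sign in \<open>ga\<close>. The square of the first direction gives c c', which the term with -
  l cancels against a because c c' = l a.\<close>

lemma Dl_Dl:
  assumes g: "\<And>p q. p + q = Suc (Suc (i + j)) \<Longrightarrow> g p q \<in> vecs R n"
  shows "Dl (Dl g) i j = zero_vec R"
proof
  fix t
  have gc: "g p q t \<in> carrier R" if "p + q = Suc (Suc (i + j))" for p q using g[OF that] vecs_carr by auto
  note cr = carr al_carr[of "Suc j"] al_carr[of j] ce_carr[of "Suc i"] ce_carr[of "Suc (Suc i)"]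
  let ?A = "g i (Suc (Suc j)) t" and ?B = "g (Suc i) (Suc j) t" and ?C = "g (Suc (Suc i)) j t"
  have A: "?A \<in> carrier R" and B: "?B \<in> carrier R" and C: "?C \<in> carrier R" using gc by auto
  have cc1: "ce (Suc i) \<otimes> (ce (Suc (Suc i)) \<otimes> ?C) = l \<otimes> (a \<otimes> ?C)"
    using ce_ce[of "Suc i"] C cr by (simp flip: m_assoc)
  show "Dl (Dl g) i j t = zero_vec R t"
  proof (cases "odd j")
    case False
    have 0: "a \<otimes> (a' \<otimes> ?A) = \<zero>" using aa' A cr by (simp flip: m_assoc)
    have "Dl (Dl g) i j t = a \<otimes> (a' \<otimes> ?A \<oplus> (\<ominus> ce (Suc i) \<otimes> ?B \<oplus> \<ominus> l \<otimes> ?C)) \<oplus>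
        (ce (Suc i) \<otimes> (a \<otimes> ?B \<oplus> (ce (Suc (Suc i)) \<otimes> ?C \<oplus> \<zero>)) \<oplus> \<zero>)"
      using False by (simp add: Dl_def al_def ga_def)
    also have "\<dots> = a \<otimes> (a' \<otimes> ?A) \<oplus> (ce (Suc i) \<otimes> (ce (Suc (Suc i)) \<otimes> ?C) \<ominus> l \<otimes> (a \<otimes> ?C))"
      using A B C cr by algebra
    also have "\<dots> = \<zero>" unfolding 0 cc1 using C cr by (simp add: a_minus_def r_neg)
    finally show ?thesis by (simp add: zero_vec_def)
  next
    case True
    then obtain k where k: "j = Suc k" "even k" by (cases j) auto
    let ?E = "g (Suc (Suc (Suc i))) k t"
    have E: "?E \<in> carrier R" using gc[of "Suc (Suc (Suc i))" k] k by simp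
    have 0: "a' \<otimes> (a \<otimes> ?A) = \<zero>" using aa' A cr m_comm[of a' a] by (simp flip: m_assoc)
    have ce3: "ce (Suc (Suc (Suc i))) = ce (Suc i)" by (simp add: ce_def)
    have "Dl (Dl g) i j t = a' \<otimes> (a \<otimes> ?A \<oplus> (ce (Suc i) \<otimes> ?B \<oplus> \<zero>)) \<oplus>
        (\<ominus> ce (Suc i) \<otimes> (a' \<otimes> ?B \<oplus> (\<ominus> ce (Suc (Suc i)) \<otimes> ?C \<oplus> \<ominus> l \<otimes> ?E)) \<oplus>
         \<ominus> l \<otimes> (a \<otimes> ?C \<oplus> (ce (Suc i) \<otimes> ?E \<oplus> \<zero>)))"
      using k ce3 by (simp add: Dl_def al_def ga_def)
    also have "\<dots> = a' \<otimes> (a \<otimes> ?A) \<oplus> (ce (Suc i) \<otimes> (ce (Suc (Suc i)) \<otimes> ?C) \<ominus> l \<otimes> (a \<otimes> ?C))"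
      using A B C E cr by algebra
    also have "\<dots> = \<zero>" unfolding 0 cc1 using C cr by (simp add: a_minus_def r_neg)
    finally show ?thesis by (simp add: zero_vec_def)
  qed
qed

lemma vchoice:
  assumes I: "I \<subseteq> carrier R" and ex: "\<forall>t. \<exists>u\<in>I. P t u"
  shows "\<exists>u\<in>vin R I n. \<forall>t<n. P t (u t)"
proof -
  obtain f where f: "\<And>t. f t \<in> I \<and> P t (f t)" using ex by metis
  show ?thesis
    by (rule bexI[of _ "\<lambda>t. if t < n then f t else \<zero>"]) (use f I in \<open>auto simp: vin_def vecs_def\<close>)
qed

text \<open>A diagonal is filled in order of increasing j. At j = 0 the decomposition of m^2 by
  \<open>gen_ce\<close> supplies two entries at once. At a later position all earlier entries of z
  vanish, so the cycle condition one place before says that \<open>al J\<close> kills the current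
  entry. It is then a multiple of the next coefficient, and the quotient lies in m because the entry
  is in m^2.\<close>

lemma fill_step:
  assumes J: "J \<le> k" and z: "\<And>i j. i + j = k \<Longrightarrow> z i j \<in> vin R (mp 2) n"
    and z0: "\<And>i j. i + j = k \<Longrightarrow> j < J \<Longrightarrow> z i j = zero_vec R"
    and cyc: "\<And>i j. Suc (i + j) = k \<Longrightarrow> Dl z i j = zero_vec R"
  shows "\<exists>h. (\<forall>i j. i + j = Suc k \<longrightarrow> h i j \<in> vin R mx n) \<and> (\<forall>i j. i + j = k \<longrightarrow> j \<le> J \<longrightarrow> Dl h i j = z i j)"
proof (cases J)
  case 0
  have zk: "z k 0 \<in> vin R (mp 2) n" using z by simp
  have "\<exists>u\<in>mx. \<exists>v\<in>mx. z k 0 t = u \<otimes> ce (Suc k) \<oplus> v \<otimes> a" for t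
    by (rule gen_ce) (rule vin_mem[OF mp_ideal zk])
  then have "\<exists>p\<in>mx \<times> mx. z k 0 t = fst p \<otimes> ce (Suc k) \<oplus> snd p \<otimes> a" for t by fastforce
  then obtain p where p: "\<And>t. p t \<in> mx \<times> mx" "\<And>t. z k 0 t = fst (p t) \<otimes> ce (Suc k) \<oplus> snd (p t) \<otimes> a" by metis
  define u v where "u t = (if t < n then fst (p t) else \<zero>)" and "v t = (if t < n then snd (p t) else \<zero>)" for t
  have pm: "fst (p t) \<in> mx" "snd (p t) \<in> mx" for t using p(1)[of t] by auto
  have u: "u \<in> vin R mx n" and v: "v \<in> vin R mx n" "\<And>t. t < n \<Longrightarrow> z k 0 t = u t \<otimes> ce (Suc k) \<oplus> v t \<otimes> a"
    using pm mx_carr p(2) by (auto simp: u_def v_def vin_def vecs_def)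
  have uc: "u t \<in> carrier R" and vc: "v t \<in> carrier R" for t using u v vin_carr vecs_carr by blast+
  let ?h = "\<lambda>i j. if j = 0 then u else if j = 1 then v else zero_vec R"
  have "Dl ?h k 0 = z k 0"
  proof
    fix t
    show "Dl ?h k 0 t = z k 0 t"
    proof (cases "t < n")
      case True
      have "Dl ?h k 0 t = v t \<otimes> a \<oplus> u t \<otimes> ce (Suc k)"
        using uc vc carr ce_carr by (simp add: Dl_def al_def ga_def m_comm)
      then show ?thesis using v(2)[OF True] uc vc carr ce_carr by (simp add: a_comm)
    next
      case False
      then have "u t = \<zero>" "v t = \<zero>" "z k 0 t = \<zero>" using vecs_ge[OF vin_carr] u v zk by auto
      then show ?thesis using carr al_carr ga_carr by (simp add: Dl_def)
    qed
  qed
  then show ?thesis using u v vin_smod[OF mx_ideal] smod_zero[OF vin_smod[OF mx_ideal]] 0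
    by (intro exI[of _ ?h]) auto
next
  case (Suc J')
  let ?i = "k - J"
  have iJ: "?i + J = k" "Suc (?i + J') = k" using J Suc by auto
  have zJ: "z ?i J \<in> vin R (mp 2) n" using z iJ by simp
  have zc: "z ?i J t \<in> carrier R" for t using vecs_carr[OF vin_carr[OF zJ]] .
  have "z ?i J t \<otimes> al J = \<zero>" for t
  proof -
    have "Dl z ?i J' t = \<zero>" using cyc[OF iJ(2)] by (simp add: zero_vec_def)
    moreover have "z (Suc ?i) J' = zero_vec R" using z0[of "Suc ?i" J'] iJ Suc by simp
    moreover have "z (?i + 2) (J' - 1) = zero_vec R" if "odd J'"
      using z0[of "?i + 2" "J' - 1"] iJ Suc that by (auto elim!: oddE)
    ultimately have "al J \<otimes> z ?i J t = \<zero>"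
      using Suc zc carr al_carr ga_carr by (auto simp: Dl_def zero_vec_def split: if_splits)
    then show ?thesis using m_comm[OF al_carr zc] by simp
  qed
  then have "\<exists>u\<in>mx. z ?i J t = u \<otimes> al (Suc J)" for t
    using ann_al[OF zc] al_mp2[of _ "Suc J"] vin_mem[OF mp_ideal zJ, of t] by metis
  then have "\<exists>u\<in>vin R mx n. \<forall>t<n. z ?i J t = u t \<otimes> al (Suc J)"
    by (intro vchoice subsetI mx_carr) auto
  then obtain u where u: "u \<in> vin R mx n" "\<And>t. t < n \<Longrightarrow> z ?i J t = u t \<otimes> al (Suc J)" by blast
  have uc: "u t \<in> carrier R" for t using u vin_carr vecs_carr by blast
  let ?h = "\<lambda>i j. if j = Suc J then u else zero_vec R"
  have "Dl ?h i j = z i j" if ij: "i + j = k" "j \<le> J" for i j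
  proof (cases "j = J")
    case True
    then have i: "i = ?i" using ij by simp
    show ?thesis
    proof
      fix t
      have "Dl ?h i j t = u t \<otimes> al (Suc J)"
        using True uc al_carr ga_carr carr m_comm[OF al_carr uc] by (auto simp: Dl_def zero_vec_def)
      moreover have "\<dots> = z i j t"
      proof (cases "t < n")
        case False
        then have "u t = \<zero>" "z i j t = \<zero>" using vecs_ge[OF vin_carr] u zJ True i by auto
        then show ?thesis using al_carr by simp
      qed (use u(2) True i in simp)
      ultimately show "Dl ?h i j t = z i j t" by simp
    qed
  next
    case False
    then have "z i j = zero_vec R" using z0 ij by simp
    moreover have "Dl ?h i j = zero_vec R"
      using False ij al_carr ga_carr carr by (auto simp: Dl_def zero_vec_def fun_eq_iff)
    ultimately show ?thesis by simp
  qed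
  then show ?thesis using u smod_zero[OF vin_smod[OF mx_ideal]] by (intro exI[of _ ?h]) auto
qed

text \<open>This is the part of the exactness of the Tate complex that is used: cycles over m^2 are
  boundaries of arrays over m. What remains after each step is again a cycle over m^2, with one more
  zero at the beginning.\<close>

lemma fill:
  assumes y: "\<And>i j. i + j = k \<Longrightarrow> y i j \<in> vin R (mp 2) n"
    and cyc: "\<And>i j. Suc (i + j) = k \<Longrightarrow> Dl y i j = zero_vec R"
  shows "\<exists>h. (\<forall>i j. i + j = Suc k \<longrightarrow> h i j \<in> vin R mx n) \<and> (\<forall>i j. i + j = k \<longrightarrow> Dl h i j = y i j)"
proof -
  interpret M: module R "fm n" by (rule module_fm)
  have m2: "mx = mp 1" using mp_1 by simp
  have "\<exists>h. (\<forall>i j. i + j = Suc k \<longrightarrow> h i j \<in> vin R mx n) \<and> (\<forall>i j. i + j = k \<longrightarrow> j < J \<longrightarrow> Dl h i j = y i j)"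
    if "J \<le> Suc k" for J
    using that
  proof (induction J)
    case 0
    then show ?case using smod_zero[OF vin_smod[OF mx_ideal]] by (intro exI[of _ "\<lambda>_ _. zero_vec R"]) auto
  next
    case (Suc J)
    then obtain h where h: "\<And>i j. i + j = Suc k \<Longrightarrow> h i j \<in> vin R mx n"
      "\<And>i j. i + j = k \<Longrightarrow> j < J \<Longrightarrow> Dl h i j = y i j" by auto
    have hv: "h i j \<in> vecs R n" if "i + j = Suc k" for i j using vin_carr[OF h(1)[OF that]] .
    have Dh: "Dl h i j \<in> vin R (mp 2) n" if "i + j = k" for i j
      using Dl_mp[of i j h 1 n] h(1) that m2 by (simp add: numeral_2_eq_2)
    define z where "z = (\<lambda>i j t. y i j t \<oplus> \<ominus> \<one> \<otimes> Dl h i j t)"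
    have yv: "y i j \<in> vecs R n" and Dhv: "Dl h i j \<in> vecs R n" if "i + j = k" for i j
      using vin_carr y Dh that by blast+
    have nDh: "(\<lambda>t. \<ominus> \<one> \<otimes> Dl h i j t) \<in> vin R (mp 2) n" if "i + j = k" for i j
      using smod_smult[OF vin_smod[OF mp_ideal] _ Dh[OF that], of "\<ominus> \<one>"] by simp
    have zm: "z i j \<in> vin R (mp 2) n" if "i + j = k" for i j
      using smod_add[OF vin_smod[OF mp_ideal] y[OF that] nDh[OF that]] by (simp add: z_def)
    have "\<exists>h'. (\<forall>i j. i + j = Suc k \<longrightarrow> h' i j \<in> vin R mx n) \<and> (\<forall>i j. i + j = k \<longrightarrow> j \<le> J \<longrightarrow> Dl h' i j = z i j)"
    proof (rule fill_step)
      show "J \<le> k" using Suc by simp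
      show "z i j = zero_vec R" if "i + j = k" "j < J" for i j
        using h(2)[OF that] vecs_carr[OF yv[OF that(1)]] by (simp add: z_def zero_vec_def l_minus r_neg)
      show "Dl z i j = zero_vec R" if ij: "Suc (i + j) = k" for i j
      proof -
        have "Dl z i j = (\<lambda>t. Dl y i j t \<oplus> Dl (\<lambda>i j t. \<ominus> \<one> \<otimes> Dl h i j t) i j t)"
          unfolding z_def by (rule Dl_add) (use yv nDh vin_carr ij in blast)+
        moreover have "Dl (\<lambda>i j t. \<ominus> \<one> \<otimes> Dl h i j t) i j = (\<lambda>t. \<ominus> \<one> \<otimes> Dl (Dl h) i j t)"
          by (rule Dl_smult) (use Dhv ij in auto)
        moreover have "Dl (Dl h) i j = zero_vec R" by (rule Dl_Dl) (use hv ij in auto)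
        ultimately show ?thesis using cyc[OF ij] by (simp add: zero_vec_def)
      qed
    qed (use zm in auto)
    then obtain h' where h': "\<And>i j. i + j = Suc k \<Longrightarrow> h' i j \<in> vin R mx n"
      "\<And>i j. i + j = k \<Longrightarrow> j \<le> J \<Longrightarrow> Dl h' i j = z i j" by blast
    have "Dl (\<lambda>i j t. h i j t \<oplus> h' i j t) i j = y i j" if ij: "i + j = k" "j < Suc J" for i j
    proof -
      have "Dl (\<lambda>i j t. h i j t \<oplus> h' i j t) i j = (\<lambda>t. Dl h i j t \<oplus> Dl h' i j t)"
        by (rule Dl_add) (use hv vin_carr h'(1) ij in blast)+
      also have "\<dots> = (\<lambda>t. Dl h i j t \<oplus> z i j t)" using h'(2) ij by simp
      also have "\<dots> = y i j"
      proof
        fix t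
        have "y i j t \<in> carrier R" "Dl h i j t \<in> carrier R"
          using vecs_carr[OF yv[OF ij(1)]] vecs_carr[OF Dhv[OF ij(1)]] by auto
        then show "Dl h i j t \<oplus> z i j t = y i j t" unfolding z_def by algebra
      qed
      finally show ?thesis .
    qed
    moreover have "(\<lambda>t. h i j t \<oplus> h' i j t) \<in> vin R mx n" if "i + j = Suc k" for i j
      using smod_add[OF vin_smod[OF mx_ideal] h(1)[OF that] h'(1)[OF that]] by simp
    ultimately show ?case by (intro exI[of _ "\<lambda>i j t. h i j t \<oplus> h' i j t"]) auto
  qed
  from this[of "Suc k"] obtain h where h: "\<forall>i j. i + j = Suc k \<longrightarrow> h i j \<in> vin R mx n"
    "\<forall>i j. i + j = k \<longrightarrow> j < Suc k \<longrightarrow> Dl h i j = y i j" by auto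
  have "Dl h i j = y i j" if "i + j = k" for i j using h(2) that by auto
  then show ?thesis using h(1) by blast
qed

end

section \<open>Minimal complexes of free modules, exact in positive degrees\<close>

locale min_complex = short_ring +
  fixes b :: "nat \<Rightarrow> nat" and D :: "nat \<Rightarrow> (nat \<Rightarrow> 'a) \<Rightarrow> nat \<Rightarrow> 'a"
  assumes D_lin: "n \<ge> 1 \<Longrightarrow> linear_map R (fm (b n)) (fm (b (n - 1))) (D n)"
    and D_mx: "n \<ge> 1 \<Longrightarrow> v \<in> vecs R (b n) \<Longrightarrow> D n v \<in> vin R mx (b (n - 1))"
    and D_D: "n \<ge> 1 \<Longrightarrow> w \<in> vecs R (b (Suc n)) \<Longrightarrow> D n (D (Suc n) w) = zero_vec R"
    and D_exact: "n \<ge> 1 \<Longrightarrow> v \<in> vecs R (b n) \<Longrightarrow> D n v = zero_vec R \<Longrightarrow> \<exists>w\<in>vecs R (b (Suc n)). v = D (Suc n) w"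
begin

lemma D_two: "n \<ge> 1 \<Longrightarrow> two_modules R (fm (b n)) (fm (b (n - 1))) (D n)"
  by (intro two_modules.intro module_fm two_modules_axioms.intro D_lin)

lemma D_closed: "n \<ge> 1 \<Longrightarrow> v \<in> vecs R (b n) \<Longrightarrow> D n v \<in> vecs R (b (n - 1))"
  using D_mx vin_carr by blast

lemma D_mp:
  assumes n: "n \<ge> 1" and v: "v \<in> vin R (mp p) (b n)"
  shows "D n v \<in> vin R (mp (Suc p)) (b (n - 1))"
proof -
  interpret f: two_modules R "fm (b n)" "fm (b (n - 1))" "D n" by (rule D_two[OF n])
  have vv: "v \<in> vecs R (b n)" using vin_carr[OF v] .
  let ?V = "vin R (mp (Suc p)) (b (n - 1))"
  have V: "smod R (fm (b (n - 1))) ?V" by (rule vin_smod[OF mp_ideal])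
  have "v \<in> {u \<in> vecs R (b n). D n u \<in> ?V}" (is "_ \<in> ?P")
  proof (rule vec_induct[OF vv])
    show "zero_vec R \<in> ?P" using f.f_zero smod_zero[OF V] by simp
    show "(\<lambda>j. x j \<oplus> y j) \<in> ?P" if "x \<in> ?P" "y \<in> ?P" for x y
      using that f.f_add[of x y] smod_add[OF V, of "D n x" "D n y"] f.M.M.a_closed[of x y] by simp
    show "ev R k (v k) \<in> ?P" if k: "k < b n" for k
    proof -
      have vk: "v k \<in> mp p" "v k \<in> carrier R" using vin_mem[OF mp_ideal v] mp_carr by auto
      have e1: "ev R k \<one> \<in> vecs R (b n)" using ev_vecs[OF k one_closed] .
      have "ev R k (v k) = v k \<odot>\<^bsub>fm (b n)\<^esub> ev R k \<one>" using vk by (auto simp: ev_def)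
      then have eq: "D n (ev R k (v k)) = (\<lambda>j. v k \<otimes> D n (ev R k \<one>) j)"
        using f.f_smult[OF vk(2), of "ev R k \<one>"] e1 by simp
      have "v k \<otimes> D n (ev R k \<one>) j \<in> mp (Suc p)" for j
      proof -
        have "D n (ev R k \<one>) j \<in> mx" using vin_mem[OF mx_ideal D_mx[OF n e1]] .
        then have "D n (ev R k \<one>) j \<otimes> v k \<in> mp (Suc p)" using mx_mult vk by blast
        then show ?thesis using m_comm vk mx_carr \<open>D n (ev R k \<one>) j \<in> mx\<close> by simp
      qed
      moreover have "D n (ev R k (v k)) \<in> vecs R (b (n - 1))" using D_closed[OF n ev_vecs[OF k vk(2)]] .
      ultimately have "D n (ev R k (v k)) \<in> ?V" unfolding vin_def using eq by simp
      then show ?thesis using ev_vecs[OF k vk(2)] by simp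
    qed
  qed
  then show ?thesis by simp
qed

end

section \<open>Minimal generators of high syzygies have linear boundary\<close>

subsection \<open>A descending chain condition\<close>

lemma stabilise1:
  fixes f :: "nat \<Rightarrow> nat"
  assumes "\<And>d. f (Suc d) \<le> f d"
  shows "\<exists>d0. \<forall>d\<ge>d0. f d = f d0"
proof -
  obtain d0 where d0: "\<And>d. f d0 \<le> f d" using ex_has_least_nat[of "\<lambda>_. True" 0 f] by blast
  have "f d \<le> f d0" if "d \<ge> d0" for d using that by (induction rule: dec_induct) (use assms le_trans in blast)+
  then show ?thesis using d0 le_antisym by blast
qed

lemma decr_le: fixes f :: "nat \<Rightarrow> nat" assumes "\<And>d. f (Suc d) \<le> f d" shows "i \<le> j \<Longrightarrow> f j \<le> f i"
  by (induction rule: dec_induct) (use assms le_trans in blast)+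

lemma finite_bound:
  fixes P :: "nat \<Rightarrow> nat \<Rightarrow> bool"
  assumes "\<And>i. i < m \<Longrightarrow> \<exists>d0. \<forall>d\<ge>d0. P i d"
  shows "\<exists>d0. \<forall>i<m. \<forall>d\<ge>d0. P i d"
  using assms
proof (induction m)
  case (Suc m)
  obtain d0 where d0: "\<forall>i<m. \<forall>d\<ge>d0. P i d" using Suc by auto
  obtain d1 where d1: "\<forall>d\<ge>d1. P m d" using Suc.prems by auto
  show ?case by (rule exI[of _ "max d0 d1"]) (use d0 d1 in \<open>auto simp: less_Suc_eq\<close>)
qed simp

text \<open>The point is uniformity in i. From a place where the global minimum is attained onwards
  the function is constant in both arguments, and the finitely many smaller i stabilise one by one.
  The version with three arguments repeats this with two arguments in place of one.\<close>

lemma stabilise2: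
  fixes f :: "nat \<Rightarrow> nat \<Rightarrow> nat"
  assumes d: "\<And>d i. f (Suc d) i \<le> f d i" and i: "\<And>d i. f d (Suc i) \<le> f d i"
  shows "\<exists>d0. \<forall>d\<ge>d0. \<forall>i. f d i = f d0 i"
proof -
  obtain da ia where min: "\<And>d i. f da ia \<le> f d i"
    using ex_has_least_nat[of "\<lambda>_. True" "(0,0)" "\<lambda>(d, i). f d i"] by auto
  have big: "f d i = f da ia" if "d \<ge> da" "i \<ge> ia" for d i
    using min[of d i] decr_le[of "\<lambda>d. f d i", OF d that(1)] decr_le[of "f da", OF i that(2)] by linarith
  have "\<exists>d0. \<forall>i<ia. \<forall>d\<ge>d0. \<forall>d'\<ge>d. f d' i = f d i"
  proof (rule finite_bound)
    fix i
    obtain d0 where H: "\<forall>d\<ge>d0. f d i = f d0 i" using stabilise1[of "\<lambda>d. f d i", OF d] by (elim exE)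
    show "\<exists>d0. \<forall>d\<ge>d0. \<forall>d'\<ge>d. f d' i = f d i"
      by (intro exI[of _ d0] allI impI) (metis H le_trans)
  qed
  then obtain d0 where d0: "\<And>i d d'. i < ia \<Longrightarrow> d \<ge> d0 \<Longrightarrow> d' \<ge> d \<Longrightarrow> f d' i = f d i" by blast
  have "f d i = f (max d0 da) i" if "d \<ge> max d0 da" for d i
    using d0[of i "max d0 da" d] big[of d i] big[of "max d0 da" i] that by (cases "i < ia") auto
  then show ?thesis by blast
qed

lemma stabilise3:
  fixes f :: "nat \<Rightarrow> nat \<Rightarrow> nat \<Rightarrow> nat"
  assumes d: "\<And>d i j. f (Suc d) i j \<le> f d i j" and i: "\<And>d i j. f d (Suc i) j \<le> f d i j"
    and j: "\<And>d i j. f d i (Suc j) \<le> f d i j"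
  shows "\<exists>d0. \<forall>d\<ge>d0. \<forall>i j. f d i j = f d0 i j"
proof -
  obtain da ia ja where min: "\<And>d i j. f da ia ja \<le> f d i j"
    using ex_has_least_nat[of "\<lambda>_. True" "(0,0,0)" "\<lambda>(d, i, j). f d i j"] by auto
  have big: "f d i j = f da ia ja" if "d \<ge> da" "i \<ge> ia" "j \<ge> ja" for d i j
    using min[of d i j] decr_le[of "\<lambda>d. f d i j", OF d that(1)] decr_le[of "\<lambda>i. f da i j", OF i that(2)]
      decr_le[of "f da ia", OF j that(3)] by linarith
  have "\<exists>d0. \<forall>i<ia. \<forall>d\<ge>d0. \<forall>d'\<ge>d. \<forall>j. f d' i j = f d i j"
  proof (rule finite_bound)
    fix i
    obtain d0 where H: "\<forall>d\<ge>d0. \<forall>j. f d i j = f d0 i j" using stabilise2[of "\<lambda>d j. f d i j", OF d j] by (elim exE)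
    show "\<exists>d0. \<forall>d\<ge>d0. \<forall>d'\<ge>d. \<forall>j. f d' i j = f d i j"
      by (intro exI[of _ d0] allI impI) (metis H le_trans)
  qed
  then obtain d0 where d0: "\<And>i d d' j. i < ia \<Longrightarrow> d \<ge> d0 \<Longrightarrow> d' \<ge> d \<Longrightarrow> f d' i j = f d i j" by blast
  have "\<exists>d0. \<forall>j<ja. \<forall>d\<ge>d0. \<forall>d'\<ge>d. \<forall>i. f d' i j = f d i j"
  proof (rule finite_bound)
    fix j
    obtain d0 where H: "\<forall>d\<ge>d0. \<forall>i. f d i j = f d0 i j" using stabilise2[of "\<lambda>d i. f d i j", OF d i] by (elim exE)
    show "\<exists>d0. \<forall>d\<ge>d0. \<forall>d'\<ge>d. \<forall>i. f d' i j = f d i j"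
      by (intro exI[of _ d0] allI impI) (metis H le_trans)
  qed
  then obtain d1 where d1: "\<And>i d d' j. j < ja \<Longrightarrow> d \<ge> d1 \<Longrightarrow> d' \<ge> d \<Longrightarrow> f d' i j = f d i j" by blast
  let ?m = "max (max d0 d1) da"
  have "f d i j = f ?m i j" if dm: "d \<ge> ?m" for d i j
  proof (cases "i < ia \<or> j < ja")
    case True
    then show ?thesis using d0[of i ?m d j] d1[of j ?m d i] dm by auto
  next
    case False
    then show ?thesis using big[of d i j] big[of ?m i j] dm by auto
  qed
  then show ?thesis by blast
qed

context short_ring
begin

text \<open>For every n a submodule of the tuples of n + 1 vectors, such that omitting the first two
  or the last two entries leads from level n + 2 to level n. The two omissions are contractions by
  the divided power variables w and z; they act like the two variables of a polynomial ring.\<close>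

definition tuples :: "nat \<Rightarrow> (nat \<Rightarrow> (nat \<Rightarrow> (nat \<Rightarrow> 'a)) \<Rightarrow> bool) \<Rightarrow> bool" where
  "tuples N P \<longleftrightarrow>
     (\<forall>n \<mu>. P n \<mu> \<longrightarrow> (\<forall>i\<le>n. \<mu> i \<in> vecs R N)) \<and>
     (\<forall>n \<mu> \<nu>. P n \<mu> \<longrightarrow> (\<forall>i\<le>n. \<nu> i = \<mu> i) \<longrightarrow> P n \<nu>) \<and>
     (\<forall>n. P n (\<lambda>_. zero_vec R)) \<and>
     (\<forall>n \<mu> \<nu>. P n \<mu> \<longrightarrow> P n \<nu> \<longrightarrow> P n (\<lambda>i t. \<mu> i t \<oplus> \<nu> i t)) \<and>
     (\<forall>n \<mu> r. r \<in> carrier R \<longrightarrow> P n \<mu> \<longrightarrow> P n (\<lambda>i t. r \<otimes> \<mu> i t)) \<and>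
     (\<forall>n \<mu>. P (n + 2) \<mu> \<longrightarrow> P n (\<lambda>i. \<mu> (i + 2)) \<and> P n \<mu>)"

lemma tuplesD:
  assumes "tuples N P"
  shows "P n \<mu> \<Longrightarrow> i \<le> n \<Longrightarrow> \<mu> i \<in> vecs R N"
    and "P n \<mu> \<Longrightarrow> (\<And>i. i \<le> n \<Longrightarrow> \<nu> i = \<mu> i) \<Longrightarrow> P n \<nu>"
    and "P n (\<lambda>_. zero_vec R)"
    and "P n \<mu> \<Longrightarrow> P n \<nu> \<Longrightarrow> P n (\<lambda>i t. \<mu> i t \<oplus> \<nu> i t)"
    and "r \<in> carrier R \<Longrightarrow> P n \<mu> \<Longrightarrow> P n (\<lambda>i t. r \<otimes> \<mu> i t)"
    and "P (n + 2) \<mu> \<Longrightarrow> P n (\<lambda>i. \<mu> (i + 2))"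
    and "P (n + 2) \<mu> \<Longrightarrow> P n \<mu>"
proof -
  note t1 = assms[unfolded tuples_def]
  note t2 = conjunct2[OF t1] note t3 = conjunct2[OF t2] note t4 = conjunct2[OF t3] note t5 = conjunct2[OF t4]
  note h = conjunct1[OF t1] conjunct1[OF t2] conjunct1[OF t3] conjunct1[OF t4] conjunct1[OF t5] conjunct2[OF t5]
  show "P n \<mu> \<Longrightarrow> i \<le> n \<Longrightarrow> \<mu> i \<in> vecs R N" by (rule h(1)[rule_format])
  show "P n \<mu> \<Longrightarrow> (\<And>i. i \<le> n \<Longrightarrow> \<nu> i = \<mu> i) \<Longrightarrow> P n \<nu>" by (rule h(2)[rule_format])
  show "P n (\<lambda>_. zero_vec R)" by (rule h(3)[rule_format])
  show "P n \<mu> \<Longrightarrow> P n \<nu> \<Longrightarrow> P n (\<lambda>i t. \<mu> i t \<oplus> \<nu> i t)" by (rule h(4)[rule_format])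
  show "r \<in> carrier R \<Longrightarrow> P n \<mu> \<Longrightarrow> P n (\<lambda>i t. r \<otimes> \<mu> i t)" by (rule h(5)[rule_format])
  show "P (n + 2) \<mu> \<Longrightarrow> P n (\<lambda>i. \<mu> (i + 2))" "P (n + 2) \<mu> \<Longrightarrow> P n \<mu>"
    by (rule conjunct1[OF h(6)[rule_format]], assumption, rule conjunct2[OF h(6)[rule_format]], assumption)
qed

text \<open>The analogue of the modules of leading coefficients in the proof of Hilbert's basis
  theorem: i leading zeros, and j further entries behind position i.\<close>

definition lead :: "(nat \<Rightarrow> (nat \<Rightarrow> (nat \<Rightarrow> 'a)) \<Rightarrow> bool) \<Rightarrow> nat \<Rightarrow> nat \<Rightarrow> (nat \<Rightarrow> 'a) set" where
  "lead P i j = {\<mu> i | \<mu>. P (i + j) \<mu> \<and> (\<forall>i'<i. \<mu> i' = zero_vec R)}"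

lemma lead_smod: assumes P: "tuples N P" shows "smod R (fm N) (lead P i j)"
proof (rule smodI)
  show "lead P i j \<subseteq> carrier (fm N)" using tuplesD(1)[OF P] by (auto simp: lead_def)
  show "\<zero>\<^bsub>fm N\<^esub> \<in> lead P i j" using tuplesD(3)[OF P, of "i + j"] unfolding lead_def by force
  show "x \<oplus>\<^bsub>fm N\<^esub> y \<in> lead P i j" if x: "x \<in> lead P i j" and y: "y \<in> lead P i j" for x y
  proof -
    obtain \<mu> where \<mu>: "x = \<mu> i" "P (i + j) \<mu>" "\<And>i'. i' < i \<Longrightarrow> \<mu> i' = zero_vec R" using x by (auto simp: lead_def)
    obtain \<nu> where \<nu>: "y = \<nu> i" "P (i + j) \<nu>" "\<And>i'. i' < i \<Longrightarrow> \<nu> i' = zero_vec R" using y by (auto simp: lead_def)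
    show ?thesis unfolding lead_def
      by (rule CollectI, rule exI[of _ "\<lambda>i t. \<mu> i t \<oplus> \<nu> i t"])
        (use \<mu> \<nu> tuplesD(4)[OF P \<mu>(2) \<nu>(2)] in \<open>auto simp: zero_vec_def\<close>)
  qed
  show "r \<odot>\<^bsub>fm N\<^esub> x \<in> lead P i j" if r: "r \<in> carrier R" and x: "x \<in> lead P i j" for r x
  proof -
    obtain \<mu> where \<mu>: "x = \<mu> i" "P (i + j) \<mu>" "\<And>i'. i' < i \<Longrightarrow> \<mu> i' = zero_vec R" using x by (auto simp: lead_def)
    show ?thesis unfolding lead_def
      by (rule CollectI, rule exI[of _ "\<lambda>i t. r \<otimes> \<mu> i t"])
        (use \<mu> tuplesD(5)[OF P r \<mu>(2)] r in \<open>auto simp: zero_vec_def\<close>)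
  qed
qed

lemma lead_shift: assumes P: "tuples N P" shows "lead P (i + 2) j \<subseteq> lead P i j" "lead P i (j + 2) \<subseteq> lead P i j"
proof -
  show "lead P (i + 2) j \<subseteq> lead P i j"
  proof
    fix x assume "x \<in> lead P (i + 2) j"
    then obtain \<mu> where \<mu>: "x = \<mu> (i + 2)" "P (i + 2 + j) \<mu>" "\<And>i'. i' < i + 2 \<Longrightarrow> \<mu> i' = zero_vec R" by (auto simp: lead_def)
    have "P (i + j + 2) \<mu>" using \<mu>(2) by (simp add: add.commute add.left_commute)
    then show "x \<in> lead P i j" unfolding lead_def
      by (intro CollectI exI[of _ "\<lambda>i. \<mu> (i + 2)"]) (use \<mu> tuplesD(6)[OF P] in auto)
  qed
  show "lead P i (j + 2) \<subseteq> lead P i j"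
  proof
    fix x assume "x \<in> lead P i (j + 2)"
    then obtain \<mu> where \<mu>: "x = \<mu> i" "P (i + (j + 2)) \<mu>" "\<And>i'. i' < i \<Longrightarrow> \<mu> i' = zero_vec R" by (auto simp: lead_def)
    have "P (i + j + 2) \<mu>" using \<mu>(2) by (simp add: add.assoc)
    then show "x \<in> lead P i j" unfolding lead_def
      by (intro CollectI exI[of _ \<mu>]) (use \<mu> tuplesD(7)[OF P] in auto)
  qed
qed

text \<open>A member of P is approximated by members of Q one entry at a time: the first wrong entry
  of the difference is a leading coefficient of P, hence of Q, and can be corrected without touching
  the earlier entries.\<close>

lemma lead_eq_imp:
  assumes P: "tuples N P" and Q: "tuples N Q" and PQ: "\<And>n \<mu>. Q n \<mu> \<Longrightarrow> P n \<mu>"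
    and eq: "\<And>i j. lead P i j = lead Q i j" and \<mu>: "P n \<mu>"
  shows "Q n \<mu>"
proof -
  have "\<exists>\<nu>. Q n \<nu> \<and> (\<forall>i<m. \<nu> i = \<mu> i)" if "m \<le> Suc n" for m
    using that
  proof (induction m)
    case 0
    then show ?case using tuplesD(3)[OF Q] by blast
  next
    case (Suc m)
    then obtain \<nu> where \<nu>: "Q n \<nu>" "\<And>i. i < m \<Longrightarrow> \<nu> i = \<mu> i" by auto
    define \<rho> where "\<rho> = (\<lambda>i t. \<mu> i t \<oplus> \<ominus> \<one> \<otimes> \<nu> i t)"
    have v: "\<mu> i \<in> vecs R N" "\<nu> i \<in> vecs R N" if "i \<le> n" for i
      using tuplesD(1)[OF P \<mu> that] tuplesD(1)[OF Q \<nu>(1) that] by auto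
    have "P n \<rho>" unfolding \<rho>_def
      by (rule tuplesD(4)[OF P \<mu> tuplesD(5)[OF P _ PQ[OF \<nu>(1)]]]) simp
    moreover have "\<rho> i = zero_vec R" if "i < m" for i
      using \<nu>(2)[OF that] v[of i] vecs_carr[of "\<mu> i" N] that Suc(2) by (simp add: \<rho>_def zero_vec_def l_minus r_neg)
    moreover have "m + (n - m) = n" using Suc by simp
    ultimately have "\<rho> m \<in> lead P m (n - m)" unfolding lead_def by auto
    then have "\<rho> m \<in> lead Q m (n - m)" using eq by simp
    then obtain \<sigma> where \<sigma>: "\<rho> m = \<sigma> m" "Q n \<sigma>" "\<And>i. i < m \<Longrightarrow> \<sigma> i = zero_vec R"
      unfolding lead_def using \<open>m + (n - m) = n\<close> by auto
    have "Q n (\<lambda>i t. \<nu> i t \<oplus> \<sigma> i t)" by (rule tuplesD(4)[OF Q \<nu>(1) \<sigma>(2)])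
    moreover have "(\<lambda>t. \<nu> i t \<oplus> \<sigma> i t) = \<mu> i" if i: "i < Suc m" for i
    proof (cases "i = m")
      case True
      have "\<nu> m t \<oplus> \<rho> m t = \<mu> m t" for t
      proof -
        have "\<nu> m t \<in> carrier R" "\<mu> m t \<in> carrier R" using v[of m] vecs_carr Suc(2) by auto
        then show ?thesis unfolding \<rho>_def by algebra
      qed
      then show ?thesis using True \<sigma>(1) by auto
    next
      case False
      then have im: "i < m" using i by simp
      have "\<mu> i \<in> vecs R N" using v[of i] im Suc(2) by simp
      then show ?thesis using \<sigma>(3)[OF im] \<nu>(2)[OF im] vecs_carr[of "\<mu> i" N] by (simp add: zero_vec_def)
    qed
    ultimately show ?case by blast
  qed
  from this[of "Suc n"] obtain \<nu> where "Q n \<nu>" "\<forall>i<Suc n. \<nu> i = \<mu> i" by auto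
  then show ?thesis using tuplesD(2)[OF Q, of n \<nu> \<mu>] by simp
qed

text \<open>The lengths of the modules \<open>lead\<close> are natural numbers that decrease in d
  and under shifts of i or j by two. By \<open>stabilise3\<close> they become independent of d,
  uniformly in i and j, and nested families with equal leading modules coincide.\<close>

lemma tuples_dcc:
  assumes P: "\<And>d. tuples N (P d)" and dec: "\<And>d n \<mu>. P (Suc d) n \<mu> \<Longrightarrow> P d n \<mu>"
  shows "\<exists>d0. \<forall>d\<ge>d0. \<forall>n \<mu>. P d0 n \<mu> \<longrightarrow> P d n \<mu>"
proof -
  interpret F: fmodule R "fm N" by (rule fmodule_fm)
  have zs: "smod R (fm N) {zero_vec R}" using F.smod_zero_mod by simp
  define f where "f d i j = slen R (fm N) {zero_vec R} (lead (P d) i j)" for d i j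
  have mono: "slen R (fm N) {zero_vec R} A \<le> slen R (fm N) {zero_vec R} B"
    if "smod R (fm N) A" "smod R (fm N) B" "A \<subseteq> B" for A B
    by (rule F.slen_mono[OF zs zs that(1,2)]) (use smod_zero[OF that(1)] that in auto)
  have sub: "lead (P (Suc d)) i j \<subseteq> lead (P d) i j" for d i j using dec unfolding lead_def by blast
  have 1: "f (Suc d) i j \<le> f d i j" for d i j
    unfolding f_def by (rule mono[OF lead_smod[OF P] lead_smod[OF P] sub])
  have 2: "f d (i + 2) j \<le> f d i j" for d i j
    unfolding f_def by (rule mono[OF lead_smod[OF P] lead_smod[OF P] lead_shift(1)[OF P]])
  have 3: "f d i (j + 2) \<le> f d i j" for d i j
    unfolding f_def by (rule mono[OF lead_smod[OF P] lead_smod[OF P] lead_shift(2)[OF P]])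
  have st: "\<exists>d0. \<forall>d\<ge>d0. \<forall>i j. f d (2 * i + p) (2 * j + q) = f d0 (2 * i + p) (2 * j + q)" for p q
  proof (rule stabilise3)
    show "f d (2 * Suc i + p) (2 * j + q) \<le> f d (2 * i + p) (2 * j + q)" for d i j
      using 2[of d "2 * i + p" "2 * j + q"] by (simp add: add.commute add.left_commute)
    show "f d (2 * i + p) (2 * Suc j + q) \<le> f d (2 * i + p) (2 * j + q)" for d i j
      using 3[of d "2 * i + p" "2 * j + q"] by (simp add: add.commute add.left_commute)
  qed (rule 1)
  \<comment> \<open>Shifts go by two, so the four parity classes of (i, j) are treated separately; k
    encodes the class by \<open>k div 2\<close> and \<open>k mod 2\<close>.\<close>
  have "\<exists>d0. \<forall>k<4. \<forall>d\<ge>d0. \<forall>d'\<ge>d. \<forall>i j. f d' (2 * i + k div 2) (2 * j + k mod 2) = f d (2 * i + k div 2) (2 * j + k mod 2)"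
  proof (rule finite_bound)
    fix k :: nat
    obtain d0 where H: "\<forall>d\<ge>d0. \<forall>i j. f d (2 * i + k div 2) (2 * j + k mod 2) = f d0 (2 * i + k div 2) (2 * j + k mod 2)"
      using st by blast
    show "\<exists>d0. \<forall>d\<ge>d0. \<forall>d'\<ge>d. \<forall>i j. f d' (2 * i + k div 2) (2 * j + k mod 2) = f d (2 * i + k div 2) (2 * j + k mod 2)"
      by (intro exI[of _ d0] allI impI) (metis H le_trans)
  qed
  then obtain d0 where d0: "\<And>k d i j. k < 4 \<Longrightarrow> d \<ge> d0 \<Longrightarrow>
      f d (2 * i + k div 2) (2 * j + k mod 2) = f d0 (2 * i + k div 2) (2 * j + k mod 2)" by blast
  have "P d n \<mu>" if d: "d \<ge> d0" and \<mu>: "P d0 n \<mu>" for d n \<mu>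
  proof (rule lead_eq_imp[OF P P _ _ \<mu>])
    have "P d0 n \<mu>" if "P d n \<mu>" for n \<mu> using d that by (induction rule: dec_induct) (use dec in blast)+
    then show dd: "\<And>n \<mu>. P d n \<mu> \<Longrightarrow> P d0 n \<mu>" .
    fix i j :: nat
    let ?k = "2 * (i mod 2) + j mod 2"
    have "?k < 4" by (auto simp: mod2_eq_if)
    moreover have "2 * (i div 2) + ?k div 2 = i" "2 * (j div 2) + ?k mod 2 = j"
      by (auto simp: mod2_eq_if elim!: oddE)
    ultimately have feq: "f d i j = f d0 i j" using d0[of ?k d "i div 2" "j div 2"] d by simp
    have s: "lead (P d) i j \<subseteq> lead (P d0) i j" using dd unfolding lead_def by blast
    have "f d0 i j = f d i j + slen R (fm N) (lead (P d) i j) (lead (P d0) i j)"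
      unfolding f_def by (rule F.slen_add[OF zs lead_smod[OF P] lead_smod[OF P] _ s])
        (use smod_zero[OF lead_smod[OF P[of d], of i j]] in simp)
    then show "lead (P d0) i j = lead (P d) i j"
      using F.slen_eq_0[OF lead_smod[OF P] lead_smod[OF P] s] feq by simp
  qed
  then show ?thesis by blast
qed

end

subsection \<open>Chains\<close>

locale orthogonal_complex = orthogonal_data + min_complex
begin

text \<open>Up to signs, a cycle of total degree n in the tensor product of F with the Tate complex.
  The diagonal i + j = n has values in F_0, where no condition is left; it is called the
  tail.\<close>

definition chain :: "nat \<Rightarrow> (nat \<Rightarrow> nat \<Rightarrow> nat \<Rightarrow> 'a) \<Rightarrow> bool" where
  "chain n g \<longleftrightarrow> (\<forall>i j. i + j \<le> n \<longrightarrow> g i j \<in> vecs R (b (n - (i + j)))) \<and>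
     (\<forall>i j. i + j < n \<longrightarrow> D (n - (i + j)) (g i j) = Dl g i j)"

lemma chainD:
  assumes "chain n g"
  shows "i + j \<le> n \<Longrightarrow> g i j \<in> vecs R (b (n - (i + j)))"
    and "i + j < n \<Longrightarrow> D (n - (i + j)) (g i j) = Dl g i j"
  using assms unfolding chain_def by auto

text \<open>If the tail consists of boundaries, then the cycle is a boundary: a bounding array h is
  constructed from the tail towards (0, 0) by exactness of F. At (0, 0) both contributions lie in m
  F_n, because the coefficients of \<open>D\<close> and of \<open>Dl\<close> lie in m.\<close>

lemma chain_lead_trivial:
  assumes g: "chain n g" and tail: "\<And>i. i \<le> n \<Longrightarrow> g i (n - i) \<in> D 1 ` vecs R (b 1)"
  shows "g 0 0 \<in> vin R mx (b n)"
proof -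
  let ?Q = "\<lambda>k h. (\<forall>i j. k \<le> i + j \<longrightarrow> i + j \<le> n \<longrightarrow> h i j \<in> vecs R (b (Suc n - (i + j)))) \<and>
     (\<forall>i j. i + j > n \<longrightarrow> h i j = zero_vec R) \<and>
     (\<forall>i j. k \<le> i + j \<longrightarrow> i + j \<le> n \<longrightarrow> g i j = (\<lambda>t. D (Suc n - (i + j)) (h i j) t \<oplus> Dl h i j t))"
  have "\<exists>h. ?Q k h" if "k \<le> n" for k
    using that
  proof (induction rule: inc_induct)
    case base
    obtain w where w: "\<And>i. i \<le> n \<Longrightarrow> w i \<in> vecs R (b 1)" "\<And>i. i \<le> n \<Longrightarrow> g i (n - i) = D 1 (w i)"
      using tail unfolding image_iff Bex_def by metis
    let ?h = "\<lambda>i j. if i + j = n then w i else zero_vec R"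
    have "Dl ?h i j = zero_vec R" if "i + j = n" for i j
      using that carr al_carr ga_carr by (auto simp: Dl_def zero_vec_def fun_eq_iff)
    moreover have "D 1 (w i) t \<in> carrier R" if "i \<le> n" for i t
      using vecs_carr[OF D_closed[OF _ w(1)[OF that]]] by simp
    moreover have "g i j = D 1 (w i)" if "i + j = n" for i j
    proof -
      have "j = n - i" "i \<le> n" using that by auto
      then show ?thesis using w(2)[of i] by simp
    qed
    ultimately have "g i j = (\<lambda>t. D (Suc n - (i + j)) (?h i j) t \<oplus> Dl ?h i j t)" if "n \<le> i + j" "i + j \<le> n" for i j
    proof -
      have ij: "i + j = n" "i \<le> n" using that by auto
      have "D 1 (w i) t \<in> carrier R" for t using vecs_carr[OF D_closed[OF _ w(1)[OF ij(2)]]] by simp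
      moreover have "Dl ?h i j = zero_vec R" "g i j = D 1 (w i)" "Suc n - (i + j) = 1" "?h i j = w i"
        using \<open>\<And>i j. i + j = n \<Longrightarrow> Dl ?h i j = zero_vec R\<close> \<open>\<And>i j. i + j = n \<Longrightarrow> g i j = D 1 (w i)\<close> ij by auto
      ultimately show ?thesis by (simp add: zero_vec_def)
    qed
    moreover have "?h i j \<in> vecs R (b (Suc n - (i + j)))" if "n \<le> i + j" "i + j \<le> n" for i j
    proof -
      have ij: "i + j = n" "i \<le> n" using that by auto
      then show ?thesis using w(1)[OF ij(2)] by simp
    qed
    ultimately have "?Q n ?h" by auto
    then show ?case by (rule exI[of _ ?h])
  next
    case (step k)
    then obtain h where hv: "\<And>i j. Suc k \<le> i + j \<Longrightarrow> i + j \<le> n \<Longrightarrow> h i j \<in> vecs R (b (Suc n - (i + j)))"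
      and hz: "\<And>i j. i + j > n \<Longrightarrow> h i j = zero_vec R"
      and hg: "\<And>i j. Suc k \<le> i + j \<Longrightarrow> i + j \<le> n \<Longrightarrow> g i j = (\<lambda>t. D (Suc n - (i + j)) (h i j) t \<oplus> Dl h i j t)" by auto
    have kn: "k < n" by (rule step)
    let ?m = "n - k"
    have m1: "?m \<ge> 1" "Suc n - Suc k = ?m" using kn by auto
    interpret f: two_modules R "fm (b ?m)" "fm (b (?m - 1))" "D ?m" by (rule D_two[OF m1(1)])
    have h1: "h p q \<in> vecs R (b ?m)" if "p + q = Suc k" for p q using hv[of p q] that kn m1 by simp
    have h2: "h p q \<in> vecs R (b (?m - 1))" if pq: "p + q = Suc (Suc k)" for p q
    proof (cases "p + q \<le> n")
      case True
      have "Suc n - (p + q) = ?m - 1" using pq kn by simp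
      then show ?thesis using hv[of p q] True pq by simp
    qed (use hz pq in simp)
    \<comment> \<open>The vector g - Dl h is a cycle of D, since D g = Dl g = Dl (D h + Dl h) on the
      next diagonal, \<open>Dl\<close> commutes with D, and \<open>Dl_Dl\<close> removes the last
      term.\<close>
    have ex: "\<exists>w\<in>vecs R (b (Suc ?m)). g i j = (\<lambda>t. D (Suc ?m) w t \<oplus> Dl h i j t)" if ij: "i + j = k" for i j
    proof -
      have gv: "g i j \<in> vecs R (b ?m)" using chainD(1)[OF g, of i j] ij kn by simp
      have Dhv: "Dl h i j \<in> vecs R (b ?m)" by (rule Dl_vecs) (use h1 ij in auto)
      have "D ?m (g i j) = Dl g i j" using chainD(2)[OF g, of i j] ij kn by simp
      also have "\<dots> = Dl (\<lambda>p q t. D ?m (h p q) t \<oplus> Dl h p q t) i j"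
        by (rule Dl_cong) (use hg ij kn m1 in auto)
      also have "\<dots> = (\<lambda>t. Dl (\<lambda>p q. D ?m (h p q)) i j t \<oplus> Dl (Dl h) i j t)"
      proof (rule Dl_add)
        fix p q assume pq: "p + q = Suc (i + j)"
        show "D ?m (h p q) \<in> vecs R (b (?m - 1))" using D_closed[OF m1(1) h1] pq ij by simp
        show "Dl h p q \<in> vecs R (b (?m - 1))" by (rule Dl_vecs) (use h2 pq ij in auto)
      qed
      also have "Dl (Dl h) i j = zero_vec R" by (rule Dl_Dl) (use h2 ij in auto)
      also have "Dl (\<lambda>p q. D ?m (h p q)) i j = D ?m (Dl h i j)"
        by (rule linear_Dl[symmetric, OF D_lin[OF m1(1)]]) (use h1 ij in auto)
      finally have eq: "D ?m (g i j) = D ?m (Dl h i j)"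
        using vecs_carr[OF D_closed[OF m1(1) Dhv]] by (simp add: zero_vec_def)
      have "D ?m (g i j \<ominus>\<^bsub>fm (b ?m)\<^esub> Dl h i j) = zero_vec R"
        using f.f_minus[of "g i j" "Dl h i j"] gv Dhv eq D_closed[OF m1(1) Dhv]
          fm_minus[of "D ?m (Dl h i j)" "b (?m - 1)" "D ?m (Dl h i j)"] vecs_carr[OF D_closed[OF m1(1) Dhv]]
        by (simp add: zero_vec_def a_minus_def r_neg)
      moreover have "g i j \<ominus>\<^bsub>fm (b ?m)\<^esub> Dl h i j \<in> vecs R (b ?m)" using f.M.M.minus_closed[of "g i j" "Dl h i j"] gv Dhv by simp
      ultimately obtain w where w: "w \<in> vecs R (b (Suc ?m))" "g i j \<ominus>\<^bsub>fm (b ?m)\<^esub> Dl h i j = D (Suc ?m) w"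
        using D_exact[OF m1(1)] by blast
      have "g i j = (\<lambda>t. D (Suc ?m) w t \<oplus> Dl h i j t)"
      proof
        fix t
        have "D (Suc ?m) w t = g i j t \<ominus> Dl h i j t" using fm_minus[OF gv Dhv] w(2) by (metis (no_types))
        then show "g i j t = D (Suc ?m) w t \<oplus> Dl h i j t"
          using vecs_carr[OF gv, of t] vecs_carr[OF Dhv, of t] by (simp add: a_minus_def a_assoc l_neg)
      qed
      then show ?thesis using w by blast
    qed
    then have "\<exists>w. \<forall>i j. i + j = k \<longrightarrow> w i j \<in> vecs R (b (Suc ?m)) \<and> g i j = (\<lambda>t. D (Suc ?m) (w i j) t \<oplus> Dl h i j t)"
      unfolding Bex_def by metis
    then obtain w where w: "\<And>i j. i + j = k \<Longrightarrow> w i j \<in> vecs R (b (Suc ?m))"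
      "\<And>i j. i + j = k \<Longrightarrow> g i j = (\<lambda>t. D (Suc ?m) (w i j) t \<oplus> Dl h i j t)" by blast
    let ?h = "\<lambda>i j. if i + j = k then w i j else h i j"
    have Dleq: "Dl ?h i j = Dl h i j" if "k \<le> i + j" for i j by (rule Dl_cong) (use that in auto)
    have Sm: "Suc n - k = Suc ?m" using kn by simp
    have "?h i j \<in> vecs R (b (Suc n - (i + j)))" if "k \<le> i + j" "i + j \<le> n" for i j
      using that w(1)[of i j] hv[of i j] Sm by auto
    moreover have "?h i j = zero_vec R" if "i + j > n" for i j using that hz kn by auto
    moreover have "g i j = (\<lambda>t. D (Suc n - (i + j)) (?h i j) t \<oplus> Dl ?h i j t)" if ij: "k \<le> i + j" "i + j \<le> n" for i j
      unfolding Dleq[OF ij(1)] using ij w(2)[of i j] hg[of i j] Sm by (cases "i + j = k") auto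
    ultimately have "?Q k ?h" by blast
    then show ?case by (rule exI[of _ ?h])
  qed
  from this[of 0] obtain h where hv: "\<And>i j. i + j \<le> n \<Longrightarrow> h i j \<in> vecs R (b (Suc n - (i + j)))"
    and hz: "\<And>i j. i + j > n \<Longrightarrow> h i j = zero_vec R"
    and hg: "\<And>i j. i + j \<le> n \<Longrightarrow> g i j = (\<lambda>t. D (Suc n - (i + j)) (h i j) t \<oplus> Dl h i j t)" by auto
  have g00: "g 0 0 = (\<lambda>t. D (Suc n) (h 0 0) t \<oplus> Dl h 0 0 t)" using hg[of 0 0] by simp
  have h0: "h 0 0 \<in> vecs R (b (Suc n))" using hv[of 0 0] by simp
  have 1: "D (Suc n) (h 0 0) \<in> vin R mx (b n)" using D_mx[OF _ h0] by simp
  have "h p q \<in> vin R (mp 0) (b n)" if pq: "p + q = Suc (0 + 0)" for p q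
  proof (cases "n = 0")
    case True
    then have "p + q > n" using pq by simp
    then have "h p q = zero_vec R" by (rule hz)
    then show ?thesis using vin_carrier by simp
  next
    case False
    then show ?thesis using hv[of p q] pq vin_carrier by simp
  qed
  then have 2: "Dl h 0 0 \<in> vin R mx (b n)" using Dl_mp[of 0 0 h 0 "b n"] mp_1 by simp
  show ?thesis using smod_add[OF vin_smod[OF mx_ideal] 1 2] g00 by simp
qed

text \<open>The array grows from w outwards. D of the last diagonal is a cycle for \<open>Dl\<close>
  over m^2, at first by assumption on w and later because the entries are in m, so
  \<open>fill\<close> supplies the next diagonal over m.\<close>

lemma primitive_chain:
  assumes n: "n \<ge> 1" and w: "w \<in> vecs R (b n)" and dw: "D n w \<in> vin R (mp 2) (b (n - 1))"
  shows "\<exists>g. chain n g \<and> g 0 0 = w \<and> (\<forall>i j. 1 \<le> i + j \<longrightarrow> i + j \<le> n \<longrightarrow> g i j \<in> vin R mx (b (n - (i + j))))"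
proof -
  let ?Q = "\<lambda>k g. g 0 0 = w \<and> (\<forall>i j. 1 \<le> i + j \<longrightarrow> i + j \<le> k \<longrightarrow> g i j \<in> vin R mx (b (n - (i + j)))) \<and>
    (\<forall>i j. i + j < k \<longrightarrow> D (n - (i + j)) (g i j) = Dl g i j)"
  have "\<exists>g. ?Q k g" if "k \<le> n" for k
    using that
  proof (induction k)
    case 0
    then show ?case by (intro exI[of _ "\<lambda>_ _. w"]) auto
  next
    case (Suc k)
    then obtain g where g0: "g 0 0 = w" and gm: "\<And>i j. 1 \<le> i + j \<Longrightarrow> i + j \<le> k \<Longrightarrow> g i j \<in> vin R mx (b (n - (i + j)))"
      and gd: "\<And>i j. i + j < k \<Longrightarrow> D (n - (i + j)) (g i j) = Dl g i j" by auto
    let ?m = "n - k"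
    have m1: "?m \<ge> 1" "n - Suc k = ?m - 1" using Suc by auto
    have gv: "g i j \<in> vecs R (b (n - (i + j)))" if "i + j \<le> k" for i j
      using gm[of i j] g0 w that vin_carr by (cases "i + j = 0") auto
    define y where "y = (\<lambda>i j. D ?m (g i j))"
    have "\<exists>h. (\<forall>i j. i + j = Suc k \<longrightarrow> h i j \<in> vin R mx (b (?m - 1))) \<and> (\<forall>i j. i + j = k \<longrightarrow> Dl h i j = y i j)"
    proof (rule fill)
      fix i j assume ij: "i + j = k"
      show "y i j \<in> vin R (mp 2) (b (?m - 1))"
      proof (cases "k = 0")
        case True
        then show ?thesis using ij g0 dw by (simp add: y_def)
      next
        case False
        then have "g i j \<in> vin R (mp 1) (b ?m)" using gm[of i j] ij mp_1 by simp
        then show ?thesis using D_mp[OF m1(1)] by (simp add: y_def numeral_2_eq_2)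
      qed
    next
      fix i j assume ij: "Suc (i + j) = k"
      have sm: "n - (i + j) = Suc ?m" using ij Suc(2) by simp
      have "Dl y i j = D ?m (Dl g i j)" unfolding y_def
        by (rule linear_Dl[symmetric, OF D_lin[OF m1(1)]]) (use gv ij in auto)
      also have "\<dots> = D ?m (D (Suc ?m) (g i j))" using gd[of i j] ij sm by simp
      also have "\<dots> = zero_vec R" by (rule D_D[OF m1(1)]) (use gv[of i j] ij sm in simp)
      finally show "Dl y i j = zero_vec R" .
    qed
    then obtain h where h: "\<And>i j. i + j = Suc k \<Longrightarrow> h i j \<in> vin R mx (b (?m - 1))"
      "\<And>i j. i + j = k \<Longrightarrow> Dl h i j = y i j" by blast
    let ?g = "\<lambda>i j. if i + j = Suc k then h i j else g i j"
    have "?g i j \<in> vin R mx (b (n - (i + j)))" if "1 \<le> i + j" "i + j \<le> Suc k" for i j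
    proof (cases "i + j = Suc k")
      case True
      have "n - (i + j) = ?m - 1" using True by simp
      then show ?thesis using h(1)[OF True] True by simp
    next
      case False
      then show ?thesis using gm[of i j] that by simp
    qed
    moreover have "D (n - (i + j)) (?g i j) = Dl ?g i j" if ij: "i + j < Suc k" for i j
    proof (cases "i + j = k")
      case True
      have "Dl ?g i j = Dl h i j" by (rule Dl_cong) (use True in auto)
      then show ?thesis using h(2)[OF True] True by (simp add: y_def)
    next
      case False
      have "Dl ?g i j = Dl g i j" by (rule Dl_cong) (use False ij in auto)
      then show ?thesis using gd[of i j] False ij by simp
    qed
    ultimately have "?Q (Suc k) ?g" using g0 by auto
    then show ?case by (rule exI[of _ ?g])
  qed
  from this[of n] obtain g where g: "?Q n g" by auto
  then have g1: "\<And>i j. 1 \<le> i + j \<Longrightarrow> i + j \<le> n \<Longrightarrow> g i j \<in> vin R mx (b (n - (i + j)))" by auto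
  have "g i j \<in> vecs R (b (n - (i + j)))" if "i + j \<le> n" for i j
    using g w that vin_carr[OF g1[of i j]] by (cases "i + j = 0") auto
  then have "chain n g" unfolding chain_def using g by blast
  then show ?thesis using g by blast
qed

lemma Dl_shift: "Dl (\<lambda>i j. g (i + 2) j) i j = Dl g (i + 2) j" "Dl (\<lambda>i j. g i (j + 2)) i j = Dl g i (j + 2)"
proof -
  show "Dl (\<lambda>i j. g (i + 2) j) i j = Dl g (i + 2) j"
    by (simp add: Dl_def ga_def ce_def)
  show "Dl (\<lambda>i j. g i (j + 2)) i j = Dl g i (j + 2)"
    by (auto simp: Dl_def ga_def al_def fun_eq_iff elim!: oddE)
qed

lemma chain_shift: "chain (n + 2) g \<Longrightarrow> chain n (\<lambda>i j. g (i + 2) j)" "chain (n + 2) g \<Longrightarrow> chain n (\<lambda>i j. g i (j + 2))"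
proof -
  have e1: "n + 2 - (i + 2 + j) = n - (i + j)" "n + 2 - (i + (j + 2)) = n - (i + j)" for i j by auto
  show "chain n (\<lambda>i j. g (i + 2) j)" if "chain (n + 2) g"
    unfolding chain_def Dl_shift
  proof (intro conjI allI impI)
    show "g (i + 2) j \<in> vecs R (b (n - (i + j)))" if "i + j \<le> n" for i j
      using chainD(1)[OF \<open>chain (n + 2) g\<close>, of "i + 2" j] that unfolding e1 by simp
    show "D (n - (i + j)) (g (i + 2) j) = Dl g (i + 2) j" if "i + j < n" for i j
      using chainD(2)[OF \<open>chain (n + 2) g\<close>, of "i + 2" j] that unfolding e1 by simp
  qed
  show "chain n (\<lambda>i j. g i (j + 2))" if "chain (n + 2) g"
    unfolding chain_def Dl_shift
  proof (intro conjI allI impI)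
    show "g i (j + 2) \<in> vecs R (b (n - (i + j)))" if "i + j \<le> n" for i j
      using chainD(1)[OF \<open>chain (n + 2) g\<close>, of i "j + 2"] that unfolding e1 by simp
    show "D (n - (i + j)) (g i (j + 2)) = Dl g i (j + 2)" if "i + j < n" for i j
      using chainD(2)[OF \<open>chain (n + 2) g\<close>, of i "j + 2"] that unfolding e1 by simp
  qed
qed

text \<open>Coefficients are compared modulo m^2. D of the lead lies in m^2 F, so independence of a
  and c puts the first diagonal into m F. The same argument one diagonal further, with a, c' and
  then with a', reaches the leads of the two shifted chains.\<close>

lemma chain_lead_shift:
  assumes g: "chain (n + 2) g" and g0: "g 0 0 \<in> vin R mx (b (n + 2))"
  shows "g 2 0 \<in> vin R mx (b n)" "g 0 2 \<in> vin R mx (b n)"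
proof -
  have v: "g 0 1 \<in> vecs R (b (n + 1))" "g 1 0 \<in> vecs R (b (n + 1))" "g 1 1 \<in> vecs R (b n)" "g 2 0 \<in> vecs R (b n)" "g 0 2 \<in> vecs R (b n)"
    using chainD(1)[OF g, of 0 1] chainD(1)[OF g, of 1 0] chainD(1)[OF g, of 1 1] chainD(1)[OF g, of 2 0] chainD(1)[OF g, of 0 2] by auto
  note vc = vecs_carr[OF v(1)] vecs_carr[OF v(2)] vecs_carr[OF v(3)] vecs_carr[OF v(4)] vecs_carr[OF v(5)]
  have D1: "D (n + 2) (g 0 0) = Dl g 0 0" "D (n + 1) (g 1 0) = Dl g 1 0" "D (n + 1) (g 0 1) = Dl g 0 1"
    using chainD(2)[OF g, of 0 0] chainD(2)[OF g, of 1 0] chainD(2)[OF g, of 0 1] by auto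
  have s2: "D (Suc k) w t \<in> mp 2" if "w \<in> vin R mx (b (Suc k))" for k w t
    using vin_mem[OF mp_ideal D_mp[of "Suc k" w 1]] that mp_1 by (simp add: numeral_2_eq_2)
  have mm: "x \<otimes> y \<in> mp 2" if "x \<in> mx" "y \<in> mx" for x y
    using mp_mult[of x 1 y 1] that mp_1 by (simp add: numeral_2_eq_2)
  have 1: "g 0 1 t \<in> mx \<and> g 1 0 t \<in> mx" for t
  proof -
    have "Dl g 0 0 t \<in> mp 2" using s2[of "g 0 0" "n + 1" t] g0 D1(1) by simp
    moreover have "Dl g 0 0 t = g 0 1 t \<otimes> a \<oplus> g 1 0 t \<otimes> c"
      using vc carr by (simp add: Dl_def al_def ga_def ce_def m_comm)
    ultimately show ?thesis using ac_mp2[OF vc(1) vc(2), of t t] by simp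
  qed
  then have f1: "g 0 1 \<in> vin R mx (b (n + 1))" "g 1 0 \<in> vin R mx (b (n + 1))" using v by (auto simp: vin_def)
  have 2: "g 1 1 t \<in> mx \<and> g 2 0 t \<in> mx" for t
  proof -
    have "Dl g 1 0 t \<in> mp 2" using s2[of "g 1 0" n t] f1 D1(2) by simp
    moreover have "Dl g 1 0 t = g 1 1 t \<otimes> a \<oplus> g 2 0 t \<otimes> c'"
      using vc carr by (simp add: Dl_def al_def ga_def ce_def m_comm numeral_2_eq_2)
    ultimately show ?thesis using ac'_mp2[OF vc(3) vc(4), of t t] by simp
  qed
  have 3: "g 0 2 t \<in> mx" for t
  proof -
    have "Dl g 0 1 t \<in> mp 2" using s2[of "g 0 1" n t] f1 D1(3) by simp
    moreover have "Dl g 0 1 t = a' \<otimes> g 0 2 t \<oplus> (\<ominus> c \<otimes> g 1 1 t \<oplus> \<ominus> l \<otimes> g 2 0 t)"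
      using vc carr by (simp add: Dl_def al_def ga_def ce_def numeral_2_eq_2)
    moreover have r: "\<ominus> c \<otimes> g 1 1 t \<oplus> \<ominus> l \<otimes> g 2 0 t \<in> mp 2"
      using 2 mem by (intro mp_add mm mx_neg) auto
    ultimately have "(a' \<otimes> g 0 2 t \<oplus> (\<ominus> c \<otimes> g 1 1 t \<oplus> \<ominus> l \<otimes> g 2 0 t)) \<ominus> (\<ominus> c \<otimes> g 1 1 t \<oplus> \<ominus> l \<otimes> g 2 0 t) \<in> mp 2"
      using mp_minus[OF _ r] by simp
    moreover have "(a' \<otimes> g 0 2 t \<oplus> (\<ominus> c \<otimes> g 1 1 t \<oplus> \<ominus> l \<otimes> g 2 0 t)) \<ominus> (\<ominus> c \<otimes> g 1 1 t \<oplus> \<ominus> l \<otimes> g 2 0 t) = g 0 2 t \<otimes> a'"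
      using vc(3-5)[of t] carr by algebra
    ultimately show ?thesis using a'_mp2[OF vc(5), of t] by simp
  qed
  show "g 2 0 \<in> vin R mx (b n)" "g 0 2 \<in> vin R mx (b n)" using v 2 3 by (auto simp: vin_def)
qed

lemma chain_zero: "chain n (\<lambda>_ _. zero_vec R)"
proof -
  have "D m (zero_vec R) = zero_vec R" if "m \<ge> 1" for m
  proof -
    interpret f: two_modules R "fm (b m)" "fm (b (m - 1))" "D m" by (rule D_two[OF that])
    show ?thesis using f.f_zero by simp
  qed
  moreover have "Dl (\<lambda>_ _. zero_vec R) i j = zero_vec R" for i j
    using carr al_carr ga_carr by (auto simp: Dl_def zero_vec_def fun_eq_iff)
  ultimately show ?thesis unfolding chain_def by auto
qed

lemma chain_add:
  assumes g: "chain n g" and h: "chain n h" shows "chain n (\<lambda>i j t. g i j t \<oplus> h i j t)"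
proof -
  have v: "(\<lambda>t. g i j t \<oplus> h i j t) \<in> vecs R (b (n - (i + j)))" if "i + j \<le> n" for i j
    using smod_add[OF module.smod_carrier[OF module_fm, of "b (n - (i + j))"], of "g i j" "h i j"] chainD(1)[OF g that] chainD(1)[OF h that] by simp
  have "D (n - (i + j)) (\<lambda>t. g i j t \<oplus> h i j t) = Dl (\<lambda>i j t. g i j t \<oplus> h i j t) i j" if ij: "i + j < n" for i j
  proof -
    have m: "n - (i + j) \<ge> 1" using ij by simp
    interpret f: two_modules R "fm (b (n - (i + j)))" "fm (b (n - (i + j) - 1))" "D (n - (i + j))" by (rule D_two[OF m])
    have gv: "g i j \<in> vecs R (b (n - (i + j)))" "h i j \<in> vecs R (b (n - (i + j)))" using chainD(1) g h ij by auto
    have "D (n - (i + j)) (\<lambda>t. g i j t \<oplus> h i j t) = (\<lambda>t. Dl g i j t \<oplus> Dl h i j t)"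
      using f.f_add[of "g i j" "h i j"] gv chainD(2)[OF g ij] chainD(2)[OF h ij] by simp
    also have "\<dots> = Dl (\<lambda>i j t. g i j t \<oplus> h i j t) i j"
    proof (rule Dl_add[symmetric, of _ _ _ "b (n - Suc (i + j))"])
      fix p q assume pq: "p + q = Suc (i + j)"
      show "g p q \<in> vecs R (b (n - Suc (i + j)))" "h p q \<in> vecs R (b (n - Suc (i + j)))"
        using chainD(1)[OF g, of p q] chainD(1)[OF h, of p q] pq ij by auto
    qed
    finally show ?thesis .
  qed
  then show ?thesis unfolding chain_def using v by blast
qed

lemma chain_smult:
  assumes g: "chain n g" and r: "r \<in> carrier R" shows "chain n (\<lambda>i j t. r \<otimes> g i j t)"
proof -
  have v: "(\<lambda>t. r \<otimes> g i j t) \<in> vecs R (b (n - (i + j)))" if "i + j \<le> n" for i j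
    using smod_smult[OF module.smod_carrier[OF module_fm, of "b (n - (i + j))"] r, of "g i j"] chainD(1)[OF g that] by simp
  have "D (n - (i + j)) (\<lambda>t. r \<otimes> g i j t) = Dl (\<lambda>i j t. r \<otimes> g i j t) i j" if ij: "i + j < n" for i j
  proof -
    have m: "n - (i + j) \<ge> 1" using ij by simp
    interpret f: two_modules R "fm (b (n - (i + j)))" "fm (b (n - (i + j) - 1))" "D (n - (i + j))" by (rule D_two[OF m])
    have gv: "g i j \<in> vecs R (b (n - (i + j)))" using chainD(1) g ij by auto
    have "D (n - (i + j)) (\<lambda>t. r \<otimes> g i j t) = (\<lambda>t. r \<otimes> Dl g i j t)"
      using f.f_smult[OF r, of "g i j"] gv chainD(2)[OF g ij] by simp
    also have "\<dots> = Dl (\<lambda>i j t. r \<otimes> g i j t) i j"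
    proof (rule Dl_smult[symmetric, of _ _ _ "b (n - Suc (i + j))", OF _ r])
      fix p q assume pq: "p + q = Suc (i + j)"
      show "g p q \<in> vecs R (b (n - Suc (i + j)))" using chainD(1)[OF g, of p q] pq ij by auto
    qed
    finally show ?thesis .
  qed
  then show ?thesis unfolding chain_def using v by blast
qed

definition tailA :: "nat \<Rightarrow> (nat \<Rightarrow> nat \<Rightarrow> 'a) \<Rightarrow> bool" where
  "tailA n \<mu> \<longleftrightarrow> (\<exists>g. chain n g \<and> (\<forall>i\<le>n. g i (n - i) = \<mu> i))"

definition tailB :: "nat \<Rightarrow> (nat \<Rightarrow> nat \<Rightarrow> 'a) \<Rightarrow> bool" where
  "tailB n \<mu> \<longleftrightarrow> (\<exists>g. chain n g \<and> g 0 0 \<in> vin R mx (b n) \<and> (\<forall>i\<le>n. g i (n - i) = \<mu> i))"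

lemma tuples_tailA: "tuples (b 0) tailA"
  unfolding tuples_def
proof (intro conjI allI impI)
  show "\<mu> i \<in> vecs R (b 0)" if "tailA n \<mu>" "i \<le> n" for n \<mu> i
    using that chainD(1)[of n _ i "n - i"] unfolding tailA_def by fastforce
  show "tailA n \<nu>" if "tailA n \<mu>" "\<forall>i\<le>n. \<nu> i = \<mu> i" for n \<mu> \<nu> using that unfolding tailA_def by auto
  show "tailA n (\<lambda>_. zero_vec R)" for n unfolding tailA_def using chain_zero by (intro exI[of _ "\<lambda>_ _. zero_vec R"]) auto
  show "tailA n (\<lambda>i t. \<mu> i t \<oplus> \<nu> i t)" if \<mu>: "tailA n \<mu>" and \<nu>: "tailA n \<nu>" for n \<mu> \<nu>
  proof -
    obtain g where g: "chain n g" "\<forall>i\<le>n. g i (n - i) = \<mu> i" using \<mu> unfolding tailA_def by blast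
    obtain h where h: "chain n h" "\<forall>i\<le>n. h i (n - i) = \<nu> i" using \<nu> unfolding tailA_def by blast
    show ?thesis unfolding tailA_def
      by (rule exI[of _ "\<lambda>i j t. g i j t \<oplus> h i j t"]) (use chain_add[OF g(1) h(1)] g h in auto)
  qed
  show "tailA n (\<lambda>i t. r \<otimes> \<mu> i t)" if r: "r \<in> carrier R" and \<mu>: "tailA n \<mu>" for n \<mu> r
  proof -
    obtain g where g: "chain n g" "\<forall>i\<le>n. g i (n - i) = \<mu> i" using \<mu> unfolding tailA_def by blast
    show ?thesis unfolding tailA_def
      by (rule exI[of _ "\<lambda>i j t. r \<otimes> g i j t"]) (use chain_smult[OF g(1) r] g in auto)
  qed
  fix n \<mu> assume "tailA (n + 2) \<mu>"
  then obtain g where g: "chain (n + 2) g" "\<forall>i\<le>n + 2. g i (n + 2 - i) = \<mu> i" unfolding tailA_def by blast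
  have "g (i + 2) (n - i) = \<mu> (i + 2)" if "i \<le> n" for i using g(2)[rule_format, of "i + 2"] that by simp
  then show "tailA n (\<lambda>i. \<mu> (i + 2))" unfolding tailA_def
    by (intro exI[of _ "\<lambda>i j. g (i + 2) j"]) (use chain_shift(1)[OF g(1)] in auto)
  have "g i (n - i + 2) = \<mu> i" if "i \<le> n" for i
  proof -
    have "n - i + 2 = n + 2 - i" using that by simp
    then show ?thesis using g(2)[rule_format, of i] that by simp
  qed
  then show "tailA n \<mu>" unfolding tailA_def
    by (intro exI[of _ "\<lambda>i j. g i (j + 2)"]) (use chain_shift(2)[OF g(1)] in auto)
qed

lemma tuples_tailB: "tuples (b 0) tailB"
  unfolding tuples_def
proof (intro conjI allI impI)
  have mxs: "smod R (fm n) (vin R mx n)" for n by (rule vin_smod[OF mx_ideal])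
  show "\<mu> i \<in> vecs R (b 0)" if "tailB n \<mu>" "i \<le> n" for n \<mu> i
    using that chainD(1)[of n _ i "n - i"] unfolding tailB_def by fastforce
  show "tailB n \<nu>" if "tailB n \<mu>" "\<forall>i\<le>n. \<nu> i = \<mu> i" for n \<mu> \<nu> using that unfolding tailB_def by auto
  show "tailB n (\<lambda>_. zero_vec R)" for n unfolding tailB_def using chain_zero smod_zero[OF mxs]
    by (intro exI[of _ "\<lambda>_ _. zero_vec R"]) auto
  show "tailB n (\<lambda>i t. \<mu> i t \<oplus> \<nu> i t)" if \<mu>: "tailB n \<mu>" and \<nu>: "tailB n \<nu>" for n \<mu> \<nu>
  proof -
    obtain g where g: "chain n g" "g 0 0 \<in> vin R mx (b n)" "\<forall>i\<le>n. g i (n - i) = \<mu> i" using \<mu> unfolding tailB_def by blast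
    obtain h where h: "chain n h" "h 0 0 \<in> vin R mx (b n)" "\<forall>i\<le>n. h i (n - i) = \<nu> i" using \<nu> unfolding tailB_def by blast
    show ?thesis unfolding tailB_def
      by (rule exI[of _ "\<lambda>i j t. g i j t \<oplus> h i j t"])
        (use chain_add[OF g(1) h(1)] smod_add[OF mxs g(2) h(2)] g h in auto)
  qed
  show "tailB n (\<lambda>i t. r \<otimes> \<mu> i t)" if r: "r \<in> carrier R" and \<mu>: "tailB n \<mu>" for n \<mu> r
  proof -
    obtain g where g: "chain n g" "g 0 0 \<in> vin R mx (b n)" "\<forall>i\<le>n. g i (n - i) = \<mu> i" using \<mu> unfolding tailB_def by blast
    show ?thesis unfolding tailB_def
      by (rule exI[of _ "\<lambda>i j t. r \<otimes> g i j t"]) (use chain_smult[OF g(1) r] smod_smult[OF mxs r g(2)] g in auto)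
  qed
  fix n \<mu> assume "tailB (n + 2) \<mu>"
  then obtain g where g: "chain (n + 2) g" "g 0 0 \<in> vin R mx (b (n + 2))" "\<forall>i\<le>n + 2. g i (n + 2 - i) = \<mu> i"
    unfolding tailB_def by blast
  note ls = chain_lead_shift[OF g(1,2)]
  have "g (i + 2) (n - i) = \<mu> (i + 2)" if "i \<le> n" for i using g(3)[rule_format, of "i + 2"] that by simp
  then show "tailB n (\<lambda>i. \<mu> (i + 2))" unfolding tailB_def
    by (intro exI[of _ "\<lambda>i j. g (i + 2) j"]) (use chain_shift(1)[OF g(1)] ls in \<open>auto simp: numeral_2_eq_2\<close>)
  have "g i (n - i + 2) = \<mu> i" if "i \<le> n" for i
  proof -
    have "n - i + 2 = n + 2 - i" using that by simp
    then show ?thesis using g(3)[rule_format, of i] that by simp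
  qed
  then show "tailB n \<mu>" unfolding tailB_def
    by (intro exI[of _ "\<lambda>i j. g i (j + 2)"]) (use chain_shift(2)[OF g(1)] ls in \<open>auto simp: numeral_2_eq_2\<close>)
qed

text \<open>The families \<open>tailC d\<close> decrease to \<open>tailB\<close> as \<open>d\<close> grows, so by the chain condition \<open>tailB\<close> is determined
  inside \<open>tailA\<close> by finitely many degrees.\<close>

definition tailC :: "nat \<Rightarrow> nat \<Rightarrow> (nat \<Rightarrow> nat \<Rightarrow> 'a) \<Rightarrow> bool" where
  "tailC d n \<mu> \<longleftrightarrow> tailA n \<mu> \<and> (\<forall>p q m. n = m + 2 * (p + q) \<longrightarrow> m \<le> d \<longrightarrow> tailB m (\<lambda>i. \<mu> (i + 2 * p)))"

lemma tuples_tailC: "tuples (b 0) (tailC d)"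
  unfolding tuples_def
proof (intro conjI allI impI)
  note A = tuplesD[OF tuples_tailA] and B = tuplesD[OF tuples_tailB]
  show "\<mu> i \<in> vecs R (b 0)" if "tailC d n \<mu>" "i \<le> n" for n \<mu> i using that A(1) unfolding tailC_def by blast
  show "tailC d n \<nu>" if \<mu>: "tailC d n \<mu>" and eq: "\<forall>i\<le>n. \<nu> i = \<mu> i" for n \<mu> \<nu>
    unfolding tailC_def
  proof (intro conjI allI impI)
    show "tailA n \<nu>" using \<mu> eq A(2)[of n \<mu> \<nu>] unfolding tailC_def by blast
    fix p q m assume h: "n = m + 2 * (p + q)" "m \<le> d"
    have "tailB m (\<lambda>i. \<mu> (i + 2 * p))" using \<mu> h unfolding tailC_def by blast
    then show "tailB m (\<lambda>i. \<nu> (i + 2 * p))" by (rule B(2)) (use eq h in auto)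
  qed
  show "tailC d n (\<lambda>_. zero_vec R)" for n using A(3) B(3) unfolding tailC_def by blast
  show "tailC d n (\<lambda>i t. \<mu> i t \<oplus> \<nu> i t)" if "tailC d n \<mu>" "tailC d n \<nu>" for n \<mu> \<nu>
    unfolding tailC_def
  proof (intro conjI allI impI)
    show "tailA n (\<lambda>i t. \<mu> i t \<oplus> \<nu> i t)" using that A(4) unfolding tailC_def by blast
    fix p q m assume h: "n = m + 2 * (p + q)" "m \<le> d"
    show "tailB m (\<lambda>i t. \<mu> (i + 2 * p) t \<oplus> \<nu> (i + 2 * p) t)"
      using that h unfolding tailC_def by (intro B(4)) blast+
  qed
  show "tailC d n (\<lambda>i t. r \<otimes> \<mu> i t)" if "r \<in> carrier R" "tailC d n \<mu>" for n \<mu> r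
    unfolding tailC_def
  proof (intro conjI allI impI)
    show "tailA n (\<lambda>i t. r \<otimes> \<mu> i t)" using that A(5) unfolding tailC_def by blast
    fix p q m assume h: "n = m + 2 * (p + q)" "m \<le> d"
    show "tailB m (\<lambda>i t. r \<otimes> \<mu> (i + 2 * p) t)" using that h unfolding tailC_def by (intro B(5)) blast+
  qed
  fix n \<mu> assume \<mu>: "tailC d (n + 2) \<mu>"
  show "tailC d n (\<lambda>i. \<mu> (i + 2))" unfolding tailC_def
  proof (intro conjI allI impI)
    show "tailA n (\<lambda>i. \<mu> (i + 2))" using \<mu> A(6) unfolding tailC_def by blast
    fix p q m assume h: "n = m + 2 * (p + q)" "m \<le> d"
    have "n + 2 = m + 2 * (Suc p + q)" using h by simp
    then have "tailB m (\<lambda>i. \<mu> (i + 2 * Suc p))" using \<mu> h unfolding tailC_def by blast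
    then show "tailB m (\<lambda>i. \<mu> (i + 2 * p + 2))" by (simp add: add.commute add.left_commute)
  qed
  show "tailC d n \<mu>" unfolding tailC_def
  proof (intro conjI allI impI)
    show "tailA n \<mu>" using \<mu> A(7) unfolding tailC_def by blast
    fix p q m assume h: "n = m + 2 * (p + q)" "m \<le> d"
    have "n + 2 = m + 2 * (p + Suc q)" using h by simp
    then show "tailB m (\<lambda>i. \<mu> (i + 2 * p))" using \<mu> h unfolding tailC_def by blast
  qed
qed

lemma tailB_shifts: "tailB (m + 2 * (p + q)) \<mu> \<Longrightarrow> tailB m (\<lambda>i. \<mu> (i + 2 * p))"
proof (induction p arbitrary: \<mu>)
  case 0
  then show ?case
  proof (induction q)
    case (Suc q)
    then show ?case using tuplesD(7)[OF tuples_tailB, of "m + 2 * (0 + q)" \<mu>] by (simp add: add.commute add.left_commute)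
  qed simp
next
  case (Suc p)
  have "m + 2 * (Suc p + q) = m + 2 * (p + q) + 2" by simp
  then have "tailB (m + 2 * (p + q)) (\<lambda>i. \<mu> (i + 2))"
    using tuplesD(6)[OF tuples_tailB, of "m + 2 * (p + q)" \<mu>] Suc.prems by metis
  then have "tailB m (\<lambda>i. \<mu> (i + 2 * p + 2))" by (rule Suc.IH)
  then show ?case by (simp add: add.commute add.left_commute)
qed

text \<open>Both double shifts of the chain belonging to w have leads in m F, so its tail satisfies
  every condition of \<open>tailC\<close> in low degrees. Beyond the stabilisation bound these
  conditions imply \<open>tailB\<close> in degree n: some chain with lead in m F has the same tail.
  The difference of the two chains has tail zero, so its lead is in m F, and then so is w.\<close>

theorem linear_boundary_eventually:
  "\<exists>n0\<ge>1. \<forall>n\<ge>n0. \<forall>w\<in>vecs R (b n). D n w \<in> vin R (mp 2) (b (n - 1)) \<longrightarrow> w \<in> vin R mx (b n)"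
proof -
  have "\<exists>d0. \<forall>d\<ge>d0. \<forall>n \<mu>. tailC d0 n \<mu> \<longrightarrow> tailC d n \<mu>"
    by (rule tuples_dcc[OF tuples_tailC]) (auto simp: tailC_def)
  then obtain d0 where d0: "\<And>d n \<mu>. d \<ge> d0 \<Longrightarrow> tailC d0 n \<mu> \<Longrightarrow> tailC d n \<mu>" by blast
  \<comment> \<open>As n exceeds d0, the conditions in \<open>tailC d0\<close> concern only proper
    shifts, with p + q at least 1, and these pass through level n - 2.\<close>
  have "w \<in> vin R mx (b n)" if n: "n \<ge> d0 + 2" and w: "w \<in> vecs R (b n)" and dw: "D n w \<in> vin R (mp 2) (b (n - 1))" for n w
  proof -
    obtain n' where n': "n = n' + 2" using n by (metis add.commute le_Suc_ex add.assoc)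
    obtain g where g: "chain n g" "g 0 0 = w" "\<And>i j. 1 \<le> i + j \<Longrightarrow> i + j \<le> n \<Longrightarrow> g i j \<in> vin R mx (b (n - (i + j)))"
      using primitive_chain[OF _ w dw] n by auto
    define \<mu> where "\<mu> i = g i (n - i)" for i
    have g': "chain (n' + 2) g" using g n' by simp
    have g2: "g 2 0 \<in> vin R mx (b n')" "g 0 2 \<in> vin R mx (b n')" using g(3)[of 2 0] g(3)[of 0 2] n' by auto
    have s1: "tailB n' (\<lambda>i. \<mu> (i + 2))" unfolding tailB_def
      by (rule exI[of _ "\<lambda>i j. g (i + 2) j"]) (use chain_shift(1)[OF g'] g2 n' in \<open>auto simp: \<mu>_def numeral_2_eq_2\<close>)
    have s2: "tailB n' \<mu>" unfolding tailB_def
      by (rule exI[of _ "\<lambda>i j. g i (j + 2)"])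
        (use chain_shift(2)[OF g'] g2 n' in \<open>auto simp: \<mu>_def numeral_2_eq_2 Suc_diff_le\<close>)
    have A: "tailA n \<mu>" unfolding tailA_def \<mu>_def using g(1) by blast
    have "tailC d0 n \<mu>" unfolding tailC_def
    proof (intro conjI allI impI A)
      fix p q m assume h: "n = m + 2 * (p + q)" "m \<le> d0"
      show "tailB m (\<lambda>i. \<mu> (i + 2 * p))"
      proof (cases p)
        case (Suc p')
        have "n' = m + 2 * (p' + q)" using h n' Suc by simp
        then have "tailB m (\<lambda>i. \<mu> (i + 2 * p' + 2))" using tailB_shifts[of m p' q "\<lambda>i. \<mu> (i + 2)"] s1 by simp
        then show ?thesis using Suc by (simp add: add.commute add.left_commute)
      next
        case 0
        then obtain q' where "q = Suc q'" using h n by (cases q) auto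
        then have "n' = m + 2 * (0 + q')" using h n' 0 by simp
        then show ?thesis using tailB_shifts[of m 0 q' \<mu>] s2 0 by simp
      qed
    qed
    then have "tailC n n \<mu>" using d0[of n] n by simp
    moreover have "n = n + 2 * (0 + 0)" by simp
    ultimately have "tailB n (\<lambda>i. \<mu> (i + 2 * 0))" unfolding tailC_def by (elim conjE allE impE) (assumption, simp)
    then obtain h where h: "chain n h" "h 0 0 \<in> vin R mx (b n)" "\<And>i. i \<le> n \<Longrightarrow> h i (n - i) = \<mu> i"
      unfolding tailB_def by auto
    \<comment> \<open>The difference of two chains with equal tails.\<close>
    let ?k = "\<lambda>i j t. g i j t \<oplus> \<ominus> \<one> \<otimes> h i j t"
    have k: "chain n ?k" by (rule chain_add[OF g(1) chain_smult[OF h(1)]]) simp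
    have "?k i (n - i) = zero_vec R" if "i \<le> n" for i
    proof -
      have "g i (n - i) \<in> vecs R (b (n - (i + (n - i))))" using chainD(1)[OF g(1), of i "n - i"] that by simp
      then have "\<And>t. g i (n - i) t \<in> carrier R" using vecs_carr by blast
      then show ?thesis using h(3)[OF that] unfolding \<mu>_def by (simp add: zero_vec_def l_minus r_neg)
    qed
    moreover have "zero_vec R \<in> D 1 ` vecs R (b 1)"
    proof -
      interpret f: two_modules R "fm (b 1)" "fm (b (1 - 1))" "D 1" by (rule D_two) simp
      show ?thesis using f.f_zero zero_vecs by (metis free_module_simps(2) image_eqI)
    qed
    ultimately have "?k 0 0 \<in> vin R mx (b n)" using chain_lead_trivial[OF k] by metis
    then have "(\<lambda>t. ?k 0 0 t \<oplus> h 0 0 t) \<in> vin R mx (b n)" using smod_add[OF vin_smod[OF mx_ideal] _ h(2)] by simp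
    moreover have "(\<lambda>t. ?k 0 0 t \<oplus> h 0 0 t) = w"
    proof
      fix t
      have "h 0 0 t \<in> carrier R" "w t \<in> carrier R" using vecs_carr w vecs_carr[OF vin_carr[OF h(2)]] by auto
      then show "?k 0 0 t \<oplus> h 0 0 t = w t" using g(2) by (simp add: l_minus a_assoc l_neg)
    qed
    ultimately show ?thesis by simp
  qed
  then show ?thesis by (intro exI[of _ "d0 + 2"]) auto
qed

text \<open>For n at least 1 the tail of the chain from \<open>primitive_chain\<close> differs from
  its lead and so lies in m F_0, which is the image of D 1.\<close>

lemma linear_boundary_residue:
  assumes D1: "D 1 ` vecs R (b 1) = vin R mx (b 0)" and n: "n \<ge> 1" and w: "w \<in> vecs R (b n)"
    and dw: "D n w \<in> vin R (mp 2) (b (n - 1))"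
  shows "w \<in> vin R mx (b n)"
proof -
  obtain g where g: "chain n g" "g 0 0 = w" "\<And>i j. 1 \<le> i + j \<Longrightarrow> i + j \<le> n \<Longrightarrow> g i j \<in> vin R mx (b (n - (i + j)))"
    using primitive_chain[OF n w dw] by auto
  have "g i (n - i) \<in> D 1 ` vecs R (b 1)" if "i \<le> n" for i
    using g(3)[of i "n - i"] that n D1 by simp
  then show ?thesis using chain_lead_trivial[OF g(1)] g(2) by blast
qed

end

section \<open>High syzygies are strict\<close>

context min_complex
begin

text \<open>The syzygy inside F_n; for n at least 1 it is the kernel of \<open>D n\<close>.\<close>

definition Om :: "nat \<Rightarrow> (nat \<Rightarrow> 'a) set" where
  "Om n = D (Suc n) ` vecs R (b (Suc n))"

text \<open>Equivalently, the image of \<open>D n\<close> meets m^2 F_(n-1) only in m times itself;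
  see \<open>Om_mp2\<close>.\<close>

definition linear_gens :: "nat \<Rightarrow> bool" where
  "linear_gens n \<longleftrightarrow> (\<forall>w\<in>vecs R (b n). D n w \<in> vin R (mp 2) (b (n - 1)) \<longrightarrow> w \<in> vin R mx (b n))"

text \<open>The right-hand side is m^2 \<open>Om n\<close>: the top power m^3 F_n is already reached
  by the m-adic filtration of the syzygy.\<close>

definition strict_socle :: "nat \<Rightarrow> bool" where
  "strict_socle n \<longleftrightarrow> vin R (mp 3) (b n) \<subseteq> D (Suc n) ` vin R (mp 2) (b (Suc n))"

abbreviation L :: "nat \<Rightarrow> (nat \<Rightarrow> 'a) set \<Rightarrow> (nat \<Rightarrow> 'a) set \<Rightarrow> nat" where
  "L n \<equiv> slen R (fm (b n))"

text \<open>For the n-th syzygy M = D F_n, the lengths of m M and, in \<open>qn\<close>, of m^2 M.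
  As M lies in m F_(n-1), m^3 M = 0; so the Hilbert function of M is given by \<open>b n\<close>,
  \<open>pn n - qn n\<close> and \<open>qn n\<close>.\<close>

definition pn :: "nat \<Rightarrow> nat" where "pn n = L (n - 1) {zero_vec R} (D n ` vin R mx (b n))"

definition qn :: "nat \<Rightarrow> nat" where "qn n = L (n - 1) {zero_vec R} (D n ` vin R (mp 2) (b n))"

lemma D_smod: "n \<ge> 1 \<Longrightarrow> smod R (fm (b n)) A \<Longrightarrow> smod R (fm (b (n - 1))) (D n ` A)"
  by (rule two_modules.smod_image[OF D_two])

lemma Om_smod: "smod R (fm (b n)) (Om n)"
  using D_smod[of "Suc n" "vecs R (b (Suc n))"] module.smod_carrier[OF module_fm, of "b (Suc n)"] by (simp add: Om_def)

lemma vecs_smod: "smod R (fm n) (vecs R n)"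
  using module.smod_carrier[OF module_fm, of n] by simp

lemma zero_smod: "smod R (fm n) {zero_vec R}"
  using module.smod_zero_mod[OF module_fm, of n] by simp

lemma Om_mx: "Om n \<subseteq> vin R mx (b n)"
  using D_mx[of "Suc n"] by (auto simp: Om_def)

lemma Om_ker: "n \<ge> 1 \<Longrightarrow> v \<in> vecs R (b n) \<Longrightarrow> D n v = zero_vec R \<longleftrightarrow> v \<in> Om n"
  using D_exact[of n v] D_D[of n] by (auto simp: Om_def)

lemma D_Om: "n \<ge> 1 \<Longrightarrow> D n ` Om n = {zero_vec R}"
proof -
  assume n: "n \<ge> 1"
  have "D n v = zero_vec R" if "v \<in> Om n" for v using Om_ker[OF n] smod_carr[OF Om_smod that] that by simp
  then show ?thesis using smod_zero[OF Om_smod[of n]] by auto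
qed

lemma L_D:
  assumes n: "n \<ge> 1" and A: "smod R (fm (b n)) A" and B: "smod R (fm (b n)) B" "A \<subseteq> B" and OA: "Om n \<subseteq> A"
  shows "L (n - 1) (D n ` A) (D n ` B) = L n A B"
  by (rule slen_image[OF fmodule_fm module_fm D_lin[OF n] A B])
    (use Om_ker[OF n] OA smod_carr[OF B(1)] in auto)

lemma D_msum_Om:
  assumes n: "n \<ge> 1" and A: "smod R (fm (b n)) A"
  shows "D n ` msum (fm (b n)) A (Om n) = D n ` A"
proof
  interpret f: two_modules R "fm (b n)" "fm (b (n - 1))" "D n" by (rule D_two[OF n])
  show "D n ` A \<subseteq> D n ` msum (fm (b n)) A (Om n)" using f.M.msum_ub1[OF A Om_smod] by blast
  show "D n ` msum (fm (b n)) A (Om n) \<subseteq> D n ` A"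
  proof
    fix z assume "z \<in> D n ` msum (fm (b n)) A (Om n)"
    then obtain x y where xy: "x \<in> A" "y \<in> Om n" "z = D n (x \<oplus>\<^bsub>fm (b n)\<^esub> y)" by (auto simp: msum_def)
    have "D n y = zero_vec R" using Om_ker[OF n] smod_carr[OF Om_smod xy(2)] xy(2) by simp
    then have "z = D n x" using xy f.f_add[of x y] smod_carr[OF A xy(1)] smod_carr[OF Om_smod xy(2)]
      f.N.M.r_zero[of "D n x"] f.f_closed[of x] by simp
    then show "z \<in> D n ` A" using xy by blast
  qed
qed

lemma L_vin: "smod R slf I \<Longrightarrow> smod R slf J \<Longrightarrow> I \<subseteq> J \<Longrightarrow> L n (vin R I (b n)) (vin R J (b n)) = ln I J * b n"
  by (rule slen_vin)

lemma vmp: "smod R (fm n) (vin R (mp k) n)" by (rule vin_smod[OF mp_ideal])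

lemma vmx: "smod R (fm n) (vin R mx n)" by (rule vin_smod[OF mx_ideal])

lemma Om_mp2: "linear_gens (Suc n) \<Longrightarrow> Om n \<inter> vin R (mp 2) (b n) = D (Suc n) ` vin R mx (b (Suc n))"
proof
  assume k: "linear_gens (Suc n)"
  show "Om n \<inter> vin R (mp 2) (b n) \<subseteq> D (Suc n) ` vin R mx (b (Suc n))"
    using k unfolding linear_gens_def Om_def by auto
  show "D (Suc n) ` vin R mx (b (Suc n)) \<subseteq> Om n \<inter> vin R (mp 2) (b n)"
    using D_mp[of "Suc n" _ 1] mp_1 vin_carr by (auto simp: Om_def numeral_2_eq_2)
qed

lemma L_Om: "L n (D (Suc n) ` vin R mx (b (Suc n))) (Om n) = b (Suc n)"
proof -
  have "L n (D (Suc n) ` vin R mx (b (Suc n))) (D (Suc n) ` vecs R (b (Suc n))) = L (Suc n) (vin R mx (b (Suc n))) (vecs R (b (Suc n)))"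
    using L_D[of "Suc n", OF _ vmx vecs_smod _ Om_mx] vin_carr by auto
  also have "\<dots> = ln mx (carrier R) * b (Suc n)"
    using L_vin[OF mx_smod smodC, of "Suc n"] mx_carr vin_carrier by auto
  finally show ?thesis using ln_mp by (simp add: Om_def)
qed

abbreviation U :: "nat \<Rightarrow> (nat \<Rightarrow> 'a) set" where
  "U n \<equiv> msum (fm (b n)) (vin R (mp 2) (b n)) (Om n)"

lemma U_facts: "smod R (fm (b n)) (U n)" "vin R (mp 2) (b n) \<subseteq> U n" "Om n \<subseteq> U n" "U n \<subseteq> vin R mx (b n)"
proof -
  interpret M: module R "fm (b n)" by (rule module_fm)
  show "smod R (fm (b n)) (U n)" by (rule M.smod_msum[OF vmp Om_smod])
  show "vin R (mp 2) (b n) \<subseteq> U n" by (rule M.msum_ub1[OF vmp Om_smod])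
  show "Om n \<subseteq> U n" by (rule M.msum_ub2[OF vmp Om_smod])
  show "U n \<subseteq> vin R mx (b n)" by (rule M.msum_least[OF vmx vin_mono[OF mp2_mx] Om_mx])
qed

lemma qn_U: "n \<ge> 1 \<Longrightarrow> qn n = L n (Om n) (U n)"
  using L_D[of n "Om n" "U n"] U_facts[of n] Om_smod D_Om[of n] D_msum_Om[OF _ vmp, of n 2] by (simp add: qn_def)

lemma pn_U: "n \<ge> 1 \<Longrightarrow> pn n = qn n + L n (U n) (vin R mx (b n))"
proof -
  assume n: "n \<ge> 1"
  interpret F: fmodule R "fm (b n)" by (rule fmodule_fm)
  have "pn n = L n (Om n) (vin R mx (b n))"
    using L_D[OF n Om_smod vmx Om_mx] D_Om[OF n] by (simp add: pn_def)
  also have "\<dots> = L n (Om n) (U n) + L n (U n) (vin R mx (b n))"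
    by (rule F.slen_add[OF Om_smod U_facts(1) vmx U_facts(3,4)])
  finally show ?thesis using qn_U[OF n] by simp
qed

text \<open>Because of \<open>linear_gens\<close>, all b (n + 1) minimal generators of
  \<open>Om n\<close> stay independent in m F/m^2 F, which has length e b_n.\<close>

lemma U_betti: assumes "linear_gens (Suc n)" shows "L n (U n) (vin R mx (b n)) + b (Suc n) = e * b n"
proof -
  interpret F: fmodule R "fm (b n)" by (rule fmodule_fm)
  have comm: "msum (fm (b n)) (Om n) (vin R (mp 2) (b n)) = U n"
    by (rule equalityI; rule F.msum_least)
      (use U_facts[of n] F.smod_msum[OF Om_smod vmp] F.msum_ub1[OF Om_smod vmp] F.msum_ub2[OF Om_smod vmp] in auto)
  have "L n (vin R (mp 2) (b n)) (U n) = b (Suc n)"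
    using F.slen_diamond[OF Om_smod vmp[of "b n" 2]] Om_mp2[OF assms] L_Om[of n] comm by simp
  moreover have "L n (vin R (mp 2) (b n)) (vin R mx (b n)) = L n (vin R (mp 2) (b n)) (U n) + L n (U n) (vin R mx (b n))"
    by (rule F.slen_add[OF vmp U_facts(1) vmx U_facts(2,4)])
  moreover have "L n (vin R (mp 2) (b n)) (vin R mx (b n)) = e * b n"
    using L_vin[OF mp_smod mx_smod mp2_mx] ln_mp by simp
  ultimately show ?thesis by simp
qed

text \<open>The length (e + 1) b_n of m^2 F_n is cut at its intersection with \<open>Om n\<close>,
  which is m \<open>Om n\<close> by \<open>Om_mp2\<close>.\<close>

lemma qn_pn: assumes n: "n \<ge> 1" and k: "linear_gens (Suc n)" shows "qn n + pn (Suc n) = (e + 1) * b n"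
proof -
  interpret F: fmodule R "fm (b n)" by (rule fmodule_fm)
  let ?I = "D (Suc n) ` vin R mx (b (Suc n))"
  have I: "smod R (fm (b n)) ?I" using D_smod[of "Suc n", OF _ vmx] by simp
  have I2: "?I \<subseteq> vin R (mp 2) (b n)" using Om_mp2[OF k] by blast
  have "qn n = L n (vin R (mp 2) (b n) \<inter> Om n) (vin R (mp 2) (b n))"
    using qn_U[OF n] F.slen_diamond[OF vmp Om_smod] by simp
  also have "vin R (mp 2) (b n) \<inter> Om n = ?I" using Om_mp2[OF k] by blast
  finally have "qn n = L n ?I (vin R (mp 2) (b n))" .
  moreover have "L n {zero_vec R} (vin R (mp 2) (b n)) = L n {zero_vec R} ?I + L n ?I (vin R (mp 2) (b n))"
    by (rule F.slen_add[OF zero_smod I vmp _ I2]) (use smod_zero[OF I] in simp)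
  moreover have "L n {zero_vec R} (vin R (mp 2) (b n)) = (e + 1) * b n"
    using L_vin[OF smod0 mp_smod, of 2 n] mp_zero vin_zero ln_mp by simp
  ultimately show ?thesis by (simp add: pn_def)
qed

lemma qn_le: "qn (Suc n) \<le> b n" and qn_eq: "qn (Suc n) = b n \<Longrightarrow> strict_socle n"
proof -
  interpret F: fmodule R "fm (b n)" by (rule fmodule_fm)
  let ?I = "D (Suc n) ` vin R (mp 2) (b (Suc n))"
  have I: "smod R (fm (b n)) ?I" using D_smod[of "Suc n", OF _ vmp] by simp
  have I3: "?I \<subseteq> vin R (mp 3) (b n)" using D_mp[of "Suc n" _ 2] by (auto simp: numeral_3_eq_3)
  have "L n {zero_vec R} (vin R (mp 3) (b n)) = L n {zero_vec R} ?I + L n ?I (vin R (mp 3) (b n))"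
    by (rule F.slen_add[OF zero_smod I vmp _ I3]) (use smod_zero[OF I] in simp)
  moreover have "L n {zero_vec R} (vin R (mp 3) (b n)) = b n"
    using L_vin[OF smod0 mp_smod, of 3 n] mp_zero vin_zero ln_mp by simp
  ultimately have eq: "b n = qn (Suc n) + L n ?I (vin R (mp 3) (b n))" by (simp add: qn_def)
  then show "qn (Suc n) \<le> b n" by simp
  assume "qn (Suc n) = b n"
  then have "L n ?I (vin R (mp 3) (b n)) = 0" using eq by simp
  then show "strict_socle n" unfolding strict_socle_def using F.slen_eq_0[OF I vmp I3] by simp
qed

text \<open>The alternating sum of the Hilbert function of the \<open>n\<close>-th syzygy.\<close>

definition psi :: "nat \<Rightarrow> int" where "psi n = int (b n) - int (pn n) + 2 * int (qn n)"

text \<open>F_n is an extension of the n-th syzygy by \<open>Om n\<close>, and H_R(-1) = 0 cancels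
  the contribution of F_n. What remains is twice the length of m^3 F_n modulo m^2
  \<open>Om n\<close>, the defect of \<open>strict_socle n\<close>.\<close>

lemma psi_step: assumes n: "n \<ge> 1" and k: "linear_gens (Suc n)" shows "psi n - psi (Suc n) = 2 * (int (b n) - int (qn (Suc n)))"
proof -
  have "int (pn n) = int (qn n) + (int e * int (b n) - int (b (Suc n)))"
    using pn_U[OF n] arg_cong[OF U_betti[OF k], of int] by simp
  moreover have "int (qn n) + int (pn (Suc n)) = (int e + 1) * int (b n)"
    using arg_cong[OF qn_pn[OF n k], of int] by (simp add: algebra_simps)
  ultimately show ?thesis unfolding psi_def by (simp add: algebra_simps)
qed

end

section \<open>Homology of multiplication by the exact pair on syzygies\<close>

context orthogonal_complex
begin

text \<open>An ordered version of the pair, because a and a' exchange roles whenever the homological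
  degree rises by one.\<close>

definition exact_elts :: "'a \<Rightarrow> 'a \<Rightarrow> bool" where
  "exact_elts y y' \<longleftrightarrow> y \<in> mx \<and> y' \<in> mx \<and> y' \<otimes> y = \<zero> \<and> (\<forall>x\<in>carrier R. y' \<otimes> x = \<zero> \<longrightarrow> (\<exists>u\<in>carrier R. x = y \<otimes> u)) \<and>
     (\<forall>x\<in>carrier R. y \<otimes> x = \<zero> \<longrightarrow> (\<exists>u\<in>carrier R. x = y' \<otimes> u)) \<and> (\<forall>r\<in>carrier R. y \<otimes> r \<in> mp 2 \<longrightarrow> r \<in> mx)"

lemma exact_eltsI:
  assumes "y \<in> mx" "y' \<in> mx" "y \<otimes> y' = \<zero>"
    and 1: "\<And>x. x \<in> carrier R \<Longrightarrow> x \<otimes> y = \<zero> \<Longrightarrow> \<exists>u\<in>carrier R. x = u \<otimes> y'"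
    and 2: "\<And>x. x \<in> carrier R \<Longrightarrow> x \<otimes> y' = \<zero> \<Longrightarrow> \<exists>u\<in>carrier R. x = u \<otimes> y"
    and 3: "\<And>r. r \<in> carrier R \<Longrightarrow> r \<otimes> y \<in> mp 2 \<Longrightarrow> r \<in> mx"
  shows "exact_elts y y'"
proof -
  have c: "y \<in> carrier R" "y' \<in> carrier R" using mx_carr assms(1,2) by auto
  show ?thesis
    unfolding exact_elts_def
  proof (intro conjI ballI impI)
    show "y' \<otimes> y = \<zero>" using assms(3) m_comm[OF c] by simp
    show "\<exists>u\<in>carrier R. x = y \<otimes> u" if x: "x \<in> carrier R" "y' \<otimes> x = \<zero>" for x
      using 2[OF x(1)] m_comm[OF c(2) x(1)] x(2) m_comm[OF c(1)] by auto
    show "\<exists>u\<in>carrier R. x = y' \<otimes> u" if x: "x \<in> carrier R" "y \<otimes> x = \<zero>" for x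
      using 1[OF x(1)] m_comm[OF c(1) x(1)] x(2) m_comm[OF c(2)] by auto
    show "r \<in> mx" if r: "r \<in> carrier R" "y \<otimes> r \<in> mp 2" for r
      using 3[OF r(1)] m_comm[OF c(1) r(1)] r(2) by simp
  qed (use assms in simp_all)
qed

lemma exact_elts_a: "exact_elts a a'"
  by (rule exact_eltsI[OF mem(1,2) aa' ann1 ann2 a_mp2])

lemma exact_elts_a': "exact_elts a' a"
  by (rule exact_eltsI[OF mem(2,1) _ ann2 ann1 a'_mp2]) (use aa' m_comm[OF carr(1,2)] in simp)

abbreviation sm :: "'a \<Rightarrow> (nat \<Rightarrow> 'a) \<Rightarrow> nat \<Rightarrow> 'a" where "sm y v \<equiv> (\<lambda>t. y \<otimes> v t)"

lemma sm_lin: "y \<in> carrier R \<Longrightarrow> linear_map R (fm n) (fm n) (sm y)"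
  unfolding linear_map_def by (auto simp: vecs_carr vecs_ge r_distr m_lcomm intro!: vecsI)

lemma sm_two: "y \<in> carrier R \<Longrightarrow> two_modules R (fm n) (fm n) (sm y)"
  by (intro two_modules.intro module_fm two_modules_axioms.intro sm_lin)

lemma sm_smod: "y \<in> carrier R \<Longrightarrow> smod R (fm n) A \<Longrightarrow> smod R (fm n) (sm y ` A)"
  by (rule two_modules.smod_image[OF sm_two])

lemma exact_elts_carr: "exact_elts y y' \<Longrightarrow> y \<in> carrier R" "exact_elts y y' \<Longrightarrow> y' \<in> carrier R"
  unfolding exact_elts_def using mx_carr by auto

lemma exact_elts_ker:
  assumes "exact_elts y y'" "v \<in> vecs R n"
  shows "sm y' v = zero_vec R \<longleftrightarrow> v \<in> sm y ` vecs R n" and "sm y v = zero_vec R \<longleftrightarrow> v \<in> sm y' ` vecs R n"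
proof -
  have vc: "v t \<in> carrier R" for t using vecs_carr[OF assms(2)] .
  have *: "sm z' v = zero_vec R \<longleftrightarrow> v \<in> sm z ` vecs R n"
    if z: "z \<in> carrier R" "z' \<in> carrier R" "z' \<otimes> z = \<zero>" and ann: "\<forall>x\<in>carrier R. z' \<otimes> x = \<zero> \<longrightarrow> (\<exists>u\<in>carrier R. x = z \<otimes> u)" for z z'
  proof
    assume h: "sm z' v = zero_vec R"
    then have "z' \<otimes> v t = \<zero>" for t by (metis zero_vec_def)
    then have "\<exists>u\<in>carrier R. v t = z \<otimes> u" for t using ann vc by blast
    then obtain u where u: "u \<in> vin R (carrier R) n" "\<forall>t<n. v t = z \<otimes> u t" using vchoice[of "carrier R" "\<lambda>t u. v t = z \<otimes> u" n] by blast
    have uv: "u \<in> vecs R n" using vin_carr[OF u(1)] .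
    have "v = sm z u"
    proof
      fix t show "v t = z \<otimes> u t" using u(2) vecs_ge[OF uv, of t] vecs_ge[OF assms(2), of t] z by (cases "t < n") auto
    qed
    then show "v \<in> sm z ` vecs R n" using uv by blast
  next
    assume "v \<in> sm z ` vecs R n"
    then obtain u where u: "u \<in> vecs R n" "v = sm z u" by blast
    have "z' \<otimes> (z \<otimes> u t) = \<zero>" for t using z vecs_carr[OF u(1)] by (simp flip: m_assoc)
    then show "sm z' v = zero_vec R" using u by (simp add: zero_vec_def)
  qed
  note c = exact_elts_carr[OF assms(1)]
  show "sm y' v = zero_vec R \<longleftrightarrow> v \<in> sm y ` vecs R n" by (rule *) (use assms(1) c in \<open>auto simp: exact_elts_def\<close>)
  have yy: "y \<otimes> y' = \<zero>" using assms(1) m_comm[OF c] by (simp add: exact_elts_def)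
  show "sm y v = zero_vec R \<longleftrightarrow> v \<in> sm y' ` vecs R n" by (rule *) (use assms(1) c yy in \<open>auto simp: exact_elts_def\<close>)
qed

lemma sm_vin: "y \<in> mx \<Longrightarrow> v \<in> vin R (mp k) n \<Longrightarrow> sm y v \<in> vin R (mp (Suc k)) n"
proof -
  assume h: "y \<in> mx" "v \<in> vin R (mp k) n"
  have "sm y v \<in> vecs R n" using smod_smult[OF vecs_smod mx_carr[OF h(1)], of v n] vin_carr[OF h(2)] by simp
  then show ?thesis using mx_mult[OF h(1) vin_mem[OF mp_ideal h(2)]] by (simp add: vin_def)
qed

lemma sm_vin0: "y \<in> mx \<Longrightarrow> v \<in> vecs R n \<Longrightarrow> sm y v \<in> vin R mx n"
  using sm_vin[of y v 0 n] vin_carrier mp_1 by simp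

lemma sm_vin1: "y \<in> mx \<Longrightarrow> v \<in> vin R mx n \<Longrightarrow> sm y v \<in> vin R (mp 2) n"
  using sm_vin[of y v 1 n] mp_1 by (simp add: numeral_2_eq_2)

text \<open>On N = F_n/\<open>Om n\<close>, the n-th syzygy, \<open>TB y' n\<close> modulo
  \<open>TA y n\<close> is the kernel of y' modulo the image of y.\<close>

definition TA :: "'a \<Rightarrow> nat \<Rightarrow> (nat \<Rightarrow> 'a) set" where
  "TA y n = msum (fm (b n)) (sm y ` vecs R (b n)) (Om n)"

definition TB :: "'a \<Rightarrow> nat \<Rightarrow> (nat \<Rightarrow> 'a) set" where
  "TB y' n = {f \<in> vecs R (b n). sm y' f \<in> Om n}"

lemma T_facts:
  assumes p: "exact_elts y y'"
  shows "smod R (fm (b n)) (TA y n)" "smod R (fm (b n)) (TB y' n)" "TA y n \<subseteq> TB y' n"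
    "sm y ` vecs R (b n) \<subseteq> TA y n" "Om n \<subseteq> TA y n"
proof -
  interpret M: module R "fm (b n)" by (rule module_fm)
  note c = exact_elts_carr[OF p]
  have s: "smod R (fm (b n)) (sm y ` vecs R (b n))" by (rule sm_smod[OF c(1) vecs_smod])
  show "smod R (fm (b n)) (TA y n)" unfolding TA_def by (rule M.smod_msum[OF s Om_smod])
  show B: "smod R (fm (b n)) (TB y' n)" unfolding TB_def
    using two_modules.smod_vimage[OF sm_two[OF c(2)] Om_smod] by simp
  show "sm y ` vecs R (b n) \<subseteq> TA y n" "Om n \<subseteq> TA y n" unfolding TA_def
    by (rule M.msum_ub1[OF s Om_smod], rule M.msum_ub2[OF s Om_smod])
  have 1: "sm y ` vecs R (b n) \<subseteq> TB y' n"
  proof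
    fix v assume v: "v \<in> sm y ` vecs R (b n)"
    then have vv: "v \<in> vecs R (b n)" using smod_carr[OF s] by simp
    show "v \<in> TB y' n" using exact_elts_ker(1)[OF p vv] v vv smod_zero[OF Om_smod] by (simp add: TB_def)
  qed
  have 2: "Om n \<subseteq> TB y' n" using smod_smult[OF Om_smod c(2)] smod_carr[OF Om_smod] by (auto simp: TB_def)
  show "TA y n \<subseteq> TB y' n" unfolding TA_def by (rule M.msum_least[OF B 1 2])
qed

lemma D_sm: "n \<ge> 1 \<Longrightarrow> y \<in> carrier R \<Longrightarrow> v \<in> vecs R (b n) \<Longrightarrow> D n (sm y v) = sm y (D n v)"
  using two_modules.f_smult[OF D_two, of n y v] by simp

text \<open>Multiplication by y and y' is exact on free modules, so the connecting map of the
  homology sequence is an isomorphism. Concretely, both sides equal the length of (y F_n intersected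
  with \<open>Om n\<close>) over y \<open>Om n\<close>: one maps there by D, the other by
  multiplication by y.\<close>

lemma T_periodic:
  assumes p: "exact_elts y y'" and p': "exact_elts y' y"
  shows "L (Suc n) (TA y (Suc n)) (TB y' (Suc n)) = L n (TA y' n) (TB y n)"
proof -
  note c = exact_elts_carr[OF p]
  let ?f = "D (Suc n)" and ?F = "vecs R (b n)" and ?F' = "vecs R (b (Suc n))"
  have s1: "Suc n \<ge> 1" by simp
  have fc: "?f v \<in> ?F" if "v \<in> ?F'" for v using D_closed[OF s1 that] by simp
  have svc: "sm z v \<in> vecs R k" if "z \<in> carrier R" "v \<in> vecs R k" for z v k
    using smod_smult[OF vecs_smod that(1), of v k] that(2) by simp
  have "L n (?f ` TA y (Suc n)) (?f ` TB y' (Suc n)) = L (Suc n) (TA y (Suc n)) (TB y' (Suc n))"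
    using L_D[OF s1 T_facts(1)[OF p] T_facts(2)[OF p] T_facts(3)[OF p] T_facts(5)[OF p]] by simp
  moreover have "?f ` TA y (Suc n) = sm y ` Om n"
  proof -
    have "?f ` TA y (Suc n) = ?f ` (sm y ` ?F')"
      unfolding TA_def by (rule D_msum_Om[OF s1 sm_smod[OF c(1) vecs_smod]])
    also have "\<dots> = sm y ` Om n" using D_sm[OF s1 c(1)] unfolding Om_def image_image by (intro image_cong) auto
    finally show ?thesis .
  qed
  moreover have "?f ` TB y' (Suc n) = sm y ` ?F \<inter> Om n"
  proof -
    have iff: "sm y' v \<in> Om (Suc n) \<longleftrightarrow> ?f v \<in> sm y ` ?F" if v: "v \<in> ?F'" for v
      using Om_ker[OF s1 svc[OF c(2) v]] D_sm[OF s1 c(2) v] exact_elts_ker(1)[OF p fc[OF v]] by simp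
    show ?thesis
    proof
      show "?f ` TB y' (Suc n) \<subseteq> sm y ` ?F \<inter> Om n" using iff unfolding TB_def Om_def by blast
      show "sm y ` ?F \<inter> Om n \<subseteq> ?f ` TB y' (Suc n)"
      proof
        fix z assume z: "z \<in> sm y ` ?F \<inter> Om n"
        then obtain v where v: "v \<in> ?F'" "z = ?f v" unfolding Om_def by blast
        then show "z \<in> ?f ` TB y' (Suc n)" using iff[OF v(1)] z unfolding TB_def by blast
      qed
    qed
  qed
  moreover have "L n (sm y ` TA y' n) (sm y ` TB y n) = L n (TA y' n) (TB y n)"
  proof (rule slen_image[OF fmodule_fm module_fm sm_lin[OF c(1)] T_facts(1)[OF p'] T_facts(2)[OF p'] T_facts(3)[OF p']])
    fix x assume x: "x \<in> TB y n" "sm y x = \<zero>\<^bsub>fm (b n)\<^esub>"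
    then have "x \<in> ?F" by (simp add: TB_def)
    then show "x \<in> TA y' n" using exact_elts_ker(2)[OF p, of x "b n"] x(2) T_facts(4)[OF p', of n] by (simp add: subset_iff)
  qed
  moreover have "sm y ` TA y' n = sm y ` Om n"
  proof
    show "sm y ` Om n \<subseteq> sm y ` TA y' n" using T_facts(5)[OF p'] by blast
    show "sm y ` TA y' n \<subseteq> sm y ` Om n"
    proof
      fix z assume "z \<in> sm y ` TA y' n"
      then obtain u \<omega> where u: "u \<in> ?F" "\<omega> \<in> Om n" "z = sm y (\<lambda>t. y' \<otimes> u t \<oplus> \<omega> t)" by (auto simp: TA_def msum_def)
      have uc: "u t \<in> carrier R" and wc: "\<omega> t \<in> carrier R" for t
        using vecs_carr[OF u(1)] vecs_carr smod_carr[OF Om_smod u(2)] by auto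
      have "y \<otimes> y' = \<zero>" using p' by (simp add: exact_elts_def)
      then have "y \<otimes> (y' \<otimes> u t \<oplus> \<omega> t) = y \<otimes> \<omega> t" for t using c uc[of t] wc[of t] by (simp add: r_distr flip: m_assoc)
      then have "z = sm y \<omega>" using u(3) by simp
      then show "z \<in> sm y ` Om n" using u(2) by blast
    qed
  qed
  moreover have "sm y ` TB y n = sm y ` ?F \<inter> Om n" unfolding TB_def by blast
  ultimately show ?thesis by simp
qed

text \<open>\<open>QQ\<close> over \<open>GG\<close> is the part of that homology in degree one of
  the syzygy: representatives lie in m F, and m^2 F is divided out.\<close>

definition QQ :: "'a \<Rightarrow> nat \<Rightarrow> (nat \<Rightarrow> 'a) set" where
  "QQ y' n = vin R mx (b n) \<inter> TB y' n"

definition GG :: "'a \<Rightarrow> nat \<Rightarrow> (nat \<Rightarrow> 'a) set" where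
  "GG y n = msum (fm (b n)) (sm y ` vecs R (b n)) (U n)"

lemma mp3_Om: "n \<ge> 1 \<Longrightarrow> vin R (mp 3) (b n) \<subseteq> Om n"
proof
  fix v assume n: "n \<ge> 1" and v: "v \<in> vin R (mp 3) (b n)"
  have "D n v \<in> vin R (mp 4) (b (n - 1))" using D_mp[OF n v] by (simp add: numeral_eq_Suc)
  then have "D n v = zero_vec R" using mp4 vin_zero by auto
  then show "v \<in> Om n" using Om_ker[OF n vin_carr[OF v]] by simp
qed

lemma Q_facts:
  assumes p: "exact_elts y y'" and n: "n \<ge> 1"
  shows "smod R (fm (b n)) (QQ y' n)" "smod R (fm (b n)) (GG y n)" "GG y n \<subseteq> QQ y' n" "TA y n \<subseteq> GG y n" "U n \<subseteq> GG y n"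
proof -
  interpret M: module R "fm (b n)" by (rule module_fm)
  note c = exact_elts_carr[OF p]
  have s: "smod R (fm (b n)) (sm y ` vecs R (b n))" by (rule sm_smod[OF c(1) vecs_smod])
  show Q: "smod R (fm (b n)) (QQ y' n)" unfolding QQ_def by (rule M.smod_int[OF vmx T_facts(2)[OF p]])
  show G: "smod R (fm (b n)) (GG y n)" unfolding GG_def by (rule M.smod_msum[OF s U_facts(1)])
  have sG: "sm y ` vecs R (b n) \<subseteq> GG y n" unfolding GG_def by (rule M.msum_ub1[OF s U_facts(1)])
  show UG: "U n \<subseteq> GG y n" unfolding GG_def by (rule M.msum_ub2[OF s U_facts(1)])
  show "TA y n \<subseteq> GG y n" unfolding TA_def using M.msum_least[OF G sG] UG U_facts(3)[of n] by blast
  have ymx: "y \<in> mx" "y' \<in> mx" using p by (auto simp: exact_elts_def)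
  have 1: "sm y ` vecs R (b n) \<subseteq> QQ y' n"
    using sm_vin0[OF ymx(1)] T_facts(3,4)[OF p, of n] unfolding QQ_def by blast
  have 2: "vin R (mp 2) (b n) \<subseteq> QQ y' n"
  proof
    fix v assume v: "v \<in> vin R (mp 2) (b n)"
    have "sm y' v \<in> vin R (mp 3) (b n)" using sm_vin[OF ymx(2) v] by (simp add: numeral_3_eq_3)
    then have "v \<in> TB y' n" using mp3_Om[OF n] vin_carr[OF v] unfolding TB_def by blast
    then show "v \<in> QQ y' n" unfolding QQ_def using v vin_mono[OF mp2_mx] by blast
  qed
  have 3: "Om n \<subseteq> QQ y' n" unfolding QQ_def using Om_mx T_facts(3,5)[OF p, of n] by blast
  show "GG y n \<subseteq> QQ y' n" unfolding GG_def
    by (rule M.msum_least[OF Q 1 M.msum_least[OF Q 2 3]])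
qed

text \<open>With h_0, h_1, h_2 the Hilbert function of the syzygy, y maps degree 0 to degree 1 and
  y' maps degree 1 to degree 2, so h_1 is at most h_0 + h_2 plus the homology in between. The three
  summands bound the successive intervals of \<open>U n\<close>, \<open>GG y n\<close>,
  \<open>QQ y' n\<close> and m F. Hence \<open>psi\<close> is bounded below by minus that
  homology.\<close>

lemma h1_bound:
  assumes p: "exact_elts y y'" and n: "n \<ge> 1"
  shows "L n (U n) (vin R mx (b n)) \<le> b n + qn n + L n (GG y n) (QQ y' n)"
proof -
  interpret F: fmodule R "fm (b n)" by (rule fmodule_fm)
  note c = exact_elts_carr[OF p]
  have ymx: "y \<in> mx" "y' \<in> mx" using p by (auto simp: exact_elts_def)
  let ?V = "vecs R (b n)" and ?M = "vin R mx (b n)"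
  have QM: "QQ y' n \<subseteq> ?M" unfolding QQ_def by blast
  have s: "smod R (fm (b n)) (sm y ` ?V)" by (rule sm_smod[OF c(1) vecs_smod])
  have split: "L n (U n) ?M = L n (U n) (GG y n) + (L n (GG y n) (QQ y' n) + L n (QQ y' n) ?M)"
    using F.slen_add[OF U_facts(1) Q_facts(2)[OF p n] vmx Q_facts(5)[OF p n]] Q_facts(3)[OF p n] QM
      F.slen_add[OF Q_facts(2)[OF p n] Q_facts(1)[OF p n] vmx Q_facts(3)[OF p n] QM] by auto
  have "L n (U n) (GG y n) \<le> b n"
  proof -
    have "L n (U n) (GG y n) = L n (sm y ` ?V \<inter> U n) (sm y ` ?V)"
      using F.slen_diamond[OF s U_facts(1)] unfolding GG_def by simp
    also have "\<dots> \<le> L n (sm y ` ?M) (sm y ` ?V)"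
    proof (rule F.slen_mono[OF sm_smod[OF c(1) vmx] F.smod_int[OF s U_facts(1)] s s])
      show "sm y ` ?M \<subseteq> sm y ` ?V \<inter> U n" using sm_vin1[OF ymx(1)] U_facts(2)[of n] vin_carr by blast
    qed auto
    also have "\<dots> = L n ?M ?V"
    proof (rule slen_image[OF fmodule_fm module_fm sm_lin[OF c(1)] vmx vecs_smod])
      show "?M \<subseteq> ?V" using vin_carr by blast
      fix x assume x: "x \<in> ?V" "sm y x = \<zero>\<^bsub>fm (b n)\<^esub>"
      then have "x \<in> sm y' ` ?V" using exact_elts_ker(2)[OF p] by simp
      then show "x \<in> ?M" using sm_vin0[OF ymx(2)] by blast
    qed
    also have "\<dots> = b n" using L_vin[OF mx_smod smodC, of n] mx_carr vin_carrier ln_mp by auto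
    finally show ?thesis .
  qed
  moreover have "L n (QQ y' n) ?M \<le> qn n"
  proof -
    have "L n (sm y' ` QQ y' n) (sm y' ` ?M) = L n (QQ y' n) ?M"
    proof (rule slen_image[OF fmodule_fm module_fm sm_lin[OF c(2)] Q_facts(1)[OF p n] vmx QM])
      fix x assume "x \<in> ?M" "sm y' x = \<zero>\<^bsub>fm (b n)\<^esub>"
      then show "x \<in> QQ y' n" using smod_zero[OF Om_smod] vin_carr unfolding QQ_def TB_def by auto
    qed
    moreover have "sm y' ` QQ y' n = sm y' ` ?M \<inter> Om n" unfolding QQ_def TB_def using vin_carr by blast
    ultimately have "L n (QQ y' n) ?M = L n (Om n) (msum (fm (b n)) (sm y' ` ?M) (Om n))"
      using F.slen_diamond[OF sm_smod[OF c(2) vmx] Om_smod] by simp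
    also have "\<dots> \<le> L n (Om n) (U n)"
    proof (rule F.slen_mono[OF Om_smod Om_smod F.smod_msum[OF sm_smod[OF c(2) vmx] Om_smod] U_facts(1)])
      show "Om n \<subseteq> msum (fm (b n)) (sm y' ` ?M) (Om n)" by (rule F.msum_ub2[OF sm_smod[OF c(2) vmx] Om_smod])
      show "msum (fm (b n)) (sm y' ` ?M) (Om n) \<subseteq> U n"
        by (rule F.msum_least[OF U_facts(1) _ U_facts(3)]) (use sm_vin1[OF ymx(2)] U_facts(2)[of n] in blast)
    qed simp
    finally show ?thesis using qn_U[OF n] by simp
  qed
  ultimately show ?thesis using split by simp
qed

lemma psi_lower: "exact_elts y y' \<Longrightarrow> n \<ge> 1 \<Longrightarrow> psi n \<ge> - int (L n (GG y n) (QQ y' n))"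
  using h1_bound[of y y' n] pn_U[of n] unfolding psi_def by linarith

lemma psi_lower_T: assumes "n \<ge> 1" shows "psi n \<ge> - int (L n (TA a n) (TB a' n))"
proof -
  interpret F: fmodule R "fm (b n)" by (rule fmodule_fm)
  have "L n (GG a n) (QQ a' n) \<le> L n (TA a n) (TB a' n)"
    by (rule F.slen_mono[OF T_facts(1)[OF exact_elts_a] Q_facts(2)[OF exact_elts_a assms] Q_facts(1)[OF exact_elts_a assms] T_facts(2)[OF exact_elts_a]
          Q_facts(4)[OF exact_elts_a assms] Q_facts(3)[OF exact_elts_a assms]]) (simp add: QQ_def)
  then show ?thesis using psi_lower[OF exact_elts_a assms] by linarith
qed

text \<open>Once generators are linear, \<open>psi\<close> decreases by twice a nonnegative defect
  at each step. The lower bound from periodicity leaves room for finitely many nonzero defects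
  only.\<close>

theorem strict_eventually: "\<exists>n1\<ge>1. \<forall>n\<ge>n1. linear_gens n \<and> strict_socle n"
proof -
  obtain n0 where n0: "n0 \<ge> 1" "\<And>n. n \<ge> n0 \<Longrightarrow> linear_gens n" using linear_boundary_eventually unfolding linear_gens_def by blast
  \<comment> \<open>One step of periodicity exchanges the two orders of the pair, so only the sum
    over both orders is constant.\<close>
  define T where "T n = L n (TA a n) (TB a' n) + L n (TA a' n) (TB a n)" for n
  have "T (Suc n) = T n" for n unfolding T_def using T_periodic[OF exact_elts_a exact_elts_a'] T_periodic[OF exact_elts_a' exact_elts_a] by simp
  then have T: "T n = T 0" for n by (induction n) auto
  have low: "psi n + int (T 0) \<ge> 0" if "n \<ge> 1" for n
    using psi_lower_T[OF that] T[of n] unfolding T_def by linarith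
  have step: "psi n - psi (Suc n) = 2 * (int (b n) - int (qn (Suc n)))" if "n \<ge> n0" for n
    using psi_step[of n] n0 that by simp
  \<comment> \<open>By \<open>low\<close> the integer is nonnegative here, so the conversion to a
    natural number does not truncate.\<close>
  define f where "f k = nat (psi (n0 + k) + int (T 0))" for k
  have "f (Suc k) \<le> f k" for k using step[of "n0 + k"] qn_le[of "n0 + k"] unfolding f_def by simp
  then obtain k0 where k0: "\<forall>k\<ge>k0. f k = f k0" using stabilise1 by blast
  have "strict_socle n" if n: "n \<ge> n0 + k0" for n
  proof -
    obtain k where k: "n = n0 + k" "k \<ge> k0" using n by (metis le_Suc_ex add.assoc le_add1)
    have "f (Suc k) = f k" using k0 k by (metis le_SucI)
    then have "psi (Suc n) = psi n" using low[of n] low[of "Suc n"] n0(1) k(1) unfolding f_def by simp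
    then have "qn (Suc n) = b n" using step[of n] k by simp
    then show ?thesis by (rule qn_eq)
  qed
  then show ?thesis using n0 by (intro exI[of _ "n0 + k0"]) auto
qed

text \<open>Homology in degree one vanishes for the residue field. At n = 0 this is m F_0 =
  \<open>Om 0\<close>. Going up, the connecting map of \<open>T_periodic\<close> preserves degree
  one: v in m F gives D v = y g in m^2 F, hence g is in m F, and the induction hypothesis for the
  exchanged pair applies to g.\<close>

lemma residue_T:
  assumes D1: "D 1 ` vecs R (b 1) = vin R mx (b 0)" and p: "exact_elts y y'" and p': "exact_elts y' y"
  shows "QQ y' n \<subseteq> TA y n"
  using p p'
proof (induction n arbitrary: y y')
  case 0
  have "vin R mx (b 0) = Om 0" using D1 by (simp add: Om_def)
  then show ?case using T_facts(5)[OF 0(1), of 0] unfolding QQ_def by blast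
next
  case (Suc n)
  note p = Suc.prems(1) and p' = Suc.prems(2)
  note c = exact_elts_carr[OF p]
  have s1: "Suc n \<ge> 1" by simp
  let ?f = "D (Suc n)" and ?F = "vecs R (b n)" and ?F' = "vecs R (b (Suc n))"
  interpret f: two_modules R "fm (b (Suc n))" "fm (b (Suc n - 1))" "?f" by (rule D_two[OF s1])
  show ?case
  proof
    fix v assume v: "v \<in> QQ y' (Suc n)"
    have vm: "v \<in> vin R mx (b (Suc n))" and vO: "sm y' v \<in> Om (Suc n)" and vv: "v \<in> ?F'"
      using v unfolding QQ_def TB_def by auto
    have fv: "?f v \<in> ?F" using D_closed[OF s1 vv] by simp
    have svv: "sm y' v \<in> ?F'" using smod_carr[OF Om_smod vO] by simp
    have "sm y' (?f v) = zero_vec R" using Om_ker[OF s1 svv] vO D_sm[OF s1 c(2) vv] by simp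
    then obtain g where g: "g \<in> ?F" "?f v = sm y g" using exact_elts_ker(1)[OF p fv] by blast
    have "?f v \<in> vin R (mp 2) (b n)" using D_mp[OF s1, of v 1] vm mp_1 by (simp add: numeral_2_eq_2)
    then have "y \<otimes> g t \<in> mp 2" for t using vin_mem[OF mp_ideal, of "?f v" 2 "b n" t] g by simp
    then have "g t \<in> mx" for t using p vecs_carr[OF g(1)] unfolding exact_elts_def by blast
    then have "g \<in> vin R mx (b n)" using g by (simp add: vin_def)
    moreover have "sm y g \<in> Om n" using g(2) vv unfolding Om_def by (metis imageI)
    ultimately have "g \<in> QQ y n" using g unfolding QQ_def TB_def by simp
    then have "g \<in> TA y' n" using Suc.IH[OF p' p] by blast
    then obtain g1 \<omega> where gw: "g1 \<in> ?F" "\<omega> \<in> Om n" "g = (\<lambda>t. y' \<otimes> g1 t \<oplus> \<omega> t)" by (auto simp: TA_def msum_def)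
    obtain w where w: "w \<in> ?F'" "\<omega> = ?f w" using gw(2) unfolding Om_def by blast
    have yy: "y \<otimes> y' = \<zero>" using p' by (simp add: exact_elts_def)
    have "sm y g = sm y \<omega>"
    proof
      fix t
      have "g1 t \<in> carrier R" "\<omega> t \<in> carrier R" using vecs_carr[OF gw(1)] vecs_carr smod_carr[OF Om_smod gw(2)] by auto
      then show "y \<otimes> g t = y \<otimes> \<omega> t" unfolding gw(3) using yy c by (simp add: r_distr flip: m_assoc)
    qed
    then have eq: "?f v = ?f (sm y w)" using g(2) w D_sm[OF s1 c(1) w(1)] by simp
    have yw: "sm y w \<in> ?F'" using smod_smult[OF vecs_smod c(1), of w] w by simp
    have "?f (v \<ominus>\<^bsub>fm (b (Suc n))\<^esub> sm y w) = zero_vec R"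
      using f.f_minus[of v "sm y w"] vv yw eq f.N.M.r_neg[of "?f (sm y w)"] f.f_closed[of "sm y w"] by (simp add: a_minus_def)
    moreover have mv: "v \<ominus>\<^bsub>fm (b (Suc n))\<^esub> sm y w \<in> ?F'" using f.M.M.minus_closed[of v "sm y w"] vv yw by simp
    ultimately have O: "v \<ominus>\<^bsub>fm (b (Suc n))\<^esub> sm y w \<in> Om (Suc n)" using Om_ker[OF s1 mv] by simp
    have "sm y w \<oplus>\<^bsub>fm (b (Suc n))\<^esub> (v \<ominus>\<^bsub>fm (b (Suc n))\<^esub> sm y w) \<in> TA y (Suc n)"
      unfolding TA_def by (rule msumI) (use w O in auto)
    moreover have "sm y w \<oplus>\<^bsub>fm (b (Suc n))\<^esub> (v \<ominus>\<^bsub>fm (b (Suc n))\<^esub> sm y w) = v"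
    proof -
      have "y \<otimes> w t \<oplus> (v t \<ominus> y \<otimes> w t) = v t" for t
      proof -
        have "y \<otimes> w t \<in> carrier R" "v t \<in> carrier R" using vecs_carr[OF yw] vecs_carr[OF vv] by auto
        then show ?thesis by algebra
      qed
      then show ?thesis using fm_minus[OF vv yw] by simp
    qed
    ultimately show "v \<in> TA y (Suc n)" by simp
  qed
qed

text \<open>The first syzygy of the residue field is m, with Hilbert function e, e, 1, so
  \<open>psi 1 = 1\<close>. By \<open>residue_T\<close> \<open>psi\<close> is never negative, and it
  drops by even amounts; so it stays 1 and no defect occurs.\<close>

theorem strict_residue:
  assumes D1: "D 1 ` vecs R (b 1) = vin R mx (b 0)" and b0: "b 0 = 1"
  shows "n \<ge> 1 \<Longrightarrow> linear_gens n" and "strict_socle n"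
proof -
  have k1: "linear_gens n" if "n \<ge> 1" for n
    unfolding linear_gens_def using linear_boundary_residue[OF D1 that] by blast
  then show "n \<ge> 1 \<Longrightarrow> linear_gens n" .
  have low: "psi n \<ge> 0" if n: "n \<ge> 1" for n
  proof -
    have "QQ a' n \<subseteq> GG a n" using residue_T[OF D1 exact_elts_a exact_elts_a'] Q_facts(4)[OF exact_elts_a n] by blast
    then have "GG a n = QQ a' n" using Q_facts(3)[OF exact_elts_a n] by blast
    then have "L n (GG a n) (QQ a' n) = 0"
      using modular_sets.len_refl[OF module.modular_smod[OF module_fm]] Q_facts(1)[OF exact_elts_a n] by simp
    then show ?thesis using psi_lower[OF exact_elts_a n] by simp
  qed
  have O0: "Om 0 = vin R mx (b 0)" using D1 by (simp add: Om_def)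
  have "D 1 ` vin R mx (b 1) = vin R (mp 2) (b 0)"
    using Om_mp2[of 0] k1[of 1] O0 Int_absorb1[OF vin_mono[OF mp2_mx]] by simp
  then have p1: "pn 1 = e + 1"
    using L_vin[OF smod0 mp_smod, of 2 0] mp_zero vin_zero ln_mp b0 by (simp add: pn_def)
  have b1: "b 1 = e"
    using L_Om[of 0] O0 \<open>D 1 ` vin R mx (b 1) = vin R (mp 2) (b 0)\<close> L_vin[OF mp_smod mx_smod mp2_mx, of 0] ln_mp b0 by simp
  have K20: "strict_socle 0"
    unfolding strict_socle_def
  proof
    interpret f: two_modules R "fm (b 1)" "fm (b (1 - 1))" "D 1" by (rule D_two) simp
    let ?I = "D 1 ` vin R (mp 2) (b 1)"
    have I: "smod R (fm (b 0)) ?I" using D_smod[of 1, OF _ vmp] by simp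
    \<comment> \<open>The ideal of m-square multiples of boundaries, with F_0 identified with R: if
      D 1 sends w to u in m, then v w with v in m^2 is sent to u v, so it contains m m^2 =
      m^3.\<close>
    let ?J = "{z \<in> carrier R. ev R 0 z \<in> ?I}"
    have J: "smod R slf ?J"
    proof (rule smodI)
      show "\<zero>\<^bsub>slf\<^esub> \<in> ?J" using smod_zero[OF I] by (simp add: ev_def zero_vec_def if_distrib cong: if_cong)
      fix x y assume "x \<in> ?J" "y \<in> ?J"
      moreover have "ev R 0 (x \<oplus> y) = (\<lambda>j. ev R 0 x j \<oplus> ev R 0 y j)" by (auto simp: ev_def)
      ultimately show "x \<oplus>\<^bsub>slf\<^esub> y \<in> ?J" using smod_add[OF I, of "ev R 0 x" "ev R 0 y"] by simp
    next
      fix r x assume "r \<in> carrier R" "x \<in> ?J"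
      moreover then have "ev R 0 (r \<otimes> x) = (\<lambda>j. r \<otimes> ev R 0 x j)" by (auto simp: ev_def)
      ultimately show "r \<odot>\<^bsub>slf\<^esub> x \<in> ?J" using smod_smult[OF I, of r "ev R 0 x"] by simp
    qed auto
    have "mp (Suc 2) \<subseteq> ?J"
    proof (rule mp_Suc_subset)
      show "ideal ?J R" using J smod_self_iff by blast
      fix u v assume u: "u \<in> mx" and v: "v \<in> mp 2"
      have uc: "u \<in> carrier R" and vc: "v \<in> carrier R" using mx_carr[OF u] mp_carr[OF v] by auto
      have "ev R 0 u \<in> vin R mx (b 0)" using ev_vin[OF _ mx_ideal u] b0 by simp
      then obtain w where w: "w \<in> vecs R (b 1)" "ev R 0 u = D 1 w" using D1 by blast
      have "sm v w \<in> vin R (mp 2) (b 1)"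
        using smod_smult[OF vecs_smod vc, of w] w mp_smult_r[OF vecs_carr[OF w(1)] v] by (simp add: vin_def)
      moreover have "D 1 (sm v w) = ev R 0 (u \<otimes> v)"
      proof -
        have "D 1 (sm v w) = sm v (ev R 0 u)" using D_sm[OF _ vc w(1)] w(2) by simp
        also have "\<dots> = ev R 0 (u \<otimes> v)" using uc vc by (auto simp: ev_def m_comm)
        finally show ?thesis .
      qed
      ultimately show "u \<otimes> v \<in> ?J" using uc vc by (metis (mono_tags, lifting) image_eqI m_closed mem_Collect_eq)
    qed
    then have m3: "mp 3 \<subseteq> ?J" by (simp add: numeral_3_eq_3)
    fix z assume z: "z \<in> vin R (mp 3) (b 0)"
    have "z = ev R 0 (z 0)" using vecs_ge[OF vin_carr[OF z]] b0 by (auto simp: ev_def fun_eq_iff)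
    moreover have "z 0 \<in> mp 3" using vin_mem[OF mp_ideal z] .
    ultimately show "z \<in> D (Suc 0) ` vin R (mp 2) (b (Suc 0))" using m3 by auto
  qed
  have q1: "qn 1 = 1"
  proof -
    have "D 1 ` vin R (mp 2) (b 1) = vin R (mp 3) (b 0)"
      using K20 D_mp[of 1 _ 2] unfolding strict_socle_def by (auto simp: numeral_3_eq_3)
    then show ?thesis using L_vin[OF smod0 mp_smod, of 3 0] mp_zero vin_zero ln_mp b0 by (simp add: qn_def)
  qed
  have psi1: "psi 1 = 1" unfolding psi_def using p1 q1 b1 by simp
  \<comment> \<open>An even drop from 1 to a nonnegative integer is 0.\<close>
  have ar: "q = x" if "p1 - p2 = 2 * (int x - int q)" "p1 = 1" "0 \<le> p2" "q \<le> x" for p1 p2 :: int and x q :: nat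
    using that by presburger
  have ps: "psi n = 1 \<and> qn (Suc n) = b n" if "n \<ge> 1" for n
    using that
  proof (induction rule: dec_induct)
    case base
    have "psi 1 - psi (Suc 1) = 2 * (int (b 1) - int (qn (Suc 1)))" using psi_step[of 1] k1 by simp
    then show ?case using ar[OF _ psi1 low[OF le_SucI[OF le_refl]] qn_le[of 1]] psi1 by simp
  next
    case (step n)
    have "psi n - psi (Suc n) = 2 * (int (b n) - int (qn (Suc n)))" using psi_step[of n] k1 step by simp
    then have p: "psi (Suc n) = 1" using step by simp
    have "psi (Suc n) - psi (Suc (Suc n)) = 2 * (int (b (Suc n)) - int (qn (Suc (Suc n))))" using psi_step[of "Suc n"] k1 by simp
    then show ?case using ar[OF _ p low[of "Suc (Suc n)"] qn_le[of "Suc n"]] p by simp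
  qed
  show "strict_socle n"
  proof (cases n)
    case 0
    then show ?thesis using K20 by simp
  next
    case (Suc m)
    then show ?thesis using ps[of n] qn_eq by simp
  qed
qed

end

section \<open>Noetherian local rings\<close>

text \<open>Zorn's lemma. Applied to the principal ideal of a nonunit it shows that elements outside
  a unique maximal ideal are units.\<close>

lemma (in cring) exists_maximalideal:
  assumes I: "ideal I R" "\<one> \<notin> I"
  shows "\<exists>J. maximalideal J R \<and> I \<subseteq> J"
proof -
  let ?A = "{J. ideal J R \<and> \<one> \<notin> J \<and> I \<subseteq> J}"
  have "\<exists>M\<in>?A. \<forall>K\<in>?A. M \<subseteq> K \<longrightarrow> K = M"
  proof (rule subset_Zorn_nonempty)
    show "?A \<noteq> {}" using I by blast
    fix C assume C: "C \<noteq> {}" "subset.chain ?A C"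
    have "subset.chain {J. ideal J R} C" using C(2) unfolding subset.chain_def by blast
    from chain_Union_is_ideal[OF this] have "ideal (\<Union>C) R" using C(1) by simp
    moreover have CA: "J \<in> ?A" if "J \<in> C" for J using C(2) that unfolding subset.chain_def by blast
    moreover have "\<one> \<notin> \<Union>C" using CA by blast
    moreover have "I \<subseteq> \<Union>C" using CA C(1) by blast
    ultimately show "\<Union>C \<in> ?A" by blast
  qed
  then obtain M where MA: "M \<in> ?A" and mxl: "\<forall>K\<in>?A. M \<subseteq> K \<longrightarrow> K = M" by (rule bexE)
  have M: "ideal M R" "\<one> \<notin> M" "I \<subseteq> M" using MA by simp_all
  have "maximalideal M R"
  proof (rule maximalidealI[OF M(1)])
    show "carrier R \<noteq> M" using M(2) by blast
    fix J assume J: "ideal J R" "M \<subseteq> J" "J \<subseteq> carrier R"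
    show "J = M \<or> J = carrier R"
    proof (cases "\<one> \<in> J")
      case True
      then show ?thesis using ideal.one_imp_carrier[OF J(1)] by blast
    next
      case False
      then show ?thesis using bspec[OF mxl, of J] J M(3) by simp
    qed
  qed
  then show ?thesis using M(3) by blast
qed

lemma local_noetherian_ring_local_cring:
  fixes R (structure)
  assumes "local_noetherian_ring R"
  shows "local_cring R (max_ideal R)"
proof -
  have R: "cring R" using assms by (simp add: local_noetherian_ring_def Defs.noetherian_ring_def)
  then interpret cring R .
  have ex: "\<exists>!I. maximalideal I R" using assms by (simp add: local_noetherian_ring_def)
  have m: "maximalideal (max_ideal R) R" unfolding max_ideal_def by (rule theI'[OF ex])
  have id: "ideal (max_ideal R) R" using m by (rule maximalideal.axioms(1))
  show ?thesis
  proof (intro local_cring.intro local_cring_axioms.intro R id)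
    show "\<one> \<notin> max_ideal R"
      using ideal.one_imp_carrier[OF id] maximalideal.I_notcarr[OF m] by blast
    fix x assume x: "x \<in> carrier R" "x \<notin> max_ideal R"
    show "x \<in> Units R"
    proof (rule ccontr)
      assume nu: "x \<notin> Units R"
      have "\<one> \<notin> PIdl x"
      proof
        assume "\<one> \<in> PIdl x"
        then obtain y where "y \<in> carrier R" "\<one> = y \<otimes> x" unfolding cgenideal_def by blast
        then show False using nu x m_comm[of x y] unfolding Units_def by force
      qed
      then obtain J where J: "maximalideal J R" "PIdl x \<subseteq> J" using exists_maximalideal[OF cgenideal_ideal[OF x(1)]] by blast
      then have "J = max_ideal R" using ex m by blast
      then show False using J(2) cgenideal_self[OF x(1)] x(2) by blast
    qed
  qed
qed

context local_cring
begin

lemma genideal_comb: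
  assumes S: "finite S" "S \<subseteq> carrier R"
  shows "\<exists>n g. (\<forall>k<n. g k \<in> Idl S) \<and> Idl S \<subseteq> comb slf n g ` vecs R n"
proof -
  obtain g where g: "bij_betw g {..<card S} S" using ex_bij_betw_nat_finite[OF S(1)] by (auto simp: lessThan_atLeast0)
  have gS: "g k \<in> S" if "k < card S" for k using bij_betwE[OF g] that by simp
  have gc: "g k \<in> carrier slf" if "k < card S" for k using gS[OF that] S(2) by auto
  interpret f: two_modules R "fm (card S)" slf "comb slf (card S) g"
    by (intro two_modules.intro module_fm module_self two_modules_axioms.intro comb_linear gc)
  have I: "ideal (comb slf (card S) g ` vecs R (card S)) R"
    using f.smod_image[OF f.M.smod_carrier] smod_self_iff by simp
  have "S \<subseteq> comb slf (card S) g ` vecs R (card S)"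
  proof
    fix x assume "x \<in> S"
    then obtain k where k: "k < card S" "x = g k" using bij_betw_imp_surj_on[OF g] by auto
    have "comb slf (card S) g (ev R k \<one>) = x"
      using comb_ev[OF module_self gc k(1) one_closed] k gc[OF k(1)] by simp
    then show "x \<in> comb slf (card S) g ` vecs R (card S)" using ev_vecs[OF k(1) one_closed] by (metis imageI)
  qed
  then have "Idl S \<subseteq> comb slf (card S) g ` vecs R (card S)" by (rule genideal_minimal[OF I])
  moreover have "\<forall>k<card S. g k \<in> Idl S" using gS genideal_self[OF S(2)] by blast
  ultimately show ?thesis by (intro exI[of _ "card S"] exI[of _ g]) simp
qed

text \<open>In a minimal system of generators of m^n = m^(n+1) the first generator would be a
  combination with coefficients in m. This is a relation with unit coefficient 1 - v 0, excluded by
  minimality, so the system is empty.\<close>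

lemma nakayama_mp:
  assumes S: "finite S" "S \<subseteq> carrier R" "mp n = Idl S" and eq: "mp (Suc n) = mp n"
  shows "mp n = {\<zero>}"
proof -
  have "\<exists>k g. (\<forall>j<k. g j \<in> mp n) \<and> mp n \<subseteq> comb slf k g ` vecs R k" using genideal_comb[OF S(1,2)] S(3) by simp
  from minimal_cover[OF module_self mp_smod this]
  obtain t g where g: "\<And>k. k < t \<Longrightarrow> g k \<in> mp n" "comb slf t g ` vecs R t = mp n"
    and ker: "\<And>v. v \<in> vecs R t \<Longrightarrow> comb slf t g v = \<zero>\<^bsub>slf\<^esub> \<Longrightarrow> v \<in> vin R mx t" by blast
  have gc: "g k \<in> carrier slf" if "k < t" for k using mp_carr[OF g(1)[OF that]] by simp
  interpret f: two_modules R "fm t" slf "comb slf t g"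
    by (intro two_modules.intro module_fm module_self two_modules_axioms.intro comb_linear gc)
  have I: "ideal (comb slf t g ` vin R mx t) R"
    using f.smod_image[OF vin_smod[OF mx_ideal]] smod_self_iff by simp
  have "mp (Suc n) \<subseteq> comb slf t g ` vin R mx t"
  proof (rule mp_Suc_subset[OF I])
    fix u v assume u: "u \<in> mx" and "v \<in> mp n"
    then obtain w where w: "w \<in> vecs R t" "v = comb slf t g w" using g(2) by blast
    have "u \<otimes> v = comb slf t g (\<lambda>j. u \<otimes> w j)" using f.f_smult[of u w] mx_carr[OF u] w by simp
    moreover have "(\<lambda>j. u \<otimes> w j) \<in> vin R mx t"
      using vecs_ge[OF w(1)] mx_carr[OF u] ideal.I_r_closed[OF mx_ideal u] vecs_carr[OF w(1)] by (auto simp: vin_def intro!: vecsI)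
    ultimately show "u \<otimes> v \<in> comb slf t g ` vin R mx t" by blast
  qed
  then have sub: "mp n \<subseteq> comb slf t g ` vin R mx t" using eq by simp
  have "t = 0"
  proof (rule ccontr)
    assume "t \<noteq> 0"
    then have t: "0 < t" by simp
    obtain v where v: "v \<in> vin R mx t" "g 0 = comb slf t g v" using sub g(1)[OF t] by blast
    have vv: "v \<in> vecs R t" using vin_carr[OF v(1)] .
    have e: "ev R 0 \<one> \<in> vecs R t" using ev_vecs[OF t one_closed] .
    have ce: "comb slf t g (ev R 0 \<one>) = g 0" using comb_ev[OF module_self gc t one_closed] gc[OF t] by simp
    have d: "ev R 0 \<one> \<ominus>\<^bsub>fm t\<^esub> v \<in> vecs R t" using f.M.M.minus_closed[of "ev R 0 \<one>" v] e vv by simp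
    have "comb slf t g (ev R 0 \<one> \<ominus>\<^bsub>fm t\<^esub> v) = \<zero>\<^bsub>slf\<^esub>"
      using f.f_minus[of "ev R 0 \<one>" v] e vv ce v(2) f.N.M.r_neg[of "g 0"] gc[OF t] by (simp add: a_minus_def)
    then have "(ev R 0 \<one> \<ominus>\<^bsub>fm t\<^esub> v) 0 \<in> mx" using vin_mem[OF mx_ideal ker[OF d]] by blast
    then have "\<one> \<ominus> v 0 \<in> mx" using fm_minus[OF e vv] by (simp add: ev_def)
    then show False using one_minus_mx vin_mem[OF mx_ideal v(1)] by blast
  qed
  then have "vecs R t = {zero_vec R}" by (auto simp: vecs_def zero_vec_def)
  then have "mp n = {comb slf t g (zero_vec R)}" using g(2) by simp
  then show ?thesis using f.f_zero by simp
qed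

lemma hlen_hilbert:
  assumes "Defs.noetherian_ring R"
  shows "hlen R slf (mp (Suc n)) (mp n) (rank_res R (mp n) (mp (Suc n)))"
  by (rule rank_res_hlen[OF mp_ideal mp_ideal mp_Suc_le mx_mult])
    (use assms mp_ideal in \<open>auto simp: Defs.noetherian_ring_def\<close>)

end

text \<open>The vanishing of the Hilbert function at 4 says m^5 = m^4, which Nakayama turns into m^4
  = 0.\<close>

lemma short_ring_of_hilbert:
  fixes R (structure)
  assumes loc: "local_noetherian_ring R"
    and H1: "hilbert_fun R 1 = e" and H2: "hilbert_fun R 2 = e"
    and H3: "hilbert_fun R 3 = 1" and H4: "hilbert_fun R 4 = 0"
  shows "short_ring R (max_ideal R) e"
proof -
  interpret local_cring R "max_ideal R" by (rule local_noetherian_ring_local_cring[OF loc])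
  have noe: "Defs.noetherian_ring R" using loc by (simp add: local_noetherian_ring_def)
  interpret S: module R slf by (rule module_self)
  have hl: "hlen R slf (mp (Suc n)) (mp n) (hilbert_fun R n)" for n
    using hlen_hilbert[OF noe] by (simp add: hilbert_fun_def)
  have "hlen R slf (mp (Suc 4)) (mp 4) 0" using hl[of 4] H4 by simp
  then have eq: "mp (Suc 4) = mp 4" by (cases rule: S.lat.has_length.cases) auto
  obtain S where "finite S" "S \<subseteq> carrier R" "mp 4 = Idl S" using noe mp_ideal unfolding Defs.noetherian_ring_def by blast
  then have m4: "mp 4 = {\<zero>}" using nakayama_mp eq by blast
  have s: "Suc 1 = 2" "Suc 2 = 3" "Suc 3 = 4" by simp_all
  show ?thesis
    by (intro short_ring.intro local_cring_axioms short_ring_axioms.intro m4)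
      (use hl[of 1] hl[of 2] hl[of 3] H1 H2 H3 in \<open>simp_all only: s\<close>)
qed

context short_ring
begin

lemma ideal_annihilator: "ideal (annihilator R mx) R"
proof -
  have "smod R slf (annihilator R mx)"
    by (rule smodI) (auto simp: annihilator_def l_distr m_assoc mx_carr)
  then show ?thesis using smod_self_iff by simp
qed

lemma socle_rank_ln:
  assumes "Defs.noetherian_ring R"
  shows "ln {\<zero>} (annihilator R mx) = rank_res R (annihilator R mx) {\<zero>}"
proof (rule S.lat.len_eq[OF rank_res_hlen[OF ideal_annihilator zeroideal]])
  show "{\<zero>} \<subseteq> annihilator R mx" using mx_carr by (auto simp: annihilator_def)
  show "r \<otimes> x \<in> {\<zero>}" if "r \<in> mx" "x \<in> annihilator R mx" for r x
    using that mx_carr m_comm[of r x] by (auto simp: annihilator_def)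
qed (use assms ideal_annihilator in \<open>auto simp: Defs.noetherian_ring_def\<close>)

text \<open>The partner b is the preimage of 1 under the given isomorphism f from the annihilator of
  a to R/aR. Then f sends r b to the class of r: surjectivity onto classes shows that b generates
  the annihilator of a, injectivity that the annihilator of b is aR.\<close>

lemma exact_pair_of_exact_zero_divisor:
  assumes a: "a \<in> mx" and ez: "exact_zero_divisor R a"
  shows "\<exists>b. exact_pair R mx e a b"
proof -
  have ac: "a \<in> carrier R" using mx_carr[OF a] .
  let ?A = "annihilator R {a}" and ?P = "PIdl a"
  let ?Q = "R Quot ?P"
  have P: "ideal ?P R" by (rule cgenideal_ideal[OF ac])
  interpret P: ideal ?P R by (rule P)
  interpret Q: ring ?Q by (rule P.quotient_is_ring)
  obtain f where bij: "bij_betw f ?A (carrier ?Q)"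
    and fs: "\<And>r x. r \<in> carrier R \<Longrightarrow> x \<in> ?A \<Longrightarrow> f (r \<otimes> x) = (?P +> r) \<otimes>\<^bsub>?Q\<^esub> f x"
    and An: "?A \<noteq> carrier R"
    using ez unfolding exact_zero_divisor_def by blast
  have hom: "(+>) ?P \<in> ring_hom R ?Q" by (rule P.rcos_ring_hom)
  have one: "\<one>\<^bsub>?Q\<^esub> = ?P +> \<one>" by (simp add: FactRing_def)
  have "\<one>\<^bsub>?Q\<^esub> \<in> f ` ?A" using bij_betw_imp_surj_on[OF bij] Q.one_closed by simp
  then obtain b where b: "b \<in> ?A" "f b = \<one>\<^bsub>?Q\<^esub>" by (auto dest: sym)
  have bc: "b \<in> carrier R" and ba: "b \<otimes> a = \<zero>" using b(1) by (auto simp: annihilator_def)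
  have frb: "f (r \<otimes> b) = ?P +> r" if "r \<in> carrier R" for r
    using fs[OF that b(1)] b(2) ring_hom_closed[OF hom that] by simp
  have rb: "r \<otimes> b \<in> ?A" if "r \<in> carrier R" for r
    using that bc ac ba by (simp add: annihilator_def m_assoc)
  have cs: "?P +> r = ?P \<longleftrightarrow> r \<in> ?P" if "r \<in> carrier R" for r
    using a_coset_join1[OF _ that P.a_subgroup] P.a_rcos_const by blast
  have f0: "f \<zero> = ?P" using frb[OF zero_closed] cs[OF zero_closed] P.zero_closed bc by simp
  have z: "\<zero> \<in> ?A" using ac by (simp add: annihilator_def)
  have bm: "b \<in> mx"
  proof (rule ccontr)
    assume "b \<notin> mx"
    then have "b \<in> Units R" using unit_notin_mx bc by blast
    then have "x = (x \<otimes> inv b) \<otimes> b \<and> x \<otimes> inv b \<in> carrier R" if "x \<in> carrier R" for x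
      using that bc by (simp add: m_assoc)
    then have "carrier R \<subseteq> ?A" using rb by (metis subsetI)
    then show False using An by (auto simp: annihilator_def)
  qed
  have "exact_pair R mx e a b"
  proof (intro exact_pair.intro short_ring_axioms exact_pair_axioms.intro a bm)
    fix x assume x: "x \<in> carrier R"
    show "x \<otimes> a = \<zero> \<longleftrightarrow> x \<in> PIdl b"
    proof
      assume "x \<otimes> a = \<zero>"
      then have xA: "x \<in> ?A" using x by (simp add: annihilator_def)
      then have "f x \<in> carrier ?Q" using bij_betwE[OF bij] by blast
      then obtain r where r: "r \<in> carrier R" "f x = ?P +> r" by (auto simp: FactRing_def A_RCOSETS_def')
      then have "x = r \<otimes> b" using frb[OF r(1)] rb[OF r(1)] xA inj_onD[OF bij_betw_imp_inj_on[OF bij]] by simp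
      then show "x \<in> PIdl b" using r unfolding cgenideal_def by blast
    next
      assume "x \<in> PIdl b"
      then show "x \<otimes> a = \<zero>" using rb unfolding cgenideal_def annihilator_def by blast
    qed
    have "x \<otimes> b = \<zero> \<longleftrightarrow> f (x \<otimes> b) = f \<zero>"
      using inj_on_eq_iff[OF bij_betw_imp_inj_on[OF bij] rb[OF x] z] by simp
    then show "x \<otimes> b = \<zero> \<longleftrightarrow> x \<in> PIdl a" using frb[OF x] f0 cs[OF x] by simp
  qed
  then show ?thesis by blast
qed

end

section \<open>Minimal free resolutions\<close>

context cring
begin

lemma linear_eq_comb:
  assumes M: "module R M" and lin: "linear_map R (fm t) M f" and v: "v \<in> vecs R t"
  shows "f v = comb M t (\<lambda>k. f (ev R k \<one>)) v"
proof -
  interpret f: two_modules R "fm t" M f by (intro two_modules.intro module_fm M two_modules_axioms.intro lin)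
  let ?g = "\<lambda>k. f (ev R k \<one>)"
  have g: "?g k \<in> carrier M" if "k < t" for k using f.f_closed[of "ev R k \<one>"] ev_vecs[OF that one_closed] by simp
  interpret h: two_modules R "fm t" M "comb M t ?g"
    by (intro two_modules.intro module_fm M two_modules_axioms.intro comb_linear g)
  have "v \<in> {u \<in> vecs R t. f u = comb M t ?g u}" (is "_ \<in> ?P")
  proof (rule vec_induct[OF v])
    show "zero_vec R \<in> ?P" using f.f_zero h.f_zero by simp
    show "(\<lambda>j. x j \<oplus> y j) \<in> ?P" if "x \<in> ?P" "y \<in> ?P" for x y
      using that f.f_add[of x y] h.f_add[of x y] f.M.M.a_closed[of x y] by simp
    show "ev R k (v k) \<in> ?P" if k: "k < t" for k
    proof -
      have vk: "v k \<in> carrier R" using vecs_carr[OF v] .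
      have "ev R k (v k) = (\<lambda>j. v k \<otimes> ev R k \<one> j)" using vk by (auto simp: ev_def)
      then have "f (ev R k (v k)) = v k \<odot>\<^bsub>M\<^esub> ?g k" using f.f_smult[OF vk, of "ev R k \<one>"] ev_vecs[OF k one_closed] by simp
      then show ?thesis using comb_ev[OF M g k vk] ev_vecs[OF k vk] by simp
    qed
  qed
  then show ?thesis by simp
qed

lemma finitely_generated_moduleI:
  assumes M: "module R M" and lin: "linear_map R (fm t) M f" and sur: "f ` vecs R t = carrier M"
  shows "finitely_generated_module R M"
  unfolding finitely_generated_module_def
proof (intro conjI M exI[of _ t] exI[of _ "\<lambda>k. f (ev R k \<one>)"] allI impI ballI)
  show "f (ev R k \<one>) \<in> carrier M" if "k < t" for k using sur ev_vecs[OF that one_closed] by blast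
  fix x assume "x \<in> carrier M"
  then obtain v where v: "v \<in> vecs R t" "x = f v" using sur by blast
  then show "\<exists>c. (\<forall>i<t. c i \<in> carrier R) \<and> x = (\<Oplus>\<^bsub>M\<^esub>i\<in>{..<t}. c i \<odot>\<^bsub>M\<^esub> f (ev R i \<one>))"
    using linear_eq_comb[OF M lin v(1)] vecs_carr[OF v(1)] by (intro exI[of _ v]) (simp add: comb_def)
qed

lemma finitely_generated_comb:
  assumes "finitely_generated_module R M"
  shows "\<exists>n g. (\<forall>k<n. g k \<in> carrier M) \<and> carrier M \<subseteq> comb M n g ` vecs R n"
proof -
  interpret M: module R M using assms by (simp add: finitely_generated_module_def)
  obtain n :: nat and g where g: "\<forall>i<n. g i \<in> carrier M"
    and gen: "\<forall>x\<in>carrier M. \<exists>c. (\<forall>i<n. c i \<in> carrier R) \<and> x = (\<Oplus>\<^bsub>M\<^esub> i\<in>{..<n}. c i \<odot>\<^bsub>M\<^esub> g i)"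
    using assms unfolding finitely_generated_module_def by blast
  have "carrier M \<subseteq> comb M n g ` vecs R n"
  proof
    fix x assume "x \<in> carrier M"
    then obtain c where c: "\<forall>i<n. c i \<in> carrier R" "x = (\<Oplus>\<^bsub>M\<^esub> i\<in>{..<n}. c i \<odot>\<^bsub>M\<^esub> g i)" using bspec[OF gen] by blast
    let ?c = "\<lambda>i. if i < n then c i else \<zero>"
    have "comb M n g ?c = x" unfolding comb_def c(2)
      by (rule M.M.finsum_cong') (use c g in auto)
    moreover have "?c \<in> vecs R n" using c by (auto simp: vecs_def)
    ultimately show "x \<in> comb M n g ` vecs R n" by blast
  qed
  then show ?thesis using g by blast
qed

lemma module_restrict:
  assumes A: "smod R (fm n) A"
  shows "module R ((fm n)\<lparr>carrier := A\<rparr>)"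
proof -
  interpret M: module R "fm n" by (rule module_fm)
  have Ac: "x j \<in> carrier R" if "x \<in> A" for x j using vecs_carr smod_carr[OF A that] by simp
  have [simp]: "\<zero>\<^bsub>(fm n)\<lparr>carrier := A\<rparr>\<^esub> = zero_vec R" "x \<oplus>\<^bsub>(fm n)\<lparr>carrier := A\<rparr>\<^esub> y = (\<lambda>j. x j \<oplus> y j)"
    "r \<odot>\<^bsub>(fm n)\<lparr>carrier := A\<rparr>\<^esub> x = (\<lambda>j. r \<otimes> x j)" for x y r by (simp_all add: free_module_def)
  have sc: "(\<lambda>j. r \<otimes> x j) \<in> A" if "r \<in> carrier R" "x \<in> A" for r x using smod_smult[OF A that] by simp
  have ad: "(\<lambda>j. x j \<oplus> y j) \<in> A" if "x \<in> A" "y \<in> A" for x y using smod_add[OF A that] by simp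
  have ze: "zero_vec R \<in> A" using smod_zero[OF A] by simp
  show ?thesis
  proof (rule moduleI)
    show "abelian_group ((fm n)\<lparr>carrier := A\<rparr>)"
    proof (rule abelian_groupI)
      fix x assume "x \<in> carrier ((fm n)\<lparr>carrier := A\<rparr>)"
      then have x: "x \<in> A" by simp
      have "\<ominus>\<^bsub>fm n\<^esub> x \<in> A" using M.smod_neg[OF A x] .
      then have "(\<lambda>j. \<ominus> x j) \<in> A" using fm_neg[of x n] smod_carr[OF A x] by simp
      moreover have "(\<lambda>j. \<ominus> x j \<oplus> x j) = zero_vec R" using Ac[OF x] by (simp add: l_neg zero_vec_def)
      ultimately show "\<exists>y\<in>carrier ((fm n)\<lparr>carrier := A\<rparr>). y \<oplus>\<^bsub>(fm n)\<lparr>carrier := A\<rparr>\<^esub> x = \<zero>\<^bsub>(fm n)\<lparr>carrier := A\<rparr>\<^esub>"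
        by (intro bexI[of _ "\<lambda>j. \<ominus> x j"]) simp_all
    qed (auto simp: ze[unfolded zero_vec_def] ad Ac a_ac zero_vec_def)
  qed (auto simp: sc Ac l_distr r_distr m_assoc is_cring)
qed

end

context short_ring
begin

lemma matvec_mx:
  assumes A: "\<And>i j. i < r \<Longrightarrow> j < c \<Longrightarrow> A i j \<in> mx" and v: "v \<in> vecs R c"
  shows "matvec R A r c v \<in> vin R mx r"
proof -
  have "dot R c (A i) v \<in> mx" if "i < r" for i
    using dot_comm[of c "A i" v] dot_ideal[OF mx_ideal, of c v "A i"] A[OF that] mx_carr vecs_carr[OF v] by simp
  then show ?thesis using mx_carr by (auto simp: vin_def matvec_dot intro!: vecsI)
qed

lemma resolution_step:
  assumes K: "smod R (fm n) K" and Kmx: "K \<subseteq> vin R mx n"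
  obtains t A where "\<And>i j. i < n \<Longrightarrow> j < t \<Longrightarrow> A i j \<in> mx" "matvec R A n t ` vecs R t = K"
    "\<And>v. v \<in> vecs R t \<Longrightarrow> matvec R A n t v = zero_vec R \<Longrightarrow> v \<in> vin R mx t"
proof -
  interpret F: fmodule R "fm n" by (rule fmodule_fm)
  have "hlen R (fm n) {zero_vec R} K (slen R (fm n) {zero_vec R} K)"
    using F.slen_hlen[OF F.smod_zero_mod K] smod_zero[OF K] by simp
  then have "\<exists>k g. (\<forall>j<k. g j \<in> K) \<and> K \<subseteq> comb (fm n) k g ` vecs R k"
    using hlen_gens_module[OF module_fm, of n K] by (metis free_module_simps(2))
  from minimal_cover[OF module_fm K this]
  obtain t g where g: "\<And>k. k < t \<Longrightarrow> g k \<in> K" "comb (fm n) t g ` vecs R t = K"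
    and ker: "\<And>v. v \<in> vecs R t \<Longrightarrow> comb (fm n) t g v = \<zero>\<^bsub>fm n\<^esub> \<Longrightarrow> v \<in> vin R mx t" by blast
  have gv: "g k \<in> vecs R n" if "k < t" for k using smod_carr[OF K g(1)[OF that]] by simp
  let ?A = "\<lambda>i k. g k i"
  have eq: "comb (fm n) t g v = matvec R ?A n t v" if "v \<in> vecs R t" for v by (rule comb_fm[OF gv that])
  show ?thesis
  proof (rule that[of t ?A])
    show "g j i \<in> mx" if "i < n" "j < t" for i j using vin_mem[OF mx_ideal, of "g j" n i] g(1)[OF that(2)] Kmx by blast
    show "matvec R ?A n t ` vecs R t = K" using g(2) image_cong[OF refl eq, of "vecs R t"] by simp
    show "v \<in> vin R mx t" if "v \<in> vecs R t" "matvec R ?A n t v = zero_vec R" for v using ker[OF that(1)] eq[OF that(1)] that(2) by simp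
  qed
qed

lemma matvec_kernel_smod:
  assumes "\<And>i j. i < r \<Longrightarrow> j < c \<Longrightarrow> A i j \<in> mx"
  shows "smod R (fm c) {v \<in> vecs R c. matvec R A r c v = zero_vec R}"
proof -
  have "two_modules R (fm c) (fm r) (matvec R A r c)"
    by (intro two_modules.intro module_fm two_modules_axioms.intro matvec_linear) (use assms mx_carr in auto)
  from two_modules.smod_vimage[OF this module.smod_zero_mod[OF module_fm]] show ?thesis by simp
qed

lemma resolution_exists:
  assumes mx: "mx = max_ideal R" and fg: "finitely_generated_module R M"
  shows "\<exists>b d \<epsilon>. min_free_resolution R M b d \<epsilon>"
proof -
  have M: "module R M" using fg by (simp add: finitely_generated_module_def)
  interpret M: module R M by fact
  from minimal_cover[OF M M.smod_carrier finitely_generated_comb[OF fg]]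
  obtain t0 g where g: "\<And>k. k < t0 \<Longrightarrow> g k \<in> carrier M" "comb M t0 g ` vecs R t0 = carrier M"
    and ker: "\<And>v. v \<in> vecs R t0 \<Longrightarrow> comb M t0 g v = \<zero>\<^bsub>M\<^esub> \<Longrightarrow> v \<in> vin R mx t0" by blast
  define \<epsilon> where "\<epsilon> = comb M t0 g"
  have el: "linear_map R (fm t0) M \<epsilon>" unfolding \<epsilon>_def by (rule comb_linear[OF M g(1)])
  have et: "two_modules R (fm t0) M \<epsilon>" by (intro two_modules.intro module_fm M two_modules_axioms.intro el)
  let ?K0 = "{v \<in> vecs R t0. \<epsilon> v = \<zero>\<^bsub>M\<^esub>}"
  let ?ker = "\<lambda>r t A. {v \<in> vecs R t. matvec R A r t v = zero_vec R}"
  \<comment> \<open>A state (r, t, A) is one differential with its numbers of rows and columns.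
    \<open>P\<close> keeps its kernel inside m F, so that the next matrix has entries in m, and
    \<open>Q\<close> is exactness between consecutive states. At level 0 the image must be the
    kernel of the augmentation.\<close>
  define P :: "nat \<Rightarrow> nat \<times> nat \<times> (nat \<Rightarrow> nat \<Rightarrow> 'a) \<Rightarrow> bool" where
    "P n x \<longleftrightarrow> (case x of (r, t, A) \<Rightarrow> (\<forall>i<r. \<forall>j<t. A i j \<in> mx) \<and> ?ker r t A \<subseteq> vin R mx t \<and>
       (n = 0 \<longrightarrow> r = t0 \<and> matvec R A r t ` vecs R t = ?K0))" for n x
  define Q :: "nat \<times> nat \<times> (nat \<Rightarrow> nat \<Rightarrow> 'a) \<Rightarrow> nat \<times> nat \<times> (nat \<Rightarrow> nat \<Rightarrow> 'a) \<Rightarrow> bool" where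
    "Q x y \<longleftrightarrow> (case x of (r, t, A) \<Rightarrow> case y of (r', t', A') \<Rightarrow> r' = t \<and> matvec R A' r' t' ` vecs R t' = ?ker r t A)" for x y
  have "\<exists>F. \<forall>n. P n (F n) \<and> Q (F n) (F (Suc n))"
  proof (rule dependent_nat_choice)
    have K0: "smod R (fm t0) ?K0" using two_modules.smod_vimage[OF et M.smod_zero_mod] by simp
    have "?K0 \<subseteq> vin R mx t0" using ker unfolding \<epsilon>_def by blast
    from resolution_step[OF K0 this] obtain t A where A: "\<And>i j. i < t0 \<Longrightarrow> j < t \<Longrightarrow> A i j \<in> mx" "matvec R A t0 t ` vecs R t = ?K0"
      "\<And>v. v \<in> vecs R t \<Longrightarrow> matvec R A t0 t v = zero_vec R \<Longrightarrow> v \<in> vin R mx t" by blast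
    have "P 0 (t0, t, A)" unfolding P_def using A by auto
    then show "\<exists>x. P 0 x" by (rule exI)
    fix x n assume Px: "P n x"
    obtain r t A where x: "x = (r, t, A)" by (cases x)
    have A: "A i j \<in> mx" if "i < r" "j < t" for i j using Px that unfolding P_def x by simp
    have "?ker r t A \<subseteq> vin R mx t" using Px unfolding P_def x by simp
    from resolution_step[OF matvec_kernel_smod[OF A] this]
    obtain t' A' where A': "\<And>i j. i < t \<Longrightarrow> j < t' \<Longrightarrow> A' i j \<in> mx" "matvec R A' t t' ` vecs R t' = ?ker r t A"
      "\<And>v. v \<in> vecs R t' \<Longrightarrow> matvec R A' t t' v = zero_vec R \<Longrightarrow> v \<in> vin R mx t'" by blast
    have "P (Suc n) (t, t', A')" unfolding P_def using A'(1,3) by auto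
    moreover have "Q x (t, t', A')" unfolding Q_def x using A'(2) by simp
    ultimately show "\<exists>y. P (Suc n) y \<and> Q x y" by (intro exI[of _ "(t, t', A')"] conjI)
  qed
  then obtain F where F: "\<And>n. P n (F n)" "\<And>n. Q (F n) (F (Suc n))" by metis
  \<comment> \<open>State n holds the differential from degree n + 1 to degree n, whence the shift
    by one in \<open>d\<close>; \<open>d 0\<close> is a default value.\<close>
  define b where "b n = (case n of 0 \<Rightarrow> t0 | Suc k \<Rightarrow> fst (snd (F k)))" for n
  define d where "d n = snd (snd (F (n - 1)))" for n
  have rows: "fst (F n) = b n" for n
  proof (cases n)
    case 0
    then show ?thesis using F(1)[of 0] by (auto simp: P_def b_def split: prod.splits)
  next
    case (Suc k)
    then show ?thesis using F(2)[of k] by (auto simp: Q_def b_def split: prod.splits)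
  qed
  have Fn: "F n = (b n, b (Suc n), d (Suc n))" for n
    using rows[of n] by (simp add: b_def d_def prod_eq_iff)
  have ex: "matvec R (d (Suc (Suc n))) (b (Suc n)) (b (Suc (Suc n))) ` vecs R (b (Suc (Suc n))) = ?ker (b n) (b (Suc n)) (d (Suc n))" for n
    using F(2)[of n] unfolding Q_def Fn by simp
  have "min_free_resolution R M b d \<epsilon>"
    unfolding min_free_resolution_def
  proof (intro conjI allI impI ballI)
    show "d i p q \<in> max_ideal R" if "1 \<le> i" "p < b (i - 1)" "q < b i" for i p q
      using F(1)[of "i - 1"] that unfolding P_def Fn mx by simp
    show "matvec R (d i) (b (i - 1)) (b i) (matvec R (d (i + 1)) (b i) (b (i + 1)) w) = zero_vec R"
      if "1 \<le> i" "w \<in> vecs R (b (i + 1))" for i w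
      using ex[of "i - 1"] that by auto
    show "\<exists>w\<in>vecs R (b (i + 1)). v = matvec R (d (i + 1)) (b i) (b (i + 1)) w"
      if "1 \<le> i" "v \<in> vecs R (b i)" "matvec R (d i) (b (i - 1)) (b i) v = zero_vec R" for i v
    proof -
      have "v \<in> ?ker (b (i - 1)) (b (Suc (i - 1))) (d (Suc (i - 1)))" using that by simp
      then show ?thesis using ex[of "i - 1"] that(1) by auto
    qed
    have b0: "b 0 = t0" by (simp add: b_def)
    show "linear_map R (fm (b 0)) M \<epsilon>" using el b0 by simp
    show "\<epsilon> ` vecs R (b 0) = carrier M" using g(2) b0 unfolding \<epsilon>_def by simp
    show "{v \<in> vecs R (b 0). \<epsilon> v = \<zero>\<^bsub>M\<^esub>} = matvec R (d 1) (b 0) (b 1) ` vecs R (b 1)"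
      using F(1)[of 0] unfolding P_def Fn by (simp add: b0)
  qed
  then show ?thesis by blast
qed

lemma min_complex_of_resolution:
  assumes mx: "mx = max_ideal R" and res: "min_free_resolution R M b d \<epsilon>"
  shows "min_complex R mx e b (\<lambda>n. matvec R (d n) (b (n - 1)) (b n))"
proof (intro min_complex.intro short_ring_axioms min_complex_axioms.intro)
  note r = res[unfolded min_free_resolution_def]
  have m: "d n p q \<in> mx" if "n \<ge> 1" "p < b (n - 1)" "q < b n" for n p q
    using r[THEN conjunct1, rule_format, OF that] mx by simp
  show "linear_map R (fm (b n)) (fm (b (n - 1))) (matvec R (d n) (b (n - 1)) (b n))" if "n \<ge> 1" for n
    by (rule matvec_linear) (use m[OF that] mx_carr in blast)
  show "matvec R (d n) (b (n - 1)) (b n) v \<in> vin R mx (b (n - 1))" if "n \<ge> 1" "v \<in> vecs R (b n)" for n v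
    by (rule matvec_mx[OF m[OF that(1)] that(2)])
  show "matvec R (d n) (b (n - 1)) (b n) (matvec R (d (Suc n)) (b (Suc n - 1)) (b (Suc n)) w) = zero_vec R"
    if "n \<ge> 1" "w \<in> vecs R (b (Suc n))" for n w
    using r[THEN conjunct2, THEN conjunct1, rule_format, of n w] that by simp
  show "\<exists>w\<in>vecs R (b (Suc n)). v = matvec R (d (Suc n)) (b (Suc n - 1)) (b (Suc n)) w"
    if "n \<ge> 1" "v \<in> vecs R (b n)" "matvec R (d n) (b (n - 1)) (b n) v = zero_vec R" for n v
    using r[THEN conjunct2, THEN conjunct2, THEN conjunct1, rule_format, of n v] that by simp
qed

end

section \<open>Acyclicity of the linear part\<close>

text \<open>Each p uses its own reason. For p = 0 linear generators apply. For p = 1, m^3 F = D (m^2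
  F) allows v to be corrected by an element of m^2 F to a cycle. For p = 2, D v lies in m^4 F = 0,
  and linear generators one step up place the preimage in m F. For p = 3, v lies in m^3 F = D (m^2
  F). From p = 4 on, v = 0.\<close>

lemma (in min_complex) strict_acyclic:
  assumes i: "i \<ge> 1" and K: "linear_gens i" "linear_gens (Suc i)" "strict_socle (i - 1)" "strict_socle i"
    and v: "v \<in> vin R (mp p) (b i)" and Dv: "D i v \<in> vin R (mp (p + 2)) (b (i - 1))"
  shows "\<exists>w\<in>vecs R (b (Suc i)). (p = 0 \<longrightarrow> w = zero_vec R) \<and> w \<in> vin R (mp (p - 1)) (b (Suc i)) \<and>
     (\<forall>q. v q \<ominus> D (Suc i) w q \<in> mp (p + 1))"
proof -
  interpret f: two_modules R "fm (b i)" "fm (b (i - 1))" "D i" by (rule D_two[OF i])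
  interpret h: two_modules R "fm (b (Suc i))" "fm (b (Suc i - 1))" "D (Suc i)" by (rule D_two) simp
  have vv: "v \<in> vecs R (b i)" using vin_carr[OF v] .
  have vc: "v q \<in> carrier R" for q using vecs_carr[OF vv] .
  have h0: "D (Suc i) (zero_vec R) = zero_vec R" using h.f_zero by simp
  have v0: "v q \<ominus> v q = \<zero>" for q using vc r_neg by (simp add: a_minus_def)
  consider "p = 0" | "p = 1" | "p = 2" | "p = 3" | "p \<ge> 4" by linarith
  then show ?thesis
  proof cases
    case 1
    have "D i v \<in> vin R (mp 2) (b (i - 1))" using Dv 1 by (simp add: numeral_2_eq_2)
    then have "v \<in> vin R mx (b i)" using K(1) vv unfolding linear_gens_def by blast
    then have "v q \<ominus> D (Suc i) (zero_vec R) q \<in> mp (p + 1)" for q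
      using vin_mem[OF mx_ideal] vc 1 mp_1 unfolding h0 by (simp add: zero_vec_def a_minus_def)
    then show ?thesis using 1 vin_carrier by (intro bexI[of _ "zero_vec R"]) auto
  next
    case 2
    then have "D i v \<in> vin R (mp 3) (b (i - 1))" using Dv by (simp add: numeral_3_eq_3)
    then have "D i v \<in> D i ` vin R (mp 2) (b i)" using K(3) i unfolding strict_socle_def by auto
    then obtain y where y: "y \<in> vin R (mp 2) (b i)" "D i v = D i y" by blast
    have yv: "y \<in> vecs R (b i)" using vin_carr[OF y(1)] .
    have mv: "v \<ominus>\<^bsub>fm (b i)\<^esub> y \<in> vecs R (b i)" using f.M.M.minus_closed[of v y] vv yv by simp
    have "D i (v \<ominus>\<^bsub>fm (b i)\<^esub> y) = zero_vec R"
      using f.f_minus[of v y] vv yv y(2) f.N.M.r_neg[of "D i y"] f.f_closed[of y] by (simp add: a_minus_def)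
    from D_exact[OF i mv this] obtain w where w: "w \<in> vecs R (b (Suc i))" "v \<ominus>\<^bsub>fm (b i)\<^esub> y = D (Suc i) w" by blast
    have "v q \<ominus> D (Suc i) w q \<in> mp (p + 1)" for q
    proof -
      have "y q \<in> carrier R" using vecs_carr[OF yv] .
      then have "v q \<ominus> (v q \<ominus> y q) = y q" using vc[of q] by algebra
      then show ?thesis using fm_minus[OF vv yv] vin_mem[OF mp_ideal y(1), of q] 2 unfolding w(2)[symmetric] by (simp add: numeral_2_eq_2)
    qed
    then show ?thesis using w 2 vin_carrier by (intro bexI[of _ w]) auto
  next
    case 3
    then have "D i v = zero_vec R" using Dv mp4 vin_zero by simp
    from D_exact[OF i vv this] obtain w where w: "w \<in> vecs R (b (Suc i))" "v = D (Suc i) w" by blast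
    have "w \<in> vin R mx (b (Suc i))" using K(2) w v 3 unfolding linear_gens_def by simp
    then show ?thesis using w 3 v0 mp_zero mp_1 by (intro bexI[of _ w]) auto
  next
    case 4
    then have "v \<in> D (Suc i) ` vin R (mp 2) (b (Suc i))" using K(4) v unfolding strict_socle_def by blast
    then obtain w where w: "w \<in> vin R (mp 2) (b (Suc i))" "v = D (Suc i) w" by blast
    then show ?thesis using 4 v0 mp_zero vin_carr[OF w(1)] by (intro bexI[of _ w]) (auto simp: numeral_2_eq_2)
  next
    case 5
    have "v q = \<zero>" for q using mp_ge4[OF 5 vin_mem[OF mp_ideal v]] .
    then have "v q \<ominus> D (Suc i) (zero_vec R) q \<in> mp (p + 1)" for q
      unfolding h0 using mp_zero by (simp add: zero_vec_def a_minus_def)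
    then show ?thesis using 5 smod_zero[OF vmp] by (intro bexI[of _ "zero_vec R"]) auto
  qed
qed

context short_ring
begin

text \<open>The shift by n serves both uses: n = 0 for the residue field itself, n at least 1 for a
  syzygy. Homological degree 1 of the truncated resolution still involves
  \<open>strict_socle n\<close> but only \<open>linear_gens\<close> above n.\<close>

lemma linear_part_acyclic_shift:
  assumes mx: "mx = max_ideal R" and C: "min_complex R mx e b (\<lambda>n. matvec R (d n) (b (n - 1)) (b n))"
    and linear_gens: "\<And>i. i > n \<Longrightarrow> min_complex.linear_gens R mx b (\<lambda>n. matvec R (d n) (b (n - 1)) (b n)) i"
    and strict_socle: "\<And>i. i \<ge> n \<Longrightarrow> min_complex.strict_socle R mx b (\<lambda>n. matvec R (d n) (b (n - 1)) (b n)) i"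
  shows "linear_part_acyclic R (\<lambda>i. b (n + i)) (\<lambda>i. d (n + i))"
  unfolding linear_part_acyclic_def
proof (intro allI impI ballI)
  interpret C: min_complex R mx e b "\<lambda>n. matvec R (d n) (b (n - 1)) (b n)" by (rule C)
  fix i p v
  assume i: "1 \<le> i" and v: "v \<in> vecs R (b (n + i))"
    and h: "(\<forall>q<b (n + i). v q \<in> ideal_power R (max_ideal R) p) \<and>
      (\<forall>r<b (n + (i - 1)). matvec R (d (n + i)) (b (n + (i - 1))) (b (n + i)) v r \<in> ideal_power R (max_ideal R) (p + 2))"
  have ni: "n + (i - 1) = n + i - 1" "n + (i + 1) = Suc (n + i)" "Suc (n + i) - 1 = n + i" using i by auto
  have i1: "n + i \<ge> 1" using i by simp
  have v1: "v \<in> vin R (mp p) (b (n + i))" using v h mx by (simp add: vin_def)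
  have v2: "matvec R (d (n + i)) (b (n + i - 1)) (b (n + i)) v \<in> vin R (mp (p + 2)) (b (n + i - 1))"
    using h mx C.D_closed[OF i1 v] unfolding ni by (simp add: vin_def)
  have k: "C.linear_gens (n + i)" "C.linear_gens (Suc (n + i))" "C.strict_socle (n + i - 1)" "C.strict_socle (n + i)" 
    by (rule linear_gens strict_socle; use i in simp)+
  obtain w where w: "w \<in> vecs R (b (Suc (n + i)))" "p = 0 \<longrightarrow> w = zero_vec R" "w \<in> vin R (mp (p - 1)) (b (Suc (n + i)))"
    "\<forall>q. v q \<ominus> matvec R (d (Suc (n + i))) (b (Suc (n + i) - 1)) (b (Suc (n + i))) w q \<in> mp (p + 1)"
    using C.strict_acyclic[OF i1 k v1 v2] by blast
  show "\<exists>w\<in>vecs R (b (n + (i + 1))). (p = 0 \<longrightarrow> w = zero_vec R) \<and>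
      (\<forall>q<b (n + (i + 1)). w q \<in> ideal_power R (max_ideal R) (p - 1)) \<and>
      (\<forall>q<b (n + i). v q \<ominus> matvec R (d (n + (i + 1))) (b (n + i)) (b (n + (i + 1))) w q \<in> ideal_power R (max_ideal R) (p + 1))"
    unfolding ni
  proof (intro bexI[OF _ w(1)] conjI allI impI)
    show "w = zero_vec R" if "p = 0" using w(2) that by simp
    show "w q \<in> ideal_power R (max_ideal R) (p - 1)" for q using vin_mem[OF mp_ideal w(3)] mx by simp
    show "v q \<ominus> matvec R (d (Suc (n + i))) (b (n + i)) (b (Suc (n + i))) w q \<in> ideal_power R (max_ideal R) (p + 1)" for q
      using w(4)[rule_format, of q] mx unfolding ni(3) by simp
  qed
qed

lemma syzygy_resolution:
  assumes mx: "mx = max_ideal R" and res: "min_free_resolution R M b d \<epsilon>" and n: "n \<ge> 1"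
  shows "min_free_resolution R (syzygy_module R b d n) (\<lambda>i. b (n + i)) (\<lambda>i. d (n + i)) (matvec R (d n) (b (n - 1)) (b n))"
    and "finitely_generated_module R (syzygy_module R b d n)"
proof -
  interpret C: min_complex R mx e b "\<lambda>n. matvec R (d n) (b (n - 1)) (b n)" by (rule min_complex_of_resolution[OF mx res])
  let ?D = "\<lambda>n. matvec R (d n) (b (n - 1)) (b n)"
  let ?S = "syzygy_module R b d n"
  have S: "?S = (fm (b (n - 1)))\<lparr>carrier := ?D n ` vecs R (b n)\<rparr>" by (simp add: syzygy_module_def)
  have mod: "module R ?S" unfolding S by (rule module_restrict[OF C.D_smod[OF n C.vecs_smod]])
  have Sz: "\<zero>\<^bsub>?S\<^esub> = zero_vec R" by (simp add: S free_module_def)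
  have lin: "linear_map R (fm (b n)) ?S (?D n)"
    using C.D_lin[OF n] unfolding linear_map_def S by (auto simp: free_module_def)
  have sur: "?D n ` vecs R (b n) = carrier ?S" by (simp add: S)
  show "finitely_generated_module R ?S" by (rule finitely_generated_moduleI[OF mod lin sur])
  note r = res[unfolded min_free_resolution_def]
  show "min_free_resolution R ?S (\<lambda>i. b (n + i)) (\<lambda>i. d (n + i)) (?D n)"
    unfolding min_free_resolution_def
  proof (intro conjI allI impI ballI)
    fix i :: nat assume i: "1 \<le> i"
    have ni: "n + (i - 1) = n + i - 1" "n + (i + 1) = Suc (n + i)" "Suc (n + i) - 1 = n + i" and i1: "n + i \<ge> 1" using i by auto
    show "d (n + i) p q \<in> max_ideal R" if "p < b (n + (i - 1))" "q < b (n + i)" for p q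
      using r[THEN conjunct1, rule_format, OF i1] that unfolding ni by simp
    show "matvec R (d (n + i)) (b (n + (i - 1))) (b (n + i)) (matvec R (d (n + (i + 1))) (b (n + i)) (b (n + (i + 1))) w) = zero_vec R"
      if "w \<in> vecs R (b (n + (i + 1)))" for w using C.D_D[OF i1, of w] that unfolding ni by simp
    show "\<exists>w\<in>vecs R (b (n + (i + 1))). v = matvec R (d (n + (i + 1))) (b (n + i)) (b (n + (i + 1))) w"
      if "v \<in> vecs R (b (n + i))" "matvec R (d (n + i)) (b (n + (i - 1))) (b (n + i)) v = zero_vec R" for v
      using C.D_exact[OF i1, of v] that unfolding ni by simp
  next
    show "linear_map R (fm (b (n + 0))) ?S (?D n)" using lin by simp
    show "?D n ` vecs R (b (n + 0)) = carrier ?S" using sur by simp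
    show "{v \<in> vecs R (b (n + 0)). ?D n v = \<zero>\<^bsub>?S\<^esub>} = matvec R (d (n + 1)) (b (n + 0)) (b (n + 1)) ` vecs R (b (n + 1))"
    proof
      show "{v \<in> vecs R (b (n + 0)). ?D n v = \<zero>\<^bsub>?S\<^esub>} \<subseteq> matvec R (d (n + 1)) (b (n + 0)) (b (n + 1)) ` vecs R (b (n + 1))"
      proof
        fix v assume "v \<in> {v \<in> vecs R (b (n + 0)). ?D n v = \<zero>\<^bsub>?S\<^esub>}"
        then show "v \<in> matvec R (d (n + 1)) (b (n + 0)) (b (n + 1)) ` vecs R (b (n + 1))"
          using C.D_exact[OF n, of v] by (auto simp: Sz)
      qed
      show "matvec R (d (n + 1)) (b (n + 0)) (b (n + 1)) ` vecs R (b (n + 1)) \<subseteq> {v \<in> vecs R (b (n + 0)). ?D n v = \<zero>\<^bsub>?S\<^esub>}"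
      proof
        fix v assume "v \<in> matvec R (d (n + 1)) (b (n + 0)) (b (n + 1)) ` vecs R (b (n + 1))"
        then obtain w where w: "w \<in> vecs R (b (Suc n))" "v = matvec R (d (Suc n)) (b n) (b (Suc n)) w" by auto
        then show "v \<in> {v \<in> vecs R (b (n + 0)). ?D n v = \<zero>\<^bsub>?S\<^esub>}"
          using C.D_D[OF n w(1)] C.D_closed[of "Suc n" w] by (simp add: Sz)
      qed
    qed
  qed
qed

end

section \<open>The residue field\<close>

context local_cring
begin

lemma residue_module_simps:
  assumes mx: "mx = max_ideal R"
  shows "carrier (residue_module R) = (+>) mx ` carrier R" and "\<zero>\<^bsub>residue_module R\<^esub> = mx"
    and "x \<in> carrier R \<Longrightarrow> y \<in> carrier R \<Longrightarrow> (mx +> x) \<oplus>\<^bsub>residue_module R\<^esub> (mx +> y) = mx +> (x \<oplus> y)"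
    and "r \<in> carrier R \<Longrightarrow> x \<in> carrier R \<Longrightarrow> r \<odot>\<^bsub>residue_module R\<^esub> (mx +> x) = mx +> (r \<otimes> x)"
    and "x \<in> carrier R \<Longrightarrow> mx +> x = mx \<longleftrightarrow> x \<in> mx"
proof -
  interpret I: ideal mx R by (rule mx_ideal)
  show "carrier (residue_module R) = (+>) mx ` carrier R"
    unfolding residue_module_def mx[symmetric] by (auto simp: FactRing_def A_RCOSETS_def')
  show "\<zero>\<^bsub>residue_module R\<^esub> = mx" unfolding residue_module_def mx[symmetric] by (simp add: FactRing_def)
  show "(mx +> x) \<oplus>\<^bsub>residue_module R\<^esub> (mx +> y) = mx +> (x \<oplus> y)" if "x \<in> carrier R" "y \<in> carrier R"
    unfolding residue_module_def mx[symmetric] using that by (simp add: FactRing_def I.a_rcos_sum)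
  show "r \<odot>\<^bsub>residue_module R\<^esub> (mx +> x) = mx +> (r \<otimes> x)" if "r \<in> carrier R" "x \<in> carrier R"
    unfolding residue_module_def mx[symmetric] using that by (simp add: I.rcoset_mult_add)
  show "mx +> x = mx \<longleftrightarrow> x \<in> mx" if "x \<in> carrier R"
    using a_coset_join1[OF _ that I.a_subgroup] I.a_rcos_const by blast
qed

lemma module_residue:
  assumes mx: "mx = max_ideal R" shows "module R (residue_module R)"
proof -
  note s = residue_module_simps[OF mx]
  have z: "mx = mx +> \<zero>" using s(5)[OF zero_closed] additive_subgroup.zero_closed[OF ideal.axioms(1)[OF mx_ideal]] by simp
  show ?thesis
  proof (rule moduleI)
    show "abelian_group (residue_module R)"
    proof (rule abelian_groupI)
      show "\<zero>\<^bsub>residue_module R\<^esub> \<in> carrier (residue_module R)" using z s(1,2) by auto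
      fix x assume "x \<in> carrier (residue_module R)"
      then obtain r where r: "r \<in> carrier R" "x = mx +> r" using s(1) by auto
      show "\<zero>\<^bsub>residue_module R\<^esub> \<oplus>\<^bsub>residue_module R\<^esub> x = x"
        using s(3)[OF zero_closed r(1)] r z s(2) by simp
      have "(mx +> \<ominus> r) \<oplus>\<^bsub>residue_module R\<^esub> x = \<zero>\<^bsub>residue_module R\<^esub>"
        using s(3)[of "\<ominus> r" r] r z s(2) by (simp add: l_neg)
      then show "\<exists>y\<in>carrier (residue_module R). y \<oplus>\<^bsub>residue_module R\<^esub> x = \<zero>\<^bsub>residue_module R\<^esub>"
        using s(1) r(1) by (intro bexI[of _ "mx +> \<ominus> r"]) auto
    qed (auto simp: s(1,3) a_ac)
  qed (auto simp: s(1,3,4) l_distr r_distr m_assoc is_cring)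
qed

lemma finitely_generated_residue:
  assumes mx: "mx = max_ideal R" shows "finitely_generated_module R (residue_module R)"
proof (rule finitely_generated_moduleI[OF module_residue[OF mx]])
  note s = residue_module_simps[OF mx]
  show "linear_map R (fm 1) (residue_module R) (\<lambda>v. mx +> v 0)"
    unfolding linear_map_def by (auto simp: s vecs_carr)
  show "(\<lambda>v. mx +> v 0) ` vecs R 1 = carrier (residue_module R)"
  proof
    show "(\<lambda>v. mx +> v 0) ` vecs R 1 \<subseteq> carrier (residue_module R)" using s(1) vecs_carr by auto
    show "carrier (residue_module R) \<subseteq> (\<lambda>v. mx +> v 0) ` vecs R 1"
    proof
      fix x assume "x \<in> carrier (residue_module R)"
      then obtain r where r: "r \<in> carrier R" "x = mx +> r" using s(1) by auto
      then show "x \<in> (\<lambda>v. mx +> v 0) ` vecs R 1"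
        using ev_vecs[of 0 1 r] by (intro image_eqI[of _ _ "ev R 0 r"]) (auto simp: ev_def)
    qed
  qed
qed

end

text \<open>The augmentation kills m F_0, while minimality of the first differential puts its kernel
  into m F_0; hence equality. Since the residue field has dimension one, this also forces rank
  one.\<close>

lemma (in short_ring) residue_resolution:
  assumes mx: "mx = max_ideal R" and res: "min_free_resolution R (residue_module R) b d \<epsilon>"
  shows "matvec R (d 1) (b 0) (b 1) ` vecs R (b 1) = vin R mx (b 0)" and "b 0 = 1"
proof -
  let ?k = "residue_module R"
  note s = residue_module_simps[OF mx]
  note r = res[unfolded min_free_resolution_def]
  interpret C: min_complex R mx e b "\<lambda>n. matvec R (d n) (b (n - 1)) (b n)" by (rule min_complex_of_resolution[OF mx res])
  have lin: "linear_map R (fm (b 0)) ?k \<epsilon>" and sur: "\<epsilon> ` vecs R (b 0) = carrier ?k"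
    and ker: "{v \<in> vecs R (b 0). \<epsilon> v = \<zero>\<^bsub>?k\<^esub>} = matvec R (d 1) (b 0) (b 1) ` vecs R (b 1)" using r by blast+
  interpret f: two_modules R "fm (b 0)" ?k \<epsilon> by (intro two_modules.intro module_fm module_residue[OF mx] two_modules_axioms.intro lin)
  have sub: "matvec R (d 1) (b 0) (b 1) ` vecs R (b 1) \<subseteq> vin R mx (b 0)" using C.D_mx[of 1] by auto
  have kz: "r \<odot>\<^bsub>?k\<^esub> x = \<zero>\<^bsub>?k\<^esub>" if r: "r \<in> mx" and x: "x \<in> carrier ?k" for r x
  proof -
    obtain t where t: "t \<in> carrier R" "x = mx +> t" using x s(1) by auto
    then show ?thesis using s(4)[OF mx_carr[OF r] t(1)] s(5)[of "r \<otimes> t"] s(2) ideal.I_r_closed[OF mx_ideal r t(1)] mx_carr[OF r] by simp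
  qed
  have evs: "\<epsilon> (ev R k r) = r \<odot>\<^bsub>?k\<^esub> \<epsilon> (ev R k \<one>)" if "k < b 0" "r \<in> carrier R" for k r
  proof -
    have "ev R k r = (\<lambda>j. r \<otimes> ev R k \<one> j)" using that by (auto simp: ev_def)
    then show ?thesis using f.f_smult[OF that(2), of "ev R k \<one>"] ev_vecs[OF that(1) one_closed] by simp
  qed
  have "vin R mx (b 0) \<subseteq> {v \<in> vecs R (b 0). \<epsilon> v = \<zero>\<^bsub>?k\<^esub>}" (is "_ \<subseteq> ?K")
  proof
    fix v assume v: "v \<in> vin R mx (b 0)"
    show "v \<in> ?K"
    proof (rule vec_induct[OF vin_carr[OF v]])
      show "zero_vec R \<in> ?K" using f.f_zero by simp
      show "(\<lambda>j. x j \<oplus> y j) \<in> ?K" if "x \<in> ?K" "y \<in> ?K" for x y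
        using that f.f_add[of x y] f.M.M.a_closed[of x y] by simp
      show "ev R k (v k) \<in> ?K" if k: "k < b 0" for k
      proof -
        have vk: "v k \<in> mx" using vin_mem[OF mx_ideal v] .
        have "\<epsilon> (ev R k \<one>) \<in> carrier ?k" using f.f_closed ev_vecs[OF k one_closed] by simp
        then show ?thesis using evs[OF k mx_carr[OF vk]] kz[OF vk] ev_vecs[OF k mx_carr[OF vk]] by simp
      qed
    qed
  qed
  then have le: "vin R mx (b 0) \<subseteq> matvec R (d 1) (b 0) (b 1) ` vecs R (b 1)" unfolding ker .
  show D1: "matvec R (d 1) (b 0) (b 1) ` vecs R (b 1) = vin R mx (b 0)" by (rule equalityI[OF sub le])
  have kmx: "v \<in> vin R mx (b 0)" if "v \<in> vecs R (b 0)" "\<epsilon> v = \<zero>\<^bsub>?k\<^esub>" for v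
  proof -
    have "v \<in> {v \<in> vecs R (b 0). \<epsilon> v = \<zero>\<^bsub>?k\<^esub>}" using that by simp
    then show ?thesis unfolding ker D1 .
  qed
  have "b 0 \<noteq> 0"
  proof
    assume "b 0 = 0"
    then have "vecs R (b 0) = {zero_vec R}" by (auto simp: vecs_def zero_vec_def)
    then have "carrier ?k = {mx}" using sur f.f_zero s(2) by simp
    then have "mx +> \<one> = mx" using s(1) one_closed by blast
    then show False using s(5)[OF one_closed] one_notin_mx by simp
  qed
  moreover have "\<not> b 0 \<ge> 2"
  proof
    assume b2: "b 0 \<ge> 2"
    have 0: "0 < b 0" and 1: "1 < b 0" using b2 by auto
    have ec: "\<epsilon> (ev R k \<one>) \<in> (+>) mx ` carrier R" if "k < b 0" for k
      using f.f_closed[of "ev R k \<one>"] ev_vecs[OF that one_closed] s(1) by simp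
    obtain r0 where r0: "r0 \<in> carrier R" "\<epsilon> (ev R 0 \<one>) = mx +> r0" using ec[OF 0] by (rule imageE)
    obtain r1 where r1: "r1 \<in> carrier R" "\<epsilon> (ev R 1 \<one>) = mx +> r1" using ec[OF 1] by (rule imageE)
    \<comment> \<open>The obvious relation r1 e_0 - r0 e_1 between the images of two basis vectors.
      Its coefficients must lie in m, so r0 does, and then e_0 itself is in the kernel, which is
      impossible.\<close>
    let ?v = "\<lambda>j. ev R 0 r1 j \<oplus> ev R 1 (\<ominus> r0) j"
    have m0: "ev R 0 r1 \<in> vecs R (b 0)" "ev R 1 (\<ominus> r0) \<in> vecs R (b 0)" using ev_vecs[OF 0 r1(1)] ev_vecs[OF 1, of "\<ominus> r0"] r0(1) by auto
    have vv: "?v \<in> vecs R (b 0)" using f.M.M.a_closed[of "ev R 0 r1" "ev R 1 (\<ominus> r0)"] m0 by simp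
    have "\<epsilon> ?v = \<epsilon> (ev R 0 r1) \<oplus>\<^bsub>?k\<^esub> \<epsilon> (ev R 1 (\<ominus> r0))" using f.f_add[of "ev R 0 r1" "ev R 1 (\<ominus> r0)"] m0 by simp
    also have "\<dots> = (mx +> (r1 \<otimes> r0)) \<oplus>\<^bsub>?k\<^esub> (mx +> (\<ominus> r0 \<otimes> r1))"
      using evs[OF 0 r1(1)] evs[OF 1, of "\<ominus> r0"] r0 r1 s(4)[OF r1(1) r0(1)] s(4)[of "\<ominus> r0" r1] by simp
    also have "\<dots> = mx +> (r1 \<otimes> r0 \<oplus> \<ominus> r0 \<otimes> r1)" using s(3)[of "r1 \<otimes> r0" "\<ominus> r0 \<otimes> r1"] r0(1) r1(1) by simp
    also have "r1 \<otimes> r0 \<oplus> \<ominus> r0 \<otimes> r1 = \<zero>" using r0(1) r1(1) by algebra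
    finally have "\<epsilon> ?v = \<zero>\<^bsub>?k\<^esub>" using s(5)[OF zero_closed] s(2) additive_subgroup.zero_closed[OF ideal.axioms(1)[OF mx_ideal]] by simp
    then have "?v 1 \<in> mx" using vin_mem[OF mx_ideal kmx[OF vv]] by blast
    then have "\<ominus> r0 \<in> mx" using r0(1) by (simp add: ev_def)
    then have "r0 \<in> mx" using additive_subgroup.a_inv_closed[OF ideal.axioms(1)[OF mx_ideal], of "\<ominus> r0"] r0(1) by simp
    then have "\<epsilon> (ev R 0 \<one>) = \<zero>\<^bsub>?k\<^esub>" using r0 s(5)[OF r0(1)] s(2) by simp
    then have "ev R 0 \<one> 0 \<in> mx" using vin_mem[OF mx_ideal kmx[OF ev_vecs[OF 0 one_closed]]] by blast
    then show False using one_notin_mx by (simp add: ev_def)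
  qed
  ultimately show "b 0 = 1" by simp
qed

section \<open>Koszul rings and Koszul syzygies\<close>

text \<open>The socle contains m^3 and is not zero, so e is at least 3; this excludes that a or b
  lies in m^2 and makes \<open>ln_Y\<close> and \<open>orthogonal_pair\<close> available.\<close>

lemma (in exact_pair) orthogonal_data_exists:
  assumes es: "e \<ge> ln {\<zero>} (annihilator R mx) + 2"
  shows "\<exists>c c' l. orthogonal_data R mx e a b c c' l"
proof -
  have "soc \<noteq> {\<zero>}" using mp3_soc mp3_ne mp_zero[of 3] by blast
  then have "ln {\<zero>} soc \<noteq> 0" using S.slen_eq_0[OF smod0 soc_smod] smod_zero[OF soc_smod] by auto
  then have e3: "e \<ge> 3" using es by (simp add: soc_def)
  have ab: "a \<notin> mp 2" "b \<notin> mp 2" using e_le_2 exact_pair.e_le_2[OF swap] e3 by auto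
  have "ln Y mx \<ge> 2" using ln_Y[OF ab] es e3 by (simp add: soc_def)
  from orthogonal_pair[OF ab this]
  obtain c c' l where c: "c \<in> mx" "c \<notin> Y" "c' \<in> mx" "c' \<notin> Y" "l \<in> mx" "c \<otimes> c' = l \<otimes> a" by blast
  have "orthogonal_data R mx e a b c c' l"
  proof (intro orthogonal_data.intro short_ring_axioms orthogonal_data_axioms.intro a_mx b_mx c(1,3,5,6) ab0)
    show "\<exists>u\<in>carrier R. x = u \<otimes> b" if "x \<in> carrier R" "x \<otimes> a = \<zero>" for x
      using ann_a[OF that(1)] that(2) unfolding cgenideal_def by blast
    show "\<exists>u\<in>carrier R. x = u \<otimes> a" if "x \<in> carrier R" "x \<otimes> b = \<zero>" for x
      using ann_b[OF that(1)] that(2) unfolding cgenideal_def by blast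
    show "r \<in> mx" if "r \<in> carrier R" "r \<otimes> a \<in> mp 2" for r by (rule mult_a_mp2[OF ab(1) that])
    show "r \<in> mx" if "r \<in> carrier R" "r \<otimes> b \<in> mp 2" for r by (rule exact_pair.mult_a_mp2[OF swap ab(2) that])
  qed (fact notin_Y[OF ab c(1,2)] notin_Y[OF ab c(3,4)])+
  then show ?thesis by blast
qed

context short_ring
begin

text \<open>As F_0 has rank one, the first differential is the single row \<open>d 1 0\<close>, and
  acyclicity of the linear part is used in homological degree 1.\<close>

lemma koszul_gens_of_koszul_ring:
  assumes mx: "mx = max_ideal R" and kos: "koszul_ring R"
  shows "\<exists>N1 N2 xg D2. koszul_gens R mx e N1 N2 xg D2"
proof -
  obtain b d \<epsilon> where res: "min_free_resolution R (residue_module R) b d \<epsilon>" and lin: "linear_part_acyclic R b d"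
    using kos unfolding koszul_ring_def koszul_module_def by blast
  interpret C: min_complex R mx e b "\<lambda>n. matvec R (d n) (b (n - 1)) (b n)" by (rule min_complex_of_resolution[OF mx res])
  note D1 = residue_resolution(1)[OF mx res] and b0 = residue_resolution(2)[OF mx res]
  note r = res[unfolded min_free_resolution_def]
  have two: "Suc 1 = 2" "2 - 1 = (1 :: nat)" "Suc (1::nat) - 1 = 1" "(1::nat) - 1 = 0" by simp_all
  have dot: "matvec R (d 1) (b 0) (b 1) v 0 = dot R (b 1) (d 1 0) v" for v using b0 by (simp add: matvec_dot)
  have "koszul_gens R mx e (b 1) (b 2) (d 1 0) (matvec R (d 2) (b 1) (b 2))"
  proof (intro koszul_gens.intro short_ring_axioms koszul_gens_axioms.intro)
    show "d 1 0 q \<in> mx" if "q < b 1" for q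
      using r[THEN conjunct1, rule_format, of 1 0 q] that b0 mx by simp
    show "\<exists>v\<in>vecs R (b 1). dot R (b 1) (d 1 0) v = u" if u: "u \<in> mx" for u
    proof -
      have "ev R 0 u \<in> vin R mx (b 0)" using ev_vin[OF _ mx_ideal u] b0 by simp
      then obtain v where v: "v \<in> vecs R (b 1)" "ev R 0 u = matvec R (d 1) (b 0) (b 1) v" unfolding D1[symmetric] by (rule imageE)
      have "u = ev R 0 u 0" by (simp add: ev_def)
      then show ?thesis using v dot[of v] by (intro bexI[of _ v]) simp_all
    qed
    show "linear_map R (fm (b 2)) (fm (b 1)) (matvec R (d 2) (b 1) (b 2))" using C.D_lin[of 2] unfolding two by simp
    show "matvec R (d 2) (b 1) (b 2) w \<in> vin R mx (b 1)" if "w \<in> vecs R (b 2)" for w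
      using C.D_mx[of 2 w] that unfolding two by simp
    show "dot R (b 1) (d 1 0) (matvec R (d 2) (b 1) (b 2) w) = \<zero>" if "w \<in> vecs R (b 2)" for w
    proof -
      have "matvec R (d 1) (b 0) (b 1) (matvec R (d 2) (b 1) (b 2) w) = zero_vec R"
        using C.D_D[of 1 w] that unfolding two by simp
      then show ?thesis using dot[of "matvec R (d 2) (b 1) (b 2) w"] by (simp add: zero_vec_def)
    qed
    fix p :: nat and v assume p: "p \<ge> 1" and v: "v \<in> vin R (mp p) (b 1)" and dv: "dot R (b 1) (d 1 0) v \<in> mp (p + 2)"
    have "\<forall>q<b 1. v q \<in> ideal_power R (max_ideal R) p" using vin_mem[OF mp_ideal v] mx by simp
    moreover have "\<forall>r<b (1 - 1). matvec R (d 1) (b (1 - 1)) (b 1) v r \<in> ideal_power R (max_ideal R) (p + 2)"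
      using dv dot[of v] b0 mx by simp
    ultimately obtain w where w: "w \<in> vecs R (b (1 + 1))" "\<forall>q<b (1 + 1). w q \<in> ideal_power R (max_ideal R) (p - 1)"
      "\<forall>q<b 1. v q \<ominus> matvec R (d (1 + 1)) (b 1) (b (1 + 1)) w q \<in> ideal_power R (max_ideal R) (p + 1)"
      using lin[unfolded linear_part_acyclic_def, rule_format, of 1 v p] vin_carr[OF v] by blast
    show "\<exists>w\<in>vin R (mp (p - 1)) (b 2). \<forall>q<b 1. v q \<ominus> matvec R (d 2) (b 1) (b 2) w q \<in> mp (p + 1)"
      using w unfolding mx[symmetric] one_add_one by (intro bexI[of _ w]) (simp_all add: vin_def)
  qed
  then show ?thesis by blast
qed

lemma koszul_ring_of_orthogonal_data:
  assumes mx: "mx = max_ideal R" and kd: "orthogonal_data R mx e a a' c c' l"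
  shows "koszul_ring R"
proof -
  obtain b d \<epsilon> where res: "min_free_resolution R (residue_module R) b d \<epsilon>"
    using resolution_exists[OF mx finitely_generated_residue[OF mx]] by blast
  note C = min_complex_of_resolution[OF mx res]
  interpret K: orthogonal_complex R mx e a a' c c' l b "\<lambda>n. matvec R (d n) (b (n - 1)) (b n)"
    by (intro orthogonal_complex.intro kd C)
  have D1: "matvec R (d 1) (b (1 - 1)) (b 1) ` vecs R (b 1) = vin R mx (b 0)"
    using residue_resolution(1)[OF mx res] by simp
  note st = K.strict_residue[OF D1 residue_resolution(2)[OF mx res]]
  have "linear_part_acyclic R (\<lambda>i. b (0 + i)) (\<lambda>i. d (0 + i))"
  proof (rule linear_part_acyclic_shift[OF mx C])
    show "K.linear_gens i" if "i > 0" for i using st(1)[of i] that by linarith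
    show "K.strict_socle i" for i by (rule st(2))
  qed
  then have "linear_part_acyclic R b d" by simp
  then show ?thesis unfolding koszul_ring_def koszul_module_def
    using res finitely_generated_residue[OF mx] by blast
qed

lemma koszul_syzygy_of_orthogonal_data:
  assumes mx: "mx = max_ideal R" and kd: "orthogonal_data R mx e a a' c c' l" and res: "min_free_resolution R M b d \<epsilon>"
  shows "\<exists>n\<ge>1. koszul_module R (syzygy_module R b d n)"
proof -
  note C = min_complex_of_resolution[OF mx res]
  interpret K: orthogonal_complex R mx e a a' c c' l b "\<lambda>n. matvec R (d n) (b (n - 1)) (b n)"
    by (intro orthogonal_complex.intro kd C)
  obtain n where n: "n \<ge> 1" "\<forall>i\<ge>n. K.linear_gens i \<and> K.strict_socle i" using K.strict_eventually by blast
  have "linear_part_acyclic R (\<lambda>i. b (n + i)) (\<lambda>i. d (n + i))"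
  proof (rule linear_part_acyclic_shift[OF mx C])
    show "K.linear_gens i" if "i > n" for i using n(2)[rule_format, of i] that by linarith
    show "K.strict_socle i" if "i \<ge> n" for i using n(2)[rule_format, of i] that by linarith
  qed
  then have "koszul_module R (syzygy_module R b d n)" unfolding koszul_module_def
    using syzygy_resolution[OF mx res n(1)] by blast
  then show ?thesis using n(1) by blast
qed

end

theorem theorem3p3:
  fixes R :: "('a, 'b) ring_scheme" and e s :: nat
  assumes local: "local_noetherian_ring R"
    and H1: "hilbert_fun R 1 = e" and H2: "hilbert_fun R 2 = e"
    and H3: "hilbert_fun R 3 = 1" and H4: "\<forall>n\<ge>4. hilbert_fun R n = 0"
    and s_def: "s = socle_rank R"
    and ezd: "\<exists>a. a \<in> max_ideal R \<and> a \<noteq> \<zero>\<^bsub>R\<^esub> \<and> exact_zero_divisor R a"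
  shows "(koszul_ring R \<longleftrightarrow> e \<ge> s + 2) \<and>
         (koszul_ring R \<longrightarrow>
            (\<forall>M :: ('a, 'c) module. finitely_generated_module R M \<longrightarrow>
               (\<exists>b d \<epsilon>. min_free_resolution R M b d \<epsilon> \<and>
                  (koszul_module R M \<or>
                   (\<exists>n\<ge>1. koszul_module R (syzygy_module R b d n))))))"
proof -
  have h4: "hilbert_fun R 4 = 0" using H4 by simp
  interpret short_ring R "max_ideal R" e by (rule short_ring_of_hilbert[OF local H1 H2 H3 h4])
  have noe: "Defs.noetherian_ring R" using local by (simp add: local_noetherian_ring_def)
  have s: "s = ln {\<zero>\<^bsub>R\<^esub>} (annihilator R (max_ideal R))"
    using socle_rank_ln[OF noe] s_def by (simp add: socle_rank_def)
  obtain a b where ep: "exact_pair R (max_ideal R) e a b"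
    using ezd exact_pair_of_exact_zero_divisor by blast
  have 1: "e \<ge> s + 2" if kos: "koszul_ring R"
  proof -
    obtain N1 N2 xg D2 where "koszul_gens R (max_ideal R) e N1 N2 xg D2"
      using koszul_gens_of_koszul_ring[OF refl kos] by blast
    then show ?thesis unfolding s by (rule koszul_gens.socle_bound[OF _ ep])
  qed
  have kd: "\<exists>c c' l. orthogonal_data R (max_ideal R) e a b c c' l" if "e \<ge> s + 2"
    using exact_pair.orthogonal_data_exists[OF ep] that unfolding s by blast
  have 2: "koszul_ring R" if "e \<ge> s + 2" using kd[OF that] koszul_ring_of_orthogonal_data[OF refl] by blast
  have 3: "\<exists>b d \<epsilon>. min_free_resolution R M b d \<epsilon> \<and>
      (koszul_module R M \<or> (\<exists>n\<ge>1. koszul_module R (syzygy_module R b d n)))"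
    if kos: "koszul_ring R" and fg: "finitely_generated_module R M" for M :: "('a, 'c) module"
  proof -
    obtain b' d \<epsilon> where res: "min_free_resolution R M b' d \<epsilon>" using resolution_exists[OF refl fg] by blast
    obtain c c' l where "orthogonal_data R (max_ideal R) e a b c c' l" using kd[OF 1[OF kos]] by blast
    from koszul_syzygy_of_orthogonal_data[OF refl this res] show ?thesis using res by blast
  qed
  show ?thesis using 1 2 3 by blast
qed

end
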